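(* Let $G$ be the (first) Grigorchuk group. (1) The Lie algebras $\mathscr L(G)$, $\mathscr L^{\mathbb F_2}(G)/\zeta(\mathscr L^{\mathbb F_2}(G))$ and ${}_2\mathscr L_{\mathrm G}$ are isomorphic, where $\zeta$ denotes the centre. (2) The Lie algebras $\mathscr L^{\mathbb Z}(G)/\zeta_\omega(\mathscr L^{\mathbb Z}(G))$ and $\mathscr L_{\mathrm G}$ are isomorphic.
   Context: **The group.** $G$ is the group of permutations of the set $\{0,1\}^*$ of words, generated by $a,b,c,d$ defined recursively, for all words $w$, by $a(0w)=1w$, $a(1w)=0w$; $b(0w)=0a(w)$, $b(1w)=1c(w)$; $c(0w)=0a(w)$, $c(1w)=1d(w)$; $d(0w)=0w$, $d(1w)=1b(w)$ (all fixing the empty word). In wreath notation $\psi:G\to G\wr\mathbb F_2$ is $a\mapsto((1,1),1)$, $b\mapsto((a,c),0)$, $c\mapsto((a,d),0)$, $d\mapsto((1,b),0)$. **$\mathscr L^{\mathbb Z}(G)$ and $\mathscr L^{\mathbb F_2}(G)$.** Let $\gamma_1=G$, $\gamma_n=[G,\gamma_{n-1}]$ be the lower central series; $\mathscr L^{\mathbb Z}(G)=\bigoplus_{n\ge1}\gamma_n/\gamma_{n+1}$ with bracket induced by commutators, $[g\gamma_{n+1},h\gamma_{m+1}]=[g,h]\gamma_{n+m+1}$. For a prime $p$, let $\gamma_1^p=G$ and $\gamma_n^p=[G,\gamma_{n-1}^p](\gamma^p_{\lceil n/p\rceil})^p$; then $\mathscr L^{\mathbb F_p}(G)=\bigoplus_{n\ge1}\gamma_n^p/\gamma_{n+1}^p$,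 with bracket induced by commutators, a restricted Lie algebra over $\mathbb F_p$ with $p$-mapping induced by $g\gamma^p_{n+1}\mapsto g^p\gamma^p_{pn+1}$. Here $p=2$. **Upper central series.** For a Lie algebra $\mathscr M$: $\zeta_0=0$, $\zeta_{n+1}/\zeta_n$ is the centre of $\mathscr M/\zeta_n$, and $\zeta_\omega=\bigcup_{n<\omega}\zeta_n$. **Self-similar Lie algebras given by generators.** Let $X'$ be a commutative $\mathbb F_p$-algebra. Given a set $S'$ and for each $s\in S'$ an expression $\psi(s)=\sum_i y_i\otimes s_i+\delta$ with $y_i\in X'$, $s_i$ in the span of $S'$, and $\delta$ a derivation of $X'$, let $s$ act on $T(X')=\bigoplus_{n\ge0}X'^{\otimes n}$ by zero on $X'^{\otimes 0}$ and recursively by $s(x_1\otimes w)=\sum_i y_ix_1\otimes s_i(w)+\delta(x_1)\otimes w$. The self-similar (restricted) Lie algebra defined by these data is the (restricted) Lie algebra of linear endomorphisms of $T(X')$ generated by $S'$. **$\mathscr L_{\mathrm G}$ and ${}_2\mathscr L_{\mathrm G}$.** These are respectively the Lie algebra and the restricted Lie algebra over $\mathbb F_2$ with alphabet $X'=\mathbb F_2[x]/(x^2)$ defined by generators $a,b,c,d$ with $\psi(a)=\partial_x$, $\psi(b)=x\otimes(a+c)$, $\psi(c)=x\otimes(a+d)$, $\psi(d)=x\otimes b$, where $\partial_x=d/dx$. **$\mathscr L(G)$.** Let $G$ be a group acting on words over $\mathbb F_p$ with $\psi:G\to G\wr\mathbb F_p$, and $S$ a generating set with $\psi(S)\subseteq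 S^{\mathbb F_p}\times\mathbb F_p$; let $S'\subseteq S$ be such that every $s\in S$ is of the form $(s')^n$ for unique $s'\in S'$, $n\in\mathbb F_p$ (the identity being a zeroth power, contributing $0$ below). Put $X'=\mathbb F_p[x]/(x^p)$. For $s'\in S'$ with $\psi(s')=((s_i^{n_i})_{i\in\mathbb F_p},n)$, $s_i\in S'$, set $\psi'(s')=\sum_{i=0}^{p-1}x^i(x+1)^{p-1-i}n_i\otimes s_i+n\partial_x$; collect this as $\sum_{s\in S'}f_s(x)\otimes s+n\partial_x$, and let $\overline{f_s}$ be the leading (highest-degree) monomial of $f_s$ with its coefficient. $\mathscr L(G)$ is the self-similar restricted Lie algebra over $\mathbb F_p$ with alphabet $X'$ generated by $S'$ with $\psi(s')=\sum_{s\in S'}\overline{f_s}(x)\otimes s+n\partial_x$. For the Grigorchuk group, $p=2$, $S=\{1,a,b,c,d\}$ and $S'=\{a,b,c,d\}$. *)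

theory Defs
  imports
    "HOL-Algebra.Algebra"
    "HOL-Library.Z2"
    "HOL-Library.Cardinality"
    "HOL-Computational_Algebra.Polynomial"
begin

section \<open>Lie rings\<close>

text \<open>
  The additive group of a Lie ring is written in the multiplicative notation of HOL-Algebra, so
  that quotients, direct sums and isomorphisms of groups are those of the library. Scalars are not
  part of the record: the base ring is always the integers or the prime field with two elements,
  and then scalar multiplication is determined by addition and every additive map is linear.
\<close>

record 'a lie_ring = "'a monoid" +
  brak :: "'a \<Rightarrow> 'a \<Rightarrow> 'a"

record 'a restricted_lie_ring = "'a lie_ring" +
  pmap :: "'a \<Rightarrow> 'a"

definition lie_isos ::
    "('a, 'm) lie_ring_scheme \<Rightarrow> ('b, 'n) lie_ring_scheme \<Rightarrow> ('a \<Rightarrow> 'b) set"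
  where "lie_isos L M =
    {h \<in> iso L M. \<forall>x\<in>carrier L. \<forall>y\<in>carrier L. h (brak L x y) = brak M (h x) (h y)}"

definition lie_isomorphic ::
    "('a, 'm) lie_ring_scheme \<Rightarrow> ('b, 'n) lie_ring_scheme \<Rightarrow> bool"
  where "lie_isomorphic L M \<longleftrightarrow> lie_isos L M \<noteq> {}"

definition restricted_lie_isomorphic ::
    "('a, 'm) restricted_lie_ring_scheme \<Rightarrow> ('b, 'n) restricted_lie_ring_scheme \<Rightarrow> bool"
  where "restricted_lie_isomorphic L M \<longleftrightarrow>
    (\<exists>h\<in>lie_isos L M. \<forall>x\<in>carrier L. h (pmap L x) = pmap M (h x))"

definition lie_centre :: "('a, 'm) lie_ring_scheme \<Rightarrow> 'a set"
  where "lie_centre L = {x \<in> carrier L. \<forall>y\<in>carrier L. brak L x y = \<one>\<^bsub>L\<^esub>}"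

definition lie_quot :: "('a, 'm) lie_ring_scheme \<Rightarrow> 'a set \<Rightarrow> 'a set lie_ring"
  where "lie_quot L I =
    \<lparr>carrier = carrier (L Mod I), monoid.mult = monoid.mult (L Mod I), one = one (L Mod I),
     brak = (\<lambda>A B. \<Union>x\<in>A. \<Union>y\<in>B. I #>\<^bsub>L\<^esub> brak L x y)\<rparr>"

definition restricted_lie_quot ::
    "('a, 'm) restricted_lie_ring_scheme \<Rightarrow> 'a set \<Rightarrow> 'a set restricted_lie_ring"
  where "restricted_lie_quot L I =
    \<lparr>carrier = carrier (lie_quot L I), monoid.mult = monoid.mult (lie_quot L I), one = one (lie_quot L I),
     brak = brak (lie_quot L I), pmap = (\<lambda>A. \<Union>x\<in>A. I #>\<^bsub>L\<^esub> pmap L x)\<rparr>"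

primrec upper_central :: "('a, 'm) lie_ring_scheme \<Rightarrow> nat \<Rightarrow> 'a set"
  where
    "upper_central L 0 = {\<one>\<^bsub>L\<^esub>}"
  | "upper_central L (Suc n) =
      {x \<in> carrier L. upper_central L n #>\<^bsub>L\<^esub> x \<in> lie_centre (lie_quot L (upper_central L n))}"

definition upper_central_omega :: "('a, 'm) lie_ring_scheme \<Rightarrow> 'a set"
  where "upper_central_omega L = (\<Union>n. upper_central L n)"


section \<open>Lie rings associated with central series of a group\<close>

definition commutator ::
    "('a, 'm) monoid_scheme \<Rightarrow> 'a \<Rightarrow> 'a \<Rightarrow> 'a"
  where "commutator G g h = g \<otimes>\<^bsub>G\<^esub> h \<otimes>\<^bsub>G\<^esub> inv\<^bsub>G\<^esub> g \<otimes>\<^bsub>G\<^esub> inv\<^bsub>G\<^esub> h"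

text \<open>Series are indexed from 1; the value at 0 is irrelevant.\<close>

fun lower_central :: "('a, 'm) monoid_scheme \<Rightarrow> nat \<Rightarrow> 'a set"
  where
    "lower_central G 0 = carrier G"
  | "lower_central G (Suc 0) = carrier G"
  | "lower_central G (Suc (Suc n)) =
      generate G {commutator G g h | g h. g \<in> carrier G \<and> h \<in> lower_central G (Suc n)}"

text \<open>
  The second term is the subgroup generated by the p-th powers of the elements of the term of
  index \<open>\<lceil>n/p\<rceil> = (n + p - 1) div p\<close>; both terms being normal, the subgroup generated by all
  generators together is their product. The guard on \<open>p\<close> serves only termination.
\<close>

function dimension_series :: "('a, 'm) monoid_scheme \<Rightarrow> nat \<Rightarrow> nat \<Rightarrow> 'a set"
  where "dimension_series G p n =
    (if n \<le> 1 \<or> p < 2 then carrier G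
     else generate G
       ({commutator G g h | g h. g \<in> carrier G \<and> h \<in> dimension_series G p (n - 1)} \<union>
        {h [^]\<^bsub>G\<^esub> p | h. h \<in> dimension_series G p ((n + p - 1) div p)}))"
  by auto

termination
proof (relation "measure (\<lambda>(G, p, n). n)", goal_cases)
  case (3 G p n)
  then have n: "2 \<le> n" and p: "2 \<le> p"
    by auto
  have "n + p \<le> n * p"
  proof -
    obtain i j where "n = i + 2" "p = j + 2"
      using n p by (metis le_add_diff_inverse2)
    then show ?thesis
      by (simp add: algebra_simps)
  qed
  then have "n + p - 1 < n * p"
    using n by linarith
  then have "(n + p - 1) div p < n"
    using p by (simp add: div_less_iff_less_mult)
  then show ?case
    by simp
qed auto

context
  fixes G :: "('a, 'm) monoid_scheme"
    and N :: "nat \<Rightarrow> 'a set"  \<comment> \<open>a descending central series with \<open>[N m, N n] \<subseteq> N (m + n)\<close>\<close>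
begin

definition layer :: "nat \<Rightarrow> 'a set monoid"
  where "layer n = (G\<lparr>carrier := N n\<rparr>) Mod N (Suc n)"

definition layer_brak :: "nat \<Rightarrow> nat \<Rightarrow> 'a set \<Rightarrow> 'a set \<Rightarrow> 'a set"
  where "layer_brak m n A B = (\<Union>g\<in>A. \<Union>h\<in>B. N (Suc (m + n)) #>\<^bsub>G\<^esub> commutator G g h)"

definition layer_square :: "nat \<Rightarrow> 'a set \<Rightarrow> 'a set"
  where "layer_square n A = (\<Union>g\<in>A. N (Suc (2 * n)) #>\<^bsub>G\<^esub> (g [^]\<^bsub>G\<^esub> (2::nat)))"

definition graded_brak :: "(nat \<Rightarrow> 'a set) \<Rightarrow> (nat \<Rightarrow> 'a set) \<Rightarrow> nat \<Rightarrow> 'a set"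
  where "graded_brak x y =
    (\<lambda>k\<in>{1..}. \<Otimes>\<^bsub>layer k\<^esub>m\<in>{1..<k}. layer_brak m (k - m) (x m) (y (k - m)))"

text \<open>
  For \<open>p = 2\<close> the p-mapping is extended from homogeneous elements by
  \<open>(x + y)\<^sup>[\<^sup>2\<^sup>] = x\<^sup>[\<^sup>2\<^sup>] + y\<^sup>[\<^sup>2\<^sup>] + [x, y]\<close>: the component of degree \<open>k\<close> of the image of a sum of homogeneous
  \<open>x\<^sub>m\<close> is the square of \<open>x\<^sub>m\<close> with \<open>2m = k\<close> (if any) plus all \<open>[x\<^sub>m, x\<^sub>n]\<close> with \<open>m < n\<close>, \<open>m + n = k\<close>.
\<close>

definition graded_square :: "(nat \<Rightarrow> 'a set) \<Rightarrow> nat \<Rightarrow> 'a set"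
  where "graded_square x =
    (\<lambda>k\<in>{1..}.
      (if even k then layer_square (k div 2) (x (k div 2)) else \<one>\<^bsub>layer k\<^esub>)
      \<otimes>\<^bsub>layer k\<^esub>
      (\<Otimes>\<^bsub>layer k\<^esub>m\<in>{m. 1 \<le> m \<and> m < k - m}. layer_brak m (k - m) (x m) (x (k - m))))"

definition graded_group :: "(nat \<Rightarrow> 'a set) monoid"
  where "graded_group = sum_group {1..} layer"

end

definition lie_Z :: "('a, 'm) monoid_scheme \<Rightarrow> (nat \<Rightarrow> 'a set) lie_ring"
  where "lie_Z G =
    (let N = lower_central G; S = graded_group G N in
     \<lparr>carrier = carrier S, monoid.mult = monoid.mult S, one = one S, brak = graded_brak G N\<rparr>)"

definition lie_F2 :: "('a, 'm) monoid_scheme \<Rightarrow> (nat \<Rightarrow> 'a set) restricted_lie_ring"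
  where "lie_F2 G =
    (let N = dimension_series G 2; S = graded_group G N in
     \<lparr>carrier = carrier S, monoid.mult = monoid.mult S, one = one S,
      brak = graded_brak G N, pmap = graded_square G N\<rparr>)"


section \<open>Self-similar Lie algebras with alphabet \<open>F\<^sub>p[x]/(x\<^sup>p)\<close>\<close>

text \<open>
  Throughout, \<open>'k\<close> is the prime field with \<open>p = CARD('k)\<close> elements. Elements of the alphabet
  \<open>X' = F\<^sub>p[x]/(x\<^sup>p)\<close> are represented by polynomials of degree below \<open>p\<close>, and elements of the tensor
  algebra \<open>T(X')\<close> by their finitely many coefficients in the monomial basis: the word
  \<open>[i\<^sub>1, \<dots>, i\<^sub>n]\<close> stands for \<open>x\<^bsup>i\<^sub>1\<^esup> \<otimes> \<dots> \<otimes> x\<^bsup>i\<^sub>n\<^esup>\<close>.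
\<close>

definition alph_mult :: "'k::field poly \<Rightarrow> 'k poly \<Rightarrow> 'k poly"
  where "alph_mult f g = (f * g) mod monom 1 CARD('k)"

definition tens :: "(nat list \<Rightarrow> 'k::zero) set"
  where "tens = {v. finite {w. v w \<noteq> 0} \<and> (\<forall>w. v w \<noteq> 0 \<longrightarrow> set w \<subseteq> {..<CARD('k)})}"

text \<open>
  The datum for a generator \<open>s\<close> is \<open>\<psi>(s) = (\<Sum>t\<in>S. coef s t \<otimes> t) + der s\<close>, with \<open>coef s t\<close> in \<open>X'\<close> and
  \<open>der s\<close> a derivation of \<open>X'\<close>.
\<close>

record ('s, 'x) self_similar =
  gens :: "'s set"
  coef :: "'s \<Rightarrow> 's \<Rightarrow> 'x"
  der :: "'s \<Rightarrow> 'x \<Rightarrow> 'x"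

text \<open>
  Writing \<open>v = (\<Sum>i<p. x\<^sup>i \<otimes> v\<^sub>i)\<close> up to a component of degree 0, where \<open>v\<^sub>i = (\<lambda>u. v (i # u))\<close>, the
  coefficient of \<open>x\<^sup>j \<otimes> w\<close> in \<open>s v\<close> is read off from
  \<open>s (x\<^sup>i \<otimes> v\<^sub>i) = (\<Sum>t. coef s t \<cdot> x\<^sup>i \<otimes> t v\<^sub>i) + der s x\<^sup>i \<otimes> v\<^sub>i\<close>.
\<close>

fun act :: "('s, 'k::field poly) self_similar \<Rightarrow> 's \<Rightarrow> (nat list \<Rightarrow> 'k) \<Rightarrow> nat list \<Rightarrow> 'k"
  where
    "act \<Psi> s v [] = 0"
  | "act \<Psi> s v (j # w) =
      (\<Sum>i<CARD('k).
        (\<Sum>t\<in>gens \<Psi>. coeff (alph_mult (coef \<Psi> s t) (monom 1 i)) j * act \<Psi> t (\<lambda>u. v (i # u)) w)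
        + coeff (der \<Psi> s (monom 1 i)) j * v (i # w))"

text \<open>Endomorphisms of \<open>T(X')\<close> are represented by functions that are extensional on \<open>tens\<close>.\<close>

type_synonym 'k endo = "(nat list \<Rightarrow> 'k) \<Rightarrow> (nat list \<Rightarrow> 'k)"

definition endo_zero :: "'k::field endo"
  where "endo_zero = (\<lambda>v\<in>tens. \<lambda>w. 0)"

definition endo_add :: "'k::field endo \<Rightarrow> 'k endo \<Rightarrow> 'k endo"
  where "endo_add f g = (\<lambda>v\<in>tens. \<lambda>w. f v w + g v w)"

definition endo_scale :: "'k::field \<Rightarrow> 'k endo \<Rightarrow> 'k endo"
  where "endo_scale c f = (\<lambda>v\<in>tens. \<lambda>w. c * f v w)"

definition endo_brak :: "'k::field endo \<Rightarrow> 'k endo \<Rightarrow> 'k endo"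
  where "endo_brak f g = (\<lambda>v\<in>tens. \<lambda>w. f (g v) w - g (f v) w)"

definition endo_pmap :: "'k::field endo \<Rightarrow> 'k endo"
  where "endo_pmap f = (\<lambda>v\<in>tens. (f ^^ CARD('k)) v)"

definition lie_subalgebra :: "'k::field endo set \<Rightarrow> bool"
  where "lie_subalgebra A \<longleftrightarrow>
    endo_zero \<in> A \<and> (\<forall>f\<in>A. \<forall>g\<in>A. endo_add f g \<in> A) \<and> (\<forall>c. \<forall>f\<in>A. endo_scale c f \<in> A) \<and>
    (\<forall>f\<in>A. \<forall>g\<in>A. endo_brak f g \<in> A)"

definition restricted_lie_subalgebra :: "'k::field endo set \<Rightarrow> bool"
  where "restricted_lie_subalgebra A \<longleftrightarrow> lie_subalgebra A \<and> (\<forall>f\<in>A. endo_pmap f \<in> A)"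

definition gen_endos :: "('s, 'k::field poly) self_similar \<Rightarrow> 'k endo set"
  where "gen_endos \<Psi> = (\<lambda>s. \<lambda>v\<in>tens. act \<Psi> s v) ` gens \<Psi>"

definition self_similar_lie :: "('s, 'k::field poly) self_similar \<Rightarrow> 'k endo lie_ring"
  where "self_similar_lie \<Psi> =
    \<lparr>carrier = lie_subalgebra hull gen_endos \<Psi>,
     monoid.mult = endo_add, one = endo_zero, brak = endo_brak\<rparr>"

definition self_similar_restricted_lie ::
    "('s, 'k::field poly) self_similar \<Rightarrow> 'k endo restricted_lie_ring"
  where "self_similar_restricted_lie \<Psi> =
    \<lparr>carrier = restricted_lie_subalgebra hull gen_endos \<Psi>,
     monoid.mult = endo_add, one = endo_zero, brak = endo_brak, pmap = endo_pmap\<rparr>"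


section \<open>The restricted Lie algebra \<open>\<L>(G)\<close> of a self-similar group\<close>

text \<open>
  For a permutation \<open>g\<close> of the words over \<open>F\<^sub>p\<close> with \<open>\<psi>(g) = ((g\<^sub>i)\<^sub>i, n)\<close>, that is
  \<open>g (i w) = (i + n) (g\<^sub>i w)\<close>, the following are \<open>g\<^sub>i\<close> and \<open>n\<close>.
\<close>

definition section_at :: "('k::field list \<Rightarrow> 'k list) \<Rightarrow> 'k \<Rightarrow> 'k list \<Rightarrow> 'k list"
  where "section_at g i = (\<lambda>w. tl (g (i # w)))"

definition rotation :: "('k::field list \<Rightarrow> 'k list) \<Rightarrow> 'k"
  where "rotation g = hd (g [0])"

text \<open>
  The exponent \<open>n\<close> in \<open>F\<^sub>p\<close> with \<open>h = s\<^sup>n\<close>; it is 0 if \<open>h\<close> is the identity, and also if \<open>h\<close> is not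
  a power of \<open>s\<close>, in which case \<open>s\<close> is not the element of \<open>S'\<close> of which \<open>h\<close> is a power.
\<close>

definition exponent_of :: "('k::field list \<Rightarrow> 'k list) \<Rightarrow> ('k list \<Rightarrow> 'k list) \<Rightarrow> 'k"
  where "exponent_of s h =
    (if \<exists>n<CARD('k). h = s ^^ n then of_nat (LEAST n. h = s ^^ n) else 0)"

definition section_poly ::
    "('k::field list \<Rightarrow> 'k list) \<Rightarrow> ('k list \<Rightarrow> 'k list) \<Rightarrow> 'k poly"
  where "section_poly s' s =
    (\<Sum>i<CARD('k). smult (exponent_of s (section_at s' (of_nat i)))
       (monom 1 1 ^ i * (monom 1 1 + 1) ^ (CARD('k) - 1 - i)))"

definition leading_monomial :: "'k::field poly \<Rightarrow> 'k poly"
  where "leading_monomial f = monom (lead_coeff f) (degree f)"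

definition group_self_similar ::
    "('k::field list \<Rightarrow> 'k list) set \<Rightarrow> ('k list \<Rightarrow> 'k list, 'k poly) self_similar"
  where "group_self_similar S' =
    \<lparr>gens = S', coef = (\<lambda>s' s. leading_monomial (section_poly s' s)),
     der = (\<lambda>s' f. smult (rotation s') (pderiv f))\<rparr>"

definition lie_of_group :: "('k::field list \<Rightarrow> 'k list) set \<Rightarrow> 'k endo restricted_lie_ring"
  where "lie_of_group S' = self_similar_restricted_lie (group_self_similar S')"


section \<open>The Grigorchuk group and the Lie algebras \<open>\<L>\<^sub>G\<close> and \<open>\<^sub>2\<L>\<^sub>G\<close>\<close>

fun grig_a :: "bit list \<Rightarrow> bit list"
  where
    "grig_a [] = []"
  | "grig_a (i # w) = (i + 1) # w"

fun grig_b grig_c grig_d :: "bit list \<Rightarrow> bit list"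
  where
    "grig_b [] = []"
  | "grig_b (i # w) = (if i = 0 then 0 # grig_a w else 1 # grig_c w)"
  | "grig_c [] = []"
  | "grig_c (i # w) = (if i = 0 then 0 # grig_a w else 1 # grig_d w)"
  | "grig_d [] = []"
  | "grig_d (i # w) = (if i = 0 then 0 # w else 1 # grig_b w)"

definition grig_gens :: "(bit list \<Rightarrow> bit list) set"
  where "grig_gens = {grig_a, grig_b, grig_c, grig_d}"

definition Grigorchuk :: "(bit list \<Rightarrow> bit list) monoid"
  where "Grigorchuk = (BijGroup UNIV)\<lparr>carrier := generate (BijGroup UNIV) grig_gens\<rparr>"

datatype letter = Ga | Gb | Gc | Gd

fun grig_coef :: "letter \<Rightarrow> letter \<Rightarrow> bit poly"
  where
    "grig_coef Gb Ga = monom 1 1"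
  | "grig_coef Gb Gc = monom 1 1"
  | "grig_coef Gc Ga = monom 1 1"
  | "grig_coef Gc Gd = monom 1 1"
  | "grig_coef Gd Gb = monom 1 1"
  | "grig_coef _ _ = 0"

definition grig_data :: "(letter, bit poly) self_similar"
  where "grig_data =
    \<lparr>gens = {Ga, Gb, Gc, Gd}, coef = grig_coef, der = (\<lambda>s f. if s = Ga then pderiv f else 0)\<rparr>"

definition L_Grig :: "bit endo lie_ring"
  where "L_Grig = self_similar_lie grig_data"

definition restricted_L_Grig :: "bit endo restricted_lie_ring"
  where "restricted_L_Grig = self_similar_restricted_lie grig_data"

end

theory Submission
  imports Defs "HOL-Library.Function_Algebras"
begin

text \<open>
  Identify the elements of \<open>T(X')\<close> with polynomial functions on binary words, and give the monomial with
  exponents \<open>w\<^sub>0 w\<^sub>1 w\<^sub>2 \<dots>\<close> the weight \<open>\<Sum> 2\<^sup>i w\<^sub>i\<close>. A group element \<open>g\<close> acts on functions as \<open>1 + \<delta>\<close>, where \<open>\<delta>\<close> lowers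
  the weight. The elements for which \<open>\<delta>\<close> lowers it by at least \<open>n\<close> form a filtration \<open>F n\<close> with
  \<open>[F m, F n] \<subseteq> F (m + n)\<close> and with squares of \<open>F n\<close> in \<open>F (2n)\<close>, and the leading terms (symbols) of the \<open>\<delta>\<close>
  define homomorphisms from both graded Lie rings of \<open>G\<close> to the endomorphisms of \<open>T(X')\<close>. In degree 1 they map
  the generators of \<open>G\<close> to those of the self-similar Lie algebra, so they are onto the two hulls.

  An element of the restricted hull commuting with the generators is zero: writing it as
  \<open>\<alpha> \<partial>\<^sub>x + 1 \<otimes> U + x \<otimes> V\<close>, one gets \<open>\<alpha> = 0\<close>, \<open>V = 0\<close> and a commuting \<open>U\<close> one level further down. So the centre and the
  upper central series lie in the kernels. In degree \<open>n\<close> the kernel is the image of \<open>N n \<inter> F (n + 1)\<close>, where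
  \<open>N\<close> is the dimension series or the lower central series. A recursive description of both series by
  pairs of sections shows that the first kernel vanishes in all odd degrees, which makes it central, and that the
  second one vanishes in all degrees \<open>2\<^sup>r\<close> with \<open>r \<ge> 2\<close>, so that bracketing with it repeatedly gives zero.
\<close>

text \<open>Weights double from level to level because an operator \<open>x \<otimes> T\<close> then
  has degree \<open>2 deg T - 1\<close>: \<open>\<partial>\<^sub>x\<close> has degree 1, and so have
  \<open>b\<close>, \<open>c\<close>, \<open>d\<close> by recursion. Taking symbols drops the lower
  term of \<open>1 + x\<close>, just as leading monomials do in the algebra attached to the group,
  and this is why the two sets of data coincide. The obstacle is that neither series of
  \<open>G\<close> is cut out by \<open>F\<close>. A pair \<open>(z, 1)\<close> has a symbol of the
  form \<open>x \<otimes> Z\<close>, whose square vanishes because \<open>x\<^sup>2 = 0\<close> in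
  the alphabet; the square of the pair therefore lies deeper in \<open>F\<close> than its place in
  the series predicts. This is how kernels arise. They are not computed: it suffices to find degrees
  in which a layer has at most two elements, the non-trivial one being represented by
  \<open>yv n\<close>, whose symbol is non-zero (in degree 1, three generators with independent
  symbols take its place).\<close>

declare add_bit_eq_xor [simp del] mult_bit_eq_and [simp del]

type_synonym vec = "nat list \<Rightarrow> bit"

lemma bit_add_self [simp]: "a + a = (0::bit)"
  by (cases a) auto

lemma bit_add_self_left [simp]: "a + (a + b) = (b::bit)"
  by (simp flip: add.assoc)

lemma vec_add_self [simp]: "v + v = (0::'b \<Rightarrow> bit)"
  by (simp add: fun_eq_iff)

lemma vec_add_self_left [simp]: "v + (v + u) = (u::'b \<Rightarrow> bit)"
  by (simp flip: add.assoc)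

lemma bit_add_eq_0_iff: "a + b = 0 \<longleftrightarrow> a = (b::bit)"
  by (cases a; cases b) auto

lemma vec_add_eq_0_iff: "u + v = 0 \<longleftrightarrow> u = (v::'b \<Rightarrow> bit)"
  by (simp add: fun_eq_iff bit_add_eq_0_iff)

section \<open>Filtered operators and their symbols\<close>

fun wt :: "nat list \<Rightarrow> nat"
  where
    "wt [] = 0"
  | "wt (j # w) = j + 2 * wt w"

text \<open>The bound is strict, so \<open>fil 0\<close> contains only 0 and the truncated
  subtraction in \<open>filt\<close> is harmless: lowering below weight 0 means annihilating.
  Supports may be infinite, so operators can be studied on all coefficient functions before
  restricting to \<open>tens\<close>.\<close>

definition fil :: "nat \<Rightarrow> vec set"
  where "fil t = {v. \<forall>w. v w \<noteq> 0 \<longrightarrow> wt w < t}"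

definition proj :: "nat \<Rightarrow> vec \<Rightarrow> vec"
  where "proj t v = (\<lambda>w. if wt w = t then v w else 0)"

definition filt :: "nat \<Rightarrow> (vec \<Rightarrow> vec) \<Rightarrow> bool"
  where "filt r T \<longleftrightarrow> (\<forall>t. \<forall>v\<in>fil t. T v \<in> fil (t - r))"

text \<open>The part of \<open>T\<close> of degree exactly \<open>r\<close>, read off one
  coefficient at a time: the value at \<open>w\<close> sees only the input of weight
  \<open>wt w + r\<close>. For \<open>filt r T\<close> this is the leading term.\<close>

definition symb :: "nat \<Rightarrow> (vec \<Rightarrow> vec) \<Rightarrow> vec \<Rightarrow> vec"
  where "symb r T v = (\<lambda>w. T (proj (wt w + r) v) w)"

definition additive_op :: "(vec \<Rightarrow> vec) \<Rightarrow> bool"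
  where "additive_op T \<longleftrightarrow> (\<forall>u v. T (u + v) = T u + T v)"

text \<open>This is what makes symbols of group elements preserve \<open>tens\<close>. Words are
  lists of arbitrary naturals, so the restriction to binary letters has to be imposed on the
  output.\<close>

definition local_op :: "(vec \<Rightarrow> vec) \<Rightarrow> bool"
  where "local_op T \<longleftrightarrow>
    (\<forall>v n. (\<forall>w. v w \<noteq> 0 \<longrightarrow> length w \<le> n) \<longrightarrow>
      (\<forall>w. T v w \<noteq> 0 \<longrightarrow> length w \<le> n \<and> set w \<subseteq> {..<2}))"

lemma additive_opD: "additive_op T \<Longrightarrow> T (u + v) = T u + T v"
  by (simp add: additive_op_def)

lemma additive_op_0: "additive_op T \<Longrightarrow> T 0 = 0"
  by (metis additive_opD add_cancel_right_right)

lemma filD: "v \<in> fil t \<Longrightarrow> t \<le> wt w \<Longrightarrow> v w = 0"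
  unfolding fil_def by (metis (mono_tags, lifting) leD mem_Collect_eq)

lemma fil_mono: "s \<le> t \<Longrightarrow> fil s \<subseteq> fil t"
  by (auto simp: fil_def)

lemma fil_add: "u \<in> fil t \<Longrightarrow> v \<in> fil t \<Longrightarrow> u + v \<in> fil t"
  unfolding fil_def by (auto simp: plus_fun_def) (metis add.right_neutral bit_not_one_iff)

lemma fil_zero: "0 \<in> fil t"
  by (auto simp: fil_def)

lemma proj_fil: "t < s \<Longrightarrow> proj t v \<in> fil s"
  by (auto simp: fil_def proj_def split: if_splits)

lemma proj_add: "proj t (u + v) = proj t u + proj t v"
  by (auto simp: proj_def)

lemma proj_proj: "proj s (proj t v) = (if s = t then proj t v else 0)"
  by (auto simp: proj_def)

lemma fil_Suc_split: "v \<in> fil (Suc t) \<Longrightarrow> v + proj t v \<in> fil t"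
  unfolding fil_def proj_def by (auto simp: plus_fun_def less_Suc_eq split: if_splits)

lemma filtD: "filt r T \<Longrightarrow> v \<in> fil t \<Longrightarrow> T v \<in> fil (t - r)"
  by (simp add: filt_def)

lemma filt_mono: "filt r T \<Longrightarrow> s \<le> r \<Longrightarrow> filt s T"
  unfolding filt_def by (meson diff_le_mono2 fil_mono in_mono)

lemma filt_add: "filt r T \<Longrightarrow> filt r S \<Longrightarrow> filt r (\<lambda>v. T v + S v)"
  by (auto simp: filt_def intro!: fil_add)

lemma filt_comp: "filt r T \<Longrightarrow> filt s S \<Longrightarrow> filt (r + s) (\<lambda>v. T (S v))"
  unfolding filt_def by (metis add.commute diff_diff_left)

lemma symb_apply_add: "additive_op T \<Longrightarrow> additive_op (symb r T)"
  by (auto simp: additive_op_def symb_def proj_add fun_eq_iff)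

lemma symb_add: "symb r (\<lambda>v. T v + S v) v = symb r T v + symb r S v"
  by (auto simp: symb_def)

lemma symb_local: "local_op T \<Longrightarrow> local_op (symb r T)"
  unfolding local_op_def
proof (intro allI impI)
  fix v n w
  assume T: "\<forall>v n. (\<forall>w. v w \<noteq> 0 \<longrightarrow> length w \<le> n) \<longrightarrow>
      (\<forall>w. T v w \<noteq> 0 \<longrightarrow> length w \<le> n \<and> set w \<subseteq> {..<2})"
    and v: "\<forall>w. v w \<noteq> (0::bit) \<longrightarrow> length w \<le> n" and w: "symb r T v w \<noteq> 0"
  have "\<forall>u. proj (wt w + r) v u \<noteq> 0 \<longrightarrow> length u \<le> n"
    using v by (auto simp: proj_def split: if_splits)
  with T w show "length w \<le> n \<and> set w \<subseteq> {..<2}"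
    unfolding symb_def by blast
qed

lemma symb_eq_0: "filt (Suc r) T \<Longrightarrow> symb r T v = 0"
proof
  fix w
  assume T: "filt (Suc r) T"
  have "T (proj (wt w + r) v) \<in> fil (wt w + Suc r - Suc r)"
    by (rule filtD[OF T]) (simp add: proj_fil)
  then show "symb r T v w = 0 w"
    by (simp add: symb_def filD)
qed

text \<open>Splitting off the top component of \<open>v\<close>, the remainder is one weight lower
  and \<open>filt r T\<close> already suffices for it, while the top component contributes at the
  critical weight exactly the symbol.\<close>

lemma filt_Suc:
  assumes T: "additive_op T" "filt r T" and 0: "\<And>v. symb r T v = 0"
  shows "filt (Suc r) T"
  unfolding filt_def
proof (intro allI ballI)
  fix t v
  assume v: "v \<in> fil t"
  show "T v \<in> fil (t - Suc r)"
  proof (cases t)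
    case 0
    then show ?thesis
      using filtD[OF T(2) v] by simp
  next
    case (Suc s)
    have "T v w = 0" if w: "s - r \<le> wt w" for w
    proof (cases "wt w + r = s")
      case True
      have "v + proj s v \<in> fil s"
        using v Suc fil_Suc_split by simp
      then have "T (v + proj s v) w = 0"
        using filD[OF filtD[OF T(2)]] w by blast
      moreover have "T (proj s v) w = 0"
        using 0[of v] True unfolding symb_def fun_eq_iff by (metis zero_fun_apply)
      ultimately show ?thesis
        using additive_opD[OF T(1), of v "proj s v"] by simp
    next
      case False
      then have "t - r \<le> wt w"
        using w Suc by auto
      then show ?thesis
        using filD[OF filtD[OF T(2) v]] by blast
    qed
    then show ?thesis
      unfolding fil_def Suc by (auto simp: not_le[symmetric])
  qed
qed

text \<open>Leading terms multiply: \<open>S\<close> sends the component of weight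
  \<open>wt w + r + s\<close> to weights at most \<open>wt w + r\<close>, and everything strictly
  below that is sent by \<open>T\<close> below \<open>wt w\<close>.\<close>

lemma symb_comp:
  assumes T: "additive_op T" "filt r T" and S: "filt s S"
  shows "symb (r + s) (\<lambda>v. T (S v)) v = symb r T (symb s S v)"
proof
  fix w
  let ?u = "S (proj (wt w + (r + s)) v)"
  have u: "?u \<in> fil (Suc (wt w + r))"
    using filtD[OF S, of "proj (wt w + (r + s)) v" "Suc (wt w + r) + s"]
    by (simp add: proj_fil)
  have "T (?u + proj (wt w + r) ?u) w = 0"
    using filD[OF filtD[OF T(2) fil_Suc_split[OF u]], of w] by simp
  then have "T ?u w = T (proj (wt w + r) ?u) w"
    by (simp add: additive_opD[OF T(1)] bit_add_eq_0_iff)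
  moreover have "proj (wt w + r) ?u = proj (wt w + r) (symb s S v)"
    by (auto simp: proj_def symb_def fun_eq_iff add.assoc)
  ultimately show "symb (r + s) (\<lambda>v. T (S v)) v w = symb r T (symb s S v) w"
    by (simp add: symb_def)
qed

lemma symb_homogeneous:
  "symb r T v w = symb r T (proj (wt w + r) v) w"
  by (simp add: symb_def proj_proj)

lemma symb_other_degree:
  "additive_op T \<Longrightarrow> r \<noteq> s \<Longrightarrow> symb r T (proj (wt w + s) v) w = 0"
  by (simp add: symb_def proj_proj additive_op_0)

section \<open>The action of word permutations on polynomial functions\<close>

text \<open>
  A vector is the list of coefficients of a function on binary words in the basis of multilinear
  monomials; \<open>val\<close> and \<open>coef_of\<close> pass between the two.
\<close>

fun val :: "vec \<Rightarrow> bit list \<Rightarrow> bit"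
  where
    "val v [] = v []"
  | "val v (i # u) =
      (if i = 0 then val (\<lambda>w. v (0 # w)) u else val ((\<lambda>w. v (0 # w)) + (\<lambda>w. v (1 # w))) u)"

fun coef_of :: "(bit list \<Rightarrow> bit) \<Rightarrow> vec"
  where
    "coef_of F [] = F []"
  | "coef_of F (j # w) =
      (if j = 0 then coef_of (\<lambda>u. F (0 # u)) w
       else if j = 1 then coef_of ((\<lambda>u. F (0 # u)) + (\<lambda>u. F (1 # u))) w else 0)"

lemma val_add: "val (u + v) = val u + val v"
proof
  fix x show "val (u + v) x = (val u + val v) x"
  proof (induction x arbitrary: u v)
    case (Cons i x)
    show ?case
    proof (cases "i = 0")
      case True
      have "val (u + v) (i # x) = val ((\<lambda>w. u (0 # w)) + (\<lambda>w. v (0 # w))) x"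
        using True by (simp add: plus_fun_def)
      then show ?thesis
        unfolding Cons.IH using True by simp
    next
      case False
      have "val (u + v) (i # x) =
          val (((\<lambda>w. u (0 # w)) + (\<lambda>w. u (1 # w))) + ((\<lambda>w. v (0 # w)) + (\<lambda>w. v (1 # w)))) x"
        using False by (simp add: plus_fun_def add_ac)
      then show ?thesis
        unfolding Cons.IH using False by (simp add: Cons.IH)
    qed
  qed simp
qed

lemma coef_of_add: "coef_of (F + H) = coef_of F + coef_of H"
proof
  fix w show "coef_of (F + H) w = (coef_of F + coef_of H) w"
  proof (induction w arbitrary: F H)
    case (Cons j w)
    consider "j = 0" | "j = 1" | "j \<noteq> 0" "j \<noteq> 1" by blast
    then show ?case
    proof cases
      case 1
      have "coef_of (F + H) (j # w) = coef_of ((\<lambda>u. F (0 # u)) + (\<lambda>u. H (0 # u))) w"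
        using 1 by (simp add: plus_fun_def)
      then show ?thesis
        unfolding Cons.IH using 1 by simp
    next
      case 2
      have "coef_of (F + H) (j # w) =
          coef_of (((\<lambda>w. F (0 # w)) + (\<lambda>w. F (1 # w))) + ((\<lambda>w. H (0 # w)) + (\<lambda>w. H (1 # w)))) w"
        using 2 by (simp add: plus_fun_def add_ac)
      then show ?thesis
        unfolding Cons.IH using 2 by (simp add: Cons.IH)
    qed simp
  qed simp
qed

lemma val_coef_of [simp]: "val (coef_of F) = F"
proof
  fix x show "val (coef_of F) x = F x"
  proof (induction x arbitrary: F)
    case (Cons i x)
    have "(\<lambda>w. coef_of F (0 # w)) = coef_of (\<lambda>u. F (0 # u))"
      "(\<lambda>w. coef_of F (Suc 0 # w)) = coef_of ((\<lambda>u. F (0 # u)) + (\<lambda>u. F (1 # u)))"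
      by auto
    then show ?case
      by (cases i) (simp_all add: Cons.IH val_add)
  qed simp
qed

lemma coef_of_zero [simp]: "coef_of 0 = 0"
  by (metis coef_of_add add_cancel_right_right)

lemma val_zero [simp]: "val 0 = 0"
  by (metis val_add add_cancel_right_right)

lemma val_long: "(\<And>w. v w \<noteq> 0 \<Longrightarrow> length w \<le> n) \<Longrightarrow> n < length x \<Longrightarrow> val v x = 0"
proof (induction x arbitrary: v n)
  case (Cons i x)
  have n: "\<And>w. v w \<noteq> 0 \<Longrightarrow> length w \<le> n"
    using Cons.prems by blast
  show ?case
  proof (cases n)
    case 0
    then have "v (j # w) = 0" for j w
      using n[of "j # w"] by (cases "v (j # w)") auto
    then have "(\<lambda>w. v (j # w)) = 0" for j
      by auto
    then show ?thesis
      by simp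
  next
    case (Suc m)
    have "length w \<le> m" if "v (j # w) \<noteq> 0" for j w
      using n[OF that] Suc by simp
    then have "val (\<lambda>w. v (j # w)) x = 0" for j
      using Cons.prems Suc by (intro Cons.IH[of _ m]) auto
    then show ?thesis
      by (simp add: val_add)
  qed
next
  case Nil
  then show ?case by simp
qed

lemma coef_of_supp:
  "(\<And>x. F x \<noteq> 0 \<Longrightarrow> length x \<le> n) \<Longrightarrow> coef_of F w \<noteq> 0 \<Longrightarrow> length w \<le> n \<and> set w \<subseteq> {..<2}"
proof (induction w arbitrary: F n)
  case (Cons j w)
  have n: "\<And>x. F x \<noteq> 0 \<Longrightarrow> length x \<le> n"
    using Cons.prems by blast
  obtain m where m: "n = Suc m"
  proof (cases n)
    case 0
    then have "F (i # x) = 0" for i x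
      using n[of "i # x"] by (cases "F (i # x)") auto
    then have "(\<lambda>x. F (i # x)) = 0" for i
      by auto
    then show ?thesis
      using Cons.prems(2) by (simp split: if_splits)
  qed
  have len: "length x \<le> m" if "F (i # x) \<noteq> 0" for i x
    using n[OF that] m by simp
  have j: "j = 0 \<or> j = 1"
    using Cons.prems(2) by (auto split: if_splits)
  have "length w \<le> m \<and> set w \<subseteq> {..<2}"
  proof (cases "coef_of (\<lambda>x. F (0 # x)) w = 0")
    case True
    then have "coef_of (\<lambda>x. F (1 # x)) w \<noteq> 0"
      using Cons.prems(2) by (auto simp: coef_of_add split: if_splits)
    then show ?thesis
      using Cons.IH[of "\<lambda>x. F (1 # x)" m] len by blast
  next
    case False
    then show ?thesis
      using Cons.IH[of "\<lambda>x. F (0 # x)" m] len by blast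
  qed
  then show ?case
    using j m by auto
qed auto

text \<open>The operator \<open>g - 1\<close> on functions, where \<open>g\<close> acts by
  composition; over \<open>bit\<close> the difference is a sum. Composition reverses products, hence
  the order of \<open>delta h\<close> and \<open>delta g\<close> in
  \<open>delta_comp\<close>.\<close>

definition delta :: "(bit list \<Rightarrow> bit list) \<Rightarrow> vec \<Rightarrow> vec"
  where "delta g v = coef_of ((\<lambda>x. val v (g x)) + val v)"

lemma delta_id [simp]: "delta (\<lambda>x. x) = (\<lambda>v. 0)"
  by (rule ext) (simp add: delta_def del: plus_fun_def)

lemma delta_additive: "additive_op (delta g)"
proof -
  have "(\<lambda>x. (val u + val v) (g x)) = (\<lambda>x. val u (g x)) + (\<lambda>x. val v (g x))" for u v
    by auto
  then show ?thesis
    by (auto simp: additive_op_def delta_def val_add coef_of_add add_ac)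
qed

lemma delta_local:
  assumes "\<And>x. length (g x) = length x"
  shows "local_op (delta g)"
  unfolding local_op_def
proof (intro allI impI)
  fix v n w
  assume v: "\<forall>w. v w \<noteq> (0::bit) \<longrightarrow> length w \<le> n" and w: "delta g v w \<noteq> 0"
  have "length x \<le> n" if "((\<lambda>x. val v (g x)) + val v) x \<noteq> 0" for x
    using that val_long[of v n] v assms by (metis (full_types) add.right_neutral leI plus_fun_apply)
  then show "length w \<le> n \<and> set w \<subseteq> {..<2}"
    using coef_of_supp w unfolding delta_def by blast
qed

lemma delta_comp: "delta (g \<circ> h) v = delta h (delta g v) + delta g v + delta h v"
proof -
  let ?f = "val v"
  have "delta h (delta g v) =
      coef_of ((\<lambda>x. ?f (g (h x))) + (\<lambda>x. ?f (h x)) + ((\<lambda>x. ?f (g x)) + ?f))"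
    unfolding delta_def by (auto intro!: arg_cong[of _ _ coef_of])
  then show ?thesis
    unfolding delta_def by (simp add: coef_of_add o_def add_ac)
qed

declare dimension_series.simps [simp del] lower_central.simps(3) [simp del]

section \<open>Commutators and central series\<close>

context group
begin

abbreviation cm :: "'a \<Rightarrow> 'a \<Rightarrow> 'a"
  where "cm \<equiv> commutator G"

lemma cancel_inv_left [simp]:
  "x \<in> carrier G \<Longrightarrow> y \<in> carrier G \<Longrightarrow> inv x \<otimes> (x \<otimes> y) = y"
  "x \<in> carrier G \<Longrightarrow> y \<in> carrier G \<Longrightarrow> x \<otimes> (inv x \<otimes> y) = y"
  by (simp_all flip: m_assoc)

text \<open>Together with the cancellation rules just declared as simp rules, these bring group
  words to reduced right-associated form, so that identities valid in free groups are settled by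
  simplification.\<close>

lemmas word_simps = commutator_def m_assoc inv_mult_group

lemma cm_closed [simp, intro]: "x \<in> carrier G \<Longrightarrow> y \<in> carrier G \<Longrightarrow> cm x y \<in> carrier G"
  by (simp add: commutator_def)

lemma inv_cm: "x \<in> carrier G \<Longrightarrow> y \<in> carrier G \<Longrightarrow> inv (cm x y) = cm y x"
  by (simp add: word_simps)

lemma cm_mult_left:
  "x \<in> carrier G \<Longrightarrow> y \<in> carrier G \<Longrightarrow> z \<in> carrier G \<Longrightarrow>
    cm (x \<otimes> y) z = x \<otimes> cm y z \<otimes> inv x \<otimes> cm x z"
  by (simp add: word_simps)

lemma cm_inv_left:
  "x \<in> carrier G \<Longrightarrow> z \<in> carrier G \<Longrightarrow> cm (inv x) z = inv x \<otimes> inv (cm x z) \<otimes> inv (inv x)"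
  by (simp add: word_simps)

lemma cm_one [simp]: "x \<in> carrier G \<Longrightarrow> cm \<one> x = \<one>" "x \<in> carrier G \<Longrightarrow> cm x \<one> = \<one>"
  by (simp_all add: word_simps)

lemma cm_square:
  "x \<in> carrier G \<Longrightarrow> z \<in> carrier G \<Longrightarrow> cm (x \<otimes> x) z = cm x (cm x z) \<otimes> (cm x z \<otimes> cm x z)"
  by (simp add: word_simps)

lemma hall_witt:
  "x \<in> carrier G \<Longrightarrow> y \<in> carrier G \<Longrightarrow> z \<in> carrier G \<Longrightarrow>
    cm (cm x y) (y \<otimes> z \<otimes> inv y) \<otimes> cm (cm y z) (z \<otimes> x \<otimes> inv z) \<otimes> cm (cm z x) (x \<otimes> y \<otimes> inv x) = \<one>"
  by (simp add: word_simps)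

text \<open>Elementwise form of \<open>[A, B] \<subseteq> N\<close>. For a subgroup \<open>N\<close>
  it says the same as the inclusion of the generated commutator subgroup, without introducing that
  subgroup.\<close>

definition csub :: "'a set \<Rightarrow> 'a set \<Rightarrow> 'a set \<Rightarrow> bool"
  where "csub A B N \<longleftrightarrow> (\<forall>a\<in>A. \<forall>b\<in>B. cm a b \<in> N)"

lemma csubD: "csub A B N \<Longrightarrow> a \<in> A \<Longrightarrow> b \<in> B \<Longrightarrow> cm a b \<in> N"
  by (simp add: csub_def)

lemma csub_mono: "csub A B N \<Longrightarrow> A' \<subseteq> A \<Longrightarrow> B' \<subseteq> B \<Longrightarrow> N \<subseteq> N' \<Longrightarrow> csub A' B' N'"
  unfolding csub_def by blast

lemma csub_sym:
  assumes "subgroup N G" "csub A B N" "A \<subseteq> carrier G" "B \<subseteq> carrier G"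
  shows "csub B A N"
  unfolding csub_def
proof (intro ballI)
  fix b a assume "b \<in> B" "a \<in> A"
  then have "inv (cm a b) \<in> N" "a \<in> carrier G" "b \<in> carrier G"
    using assms by (auto dest: csubD intro: subgroup.m_inv_closed)
  then show "cm b a \<in> N"
    by (simp add: inv_cm)
qed

lemma normal_conj: "N \<lhd> G \<Longrightarrow> x \<in> carrier G \<Longrightarrow> h \<in> N \<Longrightarrow> x \<otimes> h \<otimes> inv x \<in> N"
  by (simp add: normal.inv_op_closed2)

lemma normal_subgroup: "N \<lhd> G \<Longrightarrow> subgroup N G"
  by (simp add: normal_imp_subgroup)

lemma normal_carrier: "N \<lhd> G \<Longrightarrow> h \<in> N \<Longrightarrow> h \<in> carrier G"
  by (meson normal_subgroup subgroup.mem_carrier)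

lemma normal_mult: "N \<lhd> G \<Longrightarrow> h \<in> N \<Longrightarrow> k \<in> N \<Longrightarrow> h \<otimes> k \<in> N"
  by (meson normal_subgroup subgroup.m_closed)

lemma normal_inv: "N \<lhd> G \<Longrightarrow> h \<in> N \<Longrightarrow> inv h \<in> N"
  by (meson normal_subgroup subgroup.m_inv_closed)

lemma normal_one: "N \<lhd> G \<Longrightarrow> \<one> \<in> N"
  by (meson normal_subgroup subgroup.one_closed)

lemma normal_cm_right:
  assumes "N \<lhd> G" "x \<in> carrier G" "h \<in> N"
  shows "cm x h \<in> N"
  unfolding commutator_def using assms by (intro normal_mult normal_conj normal_inv)

lemma normal_cancel_left:
  assumes "N \<lhd> G" "n \<in> N" "x \<in> carrier G" "n \<otimes> x \<in> N"
  shows "x \<in> N"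
proof -
  have "inv n \<otimes> (n \<otimes> x) \<in> N"
    by (rule normal_mult[OF assms(1) normal_inv[OF assms(1,2)] assms(4)])
  then show ?thesis
    using assms normal_carrier by simp
qed

lemma normal_cancel_right:
  assumes "N \<lhd> G" "n \<in> N" "x \<in> carrier G" "x \<otimes> n \<in> N"
  shows "x \<in> N"
proof -
  have "(x \<otimes> n) \<otimes> inv n \<in> N"
    by (rule normal_mult[OF assms(1,4) normal_inv[OF assms(1,2)]])
  then show ?thesis
    using assms normal_carrier by (simp add: m_assoc)
qed

lemma csub_generate:
  assumes N: "N \<lhd> G" and A: "A \<subseteq> carrier G" and B: "B \<subseteq> carrier G" and AB: "csub A B N"
  shows "csub (generate G A) B N"
  unfolding csub_def
proof (intro ballI)
  fix a b assume a: "a \<in> generate G A" and b: "b \<in> B"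
  have bc: "b \<in> carrier G" using b B by blast
  show "cm a b \<in> N"
    using a
  proof (induction rule: generate.induct)
    case one
    then show ?case using bc normal_one[OF N] by simp
  next
    case (incl h)
    then show ?case using csubD[OF AB] b by blast
  next
    case (inv h)
    then have "h \<in> carrier G" using A by blast
    then show ?case
      unfolding cm_inv_left[OF \<open>h \<in> carrier G\<close> bc]
      using csubD[OF AB inv b] by (intro normal_conj[OF N] normal_inv[OF N]) auto
  next
    case (eng h1 h2)
    then have h: "h1 \<in> carrier G" "h2 \<in> carrier G"
      using generate_in_carrier A by blast+
    show ?case
      unfolding cm_mult_left[OF h bc]
      by (intro normal_mult[OF N] normal_conj[OF N] h eng)
  qed
qed

text \<open>\<open>z\<close> is the conjugate of \<open>c\<close> for which the first factor of
  \<open>hall_witt\<close> becomes \<open>cm (cm x y) c\<close> itself; the conjugations in the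
  other two factors are absorbed by the normality of \<open>A\<close> and \<open>B\<close>.\<close>

lemma three_subgroups:
  assumes N: "N \<lhd> G" and A: "A \<lhd> G" and B: "B \<lhd> G" and C: "C \<lhd> G"
    and 1: "\<And>a b c. a \<in> A \<Longrightarrow> b \<in> B \<Longrightarrow> c \<in> C \<Longrightarrow> cm (cm b c) a \<in> N"
    and 2: "\<And>a b c. a \<in> A \<Longrightarrow> b \<in> B \<Longrightarrow> c \<in> C \<Longrightarrow> cm (cm c a) b \<in> N"
    and x: "x \<in> A" and y: "y \<in> B" and c: "c \<in> C"
  shows "cm (cm x y) c \<in> N"
proof -
  define z where "z = inv y \<otimes> c \<otimes> inv (inv y)"
  have car: "x \<in> carrier G" "y \<in> carrier G" "c \<in> carrier G"
    using A B C x y c normal_carrier by auto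
  have z: "z \<in> C"
    unfolding z_def using car c by (intro normal_conj[OF C]) auto
  have zc: "z \<in> carrier G" by (simp add: z_def car)
  have cz: "y \<otimes> z \<otimes> inv y = c"
    by (simp add: z_def car m_assoc)
  have "cm (cm y z) (z \<otimes> x \<otimes> inv z) \<in> N"
    by (intro 1 normal_conj[OF A] zc x y z)
  moreover have "cm (cm z x) (x \<otimes> y \<otimes> inv x) \<in> N"
    by (intro 2 normal_conj[OF B] car x y z)
  ultimately have n: "cm (cm y z) (z \<otimes> x \<otimes> inv z) \<otimes> cm (cm z x) (x \<otimes> y \<otimes> inv x) \<in> N"
    by (rule normal_mult[OF N])
  have "cm (cm x y) c \<otimes> (cm (cm y z) (z \<otimes> x \<otimes> inv z) \<otimes> cm (cm z x) (x \<otimes> y \<otimes> inv x)) \<in> N"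
    using hall_witt[of x y z] cz car zc normal_one[OF N] by (simp add: m_assoc)
  then show ?thesis
    by (rule normal_cancel_right[OF N n, rotated]) (simp add: car)
qed

definition gcomm :: "'a set \<Rightarrow> 'a set"
  where "gcomm A = generate G {cm g h | g h. g \<in> carrier G \<and> h \<in> A}"

lemma conj_cm:
  "x \<in> carrier G \<Longrightarrow> g \<in> carrier G \<Longrightarrow> h \<in> carrier G \<Longrightarrow>
    x \<otimes> cm g h \<otimes> inv x = cm (x \<otimes> g \<otimes> inv x) (x \<otimes> h \<otimes> inv x)"
  by (simp add: word_simps)

lemma gcomm_normal:
  assumes A: "A \<lhd> G"
  shows "gcomm A \<lhd> G"
  unfolding gcomm_def
proof (rule normal_generateI)
  show "{cm g h | g h. g \<in> carrier G \<and> h \<in> A} \<subseteq> carrier G"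
    using A normal_carrier by auto
next
  fix c x assume "c \<in> {cm g h | g h. g \<in> carrier G \<and> h \<in> A}" and x: "x \<in> carrier G"
  then obtain g h where c: "c = cm g h" "g \<in> carrier G" "h \<in> A" by blast
  then have "x \<otimes> c \<otimes> inv x = cm (x \<otimes> g \<otimes> inv x) (x \<otimes> h \<otimes> inv x)"
    using A x normal_carrier by (simp add: conj_cm)
  moreover have "x \<otimes> h \<otimes> inv x \<in> A"
    using A x c by (intro normal_conj)
  ultimately show "x \<otimes> c \<otimes> inv x \<in> {cm g h | g h. g \<in> carrier G \<and> h \<in> A}"
    using x c by blast
qed

lemma gcomm_incl: "g \<in> carrier G \<Longrightarrow> h \<in> A \<Longrightarrow> cm g h \<in> gcomm A"
  unfolding gcomm_def by (rule generate.incl) blast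

lemma gcomm_least:
  assumes "subgroup N G" "csub (carrier G) A N"
  shows "gcomm A \<subseteq> N"
  unfolding gcomm_def
  by (rule generate_subgroup_incl) (use assms in \<open>auto dest: csubD\<close>)

lemma gcomm_subset: "A \<lhd> G \<Longrightarrow> gcomm A \<subseteq> A"
  by (intro gcomm_least normal_subgroup) (auto simp: csub_def normal_cm_right)

lemma gcomm_mono: "A \<subseteq> B \<Longrightarrow> gcomm A \<subseteq> gcomm B"
  unfolding gcomm_def by (intro mono_generate) blast

lemma gcomm_leastI:
  assumes N: "N \<lhd> G" and S: "S \<subseteq> carrier G" "carrier G = generate G S" and A: "A \<subseteq> carrier G"
    and "\<And>s h. s \<in> S \<Longrightarrow> h \<in> A \<Longrightarrow> cm s h \<in> N"
  shows "gcomm A \<subseteq> N"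
proof (rule gcomm_least[OF normal_subgroup[OF N]])
  show "csub (carrier G) A N"
    unfolding S(2) by (rule csub_generate[OF N S(1) A]) (use assms in \<open>auto simp: csub_def\<close>)
qed

lemma csub_gcomm:
  assumes N: "N \<lhd> G" and B: "B \<lhd> G" and C: "C \<lhd> G"
    and 1: "\<And>b c. b \<in> B \<Longrightarrow> c \<in> C \<Longrightarrow> \<forall>a\<in>carrier G. cm (cm b c) a \<in> N"
    and 2: "\<And>a c. a \<in> carrier G \<Longrightarrow> c \<in> C \<Longrightarrow> \<forall>b\<in>B. cm (cm c a) b \<in> N"
  shows "csub (gcomm B) C N"
  unfolding gcomm_def
proof (rule csub_generate[OF N])
  have G: "carrier G \<lhd> G"
    by (simp add: normal_self)
  show "csub {cm g h | g h. g \<in> carrier G \<and> h \<in> B} C N"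
    unfolding csub_def using three_subgroups[OF N G B C] 1 2 by blast
qed (use normal_carrier[OF B] normal_carrier[OF C] in auto)

text \<open>Modulo \<open>N\<close> the generated subgroup is commutative, so squaring is a
  homomorphism; precisely,
  \<open>(xy)\<^sup>2 = x\<^sup>2 [x\<^sup>-\<^sup>1, y] y\<^sup>2\<close>.\<close>

lemma generate_squares:
  assumes N: "N \<lhd> G" and S: "S \<subseteq> carrier G"
    and c: "csub (generate G S) (generate G S) N" and sq: "\<And>s. s \<in> S \<Longrightarrow> s \<otimes> s \<in> N"
    and x: "x \<in> generate G S"
  shows "x \<otimes> x \<in> N"
  using x
proof (induction rule: generate.induct)
  case one
  then show ?case using normal_one[OF N] by simp
next
  case (incl s)
  then show ?case by (rule sq)
next
  case (inv s)
  then have "inv (s \<otimes> s) \<in> N" "s \<in> carrier G"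
    using sq S by (auto intro!: normal_inv[OF N])
  then show ?case by (simp add: inv_mult_group)
next
  case (eng x y)
  then have xy: "x \<in> carrier G" "y \<in> carrier G"
    using generate_in_carrier S by blast+
  have "inv x \<in> generate G S"
    using eng generate_m_inv_closed[OF S] by blast
  then have "cm (inv x) y \<in> N"
    using csubD[OF c] eng by blast
  then have "(x \<otimes> x) \<otimes> cm (inv x) y \<otimes> (y \<otimes> y) \<in> N"
    by (rule normal_mult[OF N normal_mult[OF N eng(3)] eng(4)])
  also have "(x \<otimes> x) \<otimes> cm (inv x) y \<otimes> (y \<otimes> y) = (x \<otimes> y) \<otimes> (x \<otimes> y)"
    using xy by (simp add: word_simps)
  finally show ?case .
qed

end

subsection \<open>The lower central series\<close>

context group
begin

abbreviation lc :: "nat \<Rightarrow> 'a set"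
  where "lc \<equiv> lower_central G"

lemma lc_Suc: "1 \<le> n \<Longrightarrow> lc (Suc n) = gcomm (lc n)"
  by (cases n) (simp_all add: gcomm_def lower_central.simps(3))

lemma lc_normal: "lc n \<lhd> G"
proof (induction n)
  case (Suc n)
  then show ?case
    by (cases n) (simp_all add: normal_self gcomm_normal lc_Suc)
qed (simp add: normal_self)

lemma lc_Suc_subset: "lc (Suc n) \<subseteq> lc n"
  by (cases n) (simp_all add: lc_Suc gcomm_subset lc_normal)

lemma lc_antimono: "m \<le> n \<Longrightarrow> lc n \<subseteq> lc m"
  by (rule lift_Suc_antimono_le) (rule lc_Suc_subset)

lemma lc_cm_carrier: "1 \<le> n \<Longrightarrow> g \<in> carrier G \<Longrightarrow> h \<in> lc n \<Longrightarrow> cm g h \<in> lc (Suc n)"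
  by (simp add: lc_Suc gcomm_incl)

lemma lc_carrier: "h \<in> lc n \<Longrightarrow> h \<in> carrier G"
  using lc_normal normal_carrier by blast

lemma lc_cm_carrier': "1 \<le> n \<Longrightarrow> g \<in> carrier G \<Longrightarrow> h \<in> lc n \<Longrightarrow> cm h g \<in> lc (Suc n)"
  using normal_inv[OF lc_normal lc_cm_carrier, of n g h] by (simp add: inv_cm lc_carrier)

text \<open>Three subgroups lemma with \<open>lc (Suc m) = [G, lc m]\<close>: the induction
  hypothesis bounds \<open>[[lc m, lc n], G]\<close> and, with \<open>Suc n\<close> in place of
  \<open>n\<close>, also \<open>[[lc n, G], lc m]\<close>. Hence \<open>n\<close> stays arbitrary in
  the induction.\<close>

lemma lc_strongly_central: "1 \<le> m \<Longrightarrow> 1 \<le> n \<Longrightarrow> csub (lc m) (lc n) (lc (m + n))"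
proof (induction m arbitrary: n)
  case (Suc m)
  show ?case
  proof (cases m)
    case 0
    then show ?thesis
      using Suc.prems by (auto simp: csub_def lc_cm_carrier)
  next
    case (Suc k)
    then have m: "1 \<le> m" by simp
    show ?thesis
      unfolding lc_Suc[OF m]
    proof (rule csub_gcomm[OF lc_normal lc_normal lc_normal])
      fix b c assume "b \<in> lc m" "c \<in> lc n"
      then have "cm b c \<in> lc (m + n)"
        using Suc.IH[OF m Suc.prems(2)] by (simp add: csubD)
      then show "\<forall>a\<in>carrier G. cm (cm b c) a \<in> lc (Suc m + n)"
        using lc_cm_carrier'[of "m + n"] m by simp
    next
      fix a c assume "a \<in> carrier G" "c \<in> lc n"
      then have "cm c a \<in> lc (Suc n)"
        by (rule lc_cm_carrier'[OF Suc.prems(2)])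
      moreover have "csub (lc (Suc n)) (lc m) (lc (Suc m + n))"
        using csub_sym[OF normal_subgroup[OF lc_normal] Suc.IH[OF m, of "Suc n"]] lc_carrier
        by (simp add: subset_iff)
      ultimately show "\<forall>b\<in>lc m. cm (cm c a) b \<in> lc (Suc m + n)"
        by (simp add: csubD)
    qed
  qed
qed simp

text \<open>For \<open>h\<close> in \<open>lc m\<close> one has
  \<open>[g\<^sup>2, h] = [g, [g, h]] [g, h]\<^sup>2\<close>. The left side lies in
  \<open>lc (m + 2)\<close> because \<open>g\<^sup>2\<close> lies in \<open>lc 2\<close>, and so
  does the first factor on the right, hence also the square. Thus exponent 2 of the abelianization
  passes to all layers.\<close>

lemma lc_square:
  assumes sq: "\<And>g. g \<in> carrier G \<Longrightarrow> g \<otimes> g \<in> lc 2"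
  shows "1 \<le> n \<Longrightarrow> g \<in> lc n \<Longrightarrow> g \<otimes> g \<in> lc (Suc n)"
proof (cases n)
  case (Suc m)
  assume g: "g \<in> lc n"
  show ?thesis
  proof (cases "m = 0")
    case True
    then show ?thesis using Suc g sq by (simp add: numeral_2_eq_2)
  next
    case False
    then have m: "1 \<le> m" and n: "1 \<le> n" using Suc by auto
    let ?N = "lc (Suc n)" and ?S = "{cm g h | g h. g \<in> carrier G \<and> h \<in> lc m}"
    have N: "?N \<lhd> G" by (rule lc_normal)
    have S: "generate G ?S = lc n"
      unfolding Suc lc_Suc[OF m] gcomm_def ..
    show ?thesis
    proof (rule generate_squares[OF N, of ?S])
      show "csub (generate G ?S) (generate G ?S) ?N"
        unfolding S by (rule csub_mono[OF lc_strongly_central[OF n n]]) (use lc_antimono n in auto)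
    next
      fix c assume "c \<in> ?S"
      then obtain g h where c: "c = cm g h" "g \<in> carrier G" "h \<in> lc m" by blast
      have h: "h \<in> carrier G" using c lc_carrier by blast
      have "cm (g \<otimes> g) h \<in> ?N"
        using csubD[OF lc_strongly_central[of 2 m] sq[OF c(2)] c(3)] m Suc by simp
      moreover have "cm g (cm g h) \<in> ?N"
        unfolding Suc by (intro lc_cm_carrier c m) simp
      ultimately show "c \<otimes> c \<in> ?N"
        using normal_cancel_left[OF N, of "cm g (cm g h)" "c \<otimes> c"] cm_square[of g h] c h by simp
    next
      show "?S \<subseteq> carrier G" using lc_carrier by blast
      show "g \<in> generate G ?S" unfolding S by (rule g)
    qed
  qed
qed simp

end

subsection \<open>The dimension series for the prime 2\<close>

context group
begin

abbreviation dims :: "nat \<Rightarrow> 'a set"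
  where "dims \<equiv> dimension_series G 2"

abbreviation dims_gens :: "nat \<Rightarrow> 'a set"
  where "dims_gens n \<equiv> {cm g h | g h. g \<in> carrier G \<and> h \<in> dims (n - 1)} \<union>
    {h \<otimes> h | h. h \<in> dims ((n + 1) div 2)}"

lemma dims_1: "n \<le> 1 \<Longrightarrow> dims n = carrier G"
  by (subst dimension_series.simps) simp

lemma nat_pow_2: "h \<in> carrier G \<Longrightarrow> h [^] (2::nat) = h \<otimes> h"
  by (simp add: numeral_2_eq_2)

text \<open>Proved together because each needs the other: the powers in
  \<open>dimension_series\<close> become products only for elements of \<open>carrier G\<close>,
  which is known from the normality of earlier terms, and normality is then checked on the resulting
  generators.\<close>

lemma dims_normal: "dims n \<lhd> G"
  and dims_generate: "2 \<le> n \<Longrightarrow> dims n = generate G (dims_gens n)"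
proof (induction n rule: less_induct)
  case (less n)
  {
    case 2
    have "{h [^] (2::nat) | h. h \<in> dims ((n + 1) div 2)} = {h \<otimes> h | h. h \<in> dims ((n + 1) div 2)}"
      using normal_carrier[OF less(1)[of "(n + 1) div 2"]] 2 by (force simp: nat_pow_2)
    then show ?case
      using 2 by (subst dimension_series.simps) simp
  }
  note gen = this
  case 1
  show ?case
  proof (cases "n \<le> 1")
    case True
    then show ?thesis by (simp add: dims_1 normal_self)
  next
    case False
    then have n: "2 \<le> n" "n - 1 < n" "(n + 1) div 2 < n" by auto
    show ?thesis
      unfolding gen[OF n(1)]
    proof (rule normal_generateI)
      show "dims_gens n \<subseteq> carrier G"
        using normal_carrier[OF less(1)[OF n(2)]] normal_carrier[OF less(1)[OF n(3)]] by auto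
    next
      fix c x assume c: "c \<in> dims_gens n" and x: "x \<in> carrier G"
      from c consider g h where "c = cm g h" "g \<in> carrier G" "h \<in> dims (n - 1)"
        | h where "c = h \<otimes> h" "h \<in> dims ((n + 1) div 2)"
        by blast
      then show "x \<otimes> c \<otimes> inv x \<in> dims_gens n"
      proof cases
        case 1
        have "h \<in> carrier G"
          by (rule normal_carrier[OF less(1)[OF n(2)] 1(3)])
        then have "x \<otimes> c \<otimes> inv x = cm (x \<otimes> g \<otimes> inv x) (x \<otimes> h \<otimes> inv x)"
          using 1 x by (simp add: conj_cm)
        moreover have "x \<otimes> h \<otimes> inv x \<in> dims (n - 1)"
          by (rule normal_conj[OF less(1)[OF n(2)] x 1(3)])
        ultimately show ?thesis
          using 1 x by blast
      next
        case 2
        have "h \<in> carrier G"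
          by (rule normal_carrier[OF less(1)[OF n(3)] 2(2)])
        then have "x \<otimes> c \<otimes> inv x = (x \<otimes> h \<otimes> inv x) \<otimes> (x \<otimes> h \<otimes> inv x)"
          using 2 x by (simp add: m_assoc)
        moreover have "x \<otimes> h \<otimes> inv x \<in> dims ((n + 1) div 2)"
          by (rule normal_conj[OF less(1)[OF n(3)] x 2(2)])
        ultimately show ?thesis
          by blast
      qed
    qed
  qed
qed

lemma dims_carrier: "h \<in> dims n \<Longrightarrow> h \<in> carrier G"
  using dims_normal normal_carrier by blast

lemma dims_cm_carrier: "1 \<le> n \<Longrightarrow> g \<in> carrier G \<Longrightarrow> h \<in> dims n \<Longrightarrow> cm g h \<in> dims (Suc n)"
  by (subst dims_generate) (auto intro!: generate.incl)

lemma dims_cm_carrier': "1 \<le> n \<Longrightarrow> g \<in> carrier G \<Longrightarrow> h \<in> dims n \<Longrightarrow> cm h g \<in> dims (Suc n)"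
  using normal_inv[OF dims_normal dims_cm_carrier, of n g h] by (simp add: inv_cm dims_carrier)

lemma dims_square: "1 \<le> n \<Longrightarrow> h \<in> dims n \<Longrightarrow> h \<otimes> h \<in> dims (2 * n)"
  by (subst dims_generate) (auto intro!: generate.incl)

lemma dims_leastI:
  assumes "2 \<le> n" "subgroup N G" "csub (carrier G) (dims (n - 1)) N"
    "\<And>h. h \<in> dims ((n + 1) div 2) \<Longrightarrow> h \<otimes> h \<in> N"
  shows "dims n \<subseteq> N"
  unfolding dims_generate[OF assms(1)]
  by (rule generate_subgroup_incl) (use assms in \<open>auto dest: csubD\<close>)

text \<open>The index of the roots is rounded up, so passing from \<open>n\<close> to
  \<open>Suc n\<close> either keeps it or raises it by one; the second case needs the claim itself
  at that smaller index.\<close>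

lemma dims_Suc_subset: "dims (Suc n) \<subseteq> dims n"
proof (induction n rule: less_induct)
  case (less n)
  show ?case
  proof (cases "n \<le> 1")
    case True
    then show ?thesis using dims_carrier by (auto simp: dims_1)
  next
    case False
    show ?thesis
    proof (rule dims_leastI)
      fix h assume h: "h \<in> dims ((Suc n + 1) div 2)"
      have "(Suc n + 1) div 2 = (n + 1) div 2 \<or> (Suc n + 1) div 2 = Suc ((n + 1) div 2)"
        by auto
      then have "h \<in> dims ((n + 1) div 2)"
      proof
        assume "(Suc n + 1) div 2 = Suc ((n + 1) div 2)"
        moreover have "(n + 1) div 2 < n" using False by linarith
        ultimately show ?thesis using h less by auto
      qed (use h in simp)
      then show "h \<otimes> h \<in> dims n"
        using False by (subst dims_generate) (auto intro!: generate.incl)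
    qed (use False in \<open>auto simp: csub_def dims_normal normal_subgroup normal_cm_right\<close>)
  qed
qed

lemma dims_antimono: "m \<le> n \<Longrightarrow> dims n \<subseteq> dims m"
  by (rule lift_Suc_antimono_le) (rule dims_Suc_subset)

lemma lc_subset_dims: "lc n \<subseteq> dims n"
proof (induction n)
  case (Suc n)
  show ?case
  proof (cases "n = 0")
    case False
    then have n: "1 \<le> n" by simp
    show ?thesis
      unfolding lc_Suc[OF n]
      by (rule gcomm_least) (use Suc n in \<open>auto simp: csub_def dims_normal normal_subgroup dims_cm_carrier\<close>)
  qed (simp add: dims_1)
qed (simp add: dims_1)

text \<open>Commutator generators of \<open>dims m\<close> are covered by the three subgroups lemma,
  square generators by \<open>[h\<^sup>2, c] = [h, [h, c]] [h, c]\<^sup>2\<close>. It serves twice: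
  for strong centrality and for the kernel of the symbol map.\<close>

lemma csub_dims:
  assumes m: "2 \<le> m" and N: "N \<lhd> G" and C: "C \<lhd> G"
    and 1: "\<And>b c. b \<in> dims (m - 1) \<Longrightarrow> c \<in> C \<Longrightarrow> \<forall>a\<in>carrier G. cm (cm b c) a \<in> N"
    and 2: "\<And>a c. a \<in> carrier G \<Longrightarrow> c \<in> C \<Longrightarrow> \<forall>b\<in>dims (m - 1). cm (cm c a) b \<in> N"
    and 3: "\<And>h c. h \<in> dims ((m + 1) div 2) \<Longrightarrow> c \<in> C \<Longrightarrow> cm h (cm h c) \<in> N \<and> cm h c \<otimes> cm h c \<in> N"
  shows "csub (dims m) C N"
  unfolding dims_generate[OF m]
proof (rule csub_generate[OF N])
  have G: "carrier G \<lhd> G"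
    by (simp add: normal_self)
  show "csub (dims_gens m) C N"
    unfolding csub_def
  proof (intro ballI)
    fix x c assume x: "x \<in> dims_gens m" and c: "c \<in> C"
    then consider g h where "x = cm g h" "g \<in> carrier G" "h \<in> dims (m - 1)"
        | h where "x = h \<otimes> h" "h \<in> dims ((m + 1) div 2)"
        by blast
    then show "cm x c \<in> N"
    proof cases
      case 1
      then show ?thesis
        using three_subgroups[OF N G dims_normal C] assms(4,5) c by blast
    next
      case 2
      have "cm (h \<otimes> h) c = cm h (cm h c) \<otimes> (cm h c \<otimes> cm h c)"
        using 2 c C dims_carrier normal_carrier by (intro cm_square) blast+
      then show ?thesis
        using 3[OF 2(2) c] 2 normal_mult[OF N] by simp
    qed
  qed
qed (use dims_carrier normal_carrier[OF C] in auto)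

lemma dims_strongly_central: "1 \<le> m \<Longrightarrow> 1 \<le> n \<Longrightarrow> csub (dims m) (dims n) (dims (m + n))"
proof (induction m arbitrary: n rule: less_induct)
  case (less m)
  show ?case
  proof (cases "m = 1")
    case True
    then show ?thesis
      using less.prems by (auto simp: csub_def dims_cm_carrier dims_1)
  next
    case False
    then have m: "2 \<le> m" "1 \<le> m - 1" "m - 1 < m" "1 \<le> (m + 1) div 2" "(m + 1) div 2 < m"
      using less.prems by auto
    show ?thesis
    proof (rule csub_dims[OF m(1) dims_normal dims_normal])
      fix b c assume "b \<in> dims (m - 1)" "c \<in> dims n"
      then have "cm b c \<in> dims (m - 1 + n)"
        using less.IH[OF m(3,2) less.prems(2)] by (simp add: csubD)
      then show "\<forall>a\<in>carrier G. cm (cm b c) a \<in> dims (m + n)"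
        using dims_cm_carrier'[of "m - 1 + n"] m by simp
    next
      fix a c assume "a \<in> carrier G" "c \<in> dims n"
      then have "cm c a \<in> dims (Suc n)"
        by (rule dims_cm_carrier'[OF less.prems(2)])
      moreover have "csub (dims (Suc n)) (dims (m - 1)) (dims (m - 1 + Suc n))"
        by (rule csub_sym[OF normal_subgroup[OF dims_normal] less.IH[OF m(3,2)]]) (use dims_carrier in auto)
      ultimately show "\<forall>b\<in>dims (m - 1). cm (cm c a) b \<in> dims (m + n)"
        using m by (simp add: csubD)
    next
      fix h c assume h: "h \<in> dims ((m + 1) div 2)" and c: "c \<in> dims n"
      let ?l = "(m + 1) div 2"
      have 1: "cm h c \<in> dims (?l + n)"
        using less.IH[OF m(5,4) less.prems(2)] h c by (simp add: csubD)
      then have "cm h (cm h c) \<in> dims (?l + (?l + n))"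
        using less.IH[OF m(5,4), of "?l + n"] h less.prems by (simp add: csubD)
      moreover have "cm h c \<otimes> cm h c \<in> dims (2 * (?l + n))"
        using 1 m by (intro dims_square) auto
      moreover have "m + n \<le> ?l + (?l + n)" "m + n \<le> 2 * (?l + n)"
        by auto
      ultimately show "cm h (cm h c) \<in> dims (m + n) \<and> cm h c \<otimes> cm h c \<in> dims (m + n)"
        using dims_antimono by blast
    qed
  qed
qed

end

subsection \<open>Central series inside another filtration\<close>

locale filtered_group = group G for G (structure) +
  fixes F :: "nat \<Rightarrow> 'a set"
  assumes F_normal: "\<And>n. F n \<lhd> G"
    and F_1: "F 1 = carrier G"
    and F_strongly_central: "\<And>m n. csub (F m) (F n) (F (m + n))"
    and F_square: "\<And>n h. h \<in> F n \<Longrightarrow> h \<otimes> h \<in> F (2 * n)"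
    and F_Suc_subset: "\<And>n. F (Suc n) \<subseteq> F n"
begin

lemma F_antimono: "m \<le> n \<Longrightarrow> F n \<subseteq> F m"
  by (rule lift_Suc_antimono_le) (rule F_Suc_subset)

lemma dims_subset_F: "1 \<le> n \<Longrightarrow> dims n \<subseteq> F n"
proof (induction n rule: less_induct)
  case (less n)
  show ?case
  proof (cases "n = 1")
    case True
    then show ?thesis using F_1 by (simp add: dims_1)
  next
    case False
    then have n: "2 \<le> n" using less.prems by simp
    show ?thesis
    proof (rule dims_leastI[OF n normal_subgroup[OF F_normal]])
      show "csub (carrier G) (dims (n - 1)) (F n)"
        by (rule csub_mono[OF F_strongly_central[of 1 "n - 1"]]) (use n less.IH[of "n - 1"] F_1 in auto)
    next
      fix h assume h: "h \<in> dims ((n + 1) div 2)"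
      have "(n + 1) div 2 < n" "1 \<le> (n + 1) div 2" using n by linarith+
      then have "h \<in> F ((n + 1) div 2)"
        using less.IH h by blast
      then have "h \<otimes> h \<in> F (2 * ((n + 1) div 2))"
        by (rule F_square)
      moreover have "n \<le> 2 * ((n + 1) div 2)"
        by simp
      ultimately show "h \<otimes> h \<in> F n"
        using F_antimono by blast
    qed
  qed
qed

lemma lc_subset_F: "1 \<le> n \<Longrightarrow> lc n \<subseteq> F n"
  using dims_subset_F lc_subset_dims by blast

lemma normal_Int:
  assumes "A \<lhd> G" "B \<lhd> G"
  shows "A \<inter> B \<lhd> G"
  using assms unfolding normal_inv_iff by (auto intro: subgroups_Inter_pair)

text \<open>
  If the kernel of the symbol map vanishes in odd degrees, it is central: a bracket of two
  elements of even degree is reduced to odd degrees by the Jacobi identity.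
\<close>

lemma dims_kernel_central:
  assumes odd: "\<And>n. odd n \<Longrightarrow> dims n \<inter> F (Suc n) \<subseteq> dims (Suc n)"
  shows "1 \<le> m \<Longrightarrow> 1 \<le> n \<Longrightarrow> csub (dims m) (dims n \<inter> F (Suc n)) (dims (Suc (m + n)))"
proof (induction m arbitrary: n rule: less_induct)
  case (less m)
  let ?M = "\<lambda>n. dims n \<inter> F (Suc n)"
  have M: "?M n \<lhd> G" for n
    by (simp add: normal_Int dims_normal F_normal)
  have M_cm: "csub (dims m) (?M n) (?M (m + n))" if "1 \<le> m" for m
    using dims_strongly_central[OF that less.prems(2)] F_strongly_central[of m "Suc n"]
      dims_subset_F[OF that] unfolding csub_def by auto
  consider "odd n" | "odd (m + n)" | "even n" "even m" by auto
  then show ?case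
  proof cases
    case 1
    then show ?thesis
      using dims_strongly_central[OF less.prems(1), of "Suc n"] odd[OF 1] unfolding csub_def by auto
  next
    case 2
    then show ?thesis
      using M_cm[OF less.prems(1)] odd[OF 2] unfolding csub_def by auto
  next
    case 3
    then have m: "2 \<le> m" "1 \<le> m - 1" "m - 1 < m" "1 \<le> (m + 1) div 2" "(m + 1) div 2 < m"
      using less.prems by auto
    show ?thesis
    proof (rule csub_dims[OF m(1) dims_normal M])
      fix b c assume "b \<in> dims (m - 1)" "c \<in> ?M n"
      then have "cm b c \<in> dims (Suc (m - 1 + n))"
        using less.IH[OF m(3,2) less.prems(2)] by (simp add: csubD)
      then show "\<forall>a\<in>carrier G. cm (cm b c) a \<in> dims (Suc (m + n))"
        using dims_cm_carrier'[of "m + n"] m by simp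
    next
      fix a c assume "a \<in> carrier G" "c \<in> ?M n"
      then have "cm a c \<in> dims (Suc (1 + n))" and ac: "c \<in> carrier G" "a \<in> carrier G"
        using less.IH[of 1 n] m less.prems by (auto simp: csubD dims_1 dims_carrier)
      then have "cm c a \<in> dims (Suc (1 + n))"
        using normal_inv[OF dims_normal] by (metis inv_cm)
      moreover have "csub (dims (Suc (1 + n))) (dims (m - 1)) (dims (Suc (1 + n) + (m - 1)))"
        using m by (intro dims_strongly_central) auto
      ultimately show "\<forall>b\<in>dims (m - 1). cm (cm c a) b \<in> dims (Suc (m + n))"
        using m by (simp add: csubD add_ac)
    next
      \<comment> \<open>By induction \<open>[h, c]\<close> is already one degree deeper than
        expected, and rounding up in \<open>(m + 1) div 2\<close> loses nothing, so both terms land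
        in \<open>dims (Suc (m + n))\<close>.\<close>
      fix h c assume h: "h \<in> dims ((m + 1) div 2)" and c: "c \<in> ?M n"
      let ?l = "(m + 1) div 2"
      have 1: "cm h c \<in> dims (Suc (?l + n))"
        using less.IH[OF m(5,4) less.prems(2)] h c by (simp add: csubD)
      then have "cm h (cm h c) \<in> dims (?l + Suc (?l + n))"
        using dims_strongly_central[OF m(4), of "Suc (?l + n)"] h less.prems by (simp add: csubD)
      moreover have "cm h c \<otimes> cm h c \<in> dims (2 * Suc (?l + n))"
        using 1 m by (intro dims_square) auto
      moreover have "Suc (m + n) \<le> ?l + Suc (?l + n)" "Suc (m + n) \<le> 2 * Suc (?l + n)"
        by auto
      ultimately show "cm h (cm h c) \<in> dims (Suc (m + n)) \<and> cm h c \<otimes> cm h c \<in> dims (Suc (m + n))"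
        using dims_antimono by blast
    qed
  qed
qed

text \<open>The kernel of the symbol map is stable under brackets. An element of \<open>lc m\<close>
  is built from iterated brackets of elements of \<open>G\<close>, and bracketing with these raises
  the degree \<open>n \<le> N\<close> in steps of one. So degree \<open>N\<close> is met on the way;
  there the kernel vanishes, and the result is one degree deeper than expected.\<close>

lemma lc_kernel_cut:
  assumes N: "lc N \<inter> F (Suc N) \<subseteq> lc (Suc N)"
  shows "1 \<le> m \<Longrightarrow> 1 \<le> n \<Longrightarrow> n \<le> N \<Longrightarrow> N < m + n \<Longrightarrow> csub (lc m) (lc n \<inter> F (Suc n)) (lc (Suc (m + n)))"
proof (induction m arbitrary: n)
  case (Suc m)
  let ?M = "\<lambda>n. lc n \<inter> F (Suc n)"
  have M: "?M n \<lhd> G" for n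
    by (simp add: normal_Int lc_normal F_normal)
  have M_cm: "csub (lc m) (?M n) (?M (m + n))" if "1 \<le> m" for m
    using lc_strongly_central[OF that Suc.prems(2)] F_strongly_central[of m "Suc n"]
      lc_subset_F[OF that] unfolding csub_def by auto
  show ?case
  proof (cases "n = N")
    case True
    then show ?thesis
      using lc_strongly_central[OF Suc.prems(1), of "Suc n"] N unfolding csub_def by auto
  next
    case False
    then have m: "1 \<le> m" using Suc.prems by simp
    have low: "csub (lc m) (?M n) (lc (Suc (m + n)))"
    proof (cases "N < m + n")
      case True
      then show ?thesis using Suc m by simp
    next
      case False
      then have "m + n = N" using Suc.prems by simp
      then show ?thesis using M_cm[OF m] N unfolding csub_def by auto
    qed
    show ?thesis
      unfolding lc_Suc[OF m]
    proof (rule csub_gcomm[OF lc_normal lc_normal M])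
      fix b c assume "b \<in> lc m" "c \<in> ?M n"
      then have "cm b c \<in> lc (Suc (m + n))"
        using low by (simp add: csubD)
      then show "\<forall>a\<in>carrier G. cm (cm b c) a \<in> lc (Suc (Suc m + n))"
        using lc_cm_carrier'[of "Suc (m + n)"] by simp
    next
      fix a c assume "a \<in> carrier G" "c \<in> ?M n"
      then have "cm a c \<in> ?M (1 + n)" and ac: "c \<in> carrier G" "a \<in> carrier G"
        using csubD[OF M_cm[of 1], of a c] by (auto simp: lc_carrier)
      then have "cm c a \<in> ?M (Suc n)"
        using normal_inv[OF M] by (metis inv_cm plus_1_eq_Suc)
      moreover have "csub (?M (Suc n)) (lc m) (lc (Suc (m + Suc n)))"
        using Suc.prems False m lc_carrier
        by (intro csub_sym[OF normal_subgroup[OF lc_normal] Suc.IH]) auto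
      ultimately show "\<forall>b\<in>lc m. cm (cm c a) b \<in> lc (Suc (Suc m + n))"
        by (simp add: csubD)
    qed
  qed
qed simp

end

section \<open>The filtration of a group of word permutations by operator degree\<close>

locale word_group = group G for G :: "(bit list \<Rightarrow> bit list) monoid" (structure) +
  assumes mult_comp: "\<And>g h. g \<in> carrier G \<Longrightarrow> h \<in> carrier G \<Longrightarrow> g \<otimes> h = g \<circ> h"
    and one_fun: "\<one> = (\<lambda>x. x)"
    and length_fun: "\<And>g x. g \<in> carrier G \<Longrightarrow> length (g x) = length x"
    and filt_1: "\<And>g. g \<in> carrier G \<Longrightarrow> filt 1 (delta g)"
begin

definition F :: "nat \<Rightarrow> (bit list \<Rightarrow> bit list) set"
  where "F n = {g \<in> carrier G. filt n (delta g)}"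

lemma delta_mult:
  "g \<in> carrier G \<Longrightarrow> h \<in> carrier G \<Longrightarrow> delta (g \<otimes> h) v = delta h (delta g v) + delta g v + delta h v"
  by (simp add: mult_comp delta_comp)

lemma delta_one: "delta \<one> v = 0"
  by (simp add: one_fun)

lemma filt_zero: "filt n (\<lambda>v. 0)"
  by (auto simp: filt_def fil_zero)

text \<open>Expansion of \<open>[g, h] (h g) = g h\<close> by \<open>delta_mult\<close>. The
  operator of the commutator occurs on both sides, but on the right followed by
  \<open>delta (h \<otimes> g)\<close>, which lowers by at least 1; the equation is therefore used
  recursively.\<close>

lemma delta_commutator:
  assumes g: "g \<in> carrier G" and h: "h \<in> carrier G"
  shows "delta (cm g h) v =
    delta h (delta g v) + delta g (delta h v) + delta (h \<otimes> g) (delta (cm g h) v)"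
proof -
  have "cm g h \<otimes> (h \<otimes> g) = g \<otimes> h"
    using g h by (simp add: word_simps)
  then have "delta (h \<otimes> g) (delta (cm g h) v) + delta (cm g h) v + delta (h \<otimes> g) v =
      delta h (delta g v) + delta g v + delta h v"
    using g h by (metis delta_mult cm_closed m_closed)
  moreover have "delta (h \<otimes> g) v = delta g (delta h v) + delta h v + delta g v"
    by (rule delta_mult[OF h g])
  ultimately have "delta (h \<otimes> g) (delta (cm g h) v) + delta (cm g h) v +
      (delta g (delta h v) + delta h v + delta g v) + (delta g v + delta h v) =
      delta h (delta g v) + delta g v + delta h v + (delta g v + delta h v)"
    by simp
  then have "delta (h \<otimes> g) (delta (cm g h) v) + delta (cm g h) v + delta g (delta h v) =
      delta h (delta g v)"
    by (simp add: add_ac)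
  then have "delta h (delta g v) + delta g (delta h v) + delta (h \<otimes> g) (delta (cm g h) v) =
     (delta (h \<otimes> g) (delta (cm g h) v) + delta (cm g h) v + delta g (delta h v)) +
       delta g (delta h v) + delta (h \<otimes> g) (delta (cm g h) v)"
    by simp
  also have "\<dots> = delta (cm g h) v"
    by (simp add: add_ac)
  finally show ?thesis ..
qed

lemma filt_commutator_terms:
  "filt m (delta g) \<Longrightarrow> filt n (delta h) \<Longrightarrow>
    filt (m + n) (\<lambda>v. delta h (delta g v) + delta g (delta h v))"
  using filt_comp[of n "delta h" m "delta g"] filt_comp[of m "delta g" n "delta h"]
  by (intro filt_add) (auto simp: add.commute)

text \<open>Bootstrapping: if \<open>delta (cm g h)\<close> lowers by \<open>k\<close>, the
  correction term in \<open>delta_commutator\<close> lowers by \<open>k + 1\<close>, and so does the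
  whole operator as long as \<open>k + 1 \<le> m + n\<close>.\<close>

lemma F_commutator:
  assumes g: "g \<in> F m" and h: "h \<in> F n"
  shows "cm g h \<in> F (m + n)"
proof -
  have gh: "g \<in> carrier G" "h \<in> carrier G" "filt m (delta g)" "filt n (delta h)"
    using g h by (auto simp: F_def)
  have "filt k (delta (cm g h))" if "k \<le> m + n" for k
    using that
  proof (induction k)
    case 0
    then show ?case
      using filt_mono[OF filt_1[of "cm g h"]] gh by simp
  next
    case (Suc k)
    have "filt (1 + k) (\<lambda>v. delta (h \<otimes> g) (delta (cm g h) v))"
      using gh Suc by (intro filt_comp filt_1) auto
    then have "filt (Suc k)
        (\<lambda>v. delta h (delta g v) + delta g (delta h v) + delta (h \<otimes> g) (delta (cm g h) v))"
      using filt_add[OF filt_mono[OF filt_commutator_terms[OF gh(3,4)] Suc.prems]] by simp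
    then show ?case
      by (simp flip: delta_commutator[OF gh(1,2)])
  qed
  then show ?thesis
    using gh by (simp add: F_def)
qed

lemma symb_commutator:
  assumes g: "g \<in> F m" and h: "h \<in> F n"
  shows "symb (m + n) (delta (cm g h)) v =
    symb m (delta g) (symb n (delta h) v) + symb n (delta h) (symb m (delta g) v)"
proof -
  have gh: "g \<in> carrier G" "h \<in> carrier G" "filt m (delta g)" "filt n (delta h)"
    using g h by (auto simp: F_def)
  have "filt (1 + (m + n)) (\<lambda>v. delta (h \<otimes> g) (delta (cm g h) v))"
    using gh F_commutator[OF g h] by (intro filt_comp[of 1] filt_1) (auto simp: F_def)
  then have 0: "symb (m + n) (\<lambda>v. delta (h \<otimes> g) (delta (cm g h) v)) v = 0"
    by (simp add: symb_eq_0)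
  have eq: "delta (cm g h) =
      (\<lambda>v. (delta h (delta g v) + delta g (delta h v)) + delta (h \<otimes> g) (delta (cm g h) v))"
    by (rule ext, rule delta_commutator[OF gh(1,2)])
  have "symb (m + n) (delta (cm g h)) v =
      symb (m + n) (\<lambda>v. delta h (delta g v)) v + symb (m + n) (\<lambda>v. delta g (delta h v)) v"
    by (subst eq) (simp only: symb_add 0 add_0_right)
  also have "symb (m + n) (\<lambda>v. delta h (delta g v)) v = symb n (delta h) (symb m (delta g) v)"
    using symb_comp[OF delta_additive gh(4,3)] by (simp add: add.commute)
  also have "symb (m + n) (\<lambda>v. delta g (delta h v)) v = symb m (delta g) (symb n (delta h) v)"
    using symb_comp[OF delta_additive gh(3,4)] by simp
  finally show ?thesis
    by (subst add.commute)
qed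

text \<open>The quadratic term \<open>delta h (delta g v)\<close> lowers by \<open>2 * n\<close>,
  which exceeds \<open>n\<close> for positive \<open>n\<close>, and drops out of the symbol.\<close>

lemma symb_mult:
  assumes n: "1 \<le> n" and g: "g \<in> F n" and h: "h \<in> F n"
  shows "symb n (delta (g \<otimes> h)) v = symb n (delta g) v + symb n (delta h) v"
proof -
  have gh: "g \<in> carrier G" "h \<in> carrier G" "filt n (delta g)" "filt n (delta h)"
    using g h by (auto simp: F_def)
  have "filt (Suc n) (\<lambda>v. delta h (delta g v))"
    by (rule filt_mono[OF filt_comp[OF gh(4,3)]]) (use n in simp)
  then have 0: "symb n (\<lambda>v. delta h (delta g v)) v = 0"
    by (simp add: symb_eq_0)
  have eq: "delta (g \<otimes> h) = (\<lambda>v. delta h (delta g v) + delta g v + delta h v)"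
    by (rule ext, rule delta_mult[OF gh(1,2)])
  show ?thesis
    by (subst eq) (simp only: symb_add 0 add_0)
qed

lemma symb_one: "symb n (delta \<one>) v = 0"
  by (simp add: one_fun symb_def fun_eq_iff)

lemma delta_square: "g \<in> carrier G \<Longrightarrow> delta (g \<otimes> g) v = delta g (delta g v)"
  by (simp add: delta_mult add.assoc)

lemma F_square_closed: "g \<in> F n \<Longrightarrow> g \<otimes> g \<in> F (2 * n)"
  using filt_comp[of n "delta g" n "delta g"] by (auto simp: F_def delta_square mult_2 cong: filt_def)

lemma symb_square:
  assumes "g \<in> F n"
  shows "symb (2 * n) (delta (g \<otimes> g)) v = symb n (delta g) (symb n (delta g) v)"
proof -
  have "delta (g \<otimes> g) = (\<lambda>v. delta g (delta g v))"
    using assms by (auto simp: F_def delta_square)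
  then show ?thesis
    using symb_comp[OF delta_additive, of n g n] assms by (simp add: F_def mult_2)
qed

lemma F_mult:
  assumes "g \<in> F n" "h \<in> F n"
  shows "g \<otimes> h \<in> F n"
proof -
  have gh: "g \<in> carrier G" "h \<in> carrier G" "filt n (delta g)" "filt n (delta h)"
    using assms by (auto simp: F_def)
  have "filt n (\<lambda>v. delta h (delta g v) + delta g v + delta h v)"
    using gh filt_mono[OF filt_comp[OF gh(4,3)]] by (intro filt_add) auto
  then show ?thesis
    using gh delta_mult[OF gh(1,2)] by (simp add: F_def filt_def)
qed

text \<open>In characteristic 2, \<open>g\<^sup>-\<^sup>1 - 1 = (g\<^sup>-\<^sup>1 - 1) (g - 1) + (g
  - 1)\<close>, so the degree of \<open>delta g\<close> is inherited.\<close>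

lemma F_inv:
  assumes "g \<in> F n"
  shows "inv g \<in> F n"
proof -
  have g: "g \<in> carrier G" "filt n (delta g)"
    using assms by (auto simp: F_def)
  have "delta (inv g) v = delta (inv g) (delta g v) + delta g v" for v
  proof -
    have "delta (inv g) (delta g v) + delta g v + delta (inv g) v = 0"
      using delta_mult[of g "inv g" v] delta_one g by simp
    then show ?thesis
      by (simp add: vec_add_eq_0_iff)
  qed
  then have eq: "delta (inv g) = (\<lambda>v. delta (inv g) (delta g v) + delta g v)" ..
  have "filt n (\<lambda>v. delta (inv g) (delta g v) + delta g v)"
    using g by (intro filt_add filt_mono[OF filt_comp[OF filt_1[of "inv g"] g(2)]]) auto
  then have "filt n (delta (inv g))"
    by (subst eq)
  then show ?thesis
    using g by (simp add: F_def)
qed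

lemma F_Suc: "F (Suc n) \<subseteq> F n"
  by (auto simp: F_def intro: filt_mono)

lemma F_0: "F 0 = carrier G" and F_1': "F 1 = carrier G"
  using filt_1 filt_mono[OF filt_1] by (auto simp: F_def)

lemma F_normal': "F n \<lhd> G"
proof (rule normal_invI)
  show "subgroup (F n) G"
  proof
    show "\<one> \<in> F n"
      using filt_zero one_closed by (simp add: F_def one_fun)
  qed (auto simp: F_mult F_inv, auto simp: F_def)
next
  fix x h assume x: "x \<in> carrier G" and h: "h \<in> F n"
  have "cm x h \<in> F n"
    using F_commutator[OF _ h, of x 0] x by (simp add: F_0)
  then have "cm x h \<otimes> h \<in> F n"
    using h by (rule F_mult)
  also have "cm x h \<otimes> h = x \<otimes> h \<otimes> inv x"
    using x h by (simp add: word_simps F_def)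
  finally show "x \<otimes> h \<otimes> inv x \<in> F n" .
qed

sublocale filtered_group G F
  by (intro filtered_group.intro filtered_group_axioms.intro group_axioms F_normal' F_1' F_square_closed F_Suc)
    (simp add: csub_def F_commutator)

lemma symb_eq_0_iff:
  assumes "g \<in> F n"
  shows "(\<forall>v. symb n (delta g) v = 0) \<longleftrightarrow> g \<in> F (Suc n)"
  using assms filt_Suc[OF delta_additive, of n g] symb_eq_0[of n "delta g"] by (auto simp: F_def)

end

section \<open>Quotients of Lie rings\<close>

locale lie_rng = comm_group L for L :: "('a, 'b) lie_ring_scheme" (structure) +
  assumes brak_closed: "\<And>x y. x \<in> carrier L \<Longrightarrow> y \<in> carrier L \<Longrightarrow> brak L x y \<in> carrier L"
    and brak_left: "\<And>x y z. x \<in> carrier L \<Longrightarrow> y \<in> carrier L \<Longrightarrow> z \<in> carrier L \<Longrightarrow>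
      brak L (x \<otimes> y) z = brak L x z \<otimes> brak L y z"
    and brak_anti: "\<And>x y. x \<in> carrier L \<Longrightarrow> y \<in> carrier L \<Longrightarrow> brak L x y \<otimes> brak L y x = \<one>"
begin

lemma brak_swap: "x \<in> carrier L \<Longrightarrow> y \<in> carrier L \<Longrightarrow> brak L y x = inv (brak L x y)"
  by (metis brak_anti brak_closed inv_equality)

lemma brak_right:
  "x \<in> carrier L \<Longrightarrow> y \<in> carrier L \<Longrightarrow> z \<in> carrier L \<Longrightarrow>
    brak L x (y \<otimes> z) = brak L x y \<otimes> brak L x z"
  by (simp add: brak_swap[of _ x] brak_left brak_closed inv_mult m_comm)

lemma brak_one: "x \<in> carrier L \<Longrightarrow> brak L \<one> x = \<one>"
  using brak_left[of \<one> \<one> x] by (simp add: brak_closed)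

definition ideal_of :: "'a set \<Rightarrow> bool"
  where "ideal_of I \<longleftrightarrow> subgroup I L \<and> (\<forall>i\<in>I. \<forall>x\<in>carrier L. brak L i x \<in> I)"

lemma ideal_normal: "ideal_of I \<Longrightarrow> I \<lhd> L"
  by (simp add: ideal_of_def subgroup_imp_normal)

lemma ideal_brak_right:
  "ideal_of I \<Longrightarrow> i \<in> I \<Longrightarrow> x \<in> carrier L \<Longrightarrow> brak L x i \<in> I"
  unfolding ideal_of_def by (metis brak_swap subgroup.m_inv_closed subgroup.mem_carrier)

lemma coset_subset:
  assumes "subgroup I L" "i \<in> I" "x \<in> carrier L"
  shows "I #> (i \<otimes> x) = I #> x"
proof -
  have i: "i \<in> carrier L" using assms(1,2) by (rule subgroup.mem_carrier)
  show ?thesis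
    using coset_mult_assoc[OF subgroup.subset[OF assms(1)] i assms(3)]
      coset_join2[OF i assms(1,2)] by simp
qed

text \<open>The quotient bracket is a union over all representatives. For an ideal every member of
  the union is the same coset, and the union is not empty.\<close>

lemma quot_brak:
  assumes I: "ideal_of I" and x: "x \<in> carrier L" and y: "y \<in> carrier L"
  shows "brak (lie_quot L I) (I #> x) (I #> y) = I #> brak L x y"
proof -
  have sI: "subgroup I L"
    using I by (simp add: ideal_of_def)
  have eq: "I #> brak L a b = I #> brak L x y" if a: "a \<in> I #> x" and b: "b \<in> I #> y" for a b
  proof -
    obtain i j where ij: "i \<in> I" "a = i \<otimes> x" "j \<in> I" "b = j \<otimes> y"
      using a b by (auto simp: r_coset_def)
    have c: "i \<in> carrier L" "j \<in> carrier L"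
      using ij sI subgroup.mem_carrier by fast+
    have "brak L a b = (brak L i b \<otimes> brak L x j) \<otimes> brak L x y"
      using ij c x y by (simp add: brak_left brak_right brak_closed m_ac)
    moreover have "brak L i b \<in> I" "brak L x j \<in> I"
      using I ij x y c ideal_brak_right by (auto simp: ideal_of_def)
    ultimately show ?thesis
      using sI x y coset_subset by (simp add: brak_closed subgroup.m_closed)
  qed
  have ne: "I #> x \<noteq> {}" "I #> y \<noteq> {}"
    using rcos_self x y sI by blast+
  have "(\<Union>a\<in>I #> x. \<Union>b\<in>I #> y. I #> brak L a b) = (\<Union>a\<in>I #> x. \<Union>b\<in>I #> y. I #> brak L x y)"
    by (intro SUP_cong refl eq)
  with ne show ?thesis
    by (simp add: lie_quot_def)
qed

lemma lie_quot_sel [simp]: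
  "carrier (lie_quot L I) = carrier (L Mod I)" "monoid.mult (lie_quot L I) = monoid.mult (L Mod I)"
  "one (lie_quot L I) = I"
  by (simp_all add: lie_quot_def)

lemma quot_centre_iff:
  assumes I: "ideal_of I" and x: "x \<in> carrier L"
  shows "I #> x \<in> lie_centre (lie_quot L I) \<longleftrightarrow> (\<forall>y\<in>carrier L. brak L x y \<in> I)"
proof -
  have sI: "subgroup I L"
    using I by (simp add: ideal_of_def)
  have "I #> z = I \<longleftrightarrow> z \<in> I" if "z \<in> carrier L" for z
    using that sI by (metis coset_join1 coset_join2 subgroup.subset)
  then show ?thesis
    using x I by (auto simp: lie_centre_def carrier_FactGroup quot_brak brak_closed)
qed

text \<open>Simultaneous induction: a bracket with an element of the next term falls into the
  current term, and the inclusion is what puts it back into the next one.\<close>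

lemma upper_central_ideal: "ideal_of (upper_central L n)"
  and upper_central_mono: "upper_central L n \<subseteq> upper_central L (Suc n)"
proof (induction n)
  case 0
  {
    case 1
    show ?case
      by (auto simp: ideal_of_def triv_subgroup brak_one)
  next
    case 2
    have "ideal_of {\<one>}"
      by (auto simp: ideal_of_def triv_subgroup brak_one)
    then show ?case
      using quot_centre_iff[of "{\<one>}" \<one>] by (simp add: brak_one)
  }
next
  case (Suc n)
  have *: "upper_central L (Suc n) =
      {x \<in> carrier L. \<forall>y\<in>carrier L. brak L x y \<in> upper_central L n}" (is "_ = ?Z")
    using Suc(1) by (auto simp: quot_centre_iff)
  have s: "subgroup (upper_central L n) L"
    using Suc(1) by (simp add: ideal_of_def)
  have sub: "subgroup ?Z L"
  proof
    fix x assume x: "x \<in> ?Z"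
    have "brak L (inv x) y = inv (brak L x y)" if "y \<in> carrier L" for y
      using x that brak_left[of "inv x" x y] by (simp add: brak_one brak_closed inv_equality)
    then show "inv x \<in> ?Z"
      using x s by (simp add: subgroup.m_inv_closed)
  qed (auto simp: brak_left brak_one s subgroup.m_closed subgroup.one_closed)
  show 1: "ideal_of (upper_central L (Suc n))"
    using Suc(2) sub * by (auto simp: ideal_of_def brak_closed simp del: upper_central.simps)
  have **: "upper_central L (Suc (Suc n)) =
      {x \<in> carrier L. \<forall>y\<in>carrier L. brak L x y \<in> upper_central L (Suc n)}"
    using 1 by (subst upper_central.simps) (auto simp: quot_centre_iff simp del: upper_central.simps)
  show "upper_central L (Suc n) \<subseteq> upper_central L (Suc (Suc n))"
    using Suc(2) unfolding ** unfolding * by auto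
qed

lemma upper_central_Suc_iff:
  "x \<in> upper_central L (Suc n) \<longleftrightarrow>
    x \<in> carrier L \<and> (\<forall>y\<in>carrier L. brak L x y \<in> upper_central L n)"
  using upper_central_ideal[of n] by (auto simp: quot_centre_iff)

text \<open>The isomorphism theorem, recorded with the value of the isomorphism on cosets:
  compatibility with the 2-mapping is later deduced from this formula.\<close>

lemma lie_quot_isomorphism:
  assumes M: "group M" and h: "h \<in> hom L M" "h ` carrier L = carrier M"
    and brak: "\<And>x y. x \<in> carrier L \<Longrightarrow> y \<in> carrier L \<Longrightarrow> h (brak L x y) = brak M (h x) (h y)"
    and I: "ideal_of I" "I = {x \<in> carrier L. h x = \<one>\<^bsub>M\<^esub>}"
  shows "\<exists>f\<in>lie_isos (lie_quot L I) M. \<forall>x\<in>carrier L. f (I #> x) = h x"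
proof -
  interpret h: group_hom L M h
    using M h(1) by (simp add: group_hom_def group_hom_axioms_def)
  define f where "f = (\<lambda>A. the_elem (h ` A))"
  have ker: "kernel L M h = I"
    by (auto simp: kernel_def I(2))
  have iso: "f \<in> iso (L Mod I) M"
    using h.FactGroup_iso_set[OF h(2)] by (simp add: f_def ker)
  have f: "f (I #> x) = h x" if x: "x \<in> carrier L" for x
  proof -
    have "h ` (I #> x) = {h x}"
    proof -
      have "h (i \<otimes> x) = h x" if "i \<in> I" for i
        using that x I(2) by simp
      moreover have "x \<in> I #> x"
        using rcos_self x I(1) by (auto simp: ideal_of_def)
      ultimately show ?thesis
        unfolding r_coset_def by (auto simp: image_iff)
    qed
    then show ?thesis by (simp add: f_def)
  qed
  have "f \<in> lie_isos (lie_quot L I) M"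
    unfolding lie_isos_def
  proof (intro CollectI conjI ballI)
    show "f \<in> iso (lie_quot L I) M"
      using iso by (simp add: iso_def hom_def)
  next
    fix A B assume "A \<in> carrier (lie_quot L I)" "B \<in> carrier (lie_quot L I)"
    then obtain x y where xy: "A = I #> x" "B = I #> y" "x \<in> carrier L" "y \<in> carrier L"
      by (auto simp: carrier_FactGroup)
    then show "f (brak (lie_quot L I) A B) = brak M (f A) (f B)"
      by (simp add: quot_brak[OF I(1)] f brak brak_closed)
  qed
  with f show ?thesis by blast
qed

end

section \<open>The Lie ring of a series of a group of word permutations\<close>

lemma card_bit: "CARD(bit) = 2"
proof -
  have "(UNIV :: bit set) = {0, 1}"
    by (auto intro: bit.exhaust)
  moreover have "card {0, 1 :: bit} = 2" by simp
  ultimately show ?thesis by metis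
qed

lemma tens_iff: "v \<in> tens \<longleftrightarrow> (\<exists>n. \<forall>w. v w \<noteq> (0::bit) \<longrightarrow> length w \<le> n \<and> set w \<subseteq> {..<2})"
proof
  assume v: "v \<in> tens"
  let ?S = "{w. v w \<noteq> 0}"
  have "finite ?S" "\<forall>w\<in>?S. set w \<subseteq> {..<2}"
    using v by (auto simp: tens_def card_bit)
  then show "\<exists>n. \<forall>w. v w \<noteq> 0 \<longrightarrow> length w \<le> n \<and> set w \<subseteq> {..<2}"
    by (intro exI[of _ "Max (length ` ?S)"]) (auto intro!: Max_ge)
next
  assume "\<exists>n. \<forall>w. v w \<noteq> 0 \<longrightarrow> length w \<le> n \<and> set w \<subseteq> {..<2}"
  then obtain n where n: "\<And>w. v w \<noteq> 0 \<Longrightarrow> length w \<le> n \<and> set w \<subseteq> {..<2}" by blast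
  have "finite {w. v w \<noteq> 0}"
    by (rule finite_subset[OF _ finite_lists_length_le[of "{..<2}" n]]) (use n in auto)
  then show "v \<in> tens"
    using n by (auto simp: tens_def card_bit)
qed

lemma local_op_tens: "local_op T \<Longrightarrow> v \<in> tens \<Longrightarrow> T v \<in> tens"
  unfolding tens_iff local_op_def by meson

lemma proj_tens: "v \<in> tens \<Longrightarrow> proj t v \<in> tens"
proof -
  assume "v \<in> tens"
  then obtain n where "\<forall>w. v w \<noteq> 0 \<longrightarrow> length w \<le> n \<and> set w \<subseteq> {..<2}"
    unfolding tens_iff by blast
  then have "\<forall>w. proj t v w \<noteq> 0 \<longrightarrow> length w \<le> n \<and> set w \<subseteq> {..<2}"
    by (simp add: proj_def)
  then show ?thesis
    unfolding tens_iff by blast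
qed

lemma val_cong:
  "(\<And>u. length u = length x \<Longrightarrow> set u \<subseteq> {..<2} \<Longrightarrow> v u = v' u) \<Longrightarrow> val v x = val v' x"
proof (induction x arbitrary: v v')
  case (Cons i x)
  have "val (\<lambda>w. v (j # w)) x = val (\<lambda>w. v' (j # w)) x" if "j < 2" for j
    using that by (intro Cons.IH Cons.prems) auto
  then show ?case
    by (simp add: val_add)
qed simp

lemma coef_of_cong:
  "(\<And>u. length u = length w \<Longrightarrow> A u = B u) \<Longrightarrow> coef_of A w = coef_of B w"
proof (induction w arbitrary: A B)
  case (Cons j w)
  have "coef_of (\<lambda>w. A (i # w)) w = coef_of (\<lambda>w. B (i # w)) w" for i
    by (intro Cons.IH Cons.prems) auto
  then show ?case
    by (simp add: coef_of_add)
qed simp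

lemma delta_cong:
  assumes g: "\<And>x. length (g x) = length x"
    and v: "\<And>u. length u = length w \<Longrightarrow> set u \<subseteq> {..<2} \<Longrightarrow> v u = v' u"
  shows "delta g v w = delta g v' w"
  unfolding delta_def
proof (rule coef_of_cong)
  fix u :: "bit list" assume u: "length u = length w"
  show "((\<lambda>x. val v (g x)) + val v) u = ((\<lambda>x. val v' (g x)) + val v') u"
    using val_cong[of u v v'] val_cong[of "g u" v v'] v g u by simp
qed

text \<open>A coefficient of \<open>delta g v\<close> at \<open>w\<close> depends only on the
  coefficients of \<open>v\<close> at the finitely many binary words of the same length, so
  \<open>v\<close> may be truncated to an element of \<open>tens\<close>.\<close>

lemma symb_delta_tens:
  assumes g: "\<And>x. length (g x) = length x" and 0: "\<And>v. v \<in> tens \<Longrightarrow> symb n (delta g) v = 0"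
  shows "symb n (delta g) v = 0"
proof
  fix w :: "nat list"
  define v' :: vec where "v' = (\<lambda>u. if length u = length w \<and> set u \<subseteq> {..<2} then v u else 0)"
  have "v' \<in> tens"
    by (auto simp: tens_iff v'_def split: if_splits)
  then have "symb n (delta g) v' w = 0"
    by (simp add: 0)
  moreover have "symb n (delta g) v' w = symb n (delta g) v w"
    unfolding symb_def by (intro delta_cong[OF g]) (auto simp: proj_def v'_def)
  ultimately show "symb n (delta g) v w = 0 w"
    by simp
qed

lemma additive_op_sum:
  assumes T: "additive_op T" and S: "finite S"
  shows "T (\<lambda>w. \<Sum>n\<in>S. f n w) = (\<lambda>w. \<Sum>n\<in>S. T (f n) w)"
  using S
proof induction
  case empty
  then show ?case using additive_op_0[OF T] by (simp add: zero_fun_def)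
next
  case (insert n S)
  have "T (\<lambda>w. \<Sum>n\<in>insert n S. f n w) = T (f n + (\<lambda>w. \<Sum>n\<in>S. f n w))"
    using insert by (simp add: plus_fun_def)
  also have "\<dots> = T (f n) + (\<lambda>w. \<Sum>n\<in>S. T (f n) w)"
    using insert by (simp add: additive_opD[OF T])
  finally show ?case
    using insert by (simp add: plus_fun_def)
qed

text \<open>Reindexing a degreewise convolution by pairs \<open>(m, n)\<close>: as \<open>t\<close>
  is supported in a square of side \<open>B\<close>, the total degree runs up to
  \<open>2 * B\<close>.\<close>

lemma sum_pairs:
  fixes t :: "nat \<Rightarrow> nat \<Rightarrow> 'c::comm_monoid_add"
  assumes t: "\<And>m n. B < m \<or> B < n \<Longrightarrow> t m n = 0"
  shows "(\<Sum>k=1..2*B. \<Sum>m=1..<k. t m (k - m)) = (\<Sum>m=1..B. \<Sum>n=1..B. t m n)"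
proof -
  let ?P = "{(m, n). 1 \<le> m \<and> 1 \<le> n \<and> m + n \<le> 2 * B}"
  have t': "m \<le> B \<and> n \<le> B" if "t m n \<noteq> 0" for m n
    using that t by (meson not_le)
  have fin: "finite ?P"
    by (rule finite_subset[of _ "{..2*B} \<times> {..2*B}"]) auto
  have "(\<Sum>k=1..2*B. \<Sum>m=1..<k. t m (k - m)) =
      (\<Sum>(k, m)\<in>(SIGMA k:{1..2*B}. {1..<k}). t m (k - m))"
    by (rule sum.Sigma) auto
  also have "\<dots> = (\<Sum>(m, n)\<in>?P. t m n)"
    by (rule sum.reindex_bij_witness[of _ "\<lambda>(m, n). (m + n, m)" "\<lambda>(k, m). (m, k - m)"]) auto
  also have "\<dots> = (\<Sum>(m, n)\<in>{1..B} \<times> {1..B}. t m n)"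
    by (rule sum.mono_neutral_right[OF fin]) (auto dest: t')
  also have "\<dots> = (\<Sum>m=1..B. \<Sum>n=1..B. t m n)"
    by (rule sum.cartesian_product[symmetric])
  finally show ?thesis .
qed

text \<open>The left side has the shape of \<open>graded_square\<close>: in each degree the pairs
  with \<open>m < n\<close> supply both orders at once and the diagonal pair supplies the square, as
  in the expansion of the square of a sum.\<close>

lemma sum_symmetric_pairs:
  fixes t :: "nat \<Rightarrow> nat \<Rightarrow> bit"
  assumes t: "\<And>m n. B < m \<or> B < n \<Longrightarrow> t m n = 0"
  shows "(\<Sum>k=1..2*B. (if even k then t (k div 2) (k div 2) else 0) +
      (\<Sum>m\<in>{m. 1 \<le> m \<and> m < k - m}. t m (k - m) + t (k - m) m)) = (\<Sum>m=1..B. \<Sum>n=1..B. t m n)"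
proof -
  have "(if even k then t (k div 2) (k div 2) else 0) +
      (\<Sum>m\<in>{m. 1 \<le> m \<and> m < k - m}. t m (k - m) + t (k - m) m) = (\<Sum>m=1..<k. t m (k - m))"
    if k: "1 \<le> k" for k
  proof -
    let ?A = "{m. 1 \<le> m \<and> m < k - m}" and ?B = "{m. m < k \<and> k - m < m}" and ?C = "{m. 1 \<le> m \<and> 2 * m = k}"
    have fin: "finite ?A" "finite ?B" "finite ?C"
      by (auto intro: finite_subset[of _ "{..k}"])
    have dis: "(?A \<union> ?B) \<inter> ?C = {}" "?A \<inter> ?B = {}"
      by auto
    have eq: "{1..<k} = (?A \<union> ?B) \<union> ?C"
      using k by auto
    have "(\<Sum>m=1..<k. t m (k - m)) = (\<Sum>m\<in>?A \<union> ?B. t m (k - m)) + (\<Sum>m\<in>?C. t m (k - m))"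
      by (subst eq, rule sum.union_disjoint) (rule finite_UnI fin dis)+
    also have "(\<Sum>m\<in>?A \<union> ?B. t m (k - m)) = (\<Sum>m\<in>?A. t m (k - m)) + (\<Sum>m\<in>?B. t m (k - m))"
      by (rule sum.union_disjoint) (rule fin dis)+
    finally have "(\<Sum>m=1..<k. t m (k - m)) = (\<Sum>m\<in>?A. t m (k - m)) + (\<Sum>m\<in>?B. t m (k - m)) + (\<Sum>m\<in>?C. t m (k - m))" .
    also have "(\<Sum>m\<in>?B. t m (k - m)) = (\<Sum>m\<in>?A. t (k - m) m)"
      by (rule sum.reindex_bij_witness[of _ "\<lambda>m. k - m" "\<lambda>m. k - m"]) auto
    also have "(\<Sum>m\<in>?C. t m (k - m)) = (if even k then t (k div 2) (k div 2) else 0)"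
    proof (cases "even k")
      case True
      then have C: "?C = {k div 2}" and "k - k div 2 = k div 2"
        using k by auto
      then show ?thesis unfolding C using True by simp
    next
      case False
      then have C: "?C = {}" by auto
      show ?thesis unfolding C using False by simp
    qed
    finally show ?thesis
      by (simp add: sum.distrib add_ac)
  qed
  then have "(\<Sum>k=1..2*B. (if even k then t (k div 2) (k div 2) else 0) +
      (\<Sum>m\<in>{m. 1 \<le> m \<and> m < k - m}. t m (k - m) + t (k - m) m)) = (\<Sum>k=1..2*B. \<Sum>m=1..<k. t m (k - m))"
    by (intro sum.cong) auto
  also have "\<dots> = (\<Sum>m=1..B. \<Sum>n=1..B. t m n)"
    by (rule sum_pairs) (rule t)
  finally show ?thesis .
qed

section \<open>Layers of a central series and their symbols\<close>

locale graded_rep = word_group +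
  fixes N :: "nat \<Rightarrow> (bit list \<Rightarrow> bit list) set"
  assumes N_normal: "\<And>n. N n \<lhd> G"
    and N_Suc: "\<And>n. N (Suc n) \<subseteq> N n"
    and N_central: "\<And>m n. 1 \<le> m \<Longrightarrow> 1 \<le> n \<Longrightarrow> csub (N m) (N n) (N (m + n))"
    and N_F: "\<And>n. 1 \<le> n \<Longrightarrow> N n \<subseteq> F n"
begin

abbreviation Ly :: "nat \<Rightarrow> (bit list \<Rightarrow> bit list) set monoid"
  where "Ly \<equiv> layer G N"

definition cl :: "nat \<Rightarrow> (bit list \<Rightarrow> bit list) \<Rightarrow> (bit list \<Rightarrow> bit list) set"
  where "cl n g = N (Suc n) #> g"

text \<open>An arbitrary representative is chosen; by \<open>sy_cl\<close> the symbol depends only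
  on the class, since \<open>N (Suc n)\<close> lies in \<open>F (Suc n)\<close> and has zero symbol
  in degree \<open>n\<close>.\<close>

definition sy :: "nat \<Rightarrow> (bit list \<Rightarrow> bit list) set \<Rightarrow> vec \<Rightarrow> vec"
  where "sy n A = symb n (delta (SOME g. g \<in> A))"

lemma N_antimono: "m \<le> n \<Longrightarrow> N n \<subseteq> N m"
  by (rule lift_Suc_antimono_le) (rule N_Suc)

lemma N_carrier: "g \<in> N n \<Longrightarrow> g \<in> carrier G"
  using N_normal normal_carrier by blast

lemma cl_eq_iff:
  assumes "g \<in> carrier G" "h \<in> carrier G"
  shows "cl n g = cl n h \<longleftrightarrow> g \<otimes> inv h \<in> N (Suc n)"
proof -
  have s: "subgroup (N (Suc n)) G"
    by (rule normal_subgroup[OF N_normal])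
  show ?thesis
  proof
    assume "cl n g = cl n h"
    then have "g \<in> N (Suc n) #> h"
      using rcos_self[OF assms(1) s] by (simp add: cl_def)
    then obtain a where "a \<in> N (Suc n)" "g = a \<otimes> h"
      by (auto simp: r_coset_def)
    then show "g \<otimes> inv h \<in> N (Suc n)"
      using assms N_carrier by (simp add: m_assoc)
  next
    assume a: "g \<otimes> inv h \<in> N (Suc n)"
    have "N (Suc n) #> g = (N (Suc n) #> (g \<otimes> inv h)) #> h"
      using assms s by (simp add: coset_mult_assoc subgroup.subset m_assoc)
    also have "N (Suc n) #> (g \<otimes> inv h) = N (Suc n)"
      using assms s a by (simp add: coset_join2)
    finally show "cl n g = cl n h"
      by (simp add: cl_def)
  qed
qed

lemma cl_mult: "g \<in> carrier G \<Longrightarrow> h \<in> carrier G \<Longrightarrow> cl n g <#> cl n h = cl n (g \<otimes> h)"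
  unfolding cl_def by (rule normal.rcos_sum[OF N_normal])

lemma set_mult_restrict: "set_mult (G\<lparr>carrier := H\<rparr>) = set_mult G"
  by (simp add: set_mult_def fun_eq_iff)

lemma layer_carrier: "carrier (Ly n) = cl n ` N n"
  by (simp add: layer_def carrier_FactGroup cl_def r_coset_def)

lemma layer_mult [simp]: "monoid.mult (Ly n) = set_mult G"
  by (simp add: layer_def set_mult_restrict)

lemma layer_one [simp]: "one (Ly n) = N (Suc n)"
  by (simp add: layer_def)

lemma cl_one: "cl n \<one> = N (Suc n)"
  unfolding cl_def by (metis N_normal coset_mult_one normal_subgroup subgroup.subset)

lemma cl_N: "g \<in> N (Suc n) \<Longrightarrow> cl n g = N (Suc n)"
  using cl_eq_iff[of g \<one> n] by (simp add: cl_one N_carrier)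

lemma cl_layer: "g \<in> N n \<Longrightarrow> cl n g \<in> carrier (Ly n)"
  by (simp add: layer_carrier)

lemma layerE: "A \<in> carrier (Ly n) \<Longrightarrow> (\<And>g. g \<in> N n \<Longrightarrow> A = cl n g \<Longrightarrow> thesis) \<Longrightarrow> thesis"
  by (auto simp: layer_carrier)

lemma cl_commute:
  assumes n: "1 \<le> n" and "g \<in> N n" "h \<in> N n"
  shows "cl n (g \<otimes> h) = cl n (h \<otimes> g)"
proof -
  have c: "g \<in> carrier G" "h \<in> carrier G"
    using assms N_carrier by auto
  have "cm g h \<in> N (Suc n)"
    using csubD[OF N_central[OF n n]] assms N_antimono[of "Suc n" "n + n"] by auto
  then show ?thesis
    using c by (simp add: cl_eq_iff word_simps)
qed

lemma layer_comm_group: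
  assumes n: "1 \<le> n"
  shows "comm_group (Ly n)"
proof -
  have "N (Suc n) \<lhd> (G\<lparr>carrier := N n\<rparr>)"
    by (rule normal_restrict_supergroup[OF normal_subgroup[OF N_normal] N_normal N_Suc])
  then have "Group.group (Ly n)"
    unfolding layer_def by (rule normal.factorgroup_is_group)
  then show ?thesis
    by (rule group.group_comm_groupI)
      (auto elim!: layerE simp: cl_mult N_carrier cl_commute[OF n])
qed

lemma sy_cl:
  assumes n: "1 \<le> n" and g: "g \<in> N n"
  shows "sy n (cl n g) = symb n (delta g)"
proof -
  define k where "k = (SOME k. k \<in> cl n g)"
  have "g \<in> cl n g"
    unfolding cl_def using g by (intro rcos_self N_carrier normal_subgroup[OF N_normal])
  then have "k \<in> cl n g"
    unfolding k_def using someI[of "\<lambda>k. k \<in> cl n g" g] by blast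
  then obtain a where a: "a \<in> N (Suc n)" "k = a \<otimes> g"
    by (auto simp: cl_def r_coset_def)
  have "a \<in> F (Suc n)" "a \<in> F n" "g \<in> F n"
    using a(1) g N_F[of n] N_F[of "Suc n"] n F_Suc by auto
  then have "symb n (delta k) v = symb n (delta g) v" for v
    using symb_eq_0_iff[of a n] n unfolding a(2) by (subst symb_mult) auto
  then show ?thesis
    by (auto simp: sy_def k_def)
qed

lemma sy_mult:
  assumes "1 \<le> n" "A \<in> carrier (Ly n)" "B \<in> carrier (Ly n)"
  shows "sy n (A <#> B) v w = sy n A v w + sy n B v w"
proof -
  obtain g h where gh: "g \<in> N n" "h \<in> N n" "A = cl n g" "B = cl n h"
    using assms by (auto elim!: layerE)
  have "g \<in> F n" "h \<in> F n" using gh N_F assms by auto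
  then show ?thesis
    using gh assms(1) by (simp add: cl_mult N_carrier sy_cl normal_mult[OF N_normal] symb_mult)
qed

lemma sy_one: "1 \<le> n \<Longrightarrow> sy n (N (Suc n)) v = 0"
  using sy_cl[of n \<one>] normal_one[OF N_normal] by (simp add: cl_one symb_one)

lemma sy_additive:
  assumes "1 \<le> n" "A \<in> carrier (Ly n)"
  shows "additive_op (sy n A)"
  unfolding sy_def by (intro symb_apply_add delta_additive)

lemma sy_local:
  assumes "1 \<le> n" "A \<in> carrier (Ly n)"
  shows "local_op (sy n A)"
  using assms by (auto elim!: layerE simp: sy_cl N_carrier length_fun intro!: symb_local delta_local)

lemma sy_other_degree: "m \<noteq> n \<Longrightarrow> sy m A (proj (wt w + n) v) w = 0"
  unfolding sy_def by (rule symb_other_degree[OF delta_additive])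

lemma sy_homogeneous: "sy n A v w = sy n A (proj (wt w + n) v) w"
  unfolding sy_def by (rule symb_homogeneous)

lemma cl_cm_left:
  assumes m: "1 \<le> m" and n: "1 \<le> n" and g: "g \<in> N m" "g' \<in> N m" and h: "h \<in> N n"
  shows "cl (m + n) (cm (g \<otimes> g') h) = cl (m + n) (cm g h \<otimes> cm g' h)"
proof -
  have c: "g \<in> carrier G" "g' \<in> carrier G" "h \<in> carrier G"
    using g h N_carrier by auto
  have N: "cm g h \<in> N (m + n)" "cm g' h \<in> N (m + n)"
    using csubD[OF N_central[OF m n]] g h by auto
  have "cm g (cm g' h) \<in> N (m + (m + n))"
    using csubD[OF N_central[of m "m + n"]] m g N by simp
  then have "cm g (cm g' h) \<in> N (Suc (m + n))"
    using N_antimono[of "Suc (m + n)" "m + (m + n)"] m by auto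
  then have "cl (m + n) (g \<otimes> cm g' h \<otimes> inv g) = cl (m + n) (cm g' h)"
    using c by (simp add: cl_eq_iff commutator_def[of G g])
  then have "cl (m + n) (cm (g \<otimes> g') h) = cl (m + n) (cm g' h \<otimes> cm g h)"
    using c by (simp add: cm_mult_left flip: cl_mult)
  then show ?thesis
    using cl_commute[OF _ N] m by simp
qed

text \<open>Changing a representative in either slot alters the commutator only modulo
  \<open>N (Suc (m + n))\<close>, so the union defining \<open>layer_brak\<close> consists of a
  single coset.\<close>

lemma layer_brak_cl:
  assumes m: "1 \<le> m" and n: "1 \<le> n" and g: "g \<in> N m" and h: "h \<in> N n"
  shows "layer_brak G N m n (cl m g) (cl n h) = cl (m + n) (cm g h)"
proof -
  have c: "g \<in> carrier G" "h \<in> carrier G"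
    using g h N_carrier by auto
  have left: "cl (m + n) (cm (a \<otimes> g) k) = cl (m + n) (cm g k)"
    if a: "a \<in> N (Suc m)" and k: "k \<in> N n" for a k
  proof -
    have "cm a k \<in> N (Suc (m + n))"
      using csubD[OF N_central[of "Suc m" n]] n a k by simp
    then have "cl (m + n) (cm a k \<otimes> cm g k) = cl (m + n) (cm g k)"
      using a k c N_carrier by (simp add: cl_eq_iff m_assoc)
    then show ?thesis
      using cl_cm_left[OF m n _ g k, of a] a N_Suc by auto
  qed
  have right: "cl (m + n) (cm g (b \<otimes> h)) = cl (m + n) (cm g h)" if b: "b \<in> N (Suc n)" for b
  proof -
    have bc: "b \<in> carrier G" using b N_carrier by auto
    have "cm g b \<in> N (Suc (m + n))"
      using csubD[OF N_central[of m "Suc n"]] m g b by simp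
    moreover have "cm g (b \<otimes> h) = cm g b \<otimes> (b \<otimes> cm g h \<otimes> inv b)"
      using c bc by (simp add: word_simps)
    moreover have "cm b (cm g h) \<in> N (Suc (m + n))"
    proof -
      have "cm b (cm g h) \<in> N (Suc n + (m + n))"
        using csubD[OF N_central[of "Suc n" "m + n"] b csubD[OF N_central[OF m n] g h]] m by simp
      then show ?thesis
        using N_antimono[of "Suc (m + n)" "Suc n + (m + n)"] by auto
    qed
    ultimately have "cm g b \<otimes> cm b (cm g h) \<in> N (Suc (m + n))"
      by (intro normal_mult[OF N_normal])
    also have "cm g b \<otimes> cm b (cm g h) = cm g (b \<otimes> h) \<otimes> inv (cm g h)"
      using c bc by (simp add: word_simps)
    finally show ?thesis
      using c bc by (simp add: cl_eq_iff)
  qed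
  have eq: "cl (m + n) (cm x y) = cl (m + n) (cm g h)" if "x \<in> cl m g" "y \<in> cl n h" for x y
  proof -
    obtain a b where ab: "a \<in> N (Suc m)" "x = a \<otimes> g" "b \<in> N (Suc n)" "y = b \<otimes> h"
      using \<open>x \<in> cl m g\<close> \<open>y \<in> cl n h\<close> by (auto simp: cl_def r_coset_def)
    then have "y \<in> N n"
      using h N_Suc normal_mult[OF N_normal, of b n h] by auto
    then show ?thesis
      using left[of a y] right[of b] ab by simp
  qed
  have ne: "cl m g \<noteq> {}" "cl n h \<noteq> {}"
    unfolding cl_def using rcos_self[OF _ normal_subgroup[OF N_normal]] c by blast+
  have "layer_brak G N m n (cl m g) (cl n h) = (\<Union>x\<in>cl m g. \<Union>y\<in>cl n h. cl (m + n) (cm x y))"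
    by (simp add: layer_brak_def cl_def)
  also have "\<dots> = (\<Union>x\<in>cl m g. \<Union>y\<in>cl n h. cl (m + n) (cm g h))"
    by (intro SUP_cong refl eq)
  finally show ?thesis
    using ne by simp
qed

lemma cm_N: "1 \<le> m \<Longrightarrow> 1 \<le> n \<Longrightarrow> g \<in> N m \<Longrightarrow> h \<in> N n \<Longrightarrow> cm g h \<in> N (m + n)"
  using csubD[OF N_central] by blast

lemma layer_brak_closed:
  assumes "1 \<le> m" "1 \<le> n" "A \<in> carrier (Ly m)" "B \<in> carrier (Ly n)"
  shows "layer_brak G N m n A B \<in> carrier (Ly (m + n))"
  using assms by (auto elim!: layerE simp: layer_brak_cl cl_layer cm_N)

lemma sy_brak:
  assumes mn: "1 \<le> m" "1 \<le> n" and "A \<in> carrier (Ly m)" "B \<in> carrier (Ly n)"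
  shows "sy (m + n) (layer_brak G N m n A B) v w = sy m A (sy n B v) w + sy n B (sy m A v) w"
proof -
  obtain g h where gh: "g \<in> N m" "h \<in> N n" "A = cl m g" "B = cl n h"
    using assms by (auto elim!: layerE)
  have "g \<in> F m" "h \<in> F n" using gh N_F mn by auto
  then show ?thesis
    using gh mn by (simp add: layer_brak_cl sy_cl cm_N symb_commutator)
qed

lemma layer_brak_left:
  assumes mn: "1 \<le> m" "1 \<le> n" and "A \<in> carrier (Ly m)" "A' \<in> carrier (Ly m)" "B \<in> carrier (Ly n)"
  shows "layer_brak G N m n (A <#> A') B = layer_brak G N m n A B <#> layer_brak G N m n A' B"
proof -
  obtain g g' h where gh: "g \<in> N m" "g' \<in> N m" "h \<in> N n" "A = cl m g" "A' = cl m g'" "B = cl n h"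
    using assms by (auto elim!: layerE)
  then show ?thesis
    using mn by (simp add: cl_mult N_carrier layer_brak_cl normal_mult[OF N_normal] cl_cm_left)
qed

lemma layer_brak_anti:
  assumes mn: "1 \<le> m" "1 \<le> n" and "A \<in> carrier (Ly m)" "B \<in> carrier (Ly n)"
  shows "layer_brak G N m n A B <#> layer_brak G N n m B A = N (Suc (m + n))"
proof -
  obtain g h where gh: "g \<in> N m" "h \<in> N n" "A = cl m g" "B = cl n h"
    using assms by (auto elim!: layerE)
  moreover have "cm g h \<otimes> cm h g = \<one>"
    using gh N_carrier by (simp flip: inv_cm[of g h])
  ultimately show ?thesis
    using mn layer_brak_cl[of n m h g] by (simp add: layer_brak_cl cl_mult N_carrier add.commute[of n m] cl_one)
qed

lemma layer_brak_one:
  assumes mn: "1 \<le> m" "1 \<le> n"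
  shows "A \<in> carrier (Ly n) \<Longrightarrow> layer_brak G N m n (N (Suc m)) A = N (Suc (m + n))"
    and "A \<in> carrier (Ly m) \<Longrightarrow> layer_brak G N m n A (N (Suc n)) = N (Suc (m + n))"
  using mn layer_brak_cl[OF mn, of \<one>] layer_brak_cl[OF mn, of _ \<one>]
  by (auto elim!: layerE simp: cl_one N_carrier normal_one[OF N_normal])

lemma sy_finprod:
  assumes n: "1 \<le> n" and A: "finite A" and f: "f \<in> A \<rightarrow> carrier (Ly n)"
  shows "sy n (\<Otimes>\<^bsub>Ly n\<^esub>m\<in>A. f m) v w = (\<Sum>m\<in>A. sy n (f m) v w)"
proof -
  interpret Ln: comm_group "Ly n" by (rule layer_comm_group[OF n])
  show ?thesis
    using A f
  proof (induction rule: finite_induct)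
    case empty
    then show ?case using sy_one[OF n, of v] by simp
  next
    case (insert a A)
    then have "sy n (f a <#> (\<Otimes>\<^bsub>Ly n\<^esub>m\<in>A. f m)) v w = sy n (f a) v w + (\<Sum>m\<in>A. sy n (f m) v w)"
      using sy_mult[OF n, of "f a" "\<Otimes>\<^bsub>Ly n\<^esub>m\<in>A. f m"] Ln.finprod_closed[of f A] by auto
    then show ?case
      using insert by simp
  qed
qed

text \<open>With \<open>a\<close> in \<open>N (Suc n)\<close>, the quotient
  \<open>(ag)\<^sup>2 g\<^sup>-\<^sup>2\<close> is the product of a conjugate of
  \<open>[g, a]\<close>, of degree \<open>2 * n + 1\<close>, and of \<open>a\<^sup>2\<close>, of
  degree \<open>2 * n + 2\<close>.\<close>

lemma layer_square_cl:
  assumes sq: "\<And>n h. 1 \<le> n \<Longrightarrow> h \<in> N n \<Longrightarrow> h \<otimes> h \<in> N (2 * n)" and n: "1 \<le> n" and g: "g \<in> N n"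
  shows "layer_square G N n (cl n g) = cl (2 * n) (g \<otimes> g)"
proof -
  have c: "g \<in> carrier G"
    using g N_carrier by auto
  have eq: "cl (2 * n) (x [^] (2::nat)) = cl (2 * n) (g \<otimes> g)" if x: "x \<in> cl n g" for x
  proof -
    obtain a where a: "a \<in> N (Suc n)" "x = a \<otimes> g"
      using x by (auto simp: cl_def r_coset_def)
    then have ac: "a \<in> carrier G" "a \<in> N n"
      using N_carrier N_Suc by auto
    have "cm g a \<in> N (Suc (2 * n))"
      using cm_N[of n "Suc n" g a] n g a by (simp add: mult_2)
    then have "a \<otimes> cm g a \<otimes> inv a \<in> N (Suc (2 * n))"
      by (rule normal_conj[OF N_normal ac(1)])
    moreover have "a \<otimes> a \<in> N (Suc (2 * n))"
      using sq[of "Suc n" a] a N_Suc[of "Suc (2 * n)"] by auto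
    ultimately have "(a \<otimes> cm g a \<otimes> inv a) \<otimes> (a \<otimes> a) \<in> N (Suc (2 * n))"
      by (rule normal_mult[OF N_normal])
    also have "(a \<otimes> cm g a \<otimes> inv a) \<otimes> (a \<otimes> a) = (a \<otimes> g) \<otimes> (a \<otimes> g) \<otimes> inv (g \<otimes> g)"
      using c ac by (simp add: word_simps)
    finally show ?thesis
      using c ac by (simp add: cl_eq_iff a(2) nat_pow_2)
  qed
  have ne: "cl n g \<noteq> {}"
    unfolding cl_def using rcos_self[OF _ normal_subgroup[OF N_normal]] c by blast
  have "layer_square G N n (cl n g) = (\<Union>x\<in>cl n g. cl (2 * n) (x [^] (2::nat)))"
    by (simp add: layer_square_def cl_def)
  also have "\<dots> = (\<Union>x\<in>cl n g. cl (2 * n) (g \<otimes> g))"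
    by (intro SUP_cong refl eq)
  finally show ?thesis
    using ne by simp
qed

lemma sy_square:
  assumes sq: "\<And>n h. 1 \<le> n \<Longrightarrow> h \<in> N n \<Longrightarrow> h \<otimes> h \<in> N (2 * n)"
    and n: "1 \<le> n" and A: "A \<in> carrier (Ly n)"
  shows "layer_square G N n A \<in> carrier (Ly (2 * n))"
    and "sy (2 * n) (layer_square G N n A) v w = sy n A (sy n A v) w"
proof -
  obtain g where g: "g \<in> N n" "A = cl n g"
    using A by (auto elim!: layerE)
  then have "g \<in> F n" using N_F n by auto
  then show "layer_square G N n A \<in> carrier (Ly (2 * n))"
    "sy (2 * n) (layer_square G N n A) v w = sy n A (sy n A v) w"
    using g n by (simp_all add: layer_square_cl[OF sq] sq cl_layer sy_cl symb_square)
qed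

end

text \<open>\<open>L\<close> is given through its fields and a record scheme, so that one
  development covers the plain Lie ring of the lower central series and the restricted one of the
  dimension series.\<close>

locale graded_lie = graded_rep +
  fixes L :: "(nat \<Rightarrow> (bit list \<Rightarrow> bit list) set, 'm) lie_ring_scheme"
  assumes L_carrier: "carrier L = carrier (graded_group G N)"
    and L_mult: "monoid.mult L = monoid.mult (graded_group G N)"
    and L_one: "one L = one (graded_group G N)"
    and L_brak: "brak L = graded_brak G N"
begin

lemma Ly_group: "n \<in> {1..} \<Longrightarrow> Group.group (Ly n)"
  using layer_comm_group by (simp add: comm_group.axioms)

lemma in_L_iff:
  "x \<in> carrier L \<longleftrightarrow>
    x \<in> extensional {1..} \<and> (\<forall>n\<ge>1. x n \<in> carrier (Ly n)) \<and> (\<exists>B. \<forall>n>B. x n = N (Suc n))"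
proof -
  have "finite {n \<in> {1..}. x n \<noteq> N (Suc n)} \<longleftrightarrow> (\<exists>B. \<forall>n>B. x n = N (Suc n))"
  proof
    assume fin: "finite {n \<in> {1..}. x n \<noteq> N (Suc n)}"
    let ?M = "Max (insert 1 {n \<in> {1..}. x n \<noteq> N (Suc n)})"
    have "x n = N (Suc n)" if n: "?M < n" for n
    proof (rule ccontr)
      assume "x n \<noteq> N (Suc n)"
      moreover have "1 \<le> ?M"
        using fin by (intro Max_ge) auto
      ultimately have "n \<le> ?M"
        using fin n by (intro Max_ge) auto
      then show False using n by simp
    qed
    then show "\<exists>B. \<forall>n>B. x n = N (Suc n)" by blast
  next
    assume "\<exists>B. \<forall>n>B. x n = N (Suc n)"
    then obtain B where B: "\<forall>n>B. x n = N (Suc n)" ..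
    show "finite {n \<in> {1..}. x n \<noteq> N (Suc n)}"
      by (rule finite_subset[of _ "{..B}"]) (use B not_le in auto)
  qed
  moreover have "carrier (sum_group {1..} Ly) =
      {x \<in> \<Pi>\<^sub>E i\<in>{1..}. carrier (Ly i). finite {i \<in> {1..}. x i \<noteq> \<one>\<^bsub>Ly i\<^esub>}}"
    by (rule carrier_sum_group) (rule Ly_group)
  ultimately show ?thesis
    unfolding L_carrier graded_group_def by (auto simp: PiE_iff)
qed

lemma mult_L: "monoid.mult L x y = (\<lambda>n\<in>{1..}. x n <#> y n)"
  by (simp add: L_mult graded_group_def)

lemma one_L: "one L = (\<lambda>n\<in>{1..}. N (Suc n))"
  by (simp add: L_one graded_group_def)

lemma L_comp: "x \<in> carrier L \<Longrightarrow> 1 \<le> n \<Longrightarrow> x n \<in> carrier (Ly n)"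
  by (simp add: in_L_iff)

lemma L_eqI: "x \<in> carrier L \<Longrightarrow> y \<in> carrier L \<Longrightarrow> (\<And>n. 1 \<le> n \<Longrightarrow> x n = y n) \<Longrightarrow> x = y"
  by (auto simp: in_L_iff intro!: extensionalityI[of x "{1..}" y])

lemma L_comm_group: "comm_group L"
proof -
  have g: "Group.group (graded_group G N)"
    unfolding graded_group_def by (rule sum_group) (simp add: Ly_group)
  have "Group.group L"
  proof (rule groupI)
    fix x assume "x \<in> carrier L"
    then show "\<exists>y\<in>carrier L. y \<otimes>\<^bsub>L\<^esub> x = \<one>\<^bsub>L\<^esub>"
      using group.l_inv_ex[OF g] by (simp add: L_carrier L_mult L_one)
  qed (use g in \<open>auto simp: L_carrier L_mult L_one group.is_monoid monoid.m_closed monoid.m_assoc\<close>)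
  then show ?thesis
  proof (rule group.group_comm_groupI)
    fix x y assume x: "x \<in> carrier L" and y: "y \<in> carrier L"
    have "x n <#> y n = y n <#> x n" if "1 \<le> n" for n
      using comm_monoid.m_comm[OF comm_group.axioms(1)[OF layer_comm_group[OF that]]
          L_comp[OF x that] L_comp[OF y that]] by simp
    then show "x \<otimes>\<^bsub>L\<^esub> y = y \<otimes>\<^bsub>L\<^esub> x"
      by (auto simp: mult_L intro!: restrict_ext)
  qed
qed

lemma brak_L: "1 \<le> k \<Longrightarrow> brak L x y k = (\<Otimes>\<^bsub>Ly k\<^esub>m\<in>{1..<k}. layer_brak G N m (k - m) (x m) (y (k - m)))"
  by (simp add: L_brak graded_brak_def)

lemma brak_term:
  assumes "x \<in> carrier L" "y \<in> carrier L" "m \<in> {1..<k}"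
  shows "layer_brak G N m (k - m) (x m) (y (k - m)) \<in> carrier (Ly k)"
  using layer_brak_closed[of m "k - m" "x m" "y (k - m)"] L_comp assms by auto

lemma bound:
  assumes "x \<in> carrier L" "y \<in> carrier L"
  obtains B where "\<And>n. B < n \<Longrightarrow> x n = N (Suc n)" "\<And>n. B < n \<Longrightarrow> y n = N (Suc n)"
proof -
  obtain B C where "\<forall>n>B. x n = N (Suc n)" "\<forall>n>C. y n = N (Suc n)"
    using assms unfolding in_L_iff by auto
  then show ?thesis
    using that[of "max B C"] by simp
qed

lemma brak_term_one:
  assumes "x \<in> carrier L" "y \<in> carrier L" "m \<in> {1..<k}" and "x m = N (Suc m) \<or> y (k - m) = N (Suc (k - m))"
  shows "layer_brak G N m (k - m) (x m) (y (k - m)) = N (Suc k)"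
  using layer_brak_one[of m "k - m"] L_comp assms by auto

lemma brak_comp_one:
  assumes xy: "x \<in> carrier L" "y \<in> carrier L" and k: "1 \<le> k"
    and 0: "\<And>m. m \<in> {1..<k} \<Longrightarrow> layer_brak G N m (k - m) (x m) (y (k - m)) = N (Suc k)"
  shows "brak L x y k = N (Suc k)"
proof -
  interpret Lk: comm_group "Ly k" by (rule layer_comm_group[OF k])
  have "(\<Otimes>\<^bsub>Ly k\<^esub>m\<in>{1..<k}. layer_brak G N m (k - m) (x m) (y (k - m))) = \<one>\<^bsub>Ly k\<^esub>"
    by (rule Lk.finprod_one_eqI) (simp add: 0)
  then show ?thesis
    unfolding brak_L[OF k] by simp
qed

lemma brak_L_closed:
  assumes x: "x \<in> carrier L" and y: "y \<in> carrier L"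
  shows "brak L x y \<in> carrier L"
proof -
  obtain B where B: "\<And>n. B < n \<Longrightarrow> x n = N (Suc n)" "\<And>n. B < n \<Longrightarrow> y n = N (Suc n)"
    using bound[OF x y] by blast
  have "brak L x y k \<in> carrier (Ly k)" if k: "1 \<le> k" for k
  proof -
    interpret Lk: comm_group "Ly k" by (rule layer_comm_group[OF k])
    show ?thesis
      unfolding brak_L[OF k] by (rule Lk.finprod_closed) (use brak_term x y in auto)
  qed
  moreover have "brak L x y k = N (Suc k)" if k: "2 * B < k" for k
  proof (rule brak_comp_one[OF x y])
    fix m assume m: "m \<in> {1..<k}"
    then have "B < m \<or> B < k - m" using k by auto
    then show "layer_brak G N m (k - m) (x m) (y (k - m)) = N (Suc k)"
      using B by (intro brak_term_one[OF x y m]) auto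
  qed (use k in simp)
  moreover have "brak L x y \<in> extensional {1..}"
    by (simp add: L_brak graded_brak_def)
  ultimately show ?thesis
    unfolding in_L_iff by blast
qed

sublocale LL: lie_rng L
proof (intro lie_rng.intro lie_rng_axioms.intro L_comm_group brak_L_closed)
  fix x y z assume x: "x \<in> carrier L" and y: "y \<in> carrier L" and z: "z \<in> carrier L"
  interpret L: comm_group L by (rule L_comm_group)
  have "brak L (x \<otimes>\<^bsub>L\<^esub> y) z k = brak L x z k <#> brak L y z k" if k: "1 \<le> k" for k
  proof -
    interpret Lk: comm_group "Ly k" by (rule layer_comm_group[OF k])
    have "brak L (x \<otimes>\<^bsub>L\<^esub> y) z k = (\<Otimes>\<^bsub>Ly k\<^esub>m\<in>{1..<k}.
        layer_brak G N m (k - m) (x m) (z (k - m)) \<otimes>\<^bsub>Ly k\<^esub> layer_brak G N m (k - m) (y m) (z (k - m)))"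
      unfolding brak_L[OF k]
    proof (rule Lk.finprod_cong')
      fix m assume "m \<in> {1..<k}"
      then show "layer_brak G N m (k - m) ((x \<otimes>\<^bsub>L\<^esub> y) m) (z (k - m)) =
        layer_brak G N m (k - m) (x m) (z (k - m)) \<otimes>\<^bsub>Ly k\<^esub> layer_brak G N m (k - m) (y m) (z (k - m))"
        using layer_brak_left[of m "k - m" "x m" "y m" "z (k - m)"] L_comp[OF x] L_comp[OF y] L_comp[OF z]
        by (simp add: mult_L Suc_le_eq)
    next
      show "(\<lambda>m. layer_brak G N m (k - m) (x m) (z (k - m)) \<otimes>\<^bsub>Ly k\<^esub> layer_brak G N m (k - m) (y m) (z (k - m)))
          \<in> {1..<k} \<rightarrow> carrier (Ly k)"
        using brak_term[OF x z] brak_term[OF y z] Lk.m_closed by blast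
    qed simp
    also have "\<dots> = brak L x z k \<otimes>\<^bsub>Ly k\<^esub> brak L y z k"
      unfolding brak_L[OF k] by (rule Lk.finprod_multf) (use brak_term x y z in auto)
    finally show ?thesis by simp
  qed
  then show "brak L (x \<otimes>\<^bsub>L\<^esub> y) z = brak L x z \<otimes>\<^bsub>L\<^esub> brak L y z"
    by (intro L_eqI brak_L_closed L.m_closed x y z) (simp_all add: mult_L)
next
  fix x y assume x: "x \<in> carrier L" and y: "y \<in> carrier L"
  interpret L: comm_group L by (rule L_comm_group)
  have "brak L x y k <#> brak L y x k = N (Suc k)" if k: "1 \<le> k" for k
  proof -
    interpret Lk: comm_group "Ly k" by (rule layer_comm_group[OF k])
    let ?f = "\<lambda>m. layer_brak G N m (k - m) (x m) (y (k - m))"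
      and ?g = "\<lambda>m. layer_brak G N m (k - m) (y m) (x (k - m))"
    have im: "(\<lambda>m. k - m) ` {1..<k} = {1..<k}"
    proof
      show "{1..<k} \<subseteq> (\<lambda>m. k - m) ` {1..<k}"
      proof
        fix m assume "m \<in> {1..<k}"
        then show "m \<in> (\<lambda>m. k - m) ` {1..<k}"
          by (intro image_eqI[of _ _ "k - m"]) auto
      qed
    qed auto
    have inj: "inj_on (\<lambda>m. k - m) {1..<k}"
      by (auto simp: inj_on_def)
    \<comment> \<open>Reversing the second product pairs \<open>[x\<^sub>m, y\<^sub>n]\<close> with
      \<open>[y\<^sub>n, x\<^sub>m]\<close>, where the antisymmetry of the layers applies.\<close>
    have "finprod (Ly k) ?g {1..<k} = finprod (Ly k) (\<lambda>m. ?g (k - m)) {1..<k}"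
      using Lk.finprod_reindex[of ?g "\<lambda>m. k - m" "{1..<k}"] inj brak_term[OF y x] unfolding im by auto
    then have "brak L x y k \<otimes>\<^bsub>Ly k\<^esub> brak L y x k =
        finprod (Ly k) ?f {1..<k} \<otimes>\<^bsub>Ly k\<^esub> finprod (Ly k) (\<lambda>m. ?g (k - m)) {1..<k}"
      by (simp only: brak_L[OF k])
    also have "\<dots> = finprod (Ly k) (\<lambda>m. ?f m \<otimes>\<^bsub>Ly k\<^esub> ?g (k - m)) {1..<k}"
    proof (rule Lk.finprod_multf[symmetric])
      show "?f \<in> {1..<k} \<rightarrow> carrier (Ly k)"
        using brak_term[OF x y] by blast
      show "(\<lambda>m. ?g (k - m)) \<in> {1..<k} \<rightarrow> carrier (Ly k)"
      proof
        fix m assume "m \<in> {1..<k}"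
        then have "k - m \<in> {1..<k}" by auto
        then show "?g (k - m) \<in> carrier (Ly k)"
          by (rule brak_term[OF y x])
      qed
    qed
    also have "\<dots> = \<one>\<^bsub>Ly k\<^esub>"
    proof (rule Lk.finprod_one_eqI)
      fix m assume m: "m \<in> {1..<k}"
      then show "?f m \<otimes>\<^bsub>Ly k\<^esub> ?g (k - m) = \<one>\<^bsub>Ly k\<^esub>"
        using layer_brak_anti[of m "k - m" "x m" "y (k - m)"] L_comp[OF x] L_comp[OF y] by (simp add: Suc_le_eq)
    qed
    finally show ?thesis by simp
  qed
  then show "brak L x y \<otimes>\<^bsub>L\<^esub> brak L y x = \<one>\<^bsub>L\<^esub>"
    by (intro L_eqI brak_L_closed L.m_closed L.one_closed x y) (simp_all add: mult_L one_L)
qed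

text \<open>Defined on all vectors and with an explicit bound, so that it can be composed and summed
  freely; on \<open>tens\<close> it agrees with \<open>Phi\<close> for every bound beyond the
  support of \<open>x\<close>.\<close>

definition Psum :: "nat \<Rightarrow> (nat \<Rightarrow> (bit list \<Rightarrow> bit list) set) \<Rightarrow> vec \<Rightarrow> vec"
  where "Psum B x v = (\<lambda>w. \<Sum>n=1..B. sy n (x n) v w)"

definition Phi :: "(nat \<Rightarrow> (bit list \<Rightarrow> bit list) set) \<Rightarrow> bit endo"
  where "Phi x = (\<lambda>v\<in>tens. \<lambda>w. \<Sum>n | 1 \<le> n \<and> x n \<noteq> N (Suc n). sy n (x n) v w)"

lemma Phi_eq:
  assumes x: "x \<in> carrier L" and B: "\<And>n. B < n \<Longrightarrow> x n = N (Suc n)" and v: "v \<in> tens"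
  shows "Phi x v = Psum B x v"
proof
  fix w
  show "Phi x v w = Psum B x v w"
    unfolding Phi_def Psum_def using v
    by (simp, intro sum.mono_neutral_left) (use B not_le in \<open>auto simp: sy_one\<close>)
qed

lemma Psum_additive: "x \<in> carrier L \<Longrightarrow> additive_op (Psum B x)"
  unfolding additive_op_def Psum_def
  by (auto simp: plus_fun_def additive_opD[OF sy_additive, unfolded plus_fun_def] L_comp sum.distrib)

lemma Psum_local: "x \<in> carrier L \<Longrightarrow> local_op (Psum B x)"
  unfolding local_op_def
proof (intro allI impI)
  fix v n w assume x: "x \<in> carrier L" and v: "\<forall>w. v w \<noteq> (0::bit) \<longrightarrow> length w \<le> n" and "Psum B x v w \<noteq> 0"
  then obtain m where m: "m \<in> {1..B}" "sy m (x m) v w \<noteq> 0"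
    unfolding Psum_def by (meson sum.not_neutral_contains_not_neutral)
  then have "local_op (sy m (x m))"
    using x by (intro sy_local L_comp) auto
  then show "length w \<le> n \<and> set w \<subseteq> {..<2}"
    using v m unfolding local_op_def by blast
qed

lemma Phi_ext: "Phi x \<in> extensional tens"
  by (simp add: Phi_def)

lemma Phi_tens: "x \<in> carrier L \<Longrightarrow> v \<in> tens \<Longrightarrow> Phi x v \<in> tens"
  using bound[of x x] Phi_eq[of x _ v] local_op_tens[OF Psum_local] by metis

lemma Phi_mult:
  assumes x: "x \<in> carrier L" and y: "y \<in> carrier L"
  shows "Phi (x \<otimes>\<^bsub>L\<^esub> y) = endo_add (Phi x) (Phi y)"
proof -
  obtain B where B: "\<And>n. B < n \<Longrightarrow> x n = N (Suc n)" "\<And>n. B < n \<Longrightarrow> y n = N (Suc n)"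
    using bound[OF x y] by blast
  have "(x \<otimes>\<^bsub>L\<^esub> y) n = N (Suc n)" if "B < n" for n
    using B[OF that] that cl_mult[of \<one> \<one> n] by (simp add: mult_L cl_one)
  then have sum: "Phi (x \<otimes>\<^bsub>L\<^esub> y) v = Psum B (x \<otimes>\<^bsub>L\<^esub> y) v" if "v \<in> tens" for v
    by (rule Phi_eq[OF comm_groupE(1)[OF L_comm_group x y] _ that])
  have "Phi (x \<otimes>\<^bsub>L\<^esub> y) v w = Phi x v w + Phi y v w" if v: "v \<in> tens" for v w
    using sum[OF v] Phi_eq[OF x _ v, of B] Phi_eq[OF y _ v, of B] B
    by (simp add: Psum_def mult_L sy_mult L_comp[OF x] L_comp[OF y] sum.distrib)
  then show ?thesis
    by (auto intro!: extensionalityI[OF Phi_ext] simp: endo_add_def)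
qed

lemma Psum_comp:
  assumes x: "x \<in> carrier L" and y: "y \<in> carrier L"
  shows "Psum B x (Psum C y v) w = (\<Sum>m=1..B. \<Sum>n=1..C. sy m (x m) (sy n (y n) v) w)"
  unfolding Psum_def
  by (intro sum.cong refl)
    (simp add: additive_op_sum[OF sy_additive] L_comp[OF x])

lemma sy_zero: "sy m A 0 = 0"
  unfolding sy_def by (rule additive_op_0[OF symb_apply_add[OF delta_additive]])

lemma Phi_brak:
  assumes x: "x \<in> carrier L" and y: "y \<in> carrier L"
  shows "Phi (brak L x y) = endo_brak (Phi x) (Phi y)"
proof -
  obtain B where B: "\<And>n. B < n \<Longrightarrow> x n = N (Suc n)" "\<And>n. B < n \<Longrightarrow> y n = N (Suc n)"
    using bound[OF x y] by blast
  have "Phi (brak L x y) v w = Phi x (Phi y v) w - Phi y (Phi x v) w" if v: "v \<in> tens" for v w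
  proof -
    let ?t = "\<lambda>m n. sy m (x m) (sy n (y n) v) w + sy n (y n) (sy m (x m) v) w"
    have 1: "brak L x y k = N (Suc k)" if k: "2 * B < k" for k
    proof (rule brak_comp_one[OF x y])
      fix m assume m: "m \<in> {1..<k}"
      then have "B < m \<or> B < k - m" using k by auto
      then show "layer_brak G N m (k - m) (x m) (y (k - m)) = N (Suc k)"
        using B by (intro brak_term_one[OF x y m]) auto
    qed (use k in simp)
    have "Phi (brak L x y) v w = (\<Sum>k=1..2*B. sy k (brak L x y k) v w)"
      using Phi_eq[OF brak_L_closed[OF x y] 1 v] by (simp add: Psum_def)
    also have "\<dots> = (\<Sum>k=1..2*B. \<Sum>m=1..<k. ?t m (k - m))"
    proof (rule sum.cong[OF refl])
      fix k assume "k \<in> {1..2*B}"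
      then have k: "1 \<le> k" by simp
      have "sy k (brak L x y k) v w = (\<Sum>m=1..<k. sy k (layer_brak G N m (k - m) (x m) (y (k - m))) v w)"
        unfolding brak_L[OF k] by (rule sy_finprod[OF k]) (use brak_term[OF x y] in auto)
      also have "\<dots> = (\<Sum>m=1..<k. ?t m (k - m))"
      proof (rule sum.cong[OF refl])
        fix m assume "m \<in> {1..<k}"
        then show "sy k (layer_brak G N m (k - m) (x m) (y (k - m))) v w = ?t m (k - m)"
          using sy_brak[of m "k - m" "x m" "y (k - m)" v w] L_comp[OF x] L_comp[OF y] by (simp add: Suc_le_eq)
      qed
      finally show "sy k (brak L x y k) v w = (\<Sum>m=1..<k. ?t m (k - m))" .
    qed
    also have "\<dots> = (\<Sum>m=1..B. \<Sum>n=1..B. ?t m n)"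
    proof (rule sum_pairs[of B ?t])
      fix m n assume "B < m \<or> B < n"
      then show "?t m n = 0"
        using B sy_one[of m] sy_one[of n] by (cases m; cases n) (auto simp: sy_zero)
    qed
    also have "\<dots> = Psum B x (Psum B y v) w + Psum B y (Psum B x v) w"
      unfolding Psum_comp[OF x y] Psum_comp[OF y x]
      by (subst (2) sum.swap) (simp add: sum.distrib)
    also have "\<dots> = Phi x (Phi y v) w - Phi y (Phi x v) w"
      using v Phi_tens[OF x v] Phi_tens[OF y v] B by (simp add: Phi_eq[OF x B(1)] Phi_eq[OF y B(2)])
    finally show ?thesis .
  qed
  then show ?thesis
    by (auto intro!: extensionalityI[OF Phi_ext] simp: endo_brak_def)
qed

lemma Phi_square:
  assumes sq: "\<And>n h. 1 \<le> n \<Longrightarrow> h \<in> N n \<Longrightarrow> h \<otimes> h \<in> N (2 * n)" and x: "x \<in> carrier L"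
  shows "graded_square G N x \<in> carrier L" and "Phi (graded_square G N x) = endo_pmap (Phi x)"
proof -
  obtain B where B: "\<And>n. B < n \<Longrightarrow> x n = N (Suc n)"
    using bound[OF x x] by blast
  let ?S = "\<lambda>k. if even k then layer_square G N (k div 2) (x (k div 2)) else N (Suc k)"
    and ?A = "\<lambda>k::nat. {m. 1 \<le> m \<and> m < k - m}"
    and ?b = "\<lambda>k m. layer_brak G N m (k - m) (x m) (x (k - m))"
  have gs: "graded_square G N x k = ?S k <#> (\<Otimes>\<^bsub>Ly k\<^esub>m\<in>?A k. ?b k m)" if "1 \<le> k" for k
    using that by (simp add: graded_square_def)
  have S: "?S k \<in> carrier (Ly k)" if "1 \<le> k" for k
  proof (cases "even k")
    case True
    then have "2 * (k div 2) = k" "1 \<le> k div 2" using that by auto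
    then show ?thesis
      using True sy_square(1)[OF sq, of "k div 2" "x (k div 2)"] L_comp[OF x] by simp
  next
    case False
    then show ?thesis
      using group.is_monoid[OF Ly_group, of k] monoid.one_closed[of "Ly k"] that by simp
  qed
  have b: "?b k \<in> ?A k \<rightarrow> carrier (Ly k)" for k
    using brak_term[OF x x] by auto
  have fin: "finite (?A k)" for k
    by (rule finite_subset[of _ "{..<k}"]) (auto simp: less_diff_conv)
  have prod: "(\<Otimes>\<^bsub>Ly k\<^esub>m\<in>?A k. ?b k m) \<in> carrier (Ly k)" if "1 \<le> k" for k
    using comm_monoid.finprod_closed[OF comm_group.axioms(1)[OF layer_comm_group[OF that]] b] .
  have big: "graded_square G N x k = N (Suc k)" if k: "2 * B < k" for k
  proof -
    interpret Lk: comm_group "Ly k" by (rule layer_comm_group) (use k in simp)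
    have "?S k = N (Suc k)"
    proof (cases "even k")
      case True
      then have "2 * (k div 2) = k" "1 \<le> k div 2" "B < k div 2" using k by auto
      moreover have "layer_square G N (k div 2) (cl (k div 2) \<one>) = cl (2 * (k div 2)) \<one>"
        using layer_square_cl[OF sq, of "k div 2" \<one>] normal_one[OF N_normal] calculation by simp
      ultimately show ?thesis
        using True B[of "k div 2"] by (simp add: cl_one)
    qed simp
    moreover have "(\<Otimes>\<^bsub>Ly k\<^esub>m\<in>?A k. ?b k m) = \<one>\<^bsub>Ly k\<^esub>"
    proof (rule Lk.finprod_one_eqI)
      fix m assume "m \<in> ?A k"
      then show "?b k m = \<one>\<^bsub>Ly k\<^esub>"
        using B[of "k - m"] k by (subst brak_term_one[OF x x]) auto
    qed
    ultimately show ?thesis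
      using k gs[of k] Lk.one_closed Lk.r_one[of "N (Suc k)"] by simp
  qed
  show L: "graded_square G N x \<in> carrier L"
    unfolding in_L_iff
  proof (intro conjI allI impI exI[of _ "2 * B"])
    fix n assume n: "1 \<le> (n::nat)"
    show "graded_square G N x n \<in> carrier (Ly n)"
      unfolding gs[OF n]
      using monoid.m_closed[OF group.is_monoid[OF Ly_group] S[OF n] prod[OF n]] n by simp
  qed (use big in \<open>auto simp: graded_square_def\<close>)
  have "Phi (graded_square G N x) v w = Phi x (Phi x v) w" if v: "v \<in> tens" for v w
  proof -
    let ?t = "\<lambda>m n. sy m (x m) (sy n (x n) v) w"
    have "Phi (graded_square G N x) v w = (\<Sum>k=1..2*B. sy k (graded_square G N x k) v w)"
      using Phi_eq[OF L big v] by (simp add: Psum_def)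
    also have "\<dots> = (\<Sum>k=1..2*B. (if even k then ?t (k div 2) (k div 2) else 0) +
      (\<Sum>m\<in>?A k. ?t m (k - m) + ?t (k - m) m))"
    proof (rule sum.cong[OF refl])
      fix k assume "k \<in> {1..2*B}"
      then have k: "1 \<le> k" by simp
      have "sy k (graded_square G N x k) v w = sy k (?S k) v w + (\<Sum>m\<in>?A k. sy k (?b k m) v w)"
        unfolding gs[OF k] sy_mult[OF k S[OF k] prod[OF k]] sy_finprod[OF k fin b] ..
      also have "sy k (?S k) v w = (if even k then ?t (k div 2) (k div 2) else 0)"
      proof (cases "even k")
        case True
        then have "2 * (k div 2) = k" "1 \<le> k div 2" using k by auto
        then show ?thesis
          using True sy_square(2)[OF sq, of "k div 2" "x (k div 2)" v w] L_comp[OF x] by simp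
      next
        case False
        then show ?thesis using k by (simp add: sy_one)
      qed
      also have "(\<Sum>m\<in>?A k. sy k (?b k m) v w) = (\<Sum>m\<in>?A k. ?t m (k - m) + ?t (k - m) m)"
      proof (rule sum.cong[OF refl])
        fix m assume "m \<in> ?A k"
        then have "1 \<le> m" "m < k" by auto
        then show "sy k (?b k m) v w = ?t m (k - m) + ?t (k - m) m"
          using sy_brak[of m "k - m" "x m" "x (k - m)" v w] L_comp[OF x] by (simp add: Suc_le_eq)
      qed
      finally show "sy k (graded_square G N x k) v w = (if even k then ?t (k div 2) (k div 2) else 0) +
        (\<Sum>m\<in>?A k. ?t m (k - m) + ?t (k - m) m)" .
    qed
    also have "\<dots> = (\<Sum>m=1..B. \<Sum>n=1..B. ?t m n)"
    proof (rule sum_symmetric_pairs[of B ?t])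
      fix m n assume "B < m \<or> B < n"
      then show "?t m n = 0"
        using B sy_one[of m] sy_one[of n] by (cases m; cases n) (auto simp: sy_zero)
    qed
    also have "\<dots> = Phi x (Phi x v) w"
      using v Phi_tens[OF x v] B by (simp add: Phi_eq[OF x B] Psum_comp[OF x x])
    finally show ?thesis .
  qed
  then show "Phi (graded_square G N x) = endo_pmap (Phi x)"
    by (auto intro!: extensionalityI[OF Phi_ext] simp: endo_pmap_def card_bit numeral_2_eq_2)
qed

text \<open>On the part of \<open>v\<close> of weight \<open>wt w + n\<close> only the term of
  degree \<open>n\<close> can contribute at \<open>w\<close>. So the endomorphism determines every
  homogeneous component, and the kernel of \<open>Phi\<close> can be tested degree by
  degree.\<close>

lemma Phi_component:
  assumes x: "x \<in> carrier L" and v: "v \<in> tens" and n: "1 \<le> n"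
  shows "Phi x (proj (wt w + n) v) w = sy n (x n) v w"
proof -
  obtain B where B: "\<And>n. B < n \<Longrightarrow> x n = N (Suc n)"
    using bound[OF x x] by blast
  let ?C = "max n B" and ?p = "proj (wt w + n) v"
  have "Phi x ?p w = (\<Sum>m=1..?C. sy m (x m) ?p w)"
    using Phi_eq[OF x, of ?C ?p] B proj_tens[OF v] by (simp add: Psum_def)
  also have "\<dots> = (\<Sum>m\<in>{n}. sy m (x m) ?p w)"
    by (rule sum.mono_neutral_right) (use n in \<open>auto simp: sy_other_degree\<close>)
  finally show ?thesis
    using sy_homogeneous by simp
qed

lemma Phi_eq_zero_iff:
  assumes x: "x \<in> carrier L"
  shows "Phi x = endo_zero \<longleftrightarrow> (\<forall>n\<ge>1. \<forall>g\<in>N n. x n = cl n g \<longrightarrow> g \<in> F (Suc n))"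
proof -
  have 1: "(\<forall>v\<in>tens. sy n (x n) v = 0) \<longleftrightarrow> (\<forall>g\<in>N n. x n = cl n g \<longrightarrow> g \<in> F (Suc n))" if n: "1 \<le> n" for n
  proof -
    obtain h where h: "h \<in> N n" "x n = cl n h"
      using L_comp[OF x n] by (auto elim!: layerE)
    have "(\<forall>v\<in>tens. sy n (x n) v = 0) \<longleftrightarrow> g \<in> F (Suc n)" if g: "g \<in> N n" "x n = cl n g" for g
    proof -
      have "(\<forall>v\<in>tens. symb n (delta g) v = 0) \<longleftrightarrow> (\<forall>v. symb n (delta g) v = 0)"
        using symb_delta_tens[of g n] length_fun g N_carrier by blast
      then show ?thesis
        using symb_eq_0_iff[of g n] N_F n g by (auto simp: sy_cl)
    qed
    then show ?thesis
      using h by blast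
  qed
  have 2: "Phi x = endo_zero \<longleftrightarrow> (\<forall>n\<ge>1. \<forall>v\<in>tens. sy n (x n) v = 0)"
  proof
    assume "Phi x = endo_zero"
    then show "\<forall>n\<ge>1. \<forall>v\<in>tens. sy n (x n) v = 0"
      using Phi_component[OF x] proj_tens by (auto simp: fun_eq_iff endo_zero_def)
  next
    assume 0: "\<forall>n\<ge>1. \<forall>v\<in>tens. sy n (x n) v = 0"
    show "Phi x = endo_zero"
    proof (rule extensionalityI[OF Phi_ext])
      fix v assume "v \<in> (tens :: vec set)"
      then show "Phi x v = endo_zero v"
        using 0 by (auto simp: Phi_def endo_zero_def intro!: sum.neutral)
    qed (simp add: endo_zero_def)
  qed
  show ?thesis
    unfolding 2 using 1 by blast
qed

end

section \<open>The Grigorchuk group\<close>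

fun pr :: "(bit list \<Rightarrow> bit list) \<Rightarrow> (bit list \<Rightarrow> bit list) \<Rightarrow> bit list \<Rightarrow> bit list"
  where
    "pr g h [] = []"
  | "pr g h (i # w) = (if i = 0 then 0 # g w else 1 # h w)"

lemma grig_pr: "grig_b = pr grig_a grig_c" "grig_c = pr grig_a grig_d" "grig_d = pr (\<lambda>w. w) grig_b"
proof -
  show "grig_b = pr grig_a grig_c"
  proof
    fix w show "grig_b w = pr grig_a grig_c w" by (cases w) auto
  qed
  show "grig_c = pr grig_a grig_d"
  proof
    fix w show "grig_c w = pr grig_a grig_d w" by (cases w) auto
  qed
  show "grig_d = pr (\<lambda>w. w) grig_b"
  proof
    fix w show "grig_d w = pr (\<lambda>w. w) grig_b w" by (cases w) auto
  qed
qed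

lemma grig_a_involution: "grig_a (grig_a w) = w"
  by (cases w) (auto simp: add.assoc)

lemma grig_bcd_involution: "grig_b (grig_b w) = w" "grig_c (grig_c w) = w" "grig_d (grig_d w) = w"
  by (induction w) (auto simp: grig_a_involution)

lemma grig_a_length: "length (grig_a w) = length w"
  by (cases w) auto

lemma grig_bcd_length: "length (grig_b w) = length w" "length (grig_c w) = length w" "length (grig_d w) = length w"
  by (induction w) (auto simp: grig_a_length)

lemma coef_of_val: "coef_of (val v) w = (if set w \<subseteq> {..<2} then v w else 0)"
proof (induction w arbitrary: v)
  case (Cons j w)
  consider "j = 0" | "j = 1" | "j \<noteq> 0" "j \<noteq> 1" by blast
  then show ?case
  proof cases
    case 1
    then show ?thesis by (simp add: Cons.IH)
  next
    case 2
    have "(\<lambda>u. val v (0 # u)) + (\<lambda>u. val v (1 # u)) = val (\<lambda>w. v (1 # w))"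
      by (auto simp: val_add fun_eq_iff)
    then show ?thesis using 2 by (simp add: Cons.IH)
  next
    case 3
    then show ?thesis by auto
  qed
qed simp

abbreviation sl :: "vec \<Rightarrow> nat \<Rightarrow> vec"
  where "sl v j \<equiv> (\<lambda>w. v (j # w))"

lemma delta_Nil: "g [] = [] \<Longrightarrow> delta g v [] = 0"
  by (simp add: delta_def)

lemma delta_other: "1 < j \<Longrightarrow> delta g v (j # w) = 0"
  by (simp add: delta_def)

text \<open>A vector is the function \<open>v\<^sub>0 + x v\<^sub>1\<close> of the first letter
  \<open>x\<close>, with value \<open>v\<^sub>0\<close> at 0 and
  \<open>v\<^sub>0 + v\<^sub>1\<close> at 1. The pair acts by \<open>g\<close> on the first and by
  \<open>h\<close> on the second; the coefficient of \<open>x\<close> is the sum of the two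
  results.\<close>

lemma delta_pr:
  "delta (pr g h) v [] = 0"
  "delta (pr g h) v (0 # w) = delta g (sl v 0) w"
  "delta (pr g h) v (1 # w) = delta g (sl v 0) w + delta h (sl v 0 + sl v 1) w"
proof -
  let ?F = "(\<lambda>x. val v (pr g h x)) + val v"
  have 0: "(\<lambda>u. ?F (0 # u)) = (\<lambda>u. val (sl v 0) (g u)) + val (sl v 0)"
    and 1: "(\<lambda>u. ?F (1 # u)) = (\<lambda>u. val (sl v 0 + sl v 1) (h u)) + val (sl v 0 + sl v 1)"
    by auto
  show "delta (pr g h) v [] = 0" by (simp add: delta_Nil)
  show "delta (pr g h) v (0 # w) = delta g (sl v 0) w"
    unfolding delta_def by (simp only: coef_of.simps 0) simp
  show "delta (pr g h) v (1 # w) = delta g (sl v 0) w + delta h (sl v 0 + sl v 1) w"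
  proof -
    have "delta (pr g h) v (1 # w) = coef_of (((\<lambda>u. val (sl v 0) (g u)) + val (sl v 0)) +
        ((\<lambda>u. val (sl v 0 + sl v 1) (h u)) + val (sl v 0 + sl v 1))) w"
      unfolding delta_def coef_of.simps 0 1 by simp
    then show ?thesis
      unfolding delta_def by (simp only: coef_of_add[of "_ + _" "_ + _"] plus_fun_apply)
  qed
qed

lemma delta_grig_a:
  "delta grig_a v [] = 0"
  "delta grig_a v (0 # w) = (if set w \<subseteq> {..<2} then v (1 # w) else 0)"
  "delta grig_a v (1 # w) = 0"
proof -
  let ?F = "(\<lambda>x. val v (grig_a x)) + val v"
  have 0: "(\<lambda>u. ?F (0 # u)) = val (sl v 1)" and 1: "(\<lambda>u. ?F (1 # u)) = val (sl v 1)"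
    by (auto simp: val_add fun_eq_iff add.assoc add.commute add.left_commute)
  show "delta grig_a v [] = 0" by (simp add: delta_Nil)
  show "delta grig_a v (0 # w) = (if set w \<subseteq> {..<2} then v (1 # w) else 0)"
    unfolding delta_def by (simp only: coef_of.simps 0 coef_of_val) simp
  show "delta grig_a v (1 # w) = 0"
    unfolding delta_def by (simp only: coef_of.simps 0 1 vec_add_self coef_of_zero) simp
qed

text \<open>\<open>filt 1\<close> localised at one output word. The generators are mutually
  recursive, and this form allows induction on the word.\<close>

definition lowers :: "(bit list \<Rightarrow> bit list) \<Rightarrow> nat list \<Rightarrow> bool"
  where "lowers g w \<longleftrightarrow> (\<forall>v t. v \<in> fil t \<longrightarrow> delta g v w \<noteq> 0 \<longrightarrow> Suc (wt w) < t)"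

lemma filt_1_iff: "filt 1 (delta g) \<longleftrightarrow> (\<forall>w. lowers g w)"
  unfolding filt_def lowers_def fil_def by (auto simp: less_diff_conv)

lemma sl_fil:
  assumes "v \<in> fil t"
  shows "sl v 0 \<in> fil ((t + 1) div 2)" "sl v 1 \<in> fil ((t + 1) div 2)"
proof -
  have "wt (j # w) < t" if "v (j # w) \<noteq> 0" for j w
    using assms that by (auto simp: fil_def simp del: wt.simps)
  from this[of 0] this[of 1] show "sl v 0 \<in> fil ((t + 1) div 2)" "sl v 1 \<in> fil ((t + 1) div 2)"
    unfolding fil_def by force+
qed

lemma lowers_pr:
  assumes "lowers g w" "lowers h w"
  shows "lowers (pr g h) (j # w)"
  unfolding lowers_def
proof (intro allI impI)
  fix v t assume v: "v \<in> fil t" and 0: "delta (pr g h) v (j # w) \<noteq> 0"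
  have j: "j = 0 \<or> j = 1"
    using 0 delta_other[of j] by (metis One_nat_def less_one linorder_neqE_nat)
  have "delta g (sl v 0) w \<noteq> 0 \<or> delta h (sl v 0 + sl v 1) w \<noteq> 0"
    using 0 j by (auto simp: delta_pr simp del: One_nat_def)
  \<comment> \<open>Slices of \<open>fil t\<close> lie in \<open>fil ((t + 1) div 2)\<close>.
    Lowering by 1 in a slice is lowering by 2 here, and a letter 1 in front gives back only
    1.\<close>
  then have "Suc (wt w) < (t + 1) div 2"
    using assms sl_fil[OF v] fil_add[OF sl_fil[OF v]] unfolding lowers_def by blast
  then show "Suc (wt (j # w)) < t"
    using j by auto
qed

lemma lowers_id: "lowers (\<lambda>w. w) w"
  by (simp add: lowers_def)

lemma lowers_grig_a: "lowers grig_a w"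
  unfolding lowers_def
proof (intro allI impI)
  fix v t assume v: "v \<in> fil t" and 0: "delta grig_a v w \<noteq> 0"
  obtain j u where w: "w = j # u"
    using 0 by (cases w) (auto simp: delta_grig_a)
  have j: "j = 0"
    using 0 delta_other[of j] unfolding w
    by (metis One_nat_def delta_grig_a(3) less_one linorder_neqE_nat)
  have "v (1 # u) \<noteq> 0"
    using 0 unfolding w j delta_grig_a by (auto split: if_splits)
  then have "wt (1 # u) < t"
    using v unfolding fil_def by blast
  then show "Suc (wt w) < t"
    by (simp add: w j)
qed

lemma lowers_Nil: "g [] = [] \<Longrightarrow> lowers g []"
  by (simp add: lowers_def delta_Nil)

lemma lowers_grig_bcd: "lowers grig_b w \<and> lowers grig_c w \<and> lowers grig_d w"
proof (induction w)
  case Nil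
  then show ?case by (simp add: lowers_Nil)
next
  case (Cons j w)
  then show ?case
    by (metis grig_pr lowers_pr lowers_grig_a lowers_id)
qed

lemma grig_gens_Bij: "grig_gens \<subseteq> Bij UNIV"
proof -
  have "bij grig_a" "bij grig_b" "bij grig_c" "bij grig_d"
    by (rule involuntory_imp_bij, rule grig_a_involution grig_bcd_involution)+
  then show ?thesis
    by (auto simp: grig_gens_def Bij_def)
qed

lemma Bij_mult: "f \<in> Bij UNIV \<Longrightarrow> g \<in> Bij UNIV \<Longrightarrow> f \<otimes>\<^bsub>BijGroup UNIV\<^esub> g = f \<circ> g"
  by (auto simp: BijGroup_def compose_def)

interpretation BG: group "BijGroup (UNIV :: bit list set)"
  by (rule group_BijGroup)

lemma grig_gens_carrier: "grig_gens \<subseteq> carrier (BijGroup UNIV)"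
  using grig_gens_Bij by (simp add: BijGroup_def)

lemma gen_involution:
  assumes "s \<in> grig_gens"
  shows "s \<otimes>\<^bsub>BijGroup UNIV\<^esub> s = \<one>\<^bsub>BijGroup UNIV\<^esub>"
proof -
  have "s \<in> Bij UNIV" using assms grig_gens_Bij by blast
  moreover have "s \<circ> s = (\<lambda>x. x)"
    using assms by (auto simp: grig_gens_def fun_eq_iff grig_a_involution grig_bcd_involution)
  ultimately show ?thesis
    by (simp add: Bij_mult) (simp add: BijGroup_def fun_eq_iff)
qed

lemma subgroup_grig: "subgroup (generate (BijGroup UNIV) grig_gens) (BijGroup UNIV)"
  by (rule BG.generate_is_subgroup[OF grig_gens_carrier])

lemma Grigorchuk_carrier: "carrier Grigorchuk = generate (BijGroup UNIV) grig_gens"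
  by (simp add: Grigorchuk_def)

lemma Grigorchuk_Bij: "g \<in> carrier Grigorchuk \<Longrightarrow> g \<in> Bij UNIV"
proof -
  assume "g \<in> carrier Grigorchuk"
  then have "g \<in> carrier (BijGroup UNIV)"
    unfolding Grigorchuk_carrier by (rule subgroup.mem_carrier[OF subgroup_grig])
  then show ?thesis
    by (simp add: BijGroup_def)
qed

lemma Grigorchuk_group: "Group.group Grigorchuk"
  unfolding Grigorchuk_def by (rule BG.subgroup_imp_group[OF subgroup_grig])

lemma Grigorchuk_generate: "carrier Grigorchuk = generate Grigorchuk grig_gens"
  unfolding Grigorchuk_carrier unfolding Grigorchuk_def
  by (rule BG.generate_consistent[symmetric, OF _ subgroup_grig]) (auto intro: generate.incl)

lemma Grigorchuk_good:
  assumes "g \<in> carrier Grigorchuk"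
  shows "(\<forall>x. length (g x) = length x) \<and> filt 1 (delta g)"
  using assms unfolding Grigorchuk_carrier
proof (induction rule: generate.induct)
  case one
  have 1: "\<one>\<^bsub>BijGroup UNIV\<^esub> = (\<lambda>x. x)"
    by (simp add: BijGroup_def fun_eq_iff)
  have "filt 1 (\<lambda>v. 0)" by (auto simp: filt_def fil_zero)
  then show ?case unfolding 1 delta_id by blast
next
  case (incl s)
  then show ?case
    by (auto simp: grig_gens_def grig_a_length grig_bcd_length filt_1_iff lowers_grig_a lowers_grig_bcd
      simp del: One_nat_def)
next
  case (inv s)
  have "s \<in> carrier (BijGroup UNIV)" using inv grig_gens_carrier by blast
  then have "inv\<^bsub>BijGroup UNIV\<^esub> s = s"
    using BG.inv_equality[OF gen_involution[OF inv]] by blast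
  then show ?case
    using inv by (auto simp: grig_gens_def grig_a_length grig_bcd_length filt_1_iff lowers_grig_a lowers_grig_bcd
      simp del: One_nat_def)
next
  case (eng g h)
  have gh: "g \<in> Bij UNIV" "h \<in> Bij UNIV"
    using eng Grigorchuk_Bij by (auto simp: Grigorchuk_carrier)
  have "filt 1 (\<lambda>v. delta h (delta g v) + delta g v + delta h v)"
    using eng by (intro filt_add filt_mono[OF filt_comp[of 1 "delta h" 1 "delta g"]]) auto
  note f1 = this
  have eq: "delta (g \<circ> h) = (\<lambda>v. delta h (delta g v) + delta g v + delta h v)"
    by (rule ext, rule delta_comp)
  have "\<forall>x. length ((g \<circ> h) x) = length x"
    using eng by simp
  then show ?case
    unfolding Bij_mult[OF gh] using f1[folded eq] by blast
qed

interpretation grig: word_group Grigorchuk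
proof (intro word_group.intro word_group_axioms.intro Grigorchuk_group)
  show "g \<otimes>\<^bsub>Grigorchuk\<^esub> h = g \<circ> h" if "g \<in> carrier Grigorchuk" "h \<in> carrier Grigorchuk" for g h
    using Bij_mult[OF that[THEN Grigorchuk_Bij]] by (simp add: Grigorchuk_def)
  show "\<one>\<^bsub>Grigorchuk\<^esub> = (\<lambda>x. x)"
    by (simp add: Grigorchuk_def BijGroup_def fun_eq_iff)
qed (use Grigorchuk_good in blast)+

section \<open>The self-similar Lie algebras\<close>

lemma alph_mult_simps:
  "alph_mult 0 (f :: bit poly) = 0"
  "alph_mult (monom 1 1) (monom 1 0 :: bit poly) = monom 1 1"
  "alph_mult (monom 1 1) (monom 1 1 :: bit poly) = 0"
proof -
  show "alph_mult 0 (f :: bit poly) = 0" by (simp add: alph_mult_def)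
  have "degree (monom 1 1 :: bit poly) < degree (monom 1 2 :: bit poly)"
    by (simp add: degree_monom_eq)
  then show "alph_mult (monom 1 1) (monom 1 0 :: bit poly) = monom 1 1"
    by (simp add: alph_mult_def card_bit mult_monom mod_poly_less)
  show "alph_mult (monom 1 1) (monom 1 1 :: bit poly) = 0"
    by (simp add: alph_mult_def card_bit mult_monom numeral_2_eq_2)
qed

lemma gens_grig_data: "gens grig_data = {Ga, Gb, Gc, Gd}"
  by (simp add: grig_data_def)

lemma act_step:
  "act grig_data s v (j # w) =
    (\<Sum>t\<in>{Ga, Gb, Gc, Gd}. coeff (alph_mult (grig_coef s t) (monom 1 0)) j * act grig_data t (sl v 0) w)
    + coeff (if s = Ga then pderiv (monom 1 0) else 0) j * v (0 # w) +
    ((\<Sum>t\<in>{Ga, Gb, Gc, Gd}. coeff (alph_mult (grig_coef s t) (monom 1 1)) j * act grig_data t (sl v 1) w)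
    + coeff (if s = Ga then pderiv (monom 1 1) else 0) j * v (1 # w))"
proof -
  have "{..<CARD(bit)} = {0, 1}"
    unfolding card_bit by auto
  then show ?thesis
    by (simp add: gens_grig_data) (simp add: grig_data_def)
qed

lemma act_letters:
  "act grig_data Ga v (j # w) = (if j = 0 then v (1 # w) else 0)"
  "act grig_data Gb v (j # w) = (if j = 1 then act grig_data Ga (sl v 0) w + act grig_data Gc (sl v 0) w else 0)"
  "act grig_data Gc v (j # w) = (if j = 1 then act grig_data Ga (sl v 0) w + act grig_data Gd (sl v 0) w else 0)"
  "act grig_data Gd v (j # w) = (if j = 1 then act grig_data Gb (sl v 0) w else 0)"
  unfolding act_step by (simp_all add: alph_mult_simps[unfolded One_nat_def] alph_mult_simps(2)[simplified] pderiv_monom coeff_monom)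

fun letter_fun :: "letter \<Rightarrow> bit list \<Rightarrow> bit list"
  where
    "letter_fun Ga = grig_a"
  | "letter_fun Gb = grig_b"
  | "letter_fun Gc = grig_c"
  | "letter_fun Gd = grig_d"

declare act.simps(2) [simp del]

lemma odd_neq_even: "Suc (2 * a) \<noteq> 2 * b" "2 * b \<noteq> Suc (2 * a)"
  by presburger+

lemma proj_sl:
  "sl (proj (2 * t) v) 0 = proj t (sl v 0)" "sl (proj (2 * t) v) 1 = 0"
  "sl (proj (Suc (2 * t)) v) 0 = 0" "sl (proj (Suc (2 * t)) v) 1 = proj t (sl v 1)"
  by (auto simp: proj_def fun_eq_iff odd_neq_even)

lemma sl_tens: "v \<in> tens \<Longrightarrow> sl v j \<in> tens"
proof -
  assume "v \<in> tens"
  then obtain n where n: "\<forall>w. v w \<noteq> (0::bit) \<longrightarrow> length w \<le> n \<and> set w \<subseteq> {..<2}"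
    unfolding tens_iff by blast
  have "\<forall>w. sl v j w \<noteq> 0 \<longrightarrow> length w \<le> n \<and> set w \<subseteq> {..<2}"
    using n by (metis insert_subset length_Cons list.simps(15) Suc_leD)
  then show ?thesis unfolding tens_iff by blast
qed

lemma delta_zero: "delta g 0 = 0"
  by (rule additive_op_0[OF delta_additive])

lemma symb_id: "symb r (delta (\<lambda>x. x)) v = 0"
  by (simp add: symb_def fun_eq_iff)

text \<open>Words beginning with 0 have even weight and words beginning with 1 odd weight. Degree 1
  changes the parity, so of the terms in \<open>delta_pr\<close> only those leading from slice 0 to
  slice 1 survive, which is multiplication by \<open>x\<close>.\<close>

lemma symb_pr:
  "symb 1 (delta (pr g h)) v (0 # w) = 0"
  "symb 1 (delta (pr g h)) v (1 # w) = symb 1 (delta g) (sl v 0) w + symb 1 (delta h) (sl v 0) w"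
proof -
  have 0: "wt (0 # w) + 1 = Suc (2 * wt w)" and 1: "wt (1 # w) + 1 = 2 * (wt w + 1)" by simp_all
  show "symb 1 (delta (pr g h)) v (0 # w) = 0"
    unfolding symb_def 0 delta_pr proj_sl delta_zero by simp
  show "symb 1 (delta (pr g h)) v (1 # w) = symb 1 (delta g) (sl v 0) w + symb 1 (delta h) (sl v 0) w"
    unfolding symb_def 1 delta_pr proj_sl by simp
qed

text \<open>The bridge between group and algebra: by \<open>symb_pr\<close> the degree 1 symbols of
  \<open>b\<close>, \<open>c\<close>, \<open>d\<close> satisfy the recursion that defines
  \<open>act\<close>. The restriction to \<open>tens\<close> enters through \<open>Ga\<close>, where
  \<open>act\<close> does not test the remaining letters whereas \<open>delta grig_a\<close> returns
  0 unless they are binary.\<close>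

lemma symb_letter:
  "v \<in> tens \<Longrightarrow> symb 1 (delta (letter_fun s)) v w = act grig_data s v w"
proof (induction w arbitrary: s v)
  case Nil
  have "letter_fun s [] = []" by (cases s) auto
  then show ?case
    by (simp add: symb_def delta_Nil)
next
  case (Cons j w)
  have sl: "sl v 0 \<in> tens" by (rule sl_tens[OF Cons.prems])
  consider "j = 0" | "j = 1" | "1 < j" by linarith
  then show ?case
  proof cases
    case 1
    have a: "symb 1 (delta grig_a) v (0 # w) = v (1 # w)"
    proof (cases "set w \<subseteq> {..<2}")
      case True
      then show ?thesis
        unfolding symb_def delta_grig_a by (simp add: proj_def)
    next
      case False
      then have "v (1 # w) = 0"
        using Cons.prems unfolding tens_iff by (metis set_subset_Cons subset_trans)
      then show ?thesis
        unfolding symb_def delta_grig_a by (simp add: proj_def)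
    qed
    show ?thesis
      using a 1 by (cases s) (simp_all add: act_letters grig_pr(1,2) symb_pr del: One_nat_def, subst grig_pr(3), simp add: symb_pr del: One_nat_def)
  next
    case 2
    have d: "symb 1 (delta grig_d) v (1 # w) = symb 1 (delta grig_b) (sl v 0) w"
      by (subst grig_pr(3)) (simp only: symb_pr symb_id zero_fun_apply add_0)
    have b: "symb 1 (delta grig_b) v (1 # w) = symb 1 (delta grig_a) (sl v 0) w + symb 1 (delta grig_c) (sl v 0) w"
      by (subst grig_pr(1)) (rule symb_pr)
    have c: "symb 1 (delta grig_c) v (1 # w) = symb 1 (delta grig_a) (sl v 0) w + symb 1 (delta grig_d) (sl v 0) w"
      by (subst grig_pr(2)) (rule symb_pr)
    have a: "symb 1 (delta grig_a) v (1 # w) = 0"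
      by (simp add: symb_def delta_grig_a del: One_nat_def)
    show ?thesis
      using a b c d Cons.IH[OF sl, of Ga] Cons.IH[OF sl, of Gb] Cons.IH[OF sl, of Gc] Cons.IH[OF sl, of Gd] 2
      by (cases s) (simp_all add: act_letters)
  next
    case 3
    then show ?thesis
      by (cases s) (simp_all add: act_letters symb_def delta_other)
  qed
qed

subsection \<open>The Lie algebra of the self-similar group\<close>

lemma bit_lessThan_CARD: "{..<CARD(bit)} = {0, 1}"
  unfolding card_bit by auto

lemma grig_distinct:
  "grig_a \<noteq> (\<lambda>w. w)" "grig_b \<noteq> (\<lambda>w. w)" "grig_c \<noteq> (\<lambda>w. w)" "grig_d \<noteq> (\<lambda>w. w)"
  "grig_a \<noteq> grig_b" "grig_a \<noteq> grig_c" "grig_a \<noteq> grig_d"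
  "grig_b \<noteq> grig_c" "grig_b \<noteq> grig_d" "grig_c \<noteq> grig_d"
proof -
  have 1: "grig_a [0] = [1]" "grig_b [0] = [0]" "grig_c [0] = [0]" "grig_d [0] = [0]"
    by simp_all
  have 2: "grig_b [0, 0] = [0, 1]" "grig_c [0, 0] = [0, 1]" "grig_d [0, 0] = [0, 0]"
    "grig_b [1, 0, 0] = [1, 0, 1]" "grig_c [1, 0, 0] = [1, 0, 0]" "grig_d [1, 0, 0] = [1, 0, 1]"
    by simp_all
  show "grig_a \<noteq> (\<lambda>w. w)" "grig_b \<noteq> (\<lambda>w. w)" "grig_c \<noteq> (\<lambda>w. w)" "grig_d \<noteq> (\<lambda>w. w)"
    using 1 2 by (metis list.inject bit.distinct(1))+
  show "grig_a \<noteq> grig_b" "grig_a \<noteq> grig_c" "grig_a \<noteq> grig_d"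
    using 1 by (metis list.inject bit.distinct(1))+
  show "grig_b \<noteq> grig_c" "grig_b \<noteq> grig_d" "grig_c \<noteq> grig_d"
    using 2 by (metis list.inject bit.distinct(1))+
qed

text \<open>Only the powers 0 and 1 compete. The identity is the zeroth power and contributes 0; if
  \<open>s\<close> were the identity, \<open>LEAST\<close> would return 0 also for
  \<open>h = s\<close>.\<close>

lemma exponent_of_bit:
  "s \<noteq> (\<lambda>w. w) \<Longrightarrow> exponent_of s h = (if h = s then 1 else (0::bit))"
proof -
  assume s: "s \<noteq> (\<lambda>w. w)"
  have ex: "(\<exists>n<CARD(bit). h = s ^^ n) \<longleftrightarrow> h = id \<or> h = s"
    unfolding card_bit by (auto simp: numeral_2_eq_2 less_Suc_eq)
  show ?thesis
  proof (cases "h = s")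
    case True
    have "(LEAST n. h = s ^^ n) = 1"
    proof (rule Least_equality)
      fix n assume "h = s ^^ n"
      then show "1 \<le> n"
        using True s by (cases n) (auto simp: id_def)
    qed (simp add: True)
    then show ?thesis
      using ex True by (simp add: exponent_of_def)
  next
    case False
    show ?thesis
    proof (cases "h = id")
      case True
      have "(LEAST n. h = s ^^ n) = 0"
        by (rule Least_equality) (simp_all add: True)
      then show ?thesis
        using ex True False by (simp add: exponent_of_def)
    next
      case ne: False
      then have "\<not> (\<exists>n<CARD(bit). h = s ^^ n)"
        using ex False by blast
      then show ?thesis
        unfolding exponent_of_def using False by (simp only: if_False)
    qed
  qed
qed

lemma section_poly_bit:
  "section_poly s' s = smult (exponent_of s (section_at s' 0)) (monom 1 1 + 1) +
    smult (exponent_of s (section_at s' 1)) (monom 1 1 :: bit poly)"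
  unfolding section_poly_def bit_lessThan_CARD by (simp add: card_bit)

lemma sections:
  "section_at grig_a i = (\<lambda>w. w)"
  "section_at grig_b 0 = grig_a" "section_at grig_b 1 = grig_c"
  "section_at grig_c 0 = grig_a" "section_at grig_c 1 = grig_d"
  "section_at grig_d 0 = (\<lambda>w. w)" "section_at grig_d 1 = grig_b"
  by (simp_all add: section_at_def)

text \<open>For \<open>p = 2\<close> a section at 0 enters with \<open>x + 1\<close> and a section
  at 1 with \<open>x\<close>, and both have leading monomial \<open>x\<close>. No generator has the
  same letter as both of its sections, so nothing cancels in \<open>section_poly\<close>.\<close>

lemma leading_monomials:
  "leading_monomial (0 :: bit poly) = 0"
  "leading_monomial (monom 1 (Suc 0) :: bit poly) = monom 1 1"
  "leading_monomial (monom 1 (Suc 0) + 1 :: bit poly) = monom 1 1"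
proof -
  show "leading_monomial (0 :: bit poly) = 0"
    by (simp add: leading_monomial_def)
  show "leading_monomial (monom 1 (Suc 0) :: bit poly) = monom 1 1"
    by (simp add: leading_monomial_def degree_monom_eq)
  have d: "degree (monom 1 (Suc 0) + 1 :: bit poly) = 1"
    by (subst degree_add_eq_left) (simp_all add: degree_monom_eq)
  show "leading_monomial (monom 1 (Suc 0) + 1 :: bit poly) = monom 1 1"
    unfolding leading_monomial_def d by simp
qed

lemma group_coef:
  "leading_monomial (section_poly (letter_fun s) (letter_fun t)) = grig_coef s t"
proof -
  note [simp] = sections exponent_of_bit grig_distinct grig_distinct[symmetric] leading_monomials
  show ?thesis
    by (cases s; cases t) (simp_all add: section_poly_bit)
qed

lemma letter_fun_image: "grig_gens = letter_fun ` {Ga, Gb, Gc, Gd}"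
  by (auto simp: grig_gens_def)

lemma letter_fun_inj: "inj_on letter_fun {Ga, Gb, Gc, Gd}"
  using grig_distinct by (auto simp: inj_on_def)

lemma letter_rotation: "rotation (letter_fun s) = (if s = Ga then 1 else 0)"
  by (cases s) (simp_all add: rotation_def)

lemma act_group: "act (group_self_similar grig_gens) (letter_fun s) v w = act grig_data s v w"
proof (induction w arbitrary: s v)
  case (Cons j w)
  have "act (group_self_similar grig_gens) (letter_fun s) v (j # w) = (\<Sum>i<CARD(bit).
        (\<Sum>t\<in>grig_gens. coeff (alph_mult (leading_monomial (section_poly (letter_fun s) t)) (monom 1 i)) j *
          act (group_self_similar grig_gens) t (sl v i) w)
        + coeff (smult (rotation (letter_fun s)) (pderiv (monom 1 i))) j * v (i # w))"
    by (simp add: act.simps(2) group_self_similar_def)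
  also have "\<dots> = (\<Sum>i<CARD(bit).
        (\<Sum>t\<in>{Ga, Gb, Gc, Gd}. coeff (alph_mult (grig_coef s t) (monom 1 i)) j * act grig_data t (sl v i) w)
        + coeff (if s = Ga then pderiv (monom 1 i) else 0) j * v (i # w))"
    unfolding letter_fun_image
    by (subst sum.reindex[OF letter_fun_inj])
      (simp only: o_def group_coef Cons.IH[unfolded letter_fun_image] letter_rotation, simp cong: if_cong)
  also have "\<dots> = act grig_data s v (j # w)"
    by (simp add: act.simps(2) grig_data_def)
  finally show ?case .
qed simp

lemma gen_endos_group: "gen_endos (group_self_similar grig_gens) = gen_endos grig_data"
proof -
  have "act (group_self_similar grig_gens) (letter_fun s) = act grig_data s" for s
    by (intro ext act_group)
  moreover have "gens (group_self_similar grig_gens) = letter_fun ` gens grig_data"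
    by (simp add: group_self_similar_def gens_grig_data letter_fun_image)
  ultimately show ?thesis
    unfolding gen_endos_def by (simp add: image_image)
qed

lemma lie_of_group_eq: "lie_of_group grig_gens = restricted_L_Grig"
  by (simp add: lie_of_group_def restricted_L_Grig_def self_similar_restricted_lie_def gen_endos_group)

section \<open>The structure of the Grigorchuk group\<close>

context group
begin

lemma normal_by_generators:
  assumes S: "S \<subseteq> carrier G" "carrier G = generate G S" and S_inv: "\<And>s. s \<in> S \<Longrightarrow> inv s \<in> S"
    and N: "subgroup N G" and conj: "\<And>s h. s \<in> S \<Longrightarrow> h \<in> N \<Longrightarrow> s \<otimes> h \<otimes> inv s \<in> N"
  shows "N \<lhd> G"
proof (rule normal_invI[OF N])
  fix x h assume "x \<in> carrier G" and h: "h \<in> N"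
  then have "x \<in> generate G S" using S by simp
  then show "x \<otimes> h \<otimes> inv x \<in> N"
    using h
  proof (induction arbitrary: h rule: generate.induct)
    case one
    then show ?case using subgroup.mem_carrier[OF N] by simp
  next
    case (incl s)
    then show ?case by (rule conj)
  next
    case (inv s)
    then show ?case by (intro conj S_inv)
  next
    case (eng x y)
    have "x \<in> carrier G" "y \<in> carrier G" "h \<in> carrier G"
      using eng S subgroup.mem_carrier[OF N] by auto
    then have "(x \<otimes> y) \<otimes> h \<otimes> inv (x \<otimes> y) = x \<otimes> (y \<otimes> h \<otimes> inv y) \<otimes> inv x"
      by (simp add: word_simps)
    then show ?case using eng by simp
  qed
qed

lemma cm_mult_right:
  "x \<in> carrier G \<Longrightarrow> y \<in> carrier G \<Longrightarrow> z \<in> carrier G \<Longrightarrow>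
    cm x (y \<otimes> z) = cm x y \<otimes> (y \<otimes> cm x z \<otimes> inv y)"
  by (simp add: word_simps)

lemma cm_inv_right:
  "x \<in> carrier G \<Longrightarrow> z \<in> carrier G \<Longrightarrow> cm x (inv z) = inv z \<otimes> inv (cm x z) \<otimes> inv (inv z)"
  by (simp add: word_simps)

lemma centralizer_subgroup:
  assumes N: "N \<lhd> G" and s: "s \<in> carrier G"
  shows "subgroup {g \<in> carrier G. cm s g \<in> N} G"
proof
  fix x assume "x \<in> {g \<in> carrier G. cm s g \<in> N}"
  then have x: "x \<in> carrier G" "cm s x \<in> N" by auto
  have "cm s (inv x) \<in> N"
    unfolding cm_inv_right[OF s x(1)] using x by (intro normal_conj[OF N] normal_inv[OF N]) auto
  then show "inv x \<in> {g \<in> carrier G. cm s g \<in> N}" using x by simp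
next
  fix x y assume "x \<in> {g \<in> carrier G. cm s g \<in> N}" "y \<in> {g \<in> carrier G. cm s g \<in> N}"
  then have xy: "x \<in> carrier G" "cm s x \<in> N" "y \<in> carrier G" "cm s y \<in> N" by auto
  have "cm s (x \<otimes> y) \<in> N"
    unfolding cm_mult_right[OF s xy(1,3)] using xy by (intro normal_mult[OF N] normal_conj[OF N]) auto
  then show "x \<otimes> y \<in> {g \<in> carrier G. cm s g \<in> N}" using xy by simp
qed (use s normal_one[OF N] in auto)

text \<open>\<open>u\<close> has trivial square and is central modulo \<open>K\<close>, so adjoining
  it adds at most one coset. Describing the result by its two cosets turns every later inclusion
  into it into a case distinction.\<close>

lemma extend_normal:
  assumes S: "S \<subseteq> carrier G" "carrier G = generate G S" and S_inv: "\<And>s. s \<in> S \<Longrightarrow> inv s \<in> S"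
    and K: "K \<lhd> G" and u: "u \<in> carrier G" "u \<otimes> u \<in> K" and cm: "\<And>s. s \<in> S \<Longrightarrow> cm s u \<in> K"
  shows "{g \<in> carrier G. g \<in> K \<or> u \<otimes> g \<in> K} \<lhd> G" (is "?Y \<lhd> G")
proof (rule normal_by_generators[OF S S_inv])
  have conj_u: "inv u \<otimes> k \<otimes> u \<in> K" if "k \<in> K" for k
    using normal_conj[OF K, of "inv u" k] that u by simp
  have uiK: "u \<otimes> inv x \<in> K" if x: "x \<in> carrier G" "u \<otimes> x \<in> K" for x
  proof -
    have "inv (inv u \<otimes> (u \<otimes> x) \<otimes> u) \<in> K"
      using x by (intro normal_inv[OF K] conj_u)
    then have "inv u \<otimes> inv x \<in> K" using x u by (simp add: word_simps)
    then have "(u \<otimes> u) \<otimes> (inv u \<otimes> inv x) \<in> K" by (rule normal_mult[OF K u(2)])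
    then show ?thesis using x u by (simp add: word_simps)
  qed
  show "subgroup ?Y G"
  proof
    fix x assume "x \<in> ?Y"
    then show "inv x \<in> ?Y" using normal_inv[OF K] uiK by auto
  next
    fix x y assume "x \<in> ?Y" "y \<in> ?Y"
    then have xy: "x \<in> carrier G" "y \<in> carrier G" "x \<in> K \<or> u \<otimes> x \<in> K" "y \<in> K \<or> u \<otimes> y \<in> K"
      by auto
    have 1: "x \<otimes> y \<in> K" if "x \<in> K" "y \<in> K" using that by (rule normal_mult[OF K])
    have 2: "u \<otimes> (x \<otimes> y) \<in> K" if "x \<in> K" "u \<otimes> y \<in> K"
    proof -
      have "(u \<otimes> x \<otimes> inv u) \<otimes> (u \<otimes> y) \<in> K"
        by (rule normal_mult[OF K normal_conj[OF K u(1) that(1)] that(2)])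
      then show ?thesis using xy u by (simp add: m_assoc)
    qed
    have 3: "u \<otimes> (x \<otimes> y) \<in> K" if "u \<otimes> x \<in> K" "y \<in> K"
      using normal_mult[OF K that] xy u by (simp add: m_assoc)
    have 4: "x \<otimes> y \<in> K" if "u \<otimes> x \<in> K" "u \<otimes> y \<in> K"
    proof -
      have "u \<otimes> inv x \<in> K" using uiK that xy by blast
      then have "inv (u \<otimes> inv x) \<otimes> (u \<otimes> y) \<in> K"
        by (intro normal_mult[OF K _ that(2)] normal_inv[OF K])
      then show ?thesis using xy u by (simp add: word_simps)
    qed
    show "x \<otimes> y \<in> ?Y" using xy 1 2 3 4 by auto
  qed (use normal_one[OF K] in auto)
next
  fix s g assume s: "s \<in> S" and "g \<in> ?Y"
  then have g: "g \<in> carrier G" "g \<in> K \<or> u \<otimes> g \<in> K" and sc: "s \<in> carrier G" using S by auto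
  from g(2) show "s \<otimes> g \<otimes> inv s \<in> ?Y"
  proof
    assume "g \<in> K"
    then show ?thesis using normal_conj[OF K sc] sc g by simp
  next
    assume "u \<otimes> g \<in> K"
    then have "inv (cm s u) \<otimes> (s \<otimes> (u \<otimes> g) \<otimes> inv s) \<in> K"
      by (rule normal_mult[OF K normal_inv[OF K cm[OF s]] normal_conj[OF K sc]])
    also have "inv (cm s u) \<otimes> (s \<otimes> (u \<otimes> g) \<otimes> inv s) = u \<otimes> (s \<otimes> g \<otimes> inv s)"
      using sc u g by (simp add: word_simps)
    finally show ?thesis using sc g by simp
  qed
qed

lemma gcomm_carrier_leastI:
  assumes N: "N \<lhd> G" and S: "S \<subseteq> carrier G" "carrier G = generate G S"
    and cm: "\<And>s t. s \<in> S \<Longrightarrow> t \<in> S \<Longrightarrow> cm s t \<in> N"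
  shows "gcomm (carrier G) \<subseteq> N"
proof (rule gcomm_leastI[OF N S])
  fix s h assume s: "s \<in> S" and h: "h \<in> carrier G"
  have "csub (generate G S) S N"
    by (rule csub_generate[OF N S(1,1)]) (simp add: csub_def cm)
  then have "cm h s \<in> N" using h s S(2) by (simp add: csubD)
  then have "inv (cm h s) \<in> N" by (rule normal_inv[OF N])
  then show "cm s h \<in> N" using h s S by (simp add: inv_cm subset_iff)
qed simp

end

text \<open>The relations used below, separated from permutations so that words remain products in a
  group. \<open>pr g h\<close> stands for the element acting by \<open>g\<close> and
  \<open>h\<close> on the two subtrees; as a total function it may leave \<open>G\<close>, hence the
  recurring premises \<open>pr g h \<in> carrier G\<close>.\<close>

locale grig_group = group G for G (structure) +
  fixes pr :: "'a \<Rightarrow> 'a \<Rightarrow> 'a" and a b c d :: 'a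
  assumes abcd [simp]: "a \<in> carrier G" "b \<in> carrier G" "c \<in> carrier G" "d \<in> carrier G"
    and generated: "carrier G = generate G {a, b, c, d}"
    and squares: "a \<otimes> a = \<one>" "b \<otimes> b = \<one>" "c \<otimes> c = \<one>" "d \<otimes> d = \<one>"
    and bc: "b \<otimes> c = d"
    and pr_mult: "\<And>g h g' h'. \<lbrakk>g \<in> carrier G; h \<in> carrier G; g' \<in> carrier G; h' \<in> carrier G\<rbrakk> \<Longrightarrow>
      pr g h \<otimes> pr g' h' = pr (g \<otimes> g') (h \<otimes> h')"
    and pr_inv: "\<And>g h. \<lbrakk>g \<in> carrier G; h \<in> carrier G; pr g h \<in> carrier G\<rbrakk> \<Longrightarrow> inv (pr g h) = pr (inv g) (inv h)"
    and pr_one: "pr \<one> \<one> = \<one>"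
    and pr_inj: "\<And>g h g' h'. pr g h = pr g' h' \<longleftrightarrow> g = g' \<and> h = h'"
    and a_pr: "\<And>g h. \<lbrakk>g \<in> carrier G; h \<in> carrier G\<rbrakk> \<Longrightarrow> a \<otimes> pr g h \<otimes> a = pr h g"
    and b_pr: "b = pr a c" and c_pr: "c = pr a d" and d_pr: "d = pr \<one> b"
begin

section \<open>Pairs of sections and the subgroups they define\<close>

abbreviation "gs \<equiv> {a, b, c, d}"

lemma gs_carrier: "gs \<subseteq> carrier G"
  by simp

lemma inv_gen [simp]: "inv a = a" "inv b = b" "inv c = c" "inv d = d"
  using squares by (simp_all add: inv_equality)

lemma inv_gs: "s \<in> gs \<Longrightarrow> inv s \<in> gs"
  by auto

lemma gen_cancel:
  assumes "g \<in> carrier G"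
  shows "a \<otimes> (a \<otimes> g) = g" "b \<otimes> (b \<otimes> g) = g" "c \<otimes> (c \<otimes> g) = g" "d \<otimes> (d \<otimes> g) = g"
  using assms squares by (simp_all flip: m_assoc)

lemma bcd:
  "c \<otimes> b = d" "b \<otimes> d = c" "d \<otimes> b = c" "c \<otimes> d = b" "d \<otimes> c = b"
proof -
  have "inv (b \<otimes> c) = inv d" by (simp only: bc)
  then show 1: "c \<otimes> b = d" by (simp add: inv_mult_group)
  show "b \<otimes> d = c" by (simp add: gen_cancel flip: bc)
  show "c \<otimes> d = b" by (simp add: gen_cancel flip: 1)
  show "d \<otimes> b = c" by (simp add: m_assoc squares flip: 1)
  show "d \<otimes> c = b" by (simp add: m_assoc squares flip: bc)
qed

lemma bcd_cancel:
  assumes "g \<in> carrier G"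
  shows "b \<otimes> (c \<otimes> g) = d \<otimes> g" "c \<otimes> (b \<otimes> g) = d \<otimes> g" "b \<otimes> (d \<otimes> g) = c \<otimes> g"
    "d \<otimes> (b \<otimes> g) = c \<otimes> g" "c \<otimes> (d \<otimes> g) = b \<otimes> g" "d \<otimes> (c \<otimes> g) = b \<otimes> g"
  using assms by (simp_all add: bc bcd flip: m_assoc)

lemmas grig_simps = word_simps squares gen_cancel bc bcd bcd_cancel

text \<open>From index 3 on, all terms of both series turn out to have this shape. If
  \<open>B\<close> contains \<open>[G, A]\<close>, the condition on the product is symmetric in
  \<open>g\<close> and \<open>h\<close> and compatible with multiplication; for a subgroup
  \<open>A\<close>, the choice \<open>B = A\<close> imposes nothing, while smaller \<open>B\<close>
  still admit the antidiagonal pairs \<open>(g, g\<^sup>-\<^sup>1)\<close>.\<close>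

definition PP :: "'a set \<Rightarrow> 'a set \<Rightarrow> 'a set"
  where "PP A B = {x \<in> carrier G. \<exists>g\<in>A. \<exists>h\<in>A. x = pr g h \<and> g \<otimes> h \<in> B}"

lemma PP_I: "g \<in> A \<Longrightarrow> h \<in> A \<Longrightarrow> g \<otimes> h \<in> B \<Longrightarrow> pr g h \<in> carrier G \<Longrightarrow> pr g h \<in> PP A B"
  by (auto simp: PP_def)

lemma PP_E: "x \<in> PP A B \<Longrightarrow> (\<And>g h. x = pr g h \<Longrightarrow> g \<in> A \<Longrightarrow> h \<in> A \<Longrightarrow> g \<otimes> h \<in> B \<Longrightarrow> pr g h \<in> carrier G \<Longrightarrow> thesis) \<Longrightarrow> thesis"
  by (auto simp: PP_def)

lemma PP_carrier: "x \<in> PP A B \<Longrightarrow> x \<in> carrier G"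
  by (simp add: PP_def)

lemma PP_mono: "A \<subseteq> A' \<Longrightarrow> B \<subseteq> B' \<Longrightarrow> PP A B \<subseteq> PP A' B'"
  by (auto simp: PP_def)

lemma pr_conj:
  assumes "s \<in> carrier G" "t \<in> carrier G" "g \<in> carrier G" "h \<in> carrier G" "pr s t \<in> carrier G"
  shows "pr s t \<otimes> pr g h \<otimes> inv (pr s t) = pr (s \<otimes> g \<otimes> inv s) (t \<otimes> h \<otimes> inv t)"
  using assms by (simp add: pr_inv pr_mult)

lemma cm_pr:
  assumes "s \<in> carrier G" "t \<in> carrier G" "g \<in> carrier G" "h \<in> carrier G"
    "pr s t \<in> carrier G" "pr g h \<in> carrier G"
  shows "cm (pr s t) (pr g h) = pr (cm s g) (cm t h)"
  using assms by (simp add: commutator_def pr_inv pr_mult)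

lemma cm_a_pr:
  assumes "g \<in> carrier G" "h \<in> carrier G" "pr g h \<in> carrier G"
  shows "cm a (pr g h) = pr (h \<otimes> inv g) (g \<otimes> inv h)"
proof -
  have "cm a (pr g h) = (a \<otimes> pr g h \<otimes> a) \<otimes> inv (pr g h)"
    by (simp add: commutator_def)
  then show ?thesis
    using assms by (simp add: a_pr pr_inv pr_mult)
qed

lemma pr_swap: "g \<in> carrier G \<Longrightarrow> h \<in> carrier G \<Longrightarrow> pr g h \<in> N \<Longrightarrow> N \<lhd> G \<Longrightarrow> pr h g \<in> N"
  using normal_conj[of N a "pr g h"] by (simp add: a_pr)

definition secs :: "('a \<times> 'a) set"
  where "secs = {(a, c), (a, d), (\<one>, b)}"

lemma secs_pr: "(s, t) \<in> secs \<Longrightarrow> s \<in> carrier G \<and> t \<in> carrier G \<and> pr s t \<in> carrier G"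
  by (auto simp: secs_def simp flip: b_pr c_pr d_pr)

lemma secs_cases: "x \<in> {b, c, d} \<Longrightarrow> \<exists>s t. (s, t) \<in> secs \<and> x = pr s t"
  unfolding secs_def using b_pr c_pr d_pr by blast

text \<open>Elements of \<open>A\<close> are central modulo \<open>B\<close>, so products of
  sections may be reordered; each closure property is witnessed by a word in given products and
  commutators.\<close>

lemma PP_normal:
  assumes A: "A \<lhd> G" and B: "B \<lhd> G" and BA: "B \<subseteq> A" and AB: "csub (carrier G) A B"
  shows "PP A B \<lhd> G"
proof (rule normal_by_generators[OF gs_carrier generated inv_gs])
  note Ac = normal_carrier[OF A] and Bc = normal_carrier[OF B]
  show "subgroup (PP A B) G"
  proof
    have "pr \<one> \<one> \<in> PP A B"
      by (rule PP_I) (simp_all add: normal_one[OF A] normal_one[OF B] pr_one)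
    then show "\<one> \<in> PP A B"
      by (simp only: pr_one)
  next
    fix x y assume "x \<in> PP A B" "y \<in> PP A B"
    then obtain g h g' h' where x: "x = pr g h" "g \<in> A" "h \<in> A" "g \<otimes> h \<in> B" "pr g h \<in> carrier G"
      and y: "y = pr g' h'" "g' \<in> A" "h' \<in> A" "g' \<otimes> h' \<in> B" "pr g' h' \<in> carrier G"
      by (auto elim!: PP_E)
    note car = x(2,3)[THEN Ac] y(2,3)[THEN Ac]
    have "(g \<otimes> h) \<otimes> cm (inv h) g' \<otimes> (g' \<otimes> h') \<in> B"
      by (rule normal_mult[OF B normal_mult[OF B x(4) csubD[OF AB _ y(2)]] y(4)]) (simp add: car)
    also have "(g \<otimes> h) \<otimes> cm (inv h) g' \<otimes> (g' \<otimes> h') = (g \<otimes> g') \<otimes> (h \<otimes> h')"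
      using car by (simp add: word_simps)
    finally have "(g \<otimes> g') \<otimes> (h \<otimes> h') \<in> B" .
    then have "pr (g \<otimes> g') (h \<otimes> h') \<in> PP A B"
      using x y car by (intro PP_I normal_mult[OF A]) (simp_all flip: pr_mult)
    then show "x \<otimes> y \<in> PP A B"
      using x y car by (simp add: pr_mult)
  next
    fix x assume "x \<in> PP A B"
    then obtain g h where x: "x = pr g h" "g \<in> A" "h \<in> A" "g \<otimes> h \<in> B" "pr g h \<in> carrier G"
      by (auto elim!: PP_E)
    note car = x(2,3)[THEN Ac]
    have "inv (cm h g \<otimes> (g \<otimes> h)) \<in> B"
      by (rule normal_inv[OF B normal_mult[OF B csubD[OF AB car(2) x(2)] x(4)]])
    then have "inv g \<otimes> inv h \<in> B"
      using car by (simp add: word_simps)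
    then show "inv x \<in> PP A B"
      using x car pr_inv[OF car x(5)] inv_closed[OF x(5)]
      by (auto intro!: PP_I normal_inv[OF A])
  qed (auto simp: PP_carrier)
next
  note Ac = normal_carrier[OF A]
  fix s x assume s: "s \<in> gs" and "x \<in> PP A B"
  then obtain g h where x: "x = pr g h" "g \<in> A" "h \<in> A" "g \<otimes> h \<in> B" "pr g h \<in> carrier G"
    by (auto elim!: PP_E)
  note car = x(2,3)[THEN Ac]
  have sc: "s \<in> carrier G" using s gs_carrier by blast
  then have cl: "s \<otimes> x \<otimes> inv s \<in> carrier G" using x by simp
  show "s \<otimes> x \<otimes> inv s \<in> PP A B"
  proof (cases "s = a")
    case True
    have "cm h g \<otimes> (g \<otimes> h) \<in> B"
      by (rule normal_mult[OF B csubD[OF AB car(2) x(2)] x(4)])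
    then have "h \<otimes> g \<in> B" using car by (simp add: word_simps)
    moreover have "s \<otimes> x \<otimes> inv s = pr h g" using True x car by (simp add: a_pr)
    ultimately show ?thesis using x cl by (simp add: PP_I)
  next
    case False
    then obtain p q where pq: "(p, q) \<in> secs" "s = pr p q" using s secs_cases by blast
    then have pqc: "p \<in> carrier G" "q \<in> carrier G" using secs_pr by auto
    have eq: "s \<otimes> x \<otimes> inv s = pr (p \<otimes> g \<otimes> inv p) (q \<otimes> h \<otimes> inv q)"
      using pq pqc x car sc by (simp add: pr_conj)
    have "cm p g \<otimes> (g \<otimes> cm q h \<otimes> inv g) \<otimes> (g \<otimes> h) \<in> B"
      by (rule normal_mult[OF B normal_mult[OF B csubD[OF AB pqc(1) x(2)]
        normal_conj[OF B car(1) csubD[OF AB pqc(2) x(3)]]] x(4)])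
    also have "cm p g \<otimes> (g \<otimes> cm q h \<otimes> inv g) \<otimes> (g \<otimes> h) = (p \<otimes> g \<otimes> inv p) \<otimes> (q \<otimes> h \<otimes> inv q)"
      using car pqc by (simp add: word_simps)
    finally show ?thesis
      using cl x pqc unfolding eq by (intro PP_I normal_conj[OF A])
  qed
qed

lemma gcomm_PP_subset:
  assumes A: "A \<lhd> G" and N: "N \<lhd> G"
    and 1: "\<And>g h. \<lbrakk>g \<in> A; h \<in> A; g \<otimes> h \<in> B; pr (h \<otimes> inv g) (g \<otimes> inv h) \<in> carrier G\<rbrakk> \<Longrightarrow>
      pr (h \<otimes> inv g) (g \<otimes> inv h) \<in> N"
    and 2: "\<And>s t g h. \<lbrakk>(s, t) \<in> secs; g \<in> A; h \<in> A; g \<otimes> h \<in> B; pr (cm s g) (cm t h) \<in> carrier G\<rbrakk> \<Longrightarrow>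
      pr (cm s g) (cm t h) \<in> N"
  shows "gcomm (PP A B) \<subseteq> N"
proof (rule gcomm_leastI[OF N gs_carrier generated])
  fix s x assume s: "s \<in> gs" and "x \<in> PP A B"
  then obtain g h where x: "x = pr g h" "g \<in> A" "h \<in> A" "g \<otimes> h \<in> B" "pr g h \<in> carrier G"
    by (auto elim!: PP_E)
  note car = x(2,3)[THEN normal_carrier[OF A]]
  have cl: "cm s x \<in> carrier G" using s x gs_carrier by blast
  show "cm s x \<in> N"
  proof (cases "s = a")
    case True
    then show ?thesis using 1[OF x(2-4)] cl x car by (simp add: cm_a_pr)
  next
    case False
    then obtain p q where pq: "(p, q) \<in> secs" "s = pr p q" using s secs_cases by blast
    then have "p \<in> carrier G" "q \<in> carrier G" "pr p q \<in> carrier G" using secs_pr s gs_carrier by auto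
    then have "cm s x = pr (cm p g) (cm q h)" using x car pq by (simp add: cm_pr)
    then show ?thesis using 2[OF pq(1) x(2-4)] cl by simp
  qed
qed (auto simp: PP_carrier)

text \<open>Modulo \<open>Z\<close> one has \<open>gh = 1\<close> and \<open>g\<^sup>2 = 1\<close>,
  hence \<open>g = h\<close>. This gives
  \<open>[a, (g, h)] = (h g\<^sup>-\<^sup>1, g h\<^sup>-\<^sup>1)\<close> its deeper
  sections.\<close>

lemma PP_diff:
  assumes A: "A \<lhd> G" and Z: "Z \<lhd> G" and sq: "\<And>g. g \<in> A \<Longrightarrow> g \<otimes> g \<in> Z"
    and g: "g \<in> A" and h: "h \<in> A" and gh: "g \<otimes> h \<in> Z"
  shows "h \<otimes> inv g \<in> Z" "g \<otimes> inv h \<in> Z"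
proof -
  have car: "g \<in> carrier G" "h \<in> carrier G" using A g h normal_carrier by auto
  have "(inv g \<otimes> (g \<otimes> h) \<otimes> inv (inv g)) \<otimes> inv (g \<otimes> g) \<in> Z"
    by (rule normal_mult[OF Z normal_conj[OF Z _ gh] normal_inv[OF Z sq[OF g]]]) (simp add: car)
  then show 1: "h \<otimes> inv g \<in> Z" using car by (simp add: word_simps)
  have "inv (h \<otimes> inv g) \<in> Z" by (rule normal_inv[OF Z 1])
  then show "g \<otimes> inv h \<in> Z" using car by (simp add: word_simps)
qed

definition snd_part :: "'a set \<Rightarrow> 'a set"
  where "snd_part N = {k \<in> carrier G. pr \<one> k \<in> N}"

lemma gen_second: "s \<in> gs \<Longrightarrow> \<exists>r\<in>carrier G. pr r s \<in> carrier G"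
proof -
  have "pr c a \<in> carrier G"
    using a_pr[of a c] b_pr by (metis abcd m_closed)
  moreover have "pr a c \<in> carrier G" "pr a d \<in> carrier G" "pr \<one> b \<in> carrier G"
    using abcd b_pr c_pr d_pr by metis+
  ultimately show "s \<in> gs \<Longrightarrow> \<exists>r\<in>carrier G. pr r s \<in> carrier G"
    by auto
qed

text \<open>A pair \<open>(1, s)\<close> need not lie in \<open>G\<close>, but every generator
  \<open>s\<close> is the second section of some element of \<open>G\<close>, and conjugation by
  that element keeps the first section trivial.\<close>

lemma snd_part_normal:
  assumes N: "N \<lhd> G"
  shows "snd_part N \<lhd> G"
proof (rule normal_by_generators[OF gs_carrier generated inv_gs])
  note Nc = normal_carrier[OF N]
  show "subgroup (snd_part N) G"
  proof
    fix x y assume "x \<in> snd_part N" "y \<in> snd_part N"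
    then have xy: "x \<in> carrier G" "y \<in> carrier G" "pr \<one> x \<in> N" "pr \<one> y \<in> N" by (auto simp: snd_part_def)
    have "pr \<one> x \<otimes> pr \<one> y \<in> N" using xy by (intro normal_mult[OF N])
    then show "x \<otimes> y \<in> snd_part N" using xy by (simp add: pr_mult snd_part_def)
  next
    fix x assume "x \<in> snd_part N"
    then have x: "x \<in> carrier G" "pr \<one> x \<in> N" by (auto simp: snd_part_def)
    have "inv (pr \<one> x) \<in> N" using x by (intro normal_inv[OF N])
    then show "inv x \<in> snd_part N" using x Nc by (simp add: pr_inv snd_part_def)
  qed (use normal_one[OF N] in \<open>auto simp: snd_part_def pr_one\<close>)
next
  fix s h assume s: "s \<in> gs" and "h \<in> snd_part N"
  then have h: "h \<in> carrier G" "pr \<one> h \<in> N" by (auto simp: snd_part_def)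
  obtain r where r: "r \<in> carrier G" "pr r s \<in> carrier G" using gen_second s by blast
  have sc: "s \<in> carrier G" using s gs_carrier by blast
  have "pr r s \<otimes> pr \<one> h \<otimes> inv (pr r s) \<in> N"
    using h r by (intro normal_conj[OF N])
  then have "pr \<one> (s \<otimes> h \<otimes> inv s) \<in> N"
    using h r sc by (simp add: pr_conj)
  then show "s \<otimes> h \<otimes> inv s \<in> snd_part N"
    using h sc by (simp add: snd_part_def)
qed

lemma snd_part_gcomm:
  assumes Z: "Z \<lhd> G" and B: "B \<lhd> G" "B \<subseteq> snd_part Z"
  shows "gcomm B \<subseteq> snd_part (gcomm Z)" and "k \<in> B \<Longrightarrow> pr k (inv k) \<in> gcomm Z"
proof -
  show "gcomm B \<subseteq> snd_part (gcomm Z)"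
  proof (rule gcomm_leastI[OF snd_part_normal[OF gcomm_normal[OF Z]] gs_carrier generated])
    fix s k assume s: "s \<in> gs" and "k \<in> B"
    then have k: "k \<in> carrier G" "pr \<one> k \<in> Z" using B by (auto simp: snd_part_def)
    obtain r where r: "r \<in> carrier G" "pr r s \<in> carrier G" using gen_second s by blast
    have sc: "s \<in> carrier G" using s gs_carrier by blast
    have "cm (pr r s) (pr \<one> k) \<in> gcomm Z"
      using r k by (intro gcomm_incl)
    then have "pr \<one> (cm s k) \<in> gcomm Z"
      using r k sc normal_carrier[OF Z] by (simp add: cm_pr)
    then show "cm s k \<in> snd_part (gcomm Z)"
      using k sc by (simp add: snd_part_def)
  qed (use normal_carrier[OF B(1)] in auto)
  show "pr k (inv k) \<in> gcomm Z" if "k \<in> B"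
  proof -
    have k: "k \<in> carrier G" "pr \<one> k \<in> Z" using B that by (auto simp: snd_part_def)
    have "cm a (pr \<one> k) \<in> gcomm Z"
      using k by (intro gcomm_incl) auto
    then show ?thesis
      using k normal_carrier[OF Z] by (simp add: cm_a_pr)
  qed
qed

text \<open>\<open>(g, h) = (g, g\<^sup>-\<^sup>1) (1, gh)\<close>: the first factor is the
  commutator of \<open>a\<close> with \<open>(1, g)\<close>, the second comes from brackets in the
  second section alone.\<close>

lemma PP_subset_gcomm:
  assumes Z: "Z \<lhd> G" and B: "B \<lhd> G" "B \<subseteq> snd_part Z"
  shows "PP B (gcomm B) \<subseteq> gcomm Z"
proof
  fix x assume "x \<in> PP B (gcomm B)"
  then obtain g h where x: "x = pr g h" "g \<in> B" "h \<in> B" "g \<otimes> h \<in> gcomm B"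
    by (auto elim!: PP_E)
  have car: "g \<in> carrier G" "h \<in> carrier G" using x normal_carrier[OF B(1)] by auto
  have "pr g (inv g) \<in> gcomm Z" "pr \<one> (g \<otimes> h) \<in> gcomm Z"
    using snd_part_gcomm[OF assms] x by (auto simp: snd_part_def)
  then have "pr g (inv g) \<otimes> pr \<one> (g \<otimes> h) \<in> gcomm Z"
    by (intro normal_mult[OF gcomm_normal[OF Z]])
  then show "x \<in> gcomm Z"
    using x car by (simp add: pr_mult)
qed

lemma PP_snd_part:
  assumes N: "N \<lhd> G" and B: "B \<lhd> G" "B \<subseteq> snd_part N"
  shows "PP B B \<subseteq> N"
proof
  fix x assume "x \<in> PP B B"
  then obtain g h where x: "x = pr g h" "g \<in> B" "h \<in> B"
    by (auto elim!: PP_E)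
  have car: "g \<in> carrier G" "h \<in> carrier G" using x normal_carrier[OF B(1)] by auto
  have 1: "pr \<one> g \<in> N" "pr \<one> h \<in> N" using B x by (auto simp: snd_part_def)
  have "pr g \<one> \<in> N" using pr_swap[OF _ _ 1(1) N] car by simp
  then have "pr g \<one> \<otimes> pr \<one> h \<in> N" using 1 by (intro normal_mult[OF N])
  then show "x \<in> N" using x car by (simp add: pr_mult)
qed

text \<open>
  For \<open>Z = PP A B\<close> the set of all \<open>u\<close> with \<open>(1, u)\<close> in \<open>[G, Z]\<close> contains \<open>[b, g]\<close>, \<open>[a, g\<^sup>-\<^sup>1][c, g]\<close> and
  \<open>[a, g\<^sup>-\<^sup>1][d, g]\<close> for all \<open>g\<close> in \<open>A\<close>; one more hypothesis makes it contain all of \<open>[G, A]\<close>.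
\<close>

lemma PP_square_subset_gcomm:
  assumes A: "A \<lhd> G" and Z: "PP A (gcomm A) \<lhd> G"
    and car: "\<And>g h. g \<in> A \<Longrightarrow> h \<in> A \<Longrightarrow> g \<otimes> h \<in> gcomm A \<Longrightarrow> pr g h \<in> carrier G"
    and H: "\<And>U. U \<lhd> G \<Longrightarrow> gcomm (gcomm A) \<subseteq> U \<Longrightarrow> (\<And>g. g \<in> A \<Longrightarrow> cm b g \<in> U) \<Longrightarrow>
      (\<forall>g\<in>A. cm a g \<in> U) \<or> (\<forall>g\<in>A. cm c g \<in> U)"
  shows "PP (gcomm A) (gcomm A) \<subseteq> gcomm (PP A (gcomm A))"
proof -
  let ?B = "gcomm A" and ?Z = "PP A (gcomm A)"
  let ?C = "gcomm ?Z" and ?U = "snd_part (gcomm (PP A (gcomm A)))"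
  have B: "?B \<lhd> G" by (rule gcomm_normal[OF A])
  have C: "?C \<lhd> G" by (rule gcomm_normal[OF Z])
  have U: "?U \<lhd> G" by (rule snd_part_normal[OF C])
  have BX: "?B \<subseteq> snd_part ?Z"
  proof
    fix k assume k: "k \<in> ?B"
    then have kA: "k \<in> A" "k \<in> carrier G" using gcomm_subset[OF A] normal_carrier[OF B] by auto
    have "pr \<one> k \<in> ?Z"
      using k kA normal_one[OF A] by (intro PP_I car) auto
    then show "k \<in> snd_part ?Z" using kA by (simp add: snd_part_def)
  qed
  note BU = snd_part_gcomm[OF Z B BX]
  have prX: "pr (inv g) g \<in> ?Z" if "g \<in> A" for g
    using that normal_inv[OF A] normal_carrier[OF A] normal_one[OF B] by (intro PP_I car) auto
  \<comment> \<open>The commutator of \<open>(s, t)\<close> with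
    \<open>(g\<^sup>-\<^sup>1, g)\<close> is \<open>([s, g\<^sup>-\<^sup>1], [t, g])\<close>. Its
    first section lies in \<open>[G, A]\<close>, so an antidiagonal pair from \<open>BU\<close>
    moves it into the second section.\<close>
  have secU: "cm s (inv g) \<otimes> cm t g \<in> ?U" if st: "(s, t) \<in> secs" and g: "g \<in> A" for s t g
  proof -
    have gc: "g \<in> carrier G" using g normal_carrier[OF A] by blast
    have stc: "s \<in> carrier G" "t \<in> carrier G" "pr s t \<in> carrier G" using secs_pr[OF st] by auto
    have "cm (pr s t) (pr (inv g) g) \<in> ?C"
      using stc prX[OF g] by (intro gcomm_incl)
    then have 1: "pr (cm s (inv g)) (cm t g) \<in> ?C"
      using stc gc PP_carrier[OF prX[OF g]] by (simp add: cm_pr)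
    have p: "cm s (inv g) \<in> ?B" using stc g by (intro gcomm_incl normal_inv[OF A])
    then have "inv (pr (cm s (inv g)) (inv (cm s (inv g)))) \<in> ?C"
      by (intro normal_inv[OF C] BU)
    moreover have "inv (pr (cm s (inv g)) (inv (cm s (inv g)))) = pr (inv (cm s (inv g))) (cm s (inv g))"
      using BU(2)[OF p] normal_carrier[OF C] stc gc by (subst pr_inv) auto
    ultimately have "pr (inv (cm s (inv g))) (cm s (inv g)) \<otimes> pr (cm s (inv g)) (cm t g) \<in> ?C"
      using 1 by (intro normal_mult[OF C]) simp_all
    then have "pr \<one> (cm s (inv g) \<otimes> cm t g) \<in> ?C"
      using stc gc by (simp add: pr_mult)
    then show ?thesis using stc gc by (simp add: snd_part_def)
  qed
  have bU: "cm b g \<in> ?U" if "g \<in> A" for g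
    using secU[of \<one> b g] that normal_carrier[OF A] by (simp add: secs_def)
  have cases: "(\<forall>g\<in>A. cm a g \<in> ?U) \<or> (\<forall>g\<in>A. cm c g \<in> ?U)"
    by (rule H[OF U BU(1) bU])
  have aU: "cm a g \<in> ?U" if g: "g \<in> A" for g
  proof (cases "\<forall>g\<in>A. cm a g \<in> ?U")
    case False
    then have "cm c (inv g) \<in> ?U" using cases normal_inv[OF A g] by blast
    moreover have gc: "g \<in> carrier G" using g normal_carrier[OF A] by blast
    moreover have "cm a (inv (inv g)) \<otimes> cm c (inv g) \<in> ?U"
      using secU[of a c "inv g"] normal_inv[OF A g] by (simp add: secs_def)
    ultimately show ?thesis
      using normal_cancel_right[OF U, of "cm c (inv g)" "cm a g"] by simp
  qed (use g in blast)
  have cdU: "cm t g \<in> ?U" if "t \<in> {c, d}" and g: "g \<in> A" for t g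
  proof -
    have gc: "g \<in> carrier G" using g normal_carrier[OF A] by blast
    have "cm a (inv g) \<otimes> cm t g \<in> ?U" using secU[of a t g] that by (auto simp: secs_def)
    then show ?thesis
      using normal_cancel_left[OF U, of "cm a (inv g)" "cm t g"] aU[OF normal_inv[OF A g]] that gc by auto
  qed
  have "?B \<subseteq> ?U"
    by (rule gcomm_leastI[OF U gs_carrier generated])
      (use aU bU cdU normal_carrier[OF A] in auto)
  then show ?thesis
    by (rule PP_snd_part[OF C B])
qed

end

section \<open>The branching subgroup and the lower central series up to index 5\<close>

context grig_group
begin

lemma PP_square_I: "N \<lhd> G \<Longrightarrow> g \<in> N \<Longrightarrow> h \<in> N \<Longrightarrow> pr g h \<in> carrier G \<Longrightarrow> pr g h \<in> PP N N"
  by (simp add: PP_I normal_mult)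

lemma PP_diff_I:
  "N \<lhd> G \<Longrightarrow> h \<otimes> inv g \<in> A \<Longrightarrow> g \<otimes> inv h \<in> A \<Longrightarrow> g \<in> carrier G \<Longrightarrow> h \<in> carrier G \<Longrightarrow>
    pr (h \<otimes> inv g) (g \<otimes> inv h) \<in> carrier G \<Longrightarrow> pr (h \<otimes> inv g) (g \<otimes> inv h) \<in> PP A N"
  by (rule PP_I) (auto simp: m_assoc normal_one)

text \<open>\<open>x = (ab)\<^sup>2 = [a, b]\<close>, and its normal closure \<open>K\<close> is the
  classical branching subgroup: by \<open>pr_carrier_K\<close> all pairs from \<open>K\<close> lie
  in \<open>G\<close>. \<open>y1 = ca\<close> is the first section of \<open>x\<close>, and its
  square \<open>u\<close> is the inverse of \<open>[a, c]\<close>.\<close>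

definition x :: 'a where "x = a \<otimes> b \<otimes> (a \<otimes> b)"
definition y1 :: 'a where "y1 = c \<otimes> a"
definition u :: 'a where "u = y1 \<otimes> y1"
definition K :: "'a set" where "K = generate G {g \<otimes> x \<otimes> inv g | g. g \<in> carrier G}"

lemma x_carrier [simp]: "x \<in> carrier G" and y1_carrier [simp]: "y1 \<in> carrier G" and u_carrier [simp]: "u \<in> carrier G"
  by (simp_all add: x_def y1_def u_def)

lemma K_normal: "K \<lhd> G"
  unfolding K_def
proof (rule normal_generateI)
  fix h g assume "h \<in> {g \<otimes> x \<otimes> inv g | g. g \<in> carrier G}" and g: "g \<in> carrier G"
  then obtain k where k: "h = k \<otimes> x \<otimes> inv k" "k \<in> carrier G" by blast
  then have "g \<otimes> h \<otimes> inv g = (g \<otimes> k) \<otimes> x \<otimes> inv (g \<otimes> k)"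
    using g by (simp add: word_simps)
  then show "g \<otimes> h \<otimes> inv g \<in> {g \<otimes> x \<otimes> inv g | g. g \<in> carrier G}"
    using g k by blast
qed auto

lemma x_K: "x \<in> K"
  unfolding K_def by (rule generate.incl) (auto intro!: exI[of _ \<one>])

lemma K_least:
  assumes "N \<lhd> G" "x \<in> N"
  shows "K \<subseteq> N"
  unfolding K_def by (rule generate_subgroup_incl) (use assms normal_conj normal_subgroup in auto)

lemma aba: "a \<otimes> b \<otimes> a = pr c a" and aca: "a \<otimes> c \<otimes> a = pr d a" and ada: "a \<otimes> d \<otimes> a = pr b \<one>"
proof -
  show "a \<otimes> b \<otimes> a = pr c a" by (subst b_pr) (simp add: a_pr)
  show "a \<otimes> c \<otimes> a = pr d a" by (subst c_pr) (simp add: a_pr)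
  show "a \<otimes> d \<otimes> a = pr b \<one>" by (subst d_pr) (simp add: a_pr)
qed

lemma inv_y1: "inv y1 = a \<otimes> c"
  by (simp add: y1_def inv_mult_group)

lemma x_pr: "x = pr y1 (inv y1)"
proof -
  have "x = (a \<otimes> b \<otimes> a) \<otimes> b" by (simp add: x_def m_assoc)
  also have "\<dots> = pr c a \<otimes> pr a c" unfolding aba by (simp flip: b_pr)
  finally show ?thesis by (simp add: pr_mult y1_def inv_mult_group)
qed

lemma acac: "cm a c = pr (d \<otimes> a) (a \<otimes> d)"
proof -
  have "cm a c = (a \<otimes> c \<otimes> a) \<otimes> c" by (simp add: commutator_def m_assoc)
  also have "\<dots> = pr d a \<otimes> pr a d" unfolding aca by (simp flip: c_pr)
  finally show ?thesis by (simp add: pr_mult)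
qed

lemma adad: "cm a d = pr b b"
proof -
  have "cm a d = (a \<otimes> d \<otimes> a) \<otimes> d" by (simp add: commutator_def m_assoc)
  also have "\<dots> = pr b \<one> \<otimes> pr \<one> b" unfolding ada by (simp flip: d_pr)
  finally show ?thesis by (simp add: pr_mult)
qed

lemma adad_square: "cm a d \<otimes> cm a d = \<one>"
  unfolding adad by (simp add: pr_mult squares pr_one)

lemma lc_2: "lc 2 = gcomm (carrier G)"
  using lc_Suc[of 1] by (simp add: numeral_2_eq_2)

lemma lc_3: "lc 3 = gcomm (lc 2)"
  using lc_Suc[of 2] by (simp add: numeral_3_eq_3 numeral_2_eq_2)

lemma cm_lc_2: "g \<in> carrier G \<Longrightarrow> h \<in> carrier G \<Longrightarrow> cm g h \<in> lc 2"
  unfolding lc_2 by (rule gcomm_incl)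

lemma square_lc_2: "g \<in> carrier G \<Longrightarrow> g \<otimes> g \<in> lc 2"
proof -
  assume "g \<in> carrier G"
  then show ?thesis
    unfolding generated
    by (rule generate_squares[OF lc_normal gs_carrier, rotated 2])
      (use squares normal_one[OF lc_normal] in \<open>auto simp: csub_def cm_lc_2 generated[symmetric]\<close>)
qed

lemma lc_square': "1 \<le> n \<Longrightarrow> g \<in> lc n \<Longrightarrow> g \<otimes> g \<in> lc (Suc n)"
  by (rule lc_square[OF square_lc_2])

lemma lc_2_least:
  assumes N: "N \<lhd> G" and "cm a b \<in> N" "cm a c \<in> N" "cm a d \<in> N"
  shows "lc 2 \<subseteq> N"
  unfolding lc_2
proof (rule gcomm_carrier_leastI[OF N gs_carrier generated])
  have 1: "cm a t \<in> N" if "t \<in> {b, c, d}" for t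
    using that assms by auto
  have 2: "cm t a \<in> N" if "t \<in> {b, c, d}" for t
  proof -
    have "inv (cm a t) \<in> N" using normal_inv[OF N 1[OF that]] .
    then show ?thesis using that by (subst (asm) inv_cm) auto
  qed
  have 3: "cm s t = \<one>" if "s \<in> {b, c, d}" "t \<in> {b, c, d}" for s t
    using that by (auto simp: grig_simps)
  have 4: "cm a a = \<one>" by (simp add: grig_simps)
  fix s t assume "s \<in> gs" "t \<in> gs"
  then show "cm s t \<in> N"
    using 1 2 3 4 normal_one[OF N] by (cases "s = a"; cases "t = a") auto
qed

text \<open>\<open>b\<close> commutes with \<open>c\<close> and \<open>d\<close>, and
  \<open>[b, a] = x\<^sup>-\<^sup>1\<close>; the elements commuting with \<open>b\<close> modulo
  \<open>K\<close> form a subgroup, so the generators decide.\<close>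

lemma cm_b_K: "g \<in> carrier G \<Longrightarrow> cm b g \<in> K"
proof -
  have "cm b a = inv x" by (simp add: x_def grig_simps)
  then have "cm b a \<in> K" using normal_inv[OF K_normal x_K] by simp
  moreover have "cm b b = \<one>" "cm b c = \<one>" "cm b d = \<one>" by (simp_all add: grig_simps)
  ultimately have "gs \<subseteq> {g \<in> carrier G. cm b g \<in> K}"
    using normal_one[OF K_normal] by auto
  then have "generate G gs \<subseteq> {g \<in> carrier G. cm b g \<in> K}"
    by (rule generate_subgroup_incl[OF _ centralizer_subgroup[OF K_normal abcd(2)]])
  then show "g \<in> carrier G \<Longrightarrow> cm b g \<in> K"
    using generated by blast
qed

lemma u_adad: "u \<otimes> cm a d \<in> K"
proof -
  have "u \<otimes> cm a d = d \<otimes> inv x \<otimes> inv d"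
    by (simp add: u_def y1_def x_def grig_simps)
  then show ?thesis
    using normal_conj[OF K_normal abcd(4) normal_inv[OF K_normal x_K]] by simp
qed

text \<open>By \<open>u_adad\<close>, \<open>u\<close> is modulo \<open>K\<close> the inverse of
  \<open>[a, d] = (b, b)\<close>, which has trivial square.\<close>

lemma u_square: "u \<otimes> u \<in> K"
proof -
  let ?k = "u \<otimes> cm a d" and ?v = "cm a d"
  have v: "?v \<in> carrier G" by simp
  have "?k \<otimes> (inv ?v \<otimes> ?k \<otimes> inv (inv ?v)) \<in> K"
    by (intro normal_mult[OF K_normal u_adad] normal_conj[OF K_normal _ u_adad]) simp
  also have "?k \<otimes> (inv ?v \<otimes> ?k \<otimes> inv (inv ?v)) = u \<otimes> (?v \<otimes> inv ?v) \<otimes> u \<otimes> (?v \<otimes> ?v)"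
    using v by (simp add: m_assoc del: r_inv)
  also have "\<dots> = u \<otimes> u"
    unfolding adad_square using v by simp
  finally show ?thesis .
qed

text \<open>\<open>a\<close> and \<open>c\<close> invert \<open>u\<close>, whose square lies in
  \<open>K\<close>; \<open>b\<close> is central modulo \<open>K\<close>, and
  \<open>d = bc\<close>.\<close>

lemma cm_u_K: "g \<in> carrier G \<Longrightarrow> cm g u \<in> K"
proof -
  have "csub gs {u} K"
    unfolding csub_def
  proof (intro ballI)
    fix s v assume s: "s \<in> gs" and "v \<in> {u}"
    have uu: "inv (u \<otimes> u) \<in> K" by (rule normal_inv[OF K_normal u_square])
    have a: "cm a u = inv (u \<otimes> u)" and c: "cm c u = inv (u \<otimes> u)"
      by (simp_all add: u_def y1_def grig_simps)
    have b: "cm b u \<in> K" by (simp add: cm_b_K)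
    have "cm (b \<otimes> c) u = b \<otimes> cm c u \<otimes> inv b \<otimes> cm b u"
      by (rule cm_mult_left) auto
    also have "\<dots> \<in> K"
      using uu c b by (intro normal_mult[OF K_normal] normal_conj[OF K_normal]) auto
    finally have "cm d u \<in> K" by (simp add: bc)
    then show "cm s v \<in> K"
      using \<open>v \<in> {u}\<close> s a b c uu by auto
  qed
  then have "csub (carrier G) {u} K"
    unfolding generated by (intro csub_generate[OF K_normal gs_carrier]) auto
  then show "g \<in> carrier G \<Longrightarrow> cm g u \<in> K" by (simp add: csubD)
qed

text \<open>Modulo \<open>K\<close> the commutators \<open>[a, b]\<close>, \<open>[a, c]\<close>,
  \<open>[a, d]\<close> are 1, \<open>u\<^sup>-\<^sup>1\<close>, \<open>u\<^sup>-\<^sup>1\<close>,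
  so \<open>K\<close> has index at most 2 in \<open>lc 2\<close>.\<close>

lemma lc_2_cases: "g \<in> lc 2 \<Longrightarrow> g \<in> K \<or> u \<otimes> g \<in> K"
proof -
  let ?Y = "{g \<in> carrier G. g \<in> K \<or> u \<otimes> g \<in> K}"
  have "?Y \<lhd> G"
    by (rule extend_normal[OF gs_carrier generated inv_gs K_normal u_carrier u_square cm_u_K])
      auto
  moreover have "cm a b = x" by (simp add: x_def grig_simps)
  moreover have "u \<otimes> cm a c = \<one>" by (simp add: u_def y1_def grig_simps)
  ultimately have "lc 2 \<subseteq> ?Y"
    by (intro lc_2_least) (auto simp: x_K u_adad normal_one[OF K_normal])
  then show "g \<in> lc 2 \<Longrightarrow> g \<in> K \<or> u \<otimes> g \<in> K" by blast
qed

lemma K_lc_2: "K \<subseteq> lc 2"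
proof (rule K_least[OF lc_normal])
  have "x = cm a b" by (simp add: x_def grig_simps)
  then show "x \<in> lc 2" by (simp add: cm_lc_2)
qed

lemma u_lc_2: "u \<in> lc 2"
  unfolding u_def by (rule square_lc_2) simp

lemma lc_2_K: "csub (carrier G) (lc 2) K"
  unfolding csub_def
proof (intro ballI)
  fix s g assume s: "s \<in> carrier G" and g: "g \<in> lc 2"
  let ?S = "{g \<in> carrier G. cm s g \<in> K}"
  have S: "subgroup ?S G" by (rule centralizer_subgroup[OF K_normal s])
  have KS: "k \<in> ?S" if "k \<in> K" for k
    using that s normal_cm_right[OF K_normal] normal_carrier[OF K_normal] by auto
  have uS: "inv u \<in> ?S"
    using s cm_u_K by (intro subgroup.m_inv_closed[OF S]) auto
  have gc: "g \<in> carrier G" using g lc_carrier by blast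
  from lc_2_cases[OF g] show "cm s g \<in> K"
  proof
    assume "u \<otimes> g \<in> K"
    then have "inv u \<otimes> (u \<otimes> g) \<in> ?S"
      by (intro subgroup.m_closed[OF S uS] KS)
    then show ?thesis using gc by simp
  qed (use KS in auto)
qed

lemma lc_3_K: "lc 3 \<subseteq> K"
  unfolding lc_3 by (rule gcomm_least[OF normal_subgroup[OF K_normal] lc_2_K])

lemma K_square: "g \<in> lc 2 \<Longrightarrow> g \<otimes> g \<in> lc 3"
  using lc_square'[of 2 g] by (simp add: numeral_3_eq_3)

text \<open>The centralizer of \<open>ca\<close> modulo \<open>K\<close> contains the sections of \<open>[G, G]\<close>.\<close>

definition P :: "'a set"
  where "P = {g \<in> carrier G. cm y1 g \<in> K}"

lemma P_normal: "P \<lhd> G"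
proof (rule normal_invI)
  show s: "subgroup P G"
    unfolding P_def by (rule centralizer_subgroup[OF K_normal]) simp
  fix s g assume sg: "s \<in> carrier G" "g \<in> P"
  then have gc: "g \<in> carrier G" by (simp add: P_def)
  have "cm s g \<in> P"
    using cm_lc_2[OF sg(1) gc] csubD[OF lc_2_K] sg gc by (simp add: P_def)
  then have "cm s g \<otimes> g \<in> P" using sg by (intro subgroup.m_closed[OF s])
  then show "s \<otimes> g \<otimes> inv s \<in> P" using sg gc by (simp add: word_simps)
qed

lemma lc_2_P: "lc 2 \<subseteq> P"
  using csubD[OF lc_2_K] lc_carrier by (auto simp: P_def)

lemma b_P: "b \<in> P"
  using normal_inv[OF K_normal cm_b_K[of y1]] by (simp add: P_def inv_cm)

lemma y1_P: "y1 \<in> P"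
proof -
  have "cm y1 y1 = \<one>" by (simp add: word_simps)
  then show ?thesis by (simp add: P_def normal_one[OF K_normal])
qed

lemma lc_2_sections: "lc 2 \<subseteq> PP P (lc 2)"
proof (rule lc_2_least)
  show "PP P (lc 2) \<lhd> G"
    by (rule PP_normal[OF P_normal lc_normal lc_2_P])
      (auto simp: csub_def P_def cm_lc_2)
  have eq: "cm a b = pr y1 (inv y1)"
    unfolding x_pr[symmetric] by (simp add: x_def grig_simps)
  have "pr y1 (inv y1) \<in> PP P (lc 2)"
    by (rule PP_I) (simp_all add: y1_P normal_inv[OF P_normal] normal_one[OF lc_normal] x_pr[symmetric])
  then show "cm a b \<in> PP P (lc 2)" by (simp only: eq)
  have da: "d \<otimes> a \<in> P"
  proof -
    have "b \<otimes> y1 \<in> P" by (rule normal_mult[OF P_normal b_P y1_P])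
    then show ?thesis by (simp add: y1_def grig_simps)
  qed
  have "inv (d \<otimes> a) \<in> P" by (rule normal_inv[OF P_normal da])
  then have ad: "a \<otimes> d \<in> P" by (simp add: inv_mult_group)
  have "d \<otimes> a \<otimes> (a \<otimes> d) = \<one>" by (simp add: grig_simps)
  then have "pr (d \<otimes> a) (a \<otimes> d) \<in> PP P (lc 2)"
    by (intro PP_I da ad) (simp_all add: normal_one[OF lc_normal] acac[symmetric])
  then show "cm a c \<in> PP P (lc 2)" by (simp only: acac)
  have "pr b b \<in> PP P (lc 2)"
    by (rule PP_I[OF b_P b_P]) (simp_all add: squares normal_one[OF lc_normal] adad[symmetric])
  then show "cm a d \<in> PP P (lc 2)" by (simp only: adad)
qed

text \<open>In each pair \<open>t = s p\<close> with \<open>p\<close> one of \<open>ac\<close>,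
  \<open>ad\<close>, \<open>b\<close>, and each such \<open>p\<close> centralises \<open>P\<close>
  modulo \<open>K\<close>. Hence \<open>[s, g] [t, h]\<close> agrees with
  \<open>[s, g] [s, h]\<close> and so with \<open>[s, gh]\<close>, which lies in
  \<open>K\<close>.\<close>

lemma secs_product_K:
  assumes st: "(s, t) \<in> secs" and g: "g \<in> P" and h: "h \<in> P" and gh: "g \<otimes> h \<in> lc 2"
  shows "cm s g \<otimes> cm t h \<in> K"
proof -
  have car: "g \<in> carrier G" "h \<in> carrier G" "s \<in> carrier G" "t \<in> carrier G"
    using g h secs_pr[OF st] by (auto simp: P_def)
  have bh: "cm b h \<in> K" using car by (simp add: cm_b_K)
  have yh: "cm (inv y1) h \<in> K"
    using h car unfolding cm_inv_left[OF y1_carrier car(2)]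
    by (intro normal_conj[OF K_normal] normal_inv[OF K_normal]) (auto simp: P_def)
  have "cm (inv y1 \<otimes> b) h \<in> K"
    using bh yh car unfolding cm_mult_left[OF inv_closed[OF y1_carrier] abcd(2) car(2)]
    by (intro normal_mult[OF K_normal] normal_conj[OF K_normal]) auto
  moreover have "inv y1 \<otimes> b = a \<otimes> d" by (simp add: inv_y1 grig_simps)
  ultimately obtain p where p: "p \<in> carrier G" "t = s \<otimes> p" "cm p h \<in> K"
    using st yh bh unfolding secs_def inv_y1
    by (auto simp: grig_simps intro: that[of "a \<otimes> c"] that[of "a \<otimes> d"] that[of b])
  let ?z = "cm s h" and ?k = "s \<otimes> cm p h \<otimes> inv s"
  have k: "?k \<in> K" using p car by (intro normal_conj[OF K_normal])
  have 1: "cm s g \<otimes> (g \<otimes> ?z \<otimes> inv g) \<in> K"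
    using csubD[OF lc_2_K car(3) gh] cm_mult_right[OF car(3,1,2)] by simp
  have 2: "cm g (inv ?z) \<in> K"
    using csubD[OF lc_2_K car(1) normal_inv[OF lc_normal cm_lc_2[OF car(3,2)]]] .
  have "(cm s g \<otimes> ?k \<otimes> inv (cm s g)) \<otimes> ((cm s g \<otimes> (g \<otimes> ?z \<otimes> inv g)) \<otimes> cm g (inv ?z)) \<in> K"
    by (rule normal_mult[OF K_normal normal_conj[OF K_normal cm_closed[OF car(3,1)] k] normal_mult[OF K_normal 1 2]])
  also have "(cm s g \<otimes> ?k \<otimes> inv (cm s g)) \<otimes> ((cm s g \<otimes> (g \<otimes> ?z \<otimes> inv g)) \<otimes> cm g (inv ?z)) =
      cm s g \<otimes> (?k \<otimes> ?z)"
    using car p(1) by (simp add: m_assoc commutator_def[of G g "inv ?z"])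
  also have "?k \<otimes> ?z = cm t h"
    unfolding p(2) using car p(1) by (simp add: cm_mult_left)
  finally show ?thesis .
qed

lemma lc_3_upper: "lc 3 \<subseteq> PP (lc 2) K"
proof -
  have "gcomm (PP P (lc 2)) \<subseteq> PP (lc 2) K"
  proof (rule gcomm_PP_subset[OF P_normal])
    show "PP (lc 2) K \<lhd> G"
      by (rule PP_normal[OF lc_normal K_normal K_lc_2 lc_2_K])
  next
    fix g h assume g: "g \<in> P" and h: "h \<in> P" and gh: "g \<otimes> h \<in> lc 2"
      and pc: "pr (h \<otimes> inv g) (g \<otimes> inv h) \<in> carrier G"
    have car: "g \<in> carrier G" "h \<in> carrier G" using g h by (auto simp: P_def)
    have "g \<otimes> g \<in> lc 2" if "g \<in> P" for g
      using that by (auto simp: P_def square_lc_2)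
    note diff = PP_diff[OF P_normal lc_normal this g h gh]
    have "h \<otimes> inv g \<otimes> (g \<otimes> inv h) = \<one>" using car by (simp add: m_assoc)
    then show "pr (h \<otimes> inv g) (g \<otimes> inv h) \<in> PP (lc 2) K"
      using diff pc by (intro PP_I) (auto simp: normal_one[OF K_normal])
  next
    fix s t g h assume st: "(s, t) \<in> secs" and gh: "g \<in> P" "h \<in> P" "g \<otimes> h \<in> lc 2"
      and pc: "pr (cm s g) (cm t h) \<in> carrier G"
    then show "pr (cm s g) (cm t h) \<in> PP (lc 2) K"
      using secs_pr[OF st] by (intro PP_I secs_product_K cm_lc_2) (auto simp: P_def)
  qed
  then show ?thesis
    unfolding lc_3 using gcomm_mono[OF lc_2_sections] by blast
qed

text \<open>Such a pair either has both sections in \<open>K\<close>, and is then built from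
  conjugates of \<open>(1, x)\<close> and their swaps, or becomes one of this kind after
  multiplication by \<open>(u, u\<^sup>-\<^sup>1) = x\<^sup>2\<close>. So two elements
  decide.\<close>

lemma PP_lc_2_K_least:
  assumes N: "N \<lhd> G" and xx: "x \<otimes> x \<in> N" and x1: "pr \<one> x \<in> N"
    and g: "g \<in> lc 2" and h: "h \<in> lc 2" and gh: "g \<otimes> h \<in> K"
  shows "pr g h \<in> N"
proof -
  have U: "snd_part N \<lhd> G" by (rule snd_part_normal[OF N])
  have "K \<subseteq> snd_part N"
    by (rule K_least[OF U]) (simp add: snd_part_def x1)
  then have KK: "pr g h \<in> N" if "g \<in> K" "h \<in> K" for g h
  proof -
    have 1: "pr \<one> g \<in> N" "pr \<one> h \<in> N" and car: "g \<in> carrier G" "h \<in> carrier G"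
      using \<open>K \<subseteq> snd_part N\<close> that by (auto simp: snd_part_def)
    have "pr g \<one> \<otimes> pr \<one> h \<in> N"
      using pr_swap[OF _ _ 1(1) N] 1 car by (intro normal_mult[OF N]) auto
    then show ?thesis using car by (simp add: pr_mult)
  qed
  have car: "g \<in> carrier G" "h \<in> carrier G" using g h lc_carrier by auto
  from lc_2_cases[OF g] show ?thesis
  proof
    assume gK: "g \<in> K"
    then have "h \<in> K" using normal_cancel_left[OF K_normal gK _ gh] car by simp
    then show ?thesis using gK KK by simp
  next
    assume ug: "u \<otimes> g \<in> K"
    have "cm u g \<otimes> (g \<otimes> h) \<in> K"
      by (rule normal_mult[OF K_normal csubD[OF lc_2_K u_carrier g] gh])
    then have "(u \<otimes> g) \<otimes> (inv u \<otimes> h) \<in> K" using car by (simp add: word_simps)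
    then have "inv u \<otimes> h \<in> K" using normal_cancel_left[OF K_normal ug] car by simp
    then have 1: "pr (u \<otimes> g) (inv u \<otimes> h) \<in> N" using ug KK by simp
    have eq: "inv (x \<otimes> x) = pr (inv u) u"
    proof -
      have "x \<otimes> x = pr u (inv u)"
        by (subst (1 2) x_pr) (simp add: pr_mult u_def inv_mult_group)
      moreover have "x \<otimes> x \<in> carrier G" by simp
      ultimately show ?thesis by (metis inv_inv pr_inv u_carrier inv_closed)
    qed
    have "pr (inv u) u \<otimes> pr (u \<otimes> g) (inv u \<otimes> h) \<in> N"
      using normal_mult[OF N normal_inv[OF N xx] 1] by (simp only: eq)
    then show ?thesis using car by (simp add: pr_mult)
  qed
qed

lemma cm_d_x: "cm d x = pr \<one> (inv x)"
proof -
  have "pr \<one> b \<in> carrier G" "pr y1 (inv y1) \<in> carrier G" by (simp_all flip: d_pr x_pr)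
  then have "cm (pr \<one> b) (pr y1 (inv y1)) = pr (cm \<one> y1) (cm b (inv y1))"
    by (intro cm_pr) auto
  moreover have "cm b (inv y1) = inv x" by (simp add: inv_y1 x_def grig_simps)
  ultimately show ?thesis by (simp flip: d_pr x_pr)
qed

lemma cm_ab_x: "cm a x = inv (x \<otimes> x)" "cm b x = inv (x \<otimes> x)"
  by (simp_all add: x_def grig_simps)

lemma square_from_inv: "N \<lhd> G \<Longrightarrow> g \<in> carrier G \<Longrightarrow> inv g \<in> N \<Longrightarrow> g \<in> N"
  using normal_inv[of N "inv g"] by simp

lemma gcomm_K_gens: "x \<otimes> x \<in> gcomm K" "pr \<one> x \<in> gcomm K"
proof -
  have N: "gcomm K \<lhd> G" by (rule gcomm_normal[OF K_normal])
  have "inv (x \<otimes> x) \<in> gcomm K"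
    unfolding cm_ab_x(1)[symmetric] by (intro gcomm_incl x_K) simp
  moreover have "x \<otimes> x \<in> carrier G" by simp
  ultimately show "x \<otimes> x \<in> gcomm K" using square_from_inv[OF N, of "x \<otimes> x"] by blast
  have 1: "pr \<one> (inv x) \<in> gcomm K"
    unfolding cm_d_x[symmetric] by (intro gcomm_incl x_K) simp
  then have "inv (pr \<one> (inv x)) \<in> gcomm K" by (rule normal_inv[OF N])
  then show "pr \<one> x \<in> gcomm K"
    using normal_carrier[OF N 1] by (simp add: pr_inv)
qed

text \<open>A circle of inclusions \<open>PP (lc 2) K \<subseteq> gcomm K \<subseteq> lc 3
  \<subseteq> PP (lc 2) K\<close>; in particular the coset of \<open>u\<close> contributes no
  further commutators.\<close>

lemma lc_3_eq: "lc 3 = PP (lc 2) K" and gcomm_K: "gcomm K = lc 3"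
proof -
  have "PP (lc 2) K \<subseteq> gcomm K"
    by (auto elim!: PP_E intro!: PP_lc_2_K_least[OF gcomm_normal[OF K_normal] gcomm_K_gens])
  moreover have "gcomm K \<subseteq> lc 3"
    unfolding lc_3 by (rule gcomm_mono[OF K_lc_2])
  ultimately show "lc 3 = PP (lc 2) K" "gcomm K = lc 3"
    using lc_3_upper by auto
qed

lemma pr_lc_3: "g \<in> lc 2 \<Longrightarrow> h \<in> lc 2 \<Longrightarrow> g \<otimes> h \<in> K \<Longrightarrow> pr g h \<in> lc 3"
  using PP_lc_2_K_least[OF lc_normal] gcomm_K_gens unfolding gcomm_K by blast

lemma pr_carrier: "g \<in> lc 2 \<Longrightarrow> h \<in> lc 2 \<Longrightarrow> g \<otimes> h \<in> K \<Longrightarrow> pr g h \<in> carrier G"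
  using pr_lc_3 lc_carrier by blast

lemma pr_carrier_K: "g \<in> K \<Longrightarrow> h \<in> K \<Longrightarrow> pr g h \<in> carrier G"
  using K_lc_2 normal_mult[OF K_normal] by (intro pr_carrier) auto

lemma K_snd_lc_3: "K \<subseteq> snd_part (lc 3)"
proof (rule K_least[OF snd_part_normal[OF lc_normal]])
  show "x \<in> snd_part (lc 3)"
    using gcomm_K_gens(2) by (simp add: snd_part_def gcomm_K)
qed

lemma K_cases: "g \<in> K \<Longrightarrow> g \<in> lc 3 \<or> x \<otimes> g \<in> lc 3"
proof -
  let ?Y = "{g \<in> carrier G. g \<in> lc 3 \<or> x \<otimes> g \<in> lc 3}"
  have xx: "x \<otimes> x \<in> lc 3" using gcomm_K_gens(1) by (simp add: gcomm_K)
  have "cm s x \<in> lc 3" if "s \<in> gs" for s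
    using that gs_carrier x_K unfolding gcomm_K[symmetric] by (intro gcomm_incl) auto
  then have "?Y \<lhd> G"
    by (intro extend_normal[OF gs_carrier generated inv_gs lc_normal x_carrier xx])
  then have "K \<subseteq> ?Y"
    by (rule K_least) (simp add: xx)
  then show "g \<in> K \<Longrightarrow> g \<in> lc 3 \<or> x \<otimes> g \<in> lc 3" by blast
qed

lemma lc_4_eq: "lc 4 = PP K (lc 3)"
proof
  have 4: "lc 4 = gcomm (lc 3)"
    using lc_Suc[of 3] by simp
  show "PP K (lc 3) \<subseteq> lc 4"
    using PP_subset_gcomm[OF lc_normal K_normal K_snd_lc_3] unfolding gcomm_K 4 .
  have "gcomm (PP (lc 2) K) \<subseteq> PP K (lc 3)"
  proof (rule gcomm_PP_subset[OF lc_normal])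
    show "PP K (lc 3) \<lhd> G"
      by (rule PP_normal[OF K_normal lc_normal lc_3_K])
        (auto simp: csub_def gcomm_K[symmetric] gcomm_incl)
  next
    fix g h assume g: "g \<in> lc 2" and h: "h \<in> lc 2" and gh: "g \<otimes> h \<in> K"
      and pc: "pr (h \<otimes> inv g) (g \<otimes> inv h) \<in> carrier G"
    have car: "g \<in> carrier G" "h \<in> carrier G" using g h lc_carrier by auto
    have "g \<otimes> g \<in> K" if "g \<in> lc 2" for g
      using that K_square lc_3_K by auto
    note diff = PP_diff[OF lc_normal K_normal this g h gh]
    have "h \<otimes> inv g \<otimes> (g \<otimes> inv h) = \<one>" using car by (simp add: m_assoc)
    then show "pr (h \<otimes> inv g) (g \<otimes> inv h) \<in> PP K (lc 3)"
      using diff pc by (intro PP_I) (auto simp: normal_one[OF lc_normal])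
  next
    fix s t g h assume st: "(s, t) \<in> secs" and gh: "g \<in> lc 2" "h \<in> lc 2" "g \<otimes> h \<in> K"
      and pc: "pr (cm s g) (cm t h) \<in> carrier G"
    have "cm s g \<in> lc 3" "cm t h \<in> lc 3"
      using gh secs_pr[OF st] unfolding lc_3 by (auto intro: gcomm_incl)
    then show "pr (cm s g) (cm t h) \<in> PP K (lc 3)"
      using pc lc_3_K by (intro PP_I normal_mult[OF lc_normal]) auto
  qed
  then show "lc 4 \<subseteq> PP K (lc 3)"
    unfolding 4 lc_3_eq[symmetric] .
qed

lemma lc_5_eq: "lc 5 = PP (lc 3) (lc 3)"
proof
  have 5: "lc 5 = gcomm (PP K (gcomm K))"
    using lc_Suc[of 4] by (simp add: lc_4_eq gcomm_K)
  have N: "PP K (gcomm K) \<lhd> G"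
    unfolding gcomm_K lc_4_eq[symmetric] by (rule lc_normal)
  show "PP (lc 3) (lc 3) \<subseteq> lc 5"
    unfolding 5 gcomm_K[symmetric]
  proof (rule PP_square_subset_gcomm[OF K_normal N])
    fix g h assume "g \<in> K" "h \<in> K"
    then show "pr g h \<in> carrier G" by (rule pr_carrier_K)
  next
    fix U assume U: "U \<lhd> G" and sub: "gcomm (gcomm K) \<subseteq> U" and bU: "\<And>g. g \<in> K \<Longrightarrow> cm b g \<in> U"
    let ?C = "{g \<in> carrier G. cm a g \<in> U}"
    have C: "subgroup ?C G" by (rule centralizer_subgroup[OF U]) simp
    \<comment> \<open>\<open>[a, x]\<close> and \<open>[b, x]\<close> coincide, so the known bracket
      with \<open>b\<close> controls the one with \<open>a\<close>; every element of
      \<open>K\<close> lies in \<open>lc 3\<close> up to a factor \<open>x\<close>.\<close>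
    have xC: "inv x \<in> ?C"
      using bU[OF x_K] cm_ab_x by (intro subgroup.m_inv_closed[OF C]) auto
    have lC: "g \<in> ?C" if "g \<in> lc 3" for g
      using sub that gcomm_incl[of a g "lc 3"] lc_carrier by (auto simp: gcomm_K)
    have "cm a g \<in> U" if "g \<in> K" for g
    proof -
      have gc: "g \<in> carrier G" using that normal_carrier[OF K_normal] by blast
      from K_cases[OF that] show ?thesis
      proof
        assume "x \<otimes> g \<in> lc 3"
        then have "inv x \<otimes> (x \<otimes> g) \<in> ?C"
          by (intro subgroup.m_closed[OF C xC] lC)
        then show ?thesis using gc by simp
      qed (use lC in auto)
    qed
    then show "(\<forall>g\<in>K. cm a g \<in> U) \<or> (\<forall>g\<in>K. cm c g \<in> U)" by blast
  qed
  show "lc 5 \<subseteq> PP (lc 3) (lc 3)"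
    unfolding 5 gcomm_K
  proof (rule gcomm_PP_subset[OF K_normal])
    show "PP (lc 3) (lc 3) \<lhd> G"
      by (rule PP_normal[OF lc_normal lc_normal]) (auto simp: csub_def normal_cm_right[OF lc_normal])
  next
    fix g h assume g: "g \<in> K" and h: "h \<in> K" and gh: "g \<otimes> h \<in> lc 3"
      and pc: "pr (h \<otimes> inv g) (g \<otimes> inv h) \<in> carrier G"
    have "g \<otimes> g \<in> lc 3" if "g \<in> K" for g
      using that K_square K_lc_2 by auto
    note diff = PP_diff[OF K_normal lc_normal this g h gh]
    show "pr (h \<otimes> inv g) (g \<otimes> inv h) \<in> PP (lc 3) (lc 3)"
      by (rule PP_square_I[OF lc_normal diff pc])
  next
    fix s t g h assume st: "(s, t) \<in> secs" and gh: "g \<in> K" "h \<in> K"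
      and pc: "pr (cm s g) (cm t h) \<in> carrier G"
    have "cm s g \<in> lc 3" "cm t h \<in> lc 3"
      using gh secs_pr[OF st] unfolding gcomm_K[symmetric] by (auto intro: gcomm_incl)
    then show "pr (cm s g) (cm t h) \<in> PP (lc 3) (lc 3)"
      using pc by (intro PP_I normal_mult[OF lc_normal]) auto
  qed
qed

section \<open>Doubling recursion for the lower central series\<close>

lemma lc_K: "3 \<le> n \<Longrightarrow> lc n \<subseteq> K"
  using lc_antimono[of 3 n] lc_3_K by auto

lemma pr_carrier_lc: "3 \<le> n \<Longrightarrow> g \<in> lc n \<Longrightarrow> h \<in> lc n \<Longrightarrow> pr g h \<in> carrier G"
  using lc_K pr_carrier_K by blast

lemma lc_gcomm: "1 \<le> n \<Longrightarrow> csub (carrier G) (lc n) (lc (Suc n))"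
  by (simp add: csub_def lc_cm_carrier)

text \<open>One step of the series advances one of the two parameters of \<open>PP\<close>: from
  \<open>PP (lc k) (lc k)\<close> commutators drive the product one degree deeper, from
  \<open>PP (lc l) (lc (Suc l))\<close> they drive the sections themselves deeper. The recursion
  starts at \<open>k = 3\<close>, that is at \<open>lc 5\<close>, because \<open>lc 3\<close> and
  \<open>lc 4\<close> involve \<open>K\<close>, which lies between \<open>lc 2\<close> and
  \<open>lc 3\<close>.\<close>

lemma lc_double: "3 \<le> k \<Longrightarrow> lc (2 * k - 1) = PP (lc k) (lc k) \<and> lc (2 * k) = PP (lc k) (lc (Suc k))"
proof (induction k rule: less_induct)
  case (less k)
  have k: "1 \<le> k" "1 \<le> 2 * k - 1" using less.prems by auto
  have odd: "lc (2 * k - 1) = PP (lc k) (lc k)"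
  proof (cases "k = 3")
    case True
    then show ?thesis by (simp add: lc_5_eq)
  next
    case False
    define l where "l = k - 1"
    have l: "k = Suc l" "3 \<le> l" "l < k" using False less.prems by (auto simp: l_def)
    have even: "lc (2 * l) = PP (lc l) (lc (Suc l))"
      using less.IH[OF l(3,2)] by simp
    have gl: "gcomm (lc l) = lc (Suc l)" using lc_Suc[of l] l by simp
    have eq: "lc (2 * k - 1) = gcomm (PP (lc l) (gcomm (lc l)))"
      using lc_Suc[of "2 * l"] l by (simp add: even gl)
    have N: "PP (lc l) (gcomm (lc l)) \<lhd> G"
      unfolding gl even[symmetric] by (rule lc_normal)
    show ?thesis
      unfolding eq
    proof
      show "PP (lc k) (lc k) \<subseteq> gcomm (PP (lc l) (gcomm (lc l)))"
        unfolding l(1) gl[symmetric]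
      proof (rule PP_square_subset_gcomm[OF lc_normal N])
        fix g h assume "g \<in> lc l" "h \<in> lc l"
        then show "pr g h \<in> carrier G" using l pr_carrier_lc by blast
      next
        fix U assume U: "U \<lhd> G" and "gcomm (gcomm (lc l)) \<subseteq> U"
        then have sub: "lc (Suc (Suc l)) \<subseteq> U" using lc_Suc[of "Suc l"] by (simp add: gl)
        \<comment> \<open>The bracket with \<open>c = (a, d)\<close> raises both sections by one
          degree, which for odd \<open>l\<close> amounts to two degrees. For even \<open>l\<close>
          the bracket with \<open>a\<close> does the same, as it yields deeper sections with trivial
          product. Indices 3 and 4 are separate because their sections lie in \<open>lc 2\<close>
          and \<open>K\<close>.\<close>
        consider "l = 3" | "l = 4" | "odd l" "5 \<le> l" | "even l" "5 \<le> l" using l by (cases "odd l") force+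
        then show "(\<forall>g\<in>lc l. cm a g \<in> U) \<or> (\<forall>g\<in>lc l. cm c g \<in> U)"
        proof cases
          case 1
          have "cm c g \<in> U" if g: "g \<in> lc l" for g
          proof -
            obtain p q where g: "g = pr p q" "p \<in> lc 2" "q \<in> lc 2" "pr p q \<in> carrier G"
              using g 1 lc_3_eq by (auto elim: PP_E)
            have car: "p \<in> carrier G" "q \<in> carrier G" using g lc_carrier by auto
            have "cm (pr a d) (pr p q) = pr (cm a p) (cm d q)"
              using g car by (intro cm_pr) (auto simp flip: c_pr)
            then have "cm c g = pr (cm a p) (cm d q)" by (simp add: g flip: c_pr)
            moreover have "cm c g \<in> carrier G" using g by simp
            ultimately have "cm c g \<in> PP (lc 3) (lc 3)"
              using g unfolding lc_3 by (auto intro!: PP_I normal_mult[OF gcomm_normal[OF lc_normal]] gcomm_incl)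
            then show ?thesis using sub 1 lc_5_eq by auto
          qed
          then show ?thesis by blast
        next
          case 2
          have "cm a g \<in> U" if g: "g \<in> lc l" for g
          proof -
            obtain p q where g: "g = pr p q" "p \<in> K" "q \<in> K" "p \<otimes> q \<in> lc 3" "pr p q \<in> carrier G"
              using g 2 lc_4_eq by (auto elim: PP_E)
            have car: "p \<in> carrier G" "q \<in> carrier G" using g normal_carrier[OF K_normal] by auto
            have "g \<otimes> g \<in> lc 3" if "g \<in> K" for g
              using that K_square K_lc_2 by auto
            note diff = PP_diff[OF K_normal lc_normal this g(2-4)]
            have eq: "cm a g = pr (q \<otimes> inv p) (p \<otimes> inv q)" using g car by (simp add: cm_a_pr)
            moreover have "cm a g \<in> carrier G" using g by simp
            moreover have "q \<otimes> inv p \<otimes> (p \<otimes> inv q) = \<one>" using car by (simp add: m_assoc)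
            ultimately have "cm a g \<in> PP (lc 3) (lc 4)"
              using diff by (auto intro!: PP_I normal_one[OF lc_normal])
            moreover have "lc 6 = PP (lc 3) (lc 4)"
              using less.IH[of 3] l 2 by simp
            ultimately show ?thesis using sub 2 by auto
          qed
          then show ?thesis by blast
        next
          case 3
          then obtain m where m: "l = 2 * m - 1" "3 \<le> m" "m < k" "Suc m < k"
            using l by (auto elim!: oddE intro: that[of "(l + 1) div 2"])
          have "cm c g \<in> U" if g: "g \<in> lc l" for g
          proof -
            obtain p q where g: "g = pr p q" "p \<in> lc m" "q \<in> lc m" "pr p q \<in> carrier G"
              using g less.IH[OF m(3,2)] m(1) by (auto elim: PP_E)
            have car: "p \<in> carrier G" "q \<in> carrier G" using g lc_carrier by auto
            have "cm (pr a d) (pr p q) = pr (cm a p) (cm d q)"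
              using g car by (intro cm_pr) (auto simp flip: c_pr)
            then have "cm c g = pr (cm a p) (cm d q)" by (simp add: g flip: c_pr)
            moreover have "cm c g \<in> carrier G" using g by simp
            ultimately have "cm c g \<in> PP (lc (Suc m)) (lc (Suc m))"
              using g m by (auto intro!: PP_I normal_mult[OF lc_normal] lc_cm_carrier)
            moreover have "2 * Suc m - 1 = Suc (Suc l)" using m by simp
            ultimately show ?thesis using sub less.IH[OF m(4)] m by auto
          qed
          then show ?thesis by blast
        next
          case 4
          then obtain m where m: "l = 2 * m" "3 \<le> m" "m < k" "Suc m < k"
            using l by (auto elim!: evenE)
          have "cm a g \<in> U" if g: "g \<in> lc l" for g
          proof -
            obtain p q where g: "g = pr p q" "p \<in> lc m" "q \<in> lc m" "p \<otimes> q \<in> lc (Suc m)" "pr p q \<in> carrier G"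
              using g less.IH[OF m(3,2)] m(1) by (auto elim: PP_E)
            have car: "p \<in> carrier G" "q \<in> carrier G" using g lc_carrier by auto
            have "g \<otimes> g \<in> lc (Suc m)" if "g \<in> lc m" for g
              using that lc_square' m by simp
            note diff = PP_diff[OF lc_normal lc_normal this g(2-4)]
            have eq: "cm a g = pr (q \<otimes> inv p) (p \<otimes> inv q)" using g car by (simp add: cm_a_pr)
            moreover have "cm a g \<in> carrier G" using g by simp
            moreover have "q \<otimes> inv p \<otimes> (p \<otimes> inv q) = \<one>" using car by (simp add: m_assoc)
            ultimately have "cm a g \<in> PP (lc (Suc m)) (lc (Suc (Suc m)))"
              using diff by (auto intro!: PP_I normal_one[OF lc_normal])
            moreover have "2 * Suc m = Suc (Suc l)" using m by simp
            ultimately show ?thesis using sub less.IH[OF m(4)] m by auto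
          qed
          then show ?thesis by blast
        qed
      qed
      show "gcomm (PP (lc l) (gcomm (lc l))) \<subseteq> PP (lc k) (lc k)"
        unfolding gl l(1)
      proof (rule gcomm_PP_subset[OF lc_normal])
        show "PP (lc (Suc l)) (lc (Suc l)) \<lhd> G"
          by (rule PP_normal[OF lc_normal lc_normal]) (auto simp: csub_def normal_cm_right[OF lc_normal])
      next
        fix g h assume g: "g \<in> lc l" and h: "h \<in> lc l" and gh: "g \<otimes> h \<in> lc (Suc l)"
          and pc: "pr (h \<otimes> inv g) (g \<otimes> inv h) \<in> carrier G"
        have "g \<otimes> g \<in> lc (Suc l)" if "g \<in> lc l" for g
          using that lc_square' l by simp
        note diff = PP_diff[OF lc_normal lc_normal this g h gh]
        show "pr (h \<otimes> inv g) (g \<otimes> inv h) \<in> PP (lc (Suc l)) (lc (Suc l))"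
          by (rule PP_square_I[OF lc_normal diff pc])
      next
        fix s t g h assume st: "(s, t) \<in> secs" and gh: "g \<in> lc l" "h \<in> lc l"
          and pc: "pr (cm s g) (cm t h) \<in> carrier G"
        have "cm s g \<in> lc (Suc l)" "cm t h \<in> lc (Suc l)"
          using gh secs_pr[OF st] l by (auto intro!: lc_cm_carrier)
        then show "pr (cm s g) (cm t h) \<in> PP (lc (Suc l)) (lc (Suc l))"
          using pc by (intro PP_I normal_mult[OF lc_normal]) auto
      qed
    qed
  qed
  have gk: "gcomm (lc k) = lc (Suc k)" using lc_Suc[of k] k by simp
  have eq: "lc (2 * k) = gcomm (lc (2 * k - 1))"
    using lc_Suc[OF k(2)] k by (simp add: Suc_diff_le)
  have N: "PP (lc k) (lc k) \<lhd> G" unfolding odd[symmetric] by (rule lc_normal)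
  have snd: "lc k \<subseteq> snd_part (PP (lc k) (lc k))"
  proof
    fix h assume h: "h \<in> lc k"
    then have "pr \<one> h \<in> PP (lc k) (lc k)"
      using pr_carrier_lc[OF less.prems] lc_carrier by (intro PP_I) (auto simp: normal_one[OF lc_normal])
    then show "h \<in> snd_part (PP (lc k) (lc k))" using h lc_carrier by (auto simp: snd_part_def)
  qed
  have "lc (2 * k) = PP (lc k) (lc (Suc k))"
    unfolding eq odd
  proof
    show "PP (lc k) (lc (Suc k)) \<subseteq> gcomm (PP (lc k) (lc k))"
      using PP_subset_gcomm[OF N lc_normal snd] unfolding gk .
    show "gcomm (PP (lc k) (lc k)) \<subseteq> PP (lc k) (lc (Suc k))"
    proof (rule gcomm_PP_subset[OF lc_normal])
      show "PP (lc k) (lc (Suc k)) \<lhd> G"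
        by (rule PP_normal[OF lc_normal lc_normal lc_Suc_subset lc_gcomm[OF k(1)]])
    next
      fix g h assume g: "g \<in> lc k" and h: "h \<in> lc k"
        and pc: "pr (h \<otimes> inv g) (g \<otimes> inv h) \<in> carrier G"
      have car: "g \<in> carrier G" "h \<in> carrier G" using g h lc_carrier by auto
      have "h \<otimes> inv g \<in> lc k" "g \<otimes> inv h \<in> lc k"
        using g h by (auto intro!: normal_mult[OF lc_normal] normal_inv[OF lc_normal])
      then show "pr (h \<otimes> inv g) (g \<otimes> inv h) \<in> PP (lc k) (lc (Suc k))"
        by (rule PP_diff_I[OF lc_normal _ _ car pc])
    next
      fix s t g h assume st: "(s, t) \<in> secs" and gh: "g \<in> lc k" "h \<in> lc k"
        and pc: "pr (cm s g) (cm t h) \<in> carrier G"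
      have 1: "cm s g \<in> lc (Suc k)" "cm t h \<in> lc (Suc k)"
        using gh secs_pr[OF st] k by (auto intro!: lc_cm_carrier)
      then show "pr (cm s g) (cm t h) \<in> PP (lc k) (lc (Suc k))"
        using pc lc_Suc_subset by (intro PP_I normal_mult[OF lc_normal]) auto
    qed
  qed
  with odd show ?case by simp
qed

end

section \<open>Representatives of layers, and chains with steps of index at most two\<close>

context grig_group
begin

text \<open>The element \<open>yv n\<close> represents the layer of index \<open>n\<close>; its symbol is nonzero in degree \<open>n\<close>.\<close>

function yv :: "nat \<Rightarrow> 'a"
  where "yv n = (if n \<le> 1 then y1 else if odd n then pr (yv ((n + 1) div 2)) \<one>
    else pr (yv (n div 2)) (inv (yv (n div 2))))"
  by auto
termination
  by (relation "measure (\<lambda>n. n)") (auto elim!: oddE)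

declare yv.simps [simp del]

lemma yv_1: "yv 1 = y1" and yv_odd: "1 \<le> k \<Longrightarrow> yv (2 * k + 1) = pr (yv (k + 1)) \<one>"
  and yv_even: "1 \<le> k \<Longrightarrow> yv (2 * k) = pr (yv k) (inv (yv k))"
  by (subst yv.simps; simp)+

lemma yv_2: "yv 2 = x"
  using yv_even[of 1] by (simp add: yv_1[simplified] x_pr)

lemma lc_odd: "3 \<le> k \<Longrightarrow> lc (2 * k - 1) = PP (lc k) (lc k)" and lc_even: "3 \<le> k \<Longrightarrow> lc (2 * k) = PP (lc k) (lc (Suc k))"
  using lc_double by auto

text \<open>Pairs double the index: by \<open>lc_odd\<close>, \<open>(y, 1)\<close> has index
  \<open>2k + 1\<close> if \<open>y\<close> has index \<open>k + 1\<close>, and by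
  \<open>lc_even\<close>, \<open>(y, y\<^sup>-\<^sup>1)\<close> has index \<open>2k\<close> if
  \<open>y\<close> has index \<open>k\<close>. Indices up to 4 precede that recursion.\<close>

lemma yv_lc: "1 \<le> n \<Longrightarrow> yv n \<in> lc n"
proof (induction n rule: less_induct)
  case (less n)
  consider "n = 1" | "n = 2" | "n = 3" | "n = 4" | "5 \<le> n" using less.prems by linarith
  then show ?case
  proof cases
    case 1
    then show ?thesis by (simp add: yv_1[simplified])
  next
    case 2
    then show ?thesis using K_lc_2 x_K by (auto simp: yv_2)
  next
    case 3
    have y: "yv 3 = pr x \<one>" using yv_odd[of 1] by (simp add: yv_2[simplified] numeral_2_eq_2[symmetric] numeral_3_eq_3[symmetric])
    have "pr x \<one> \<in> lc 3"
      using x_K K_lc_2 normal_one[OF lc_normal] by (intro pr_lc_3) auto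
    then show ?thesis using 3 y by simp
  next
    case 4
    have y: "yv 4 = pr x (inv x)" using yv_even[of 2] by (simp add: yv_2)
    have "pr x (inv x) \<in> lc 4"
      unfolding lc_4_eq using x_K normal_inv[OF K_normal x_K]
      by (intro PP_I pr_carrier_K) (auto simp: normal_one[OF lc_normal])
    then show ?thesis using 4 y by simp
  next
    case 5
    show ?thesis
    proof (cases "odd n")
      case True
      then obtain k where k: "n = 2 * k + 1" by (auto elim: oddE)
      then have k2: "2 \<le> k" "k + 1 < n" using 5 by auto
      then have y: "yv (k + 1) \<in> lc (k + 1)" using less.IH by simp
      have "pr (yv (k + 1)) \<one> \<in> PP (lc (k + 1)) (lc (k + 1))"
        using y k2 normal_one[OF lc_normal] by (intro PP_square_I[OF lc_normal] pr_carrier_lc[of "k + 1"]) auto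
      then show ?thesis using k k2 lc_odd[of "k + 1"] yv_odd[of k] by simp
    next
      case False
      then obtain k where k: "n = 2 * k" by (auto elim: evenE)
      then have k3: "3 \<le> k" "k < n" using 5 by auto
      then have y: "yv k \<in> lc k" using less.IH by simp
      then have "pr (yv k) (inv (yv k)) \<in> PP (lc k) (lc (Suc k))"
        using k3 normal_inv[OF lc_normal y] lc_carrier
        by (intro PP_I pr_carrier_lc[of k]) (auto simp: normal_one[OF lc_normal])
      then show ?thesis using k k3 lc_even[of k] yv_even[of k] by simp
    qed
  qed
qed

lemma yv_carrier: "1 \<le> n \<Longrightarrow> yv n \<in> carrier G"
  using yv_lc lc_carrier by blast

lemma yv_dims: "1 \<le> n \<Longrightarrow> yv n \<in> dims n"
  using yv_lc lc_subset_dims by blast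

text \<open>One application of these two lemmas to each of the inclusions in a chain doubles its length.\<close>

lemma PP_outer_step:
  assumes A: "\<And>g. g \<in> A \<Longrightarrow> g \<in> carrier G" and y: "y \<in> carrier G" "pr y \<one> \<in> carrier G"
    and AB: "\<And>g. g \<in> A' \<Longrightarrow> g \<in> B \<or> inv y \<otimes> g \<in> B" and yA: "y \<in> A" and N: "A \<lhd> G"
    and g: "g \<in> PP A A'"
  shows "g \<in> PP A B \<or> inv (pr y \<one>) \<otimes> g \<in> PP A B"
proof -
  obtain p q where pq: "g = pr p q" "p \<in> A" "q \<in> A" "p \<otimes> q \<in> A'" "pr p q \<in> carrier G"
    using g by (auto elim: PP_E)
  have car: "p \<in> carrier G" "q \<in> carrier G" using pq A by auto
  from AB[OF pq(4)] show ?thesis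
  proof
    assume "p \<otimes> q \<in> B"
    then show ?thesis using pq by (simp add: PP_I)
  next
    assume B: "inv y \<otimes> (p \<otimes> q) \<in> B"
    have eq: "inv (pr y \<one>) \<otimes> g = pr (inv y \<otimes> p) q"
      using y car pq by (simp add: pr_inv pr_mult)
    have "inv y \<otimes> p \<in> A" using yA pq by (intro normal_mult[OF N] normal_inv[OF N])
    moreover have "inv (pr y \<one>) \<otimes> g \<in> carrier G" using y pq by simp
    ultimately show ?thesis using B pq y car unfolding eq by (auto intro!: PP_I simp: m_assoc)
  qed
qed

lemma PP_inner_step:
  assumes A: "A \<lhd> G" and B: "B \<lhd> G" and D: "D \<lhd> G" and DB: "D \<subseteq> B" and y: "y \<in> A" "pr y (inv y) \<in> carrier G"
    and AB: "\<And>g. g \<in> A \<Longrightarrow> g \<in> B \<or> inv y \<otimes> g \<in> B" and AD: "csub (carrier G) A D"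
    and g: "g \<in> PP A D"
  shows "g \<in> PP B D \<or> inv (pr y (inv y)) \<otimes> g \<in> PP B D"
proof -
  obtain p q where pq: "g = pr p q" "p \<in> A" "q \<in> A" "p \<otimes> q \<in> D" "pr p q \<in> carrier G"
    using g by (auto elim: PP_E)
  have car: "p \<in> carrier G" "q \<in> carrier G" "y \<in> carrier G" using pq y A normal_carrier by auto
  from AB[OF pq(2)] show ?thesis
  proof
    assume p: "p \<in> B"
    have "q \<in> B" using normal_cancel_left[OF B p car(2)] pq(4) DB by blast
    then show ?thesis using p pq by (simp add: PP_I)
  next
    assume p: "inv y \<otimes> p \<in> B"
    have eq: "inv (pr y (inv y)) \<otimes> g = pr (inv y \<otimes> p) (y \<otimes> q)"
      using y car pq by (simp add: pr_inv pr_mult)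
    have "cm (inv y) p \<otimes> (p \<otimes> q) \<in> D"
      using normal_mult[OF D csubD[OF AD inv_closed[OF car(3)] pq(2)] pq(4)] .
    then have d: "(inv y \<otimes> p) \<otimes> (y \<otimes> q) \<in> D" using car by (simp add: word_simps)
    then have "y \<otimes> q \<in> B" using normal_cancel_left[OF B p _ subsetD[OF DB d]] car by simp
    moreover have "inv (pr y (inv y)) \<otimes> g \<in> carrier G" using y pq by simp
    ultimately show ?thesis using d p unfolding eq by (auto intro!: PP_I)
  qed
qed

lemma csub_PP:
  assumes A: "A \<lhd> G" and N: "N \<lhd> G" and BB: "B' \<lhd> G" and N_eq: "N = PP A' B'"
    and diff: "\<And>g h. g \<in> A \<Longrightarrow> h \<in> A \<Longrightarrow> g \<otimes> h \<in> B \<Longrightarrow> h \<otimes> inv g \<in> A' \<and> g \<otimes> inv h \<in> A'"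
    and AA: "csub (carrier G) A A'" "csub (carrier G) A B'"
  shows "csub (carrier G) (PP A B) N"
proof -
  have "gcomm (PP A B) \<subseteq> N"
  proof (rule gcomm_PP_subset[OF A N])
    fix g h assume "g \<in> A" "h \<in> A" "g \<otimes> h \<in> B" "pr (h \<otimes> inv g) (g \<otimes> inv h) \<in> carrier G"
    then show "pr (h \<otimes> inv g) (g \<otimes> inv h) \<in> N"
      using diff normal_carrier[OF A] unfolding N_eq by (intro PP_diff_I[OF BB]) auto
  next
    fix s t g h assume "(s, t) \<in> secs" "g \<in> A" "h \<in> A" and "pr (cm s g) (cm t h) \<in> carrier G"
    then show "pr (cm s g) (cm t h) \<in> N"
      using AA secs_pr unfolding N_eq by (intro PP_I normal_mult[OF BB]) (auto dest: csubD)
  qed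
  then show ?thesis by (auto simp: csub_def gcomm_incl)
qed

text \<open>
  To be proved for \<open>A\<close>, \<open>B\<close>, \<open>D\<close> the terms of index \<open>2i + 1\<close>, \<open>2i + 2\<close>, \<open>2i + 3\<close> of the dimension series; \<open>C\<close> is
  a subgroup between \<open>D\<close> and \<open>B\<close> which makes the recursion close up.
\<close>

definition quad :: "nat \<Rightarrow> 'a set \<Rightarrow> 'a set \<Rightarrow> 'a set \<Rightarrow> 'a set \<Rightarrow> bool"
  where "quad i A B C D \<longleftrightarrow>
    A \<lhd> G \<and> B \<lhd> G \<and> C \<lhd> G \<and> D \<lhd> G \<and> B \<subseteq> A \<and> C \<subseteq> B \<and> D \<subseteq> C \<and>
    csub (carrier G) A B \<and> csub (carrier G) B D \<and>
    (\<forall>g\<in>A. g \<otimes> g \<in> B) \<and> (\<forall>g\<in>B. g \<otimes> g \<in> D) \<and>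
    (\<forall>g\<in>B. g \<in> C \<or> inv (yv (i + 1) \<otimes> yv (i + 1)) \<otimes> g \<in> C) \<and>
    (\<forall>g\<in>C. g \<in> D \<or> inv (yv (2 * i + 2)) \<otimes> g \<in> D) \<and>
    yv (i + 1) \<otimes> yv (i + 1) \<in> B \<and> yv (2 * i + 2) \<in> C \<and>
    A \<subseteq> lc (i + 1) \<and> C \<subseteq> K \<and> B \<subseteq> lc 2 \<and>
    (1 \<le> i \<longrightarrow> C \<subseteq> lc (i + 2) \<and> csub (carrier G) A C \<and> A \<subseteq> lc 3 \<and> yv (2 * i + 1) \<in> A \<and>
      (\<forall>g\<in>A. g \<in> B \<or> inv (yv (2 * i + 1)) \<otimes> g \<in> B))"

lemma quadD:
  assumes "quad i A B C D"
  shows "A \<lhd> G" "B \<lhd> G" "C \<lhd> G" "D \<lhd> G" "B \<subseteq> A" "C \<subseteq> B" "D \<subseteq> C"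
    and "csub (carrier G) A B" "csub (carrier G) B D"
    and "\<And>g. g \<in> A \<Longrightarrow> g \<otimes> g \<in> B" "\<And>g. g \<in> B \<Longrightarrow> g \<otimes> g \<in> D"
    and "\<And>g. g \<in> B \<Longrightarrow> g \<in> C \<or> inv (yv (i + 1) \<otimes> yv (i + 1)) \<otimes> g \<in> C"
    and "\<And>g. g \<in> C \<Longrightarrow> g \<in> D \<or> inv (yv (2 * i + 2)) \<otimes> g \<in> D"
    and "yv (i + 1) \<otimes> yv (i + 1) \<in> B" "yv (2 * i + 2) \<in> C"
    and "A \<subseteq> lc (i + 1)" "C \<subseteq> K" "B \<subseteq> lc 2"
  using assms unfolding quad_def
  apply -
  apply (elim conjE, assumption)
  apply (elim conjE, assumption)
  apply (elim conjE, assumption)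
  apply (elim conjE, assumption)
  apply (elim conjE, assumption)
  apply (elim conjE, assumption)
  apply (elim conjE, assumption)
  apply (elim conjE, assumption)
  apply (elim conjE, assumption)
  apply (elim conjE, drule (1) bspec, assumption)
  apply (elim conjE, drule (1) bspec, assumption)
  apply (elim conjE, drule (1) bspec, assumption)
  apply (elim conjE, drule (1) bspec, assumption)
  apply (elim conjE, assumption)
  apply (elim conjE, assumption)
  apply (elim conjE, assumption)
  apply (elim conjE, assumption)
  apply (elim conjE, assumption)
  done

lemma quadD_pos:
  assumes "quad i A B C D" "1 \<le> i"
  shows "C \<subseteq> lc (i + 2)" "csub (carrier G) A C" "A \<subseteq> lc 3" "yv (2 * i + 1) \<in> A"
    and "\<And>g. g \<in> A \<Longrightarrow> g \<in> B \<or> inv (yv (2 * i + 1)) \<otimes> g \<in> B"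
  using assms unfolding quad_def
  apply -
  apply (elim conjE, drule (1) mp, elim conjE, assumption)
  apply (elim conjE, drule (1) mp, elim conjE, assumption)
  apply (elim conjE, drule (1) mp, elim conjE, assumption)
  apply (elim conjE, drule (1) mp, elim conjE, assumption)
  apply (elim conjE, drule (1) mp, elim conjE, drule (1) bspec, assumption)
  done

lemma csub_carrier_self: "N \<lhd> G \<Longrightarrow> csub (carrier G) N N"
  by (simp add: csub_def normal_cm_right)

text \<open>The start consists of degrees 1, 2, 3 with \<open>K\<close> inserted between
  \<open>lc 2\<close> and \<open>lc 3\<close>; the steps from \<open>lc 2\<close> down are
  represented by \<open>u = y1\<^sup>2\<close> and \<open>x\<close>. Nothing is claimed about
  representatives of \<open>G\<close> over \<open>lc 2\<close>, where three generators
  occur.\<close>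

lemma quad_0: "quad 0 (carrier G) (lc 2) K (lc 3)"
proof -
  have 1: "inv (yv (0 + 1) \<otimes> yv (0 + 1)) \<otimes> g \<in> K" if "g \<in> lc 2" "u \<otimes> g \<in> K" for g
  proof -
    have "inv (u \<otimes> u) \<otimes> (u \<otimes> g) \<in> K"
      using that by (intro normal_mult[OF K_normal _ that(2)] normal_inv[OF K_normal] u_square)
    then show ?thesis using lc_carrier[OF that(1)] by (simp add: yv_1[simplified] u_def[symmetric] inv_mult_group m_assoc)
  qed
  have 2: "inv (yv (2 * 0 + 2)) \<otimes> g \<in> lc 3" if "g \<in> K" "x \<otimes> g \<in> lc 3" for g
  proof -
    have "inv (x \<otimes> x) \<otimes> (x \<otimes> g) \<in> lc 3"
      using gcomm_K_gens(1) unfolding gcomm_K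
      by (intro normal_mult[OF lc_normal _ that(2)] normal_inv[OF lc_normal])
    then have "inv x \<otimes> g \<in> lc 3" using normal_carrier[OF K_normal that(1)] by (simp add: inv_mult_group m_assoc)
    then show ?thesis by (simp add: yv_2[simplified numeral_2_eq_2])
  qed
  have "csub (carrier G) (lc 2) (lc 3)"
    using lc_gcomm[of 2] by (simp add: numeral_3_eq_3)
  moreover have "csub (carrier G) (carrier G) (lc 2)"
    by (simp add: csub_def cm_lc_2)
  moreover have "\<forall>g\<in>lc 2. g \<in> K \<or> inv (yv (0 + 1) \<otimes> yv (0 + 1)) \<otimes> g \<in> K"
    using 1 lc_2_cases by blast
  moreover have "\<forall>g\<in>K. g \<in> lc 3 \<or> inv (yv (2 * 0 + 2)) \<otimes> g \<in> lc 3"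
    using 2 K_cases by blast
  moreover have "yv (0 + 1) \<otimes> yv (0 + 1) \<in> lc 2"
    using u_lc_2 by (simp add: yv_1[simplified] u_def)
  moreover have "yv (2 * 0 + 2) \<in> K"
    using x_K by (simp add: yv_2[simplified numeral_2_eq_2])
  ultimately show ?thesis
    unfolding quad_def
    using lc_normal K_normal normal_self K_lc_2 lc_3_K square_lc_2 K_square lc_carrier
    by auto
qed

lemma yv_square_odd: "1 \<le> i \<Longrightarrow> yv (2 * i + 1) \<otimes> yv (2 * i + 1) = pr (yv (i + 1) \<otimes> yv (i + 1)) \<one>"
  using yv_carrier[of "i + 1"] by (simp add: yv_odd[simplified] pr_mult)

lemma yv_square_even:
  "1 \<le> i \<Longrightarrow> yv (2 * i) \<otimes> yv (2 * i) = pr (yv i \<otimes> yv i) (inv (yv i \<otimes> yv i))"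
  using yv_carrier[of i] by (simp add: yv_even pr_mult inv_mult_group)

lemma square_product:
  assumes "g \<in> carrier G" "h \<in> carrier G"
  shows "(g \<otimes> g) \<otimes> (h \<otimes> h) = cm g (g \<otimes> h) \<otimes> ((g \<otimes> h) \<otimes> (g \<otimes> h))"
  using assms by (simp add: word_simps)

text \<open>For pairs from \<open>A\<close> the product runs through \<open>A\<close>,
  \<open>B\<close>, \<open>C\<close>, and then the sections drop to \<open>B\<close>. With
  \<open>y = yv (2 * i + 1)\<close> and \<open>z = yv (i + 1)\<close>, the steps are represented by
  \<open>(y, 1)\<close>, \<open>(z\<^sup>2, 1)\<close> and \<open>(y, y\<^sup>-\<^sup>1)\<close>.
  Positivity of \<open>i\<close> puts \<open>A\<close> inside \<open>K\<close>, so that all pairs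
  from \<open>A\<close> lie in \<open>G\<close>.\<close>

lemma quad_even:
  assumes i: "1 \<le> i" and q: "quad i A B C D"
  shows "quad (2 * i) (PP A A) (PP A B) (PP A C) (PP B C)"
proof -
  note A = quadD(1)[OF q] and B = quadD(2)[OF q] and C = quadD(3)[OF q] and D = quadD(4)[OF q]
    and BA = quadD(5)[OF q] and CB = quadD(6)[OF q] and DC = quadD(7)[OF q] and cAB = quadD(8)[OF q] and cBD = quadD(9)[OF q] and sA = quadD(10)[OF q] and sB = quadD(11)[OF q]
    and yB = quadD(12)[OF q] and y2 = quadD(14)[OF q] and Al = quadD(16)[OF q]
  note Cl = quadD_pos(1)[OF q i] and cAC = quadD_pos(2)[OF q i] and A3 = quadD_pos(3)[OF q i] and y1A = quadD_pos(4)[OF q i] and yA = quadD_pos(5)[OF q i]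
  have prc: "pr g h \<in> carrier G" if "g \<in> A" "h \<in> A" for g h
    using that A3 lc_3_K pr_carrier_K by blast
  have cAA: "csub (carrier G) A A" by (rule csub_carrier_self[OF A])
  have cBC: "csub (carrier G) B C" using csub_mono[OF cBD _ _ DC] by simp
  note N = PP_normal[OF A A _ cAA] PP_normal[OF A B BA cAB] PP_normal[OF A C _ cAC] PP_normal[OF B C CB cBC]
  have CA: "C \<subseteq> A" using BA CB by blast
  have N1: "PP A A \<lhd> G" "PP A B \<lhd> G" "PP A C \<lhd> G" "PP B C \<lhd> G"
    using N CA by auto
  have sub: "PP A B \<subseteq> PP A A" "PP A C \<subseteq> PP A B" "PP B C \<subseteq> PP A C"
    by (intro PP_mono BA CB subset_refl)+
  have c1: "csub (carrier G) (PP A A) (PP A C)"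
    by (rule csub_PP[OF A N1(3) C refl _ cAA cAC])
      (auto intro!: normal_mult[OF A] normal_inv[OF A])
  have c2: "csub (carrier G) (PP A B) (PP B C)"
    by (rule csub_PP[OF A N1(4) C refl _ cAB cAC]) (use PP_diff[OF A B sA] in blast)
  have s1: "g \<otimes> g \<in> PP A B" if gP: "g \<in> PP A A" for g
  proof -
    obtain p q where g: "g = pr p q" "p \<in> A" "q \<in> A" "pr p q \<in> carrier G" using gP by (rule PP_E)
    have car: "p \<in> carrier G" "q \<in> carrier G" using g normal_carrier[OF A] by auto
    have eq: "g \<otimes> g = pr (p \<otimes> p) (q \<otimes> q)" using g car by (simp add: pr_mult)
    have "p \<otimes> p \<in> B" "q \<otimes> q \<in> B" using g sA by auto
    moreover have "pr (p \<otimes> p) (q \<otimes> q) \<in> carrier G" using g car by (simp flip: pr_mult)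
    ultimately show ?thesis
      unfolding eq using BA normal_mult[OF B, of "p \<otimes> p" "q \<otimes> q"] by (blast intro: PP_I)
  qed
  have s2: "g \<otimes> g \<in> PP B C" if gP: "g \<in> PP A B" for g
  proof -
    obtain p q where g: "g = pr p q" "p \<in> A" "q \<in> A" "p \<otimes> q \<in> B" "pr p q \<in> carrier G" using gP by (rule PP_E)
    have car: "p \<in> carrier G" "q \<in> carrier G" using g normal_carrier[OF A] by auto
    have eq: "g \<otimes> g = pr (p \<otimes> p) (q \<otimes> q)" using g car by (simp add: pr_mult)
    \<comment> \<open>\<open>p\<^sup>2 q\<^sup>2\<close> is the square of \<open>pq\<close> up to a
      commutator with \<open>pq\<close>; as \<open>pq\<close> lies in \<open>B\<close>, both fall
      into \<open>D\<close>.\<close>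
    have "cm p (p \<otimes> q) \<otimes> ((p \<otimes> q) \<otimes> (p \<otimes> q)) \<in> D"
      by (rule normal_mult[OF D csubD[OF cBD car(1) g(4)] sB[OF g(4)]])
    then have "p \<otimes> p \<otimes> (q \<otimes> q) \<in> C" using DC by (simp add: square_product[OF car] subset_iff)
    moreover have "pr (p \<otimes> p) (q \<otimes> q) \<in> carrier G" using g car by (simp flip: pr_mult)
    moreover have "p \<otimes> p \<in> B" "q \<otimes> q \<in> B" using g sA by auto
    ultimately show ?thesis unfolding eq by (blast intro: PP_I)
  qed
  have yc: "yv (2 * i + 1) \<in> carrier G" "yv (i + 1) \<otimes> yv (i + 1) \<in> carrier G"
    using yv_carrier by auto
  have one: "\<one> \<in> A" by (rule normal_one[OF A])
  have yodd: "yv (2 * i + 1) \<otimes> yv (2 * i + 1) = pr (yv (i + 1) \<otimes> yv (i + 1)) \<one>"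
    by (rule yv_square_odd[OF i])
  have yodd': "yv (2 * (2 * i) + 1) = pr (yv (2 * i + 1)) \<one>"
    using i by (intro yv_odd) simp
  have yev: "yv (2 * (2 * i) + 2) = pr (yv (2 * i + 1)) (inv (yv (2 * i + 1)))"
    using yv_even[of "2 * i + 1"] by (simp add: algebra_simps)
  have step2: "g \<in> PP A C \<or> inv (yv (2 * i + 1) \<otimes> yv (2 * i + 1)) \<otimes> g \<in> PP A C" if "g \<in> PP A B" for g
    unfolding yodd
    by (rule PP_outer_step[OF normal_carrier[OF A] yc(2) _ yB _ A that]) (use y2 BA one prc in auto)
  have step3: "g \<in> PP B C \<or> inv (yv (2 * (2 * i) + 2)) \<otimes> g \<in> PP B C" if "g \<in> PP A C" for g
    unfolding yev
    by (rule PP_inner_step[OF A B C CB y1A _ yA cAC that]) (intro prc y1A normal_inv[OF A])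
  have step1: "g \<in> PP A B \<or> inv (yv (2 * (2 * i) + 1)) \<otimes> g \<in> PP A B" if "g \<in> PP A A" for g
    unfolding yodd'
    by (rule PP_outer_step[OF normal_carrier[OF A] yc(1) _ yA y1A A that]) (use prc y1A one in auto)
  have m2: "yv (2 * i + 1) \<otimes> yv (2 * i + 1) \<in> PP A B"
    unfolding yodd using y2 BA one yc prc by (intro PP_I) auto
  have m3: "yv (2 * (2 * i) + 2) \<in> PP A C"
    unfolding yev using y1A yc normal_one[OF C] by (intro PP_I prc normal_inv[OF A]) auto
  have m1: "yv (2 * (2 * i) + 1) \<in> PP A A"
    unfolding yodd' using y1A yc one by (intro PP_I prc) auto
  have l1: "PP A A \<subseteq> lc (2 * i + 1)"
  proof (cases "i = 1")
    case True
    have "PP A A \<subseteq> PP (lc 2) K"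
      using A3 lc_3_K lc_antimono[of 2 3] by (intro PP_mono) auto
    then show ?thesis using True lc_3_eq by (simp add: numeral_3_eq_3)
  next
    case False
    then show ?thesis using lc_odd[of "i + 1"] PP_mono[OF Al Al] i by simp
  qed
  have l3: "PP A C \<subseteq> lc (2 * i + 2)"
  proof (cases "i = 1")
    case True
    have "PP A C \<subseteq> PP K (lc 3)"
      using A3 lc_3_K Cl True by (intro PP_mono) (auto simp: numeral_3_eq_3)
    then show ?thesis using True lc_4_eq by (simp add: numeral_eq_Suc)
  next
    case False
    then show ?thesis using lc_even[of "i + 1"] PP_mono[OF Al Cl] i by simp
  qed
  have l: "PP A A \<subseteq> lc 3" "PP A C \<subseteq> K" "PP A B \<subseteq> lc 2"
    using l1 l3 sub lc_antimono[of 3 "2 * i + 1"] lc_antimono[of 2 "2 * i + 1"] lc_K[of "2 * i + 2"] i by auto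
  have c1': "csub (carrier G) (PP A A) (PP A B)"
    by (rule csub_mono[OF c1 _ _ sub(2)]) auto
  show ?thesis
    unfolding quad_def
    using N1 sub c1 c1' c2 s1 s2 step1 step2 step3 m1 m2 m3 l l1 l3 by blast
qed

text \<open>Continues the chain of \<open>quad_even\<close> from its last member
  \<open>PP B C\<close>, lowering product and sections in turn until both are in \<open>D\<close>.
  Here \<open>i = 0\<close> is allowed: pairs from \<open>lc 2\<close> with product in
  \<open>K\<close> already lie in \<open>G\<close>.\<close>

lemma quad_odd:
  assumes q: "quad i A B C D"
  shows "quad (2 * i + 1) (PP B C) (PP B D) (PP C D) (PP D D)"
proof -
  note A = quadD(1)[OF q] and B = quadD(2)[OF q] and C = quadD(3)[OF q] and D = quadD(4)[OF q]
    and BA = quadD(5)[OF q] and CB = quadD(6)[OF q] and DC = quadD(7)[OF q] and cAB = quadD(8)[OF q] and cBD = quadD(9)[OF q] and sB = quadD(11)[OF q]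
    and yB = quadD(12)[OF q] and yC = quadD(13)[OF q] and y2 = quadD(14)[OF q] and y2C = quadD(15)[OF q] and Al = quadD(16)[OF q] and CK = quadD(17)[OF q] and B2 = quadD(18)[OF q]
  note Cl = quadD_pos(1)[OF q] and A3 = quadD_pos(3)[OF q]
  have prc: "pr g h \<in> carrier G" if "g \<in> B" "h \<in> B" "g \<otimes> h \<in> C" for g h
    using that B2 CK by (intro pr_carrier) auto
  have DB: "D \<subseteq> B" using DC CB by blast
  have cBC: "csub (carrier G) B C" using csub_mono[OF cBD _ _ DC] by simp
  have cCD: "csub (carrier G) C D" using csub_mono[OF cBD _ CB] by simp
  have cDD: "csub (carrier G) D D" by (rule csub_carrier_self[OF D])
  have N1: "PP B C \<lhd> G" "PP B D \<lhd> G" "PP C D \<lhd> G" "PP D D \<lhd> G"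
    using PP_normal[OF B C CB cBC] PP_normal[OF B D DB cBD] PP_normal[OF C D DC cCD] PP_normal[OF D D _ cDD] by auto
  have sub: "PP B D \<subseteq> PP B C" "PP C D \<subseteq> PP B D" "PP D D \<subseteq> PP C D"
    by (intro PP_mono CB DC subset_refl)+
  have c1: "csub (carrier G) (PP B C) (PP C D)"
    by (rule csub_PP[OF B N1(3) D refl _ cBC cBD]) (use PP_diff[OF B C] sB DC in blast)
  have c2: "csub (carrier G) (PP B D) (PP D D)"
    by (rule csub_PP[OF B N1(4) D refl _ cBD cBD]) (use PP_diff[OF B D sB] in blast)
  have s: "g \<otimes> g \<in> PP D D" if gP: "g \<in> PP B C" for g
  proof -
    obtain p q where g: "g = pr p q" "p \<in> B" "q \<in> B" "pr p q \<in> carrier G" using gP by (rule PP_E)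
    have car: "p \<in> carrier G" "q \<in> carrier G" using g normal_carrier[OF B] by auto
    have eq: "g \<otimes> g = pr (p \<otimes> p) (q \<otimes> q)" using g car by (simp add: pr_mult)
    have "pr (p \<otimes> p) (q \<otimes> q) \<in> carrier G" using g car by (simp flip: pr_mult)
    then show ?thesis
      unfolding eq using g sB by (intro PP_square_I[OF D]) auto
  qed
  have s1: "g \<otimes> g \<in> PP B D" if "g \<in> PP B C" for g using s[OF that] sub by blast
  have s2: "g \<otimes> g \<in> PP D D" if "g \<in> PP B D" for g using s that sub by blast
  have yc: "yv (2 * i + 2) \<in> carrier G" "yv (i + 1) \<otimes> yv (i + 1) \<in> carrier G"
    using yv_carrier by auto
  have yodd: "yv (2 * (2 * i + 1) + 1) = pr (yv (2 * i + 2)) \<one>"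
    using yv_odd[of "2 * i + 1"] by simp
  have yev: "yv (2 * (2 * i + 1) + 2) = pr (yv (2 * i + 2)) (inv (yv (2 * i + 2)))"
    using yv_even[of "2 * i + 2"] by (simp add: algebra_simps)
  have ysq: "yv (2 * i + 1 + 1) \<otimes> yv (2 * i + 1 + 1) =
      pr (yv (i + 1) \<otimes> yv (i + 1)) (inv (yv (i + 1) \<otimes> yv (i + 1)))"
    using yv_square_even[of "i + 1"] by simp
  have y2B: "yv (2 * i + 2) \<in> B" using y2C CB by blast
  have one: "\<one> \<in> B" "\<one> \<in> C" "\<one> \<in> D" using normal_one B C D by auto
  have step1: "g \<in> PP B D \<or> inv (yv (2 * (2 * i + 1) + 1)) \<otimes> g \<in> PP B D" if "g \<in> PP B C" for g
    unfolding yodd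
    by (rule PP_outer_step[OF normal_carrier[OF B] yc(1) _ yC y2B B that]) (use prc y2B one y2C yc in auto)
  have step2: "g \<in> PP C D \<or> inv (yv (2 * i + 1 + 1) \<otimes> yv (2 * i + 1 + 1)) \<otimes> g \<in> PP C D" if "g \<in> PP B D" for g
    unfolding ysq
    by (rule PP_inner_step[OF B C D DC y2 _ yB cBD that]) (use prc y2 one yc normal_inv[OF B y2] in auto)
  have step3: "g \<in> PP D D \<or> inv (yv (2 * (2 * i + 1) + 2)) \<otimes> g \<in> PP D D" if "g \<in> PP C D" for g
    unfolding yev
    by (rule PP_inner_step[OF C D D _ y2C _ yC cCD that]) (use prc y2B one yc normal_inv[OF B y2B] in auto)
  have m1: "yv (2 * (2 * i + 1) + 1) \<in> PP B C"
    unfolding yodd using y2B y2C one yc by (intro PP_I prc) auto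
  have m2: "yv (2 * i + 1 + 1) \<otimes> yv (2 * i + 1 + 1) \<in> PP B D"
    unfolding ysq using y2 one yc normal_inv[OF B y2] by (intro PP_I prc) auto
  have m3: "yv (2 * (2 * i + 1) + 2) \<in> PP C D"
    unfolding yev using y2C y2B one yc normal_inv[OF C y2C] normal_inv[OF B y2B] by (intro PP_I prc) auto
  have BC3: "PP B C \<subseteq> lc 3"
    unfolding lc_3_eq by (rule PP_mono[OF B2 CK])
  have l1: "PP B C \<subseteq> lc (2 * i + 1 + 1)"
  proof -
    consider "i = 0" | "i = 1" | "2 \<le> i" by linarith
    then show ?thesis
    proof cases
      case 1
      then show ?thesis using BC3 lc_antimono[of 2 3] by (auto simp: numeral_2_eq_2)
    next
      case 2
      have "PP B C \<subseteq> PP K (lc 3)"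
        using BA A3 Cl lc_3_K 2 by (intro PP_mono) (auto simp: numeral_3_eq_3)
      then show ?thesis using 2 lc_4_eq by (simp add: numeral_eq_Suc)
    next
      case 3
      have "PP B C \<subseteq> PP (lc (i + 1)) (lc (Suc (i + 1)))"
        using BA Al Cl 3 by (intro PP_mono) auto
      then show ?thesis using lc_even[of "i + 1"] 3 by simp
    qed
  qed
  have l3: "PP C D \<subseteq> lc (2 * i + 1 + 2)"
  proof (cases "i = 0")
    case True
    have "PP C D \<subseteq> lc 3" using BC3 sub by blast
    then show ?thesis using True by (simp add: numeral_3_eq_3)
  next
    case False
    have "PP C D \<subseteq> PP (lc (i + 2)) (lc (i + 2))"
      using Cl DC False by (intro PP_mono) auto
    then show ?thesis using lc_odd[of "i + 2"] False by simp
  qed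
  have l: "PP C D \<subseteq> K" "PP B D \<subseteq> lc 2"
    using BC3 sub lc_3_K lc_antimono[of 2 3] by auto
  have c1': "csub (carrier G) (PP B C) (PP B D)"
    by (rule csub_mono[OF c1 _ _ sub(2)]) auto
  show ?thesis
    unfolding quad_def
    using N1 sub c1 c1' c2 s1 s2 step1 step2 step3 m1 m2 m3 l l1 l3 BC3 by blast
qed

end

section \<open>The dimension series as a chain of pair subgroups\<close>

context grig_group
begin

text \<open>
  Passing from \<open>j\<close> to \<open>2j\<close> and \<open>2j + 1\<close> splits each step of the chain for \<open>j\<close> into two, by taking pairs of
  sections; the last set for \<open>j\<close> is the first one for \<open>j + 1\<close>.
\<close>

fun qd :: "nat \<Rightarrow> 'a set \<times> 'a set \<times> 'a set \<times> 'a set"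
  where "qd n = (if n = 0 then (carrier G, lc 2, K, lc 3)
    else case qd (n div 2) of (A, B, C, D) \<Rightarrow>
      if even n then (PP A A, PP A B, PP A C, PP B C) else (PP B C, PP B D, PP C D, PP D D))"

declare qd.simps [simp del]

definition qA :: "nat \<Rightarrow> 'a set" where "qA n = fst (qd n)"
definition qB :: "nat \<Rightarrow> 'a set" where "qB n = fst (snd (qd n))"
definition qC :: "nat \<Rightarrow> 'a set" where "qC n = fst (snd (snd (qd n)))"

lemma qd_0: "qd 0 = (carrier G, lc 2, K, lc 3)"
  by (subst qd.simps) simp

lemma qd_even: "1 \<le> j \<Longrightarrow> qd j = (A, B, C, D) \<Longrightarrow> qd (2 * j) = (PP A A, PP A B, PP A C, PP B C)"
  by (subst qd.simps) simp

lemma qd_odd: "qd j = (A, B, C, D) \<Longrightarrow> qd (2 * j + 1) = (PP B C, PP B D, PP C D, PP D D)"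
  by (subst qd.simps) simp

text \<open>The pieces fit together: the chain for \<open>j\<close> is computed from the one for
  \<open>j div 2\<close>, and for odd \<open>j\<close> induction identifies the last set
  \<open>D\<close> of the latter with the first set for the next index.\<close>

lemma qd_last: "snd (snd (snd (qd j))) = qA (Suc j)"
proof (induction j rule: less_induct)
  case (less j)
  obtain i A B C D where i: "qd i = (A, B, C, D)" "j = 2 * i \<or> j = 2 * i + 1"
    by (metis parity_cases mult.commute mult_2_right prod_cases4 odd_two_times_div_two_succ even_two_times_div_two)
  show ?case
  proof (cases "j = 0")
    case True
    then show ?thesis using qd_odd[OF qd_0] by (simp add: qA_def qd_0 lc_3_eq)
  next
    case False
    from i(2) show ?thesis
    proof
      assume j: "j = 2 * i"
      then show ?thesis using qd_even[OF _ i(1)] qd_odd[OF i(1)] False by (simp add: qA_def)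
    next
      assume j: "j = 2 * i + 1"
      then have "D = qA (Suc i)" using less.IH[of i] i by simp
      moreover obtain A' B' C' D' where "qd (Suc i) = (A', B', C', D')" by (metis prod_cases4)
      ultimately show ?thesis using qd_even[of "Suc i"] qd_odd[OF i(1)] j by (simp add: qA_def)
    qed
  qed
qed

lemma qd_eq: "qd j = (qA j, qB j, qC j, qA (Suc j))"
  by (metis qd_last qA_def qB_def qC_def prod.collapse)

lemma q_0: "qA 0 = carrier G" "qB 0 = lc 2" "qC 0 = K" "qA (Suc 0) = lc 3"
  using qd_eq[of 0] by (simp_all add: qd_0)

lemma q_even: "1 \<le> j \<Longrightarrow> qA (2 * j) = PP (qA j) (qA j)" "1 \<le> j \<Longrightarrow> qB (2 * j) = PP (qA j) (qB j)"
  using qd_even[OF _ qd_eq[of j]] qd_eq[of "2 * j"] by auto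

lemma q_odd: "qA (2 * j + 1) = PP (qB j) (qC j)" "qB (2 * j + 1) = PP (qB j) (qA (Suc j))"
  using qd_odd[OF qd_eq[of j]] qd_eq[of "2 * j + 1"] by auto

lemma quad_q: "quad j (qA j) (qB j) (qC j) (qA (Suc j))"
proof (induction j rule: less_induct)
  case (less j)
  show ?case
  proof (cases "j = 0")
    case True
    then show ?thesis using quad_0 by (simp add: q_0)
  next
    case False
    show ?thesis
    proof (cases "even j")
      case True
      then obtain i where i: "j = 2 * i" by (auto elim: evenE)
      then have i1: "1 \<le> i" "i < j" using False by auto
      show ?thesis
        using quad_even[OF i1(1) less.IH[OF i1(2)]] qd_even[OF i1(1) qd_eq[of i]] qd_eq[of "2 * i"]
        by (simp add: i)
    next
      case False
      then obtain i where i: "j = 2 * i + 1" by (auto elim: oddE)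
      then have i1: "i < j" by auto
      show ?thesis
        using quad_odd[OF less.IH[OF i1]] qd_odd[OF qd_eq[of i]] qd_eq[of "2 * i + 1"]
        by (simp add: i)
    qed
  qed
qed

text \<open>The candidate for the dimension series. The sets \<open>qC\<close> are skipped, so even
  layers may have order 4, whereas odd layers from 3 on have order at most 2.\<close>

definition E :: "nat \<Rightarrow> 'a set"
  where "E n = (if odd n then qA (n div 2) else qB (n div 2 - 1))"

lemma E_q: "E (2 * i + 1) = qA i" "E (2 * i + 2) = qB i" "E (2 * i + 3) = qA (Suc i)"
  by (simp_all add: E_def)

lemma E_cases:
  fixes n :: nat
  assumes "1 \<le> n"
  obtains i where "n = 2 * i + 1" | i where "n = 2 * i + 2"
proof (cases "even n")
  case True
  then obtain k where "n = 2 * k" by (auto elim: evenE)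
  then have "n = 2 * (k - 1) + 2" using assms by simp
  then show ?thesis using that(2) by blast
next
  case False
  then show ?thesis using that(1) by (auto elim: oddE)
qed

lemma E_normal: "1 \<le> n \<Longrightarrow> E n \<lhd> G"
  by (erule E_cases) (simp_all only: E_q quadD(1,2)[OF quad_q])

lemma E_Suc_subset: "1 \<le> n \<Longrightarrow> E (Suc n) \<subseteq> E n"
proof (erule E_cases)
  fix i assume n: "n = 2 * i + 1"
  then show ?thesis using quadD(5)[OF quad_q, of i] E_q(1,2)[of i] by simp
next
  fix i assume n: "n = 2 * i + 2"
  then have "Suc n = 2 * i + 3" by simp
  then show ?thesis using quadD(6,7)[OF quad_q, of i] n by (auto simp only: E_q)
qed

lemma E_antimono: "m \<le> n \<Longrightarrow> 1 \<le> m \<Longrightarrow> E n \<subseteq> E m"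
proof (induction n rule: dec_induct)
  case (step n)
  then show ?case using E_Suc_subset[of n] by auto
qed auto

lemma E_central: "1 \<le> n \<Longrightarrow> csub (carrier G) (E n) (E (Suc n))"
proof (erule E_cases)
  fix i assume n: "n = 2 * i + 1"
  then show ?thesis using quadD(8)[OF quad_q, of i] E_q(1,2)[of i] by simp
next
  fix i assume n: "n = 2 * i + 2"
  then have "Suc n = 2 * i + 3" by simp
  then show ?thesis using quadD(9)[OF quad_q, of i] n by (simp only: E_q)
qed

lemma E_1: "E 1 = carrier G" and E_2: "E 2 = lc 2" and E_3: "E 3 = lc 3"
  by (simp_all add: E_def q_0)

lemma E_5: "1 \<le> j \<Longrightarrow> E (4 * j + 1) = PP (E (2 * j + 1)) (E (2 * j + 1))"
  and E_6: "1 \<le> j \<Longrightarrow> E (4 * j + 2) = PP (E (2 * j + 1)) (E (2 * j + 2))"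
  and E_7: "E (4 * j + 3) = PP (E (2 * j + 2)) (qC j)"
  and E_8: "E (4 * j + 4) = PP (E (2 * j + 2)) (E (2 * j + 3))"
proof -
  have eq: "4 * j + 1 = 2 * (2 * j) + 1" "4 * j + 2 = 2 * (2 * j) + 2"
    "4 * j + 3 = 2 * (2 * j + 1) + 1" "4 * j + 4 = 2 * (2 * j + 1) + 2"
    by simp_all
  show "1 \<le> j \<Longrightarrow> E (4 * j + 1) = PP (E (2 * j + 1)) (E (2 * j + 1))"
    and "1 \<le> j \<Longrightarrow> E (4 * j + 2) = PP (E (2 * j + 1)) (E (2 * j + 2))"
    and "E (4 * j + 3) = PP (E (2 * j + 2)) (qC j)"
    and "E (4 * j + 4) = PP (E (2 * j + 2)) (E (2 * j + 3))"
    unfolding eq E_q by (simp_all only: q_even q_odd)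
qed

text \<open>Descending induction on the index of \<open>E\<close> with \<open>n\<close> fixed. At
  index \<open>2 * n - 1\<close> the inclusion holds because
  \<open>qA (n - 1) \<subseteq> lc n\<close>; each step back towards \<open>n\<close> adjoins
  representatives \<open>yv m\<close>, or squares of them, that lie in \<open>dims m\<close> by
  construction.\<close>

lemma E_subset_dims: "1 \<le> n \<Longrightarrow> E n \<subseteq> dims n"
proof -
  assume "1 \<le> n"
  consider "n = 1" | "2 \<le> n" using \<open>1 \<le> n\<close> by linarith
  then show ?thesis
  proof cases
    case 1
    then show ?thesis by (simp add: dims_1 E_1[simplified])
  next
    case 2
    have "E k \<subseteq> dims n" if "k \<le> 2 * n - 1" "n \<le> k" for k
      using that
    proof (induction rule: inc_induct)
      case base
      have "qA (n - 1) \<subseteq> lc (n - 1 + 1)" by (rule quadD(16)[OF quad_q])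
      then have "E (2 * (n - 1) + 1) \<subseteq> dims n"
        using lc_subset_dims[of n] 2 unfolding E_q by simp
      moreover have "2 * (n - 1) + 1 = 2 * n - 1" using 2 by simp
      ultimately show ?case by simp
    next
      case (step m)
      have m1: "1 \<le> m" and nm: "n \<le> m" using step 2 by simp_all
      have IH: "E (Suc m) \<subseteq> dims n" using step by simp
      have cancel: "g \<in> dims n" if "inv y \<otimes> g \<in> dims n" "y \<in> dims n" "g \<in> carrier G" for g y
        using normal_cancel_left[OF dims_normal normal_inv[OF dims_normal that(2)] that(3,1)] .
      show ?case
      proof
        fix g assume g: "g \<in> E m"
        have gc: "g \<in> carrier G" using normal_carrier[OF E_normal[OF m1] g] .
        from m1 show "g \<in> dims n"
        proof (cases rule: E_cases)
          case (1 i)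
          have i: "1 \<le> i" using 1 2 nm by linarith
          have "Suc m = 2 * i + 2" using 1 by simp
          then have S: "qB i \<subseteq> dims n" using IH by (simp only: E_q)
          have y: "yv (2 * i + 1) \<in> dims n"
            using yv_dims[OF m1] dims_antimono[of n m] nm 1 by auto
          have "g \<in> qB i \<or> inv (yv (2 * i + 1)) \<otimes> g \<in> qB i"
            using quadD_pos(5)[OF quad_q i] g unfolding 1 E_q by blast
          then show ?thesis using S cancel[OF _ y gc] by blast
        next
          case (2 i)
          have "Suc m = 2 * i + 3" using 2 by simp
          then have S: "qA (Suc i) \<subseteq> dims n" using IH by (simp only: E_q)
          have D: "dims (2 * i + 2) \<subseteq> dims n" using dims_antimono[of n m] nm 2 by simp
          have y: "yv (2 * i + 2) \<in> dims n"
            using yv_dims[of "2 * i + 2"] D by auto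
          have "yv (i + 1) \<otimes> yv (i + 1) \<in> dims (2 * (i + 1))"
            by (intro dims_square yv_dims) auto
          then have y2: "yv (i + 1) \<otimes> yv (i + 1) \<in> dims n"
            using D by auto
          have C: "h \<in> dims n" if h: "h \<in> qC i" for h
          proof -
            have "h \<in> carrier G" using normal_carrier[OF quadD(3)[OF quad_q] h] .
            then show ?thesis using quadD(13)[OF quad_q h] S cancel[OF _ y] by blast
          qed
          have "g \<in> qC i \<or> inv (yv (i + 1) \<otimes> yv (i + 1)) \<otimes> g \<in> qC i"
            using quadD(12)[OF quad_q] g unfolding 2 E_q by blast
          then show ?thesis using C cancel[OF _ y2 gc] by blast
        qed
      qed
    qed
    then show ?thesis by simp
  qed
qed

lemma square_PP:
  assumes M: "M \<lhd> G" and sX: "\<And>g. g \<in> M \<Longrightarrow> g \<otimes> g \<in> M'"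
    and prod: "\<And>p q. p \<in> M \<Longrightarrow> q \<in> M \<Longrightarrow> p \<otimes> q \<in> Y \<Longrightarrow> (p \<otimes> p) \<otimes> (q \<otimes> q) \<in> Y'"
    and g: "g \<in> PP M Y"
  shows "g \<otimes> g \<in> PP M' Y'"
proof -
  obtain p q where pq: "g = pr p q" "p \<in> M" "q \<in> M" "p \<otimes> q \<in> Y" "pr p q \<in> carrier G"
    using g by (rule PP_E)
  have car: "p \<in> carrier G" "q \<in> carrier G" using pq normal_carrier[OF M] by auto
  have eq: "g \<otimes> g = pr (p \<otimes> p) (q \<otimes> q)" using pq car by (simp add: pr_mult)
  have "pr (p \<otimes> p) (q \<otimes> q) \<in> carrier G" using pq car by (simp flip: pr_mult)
  then show ?thesis unfolding eq using sX prod pq by (blast intro: PP_I)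
qed

text \<open>Squaring acts on both sections, so the claim for \<open>l\<close> reduces to indices of
  about half the size; the residue of \<open>l\<close> modulo 4 decides which form of
  \<open>PP\<close> occurs. The product condition requires a commutator bound inside
  \<open>E\<close>, which is borrowed from the strong centrality of \<open>dims\<close> in the range
  where \<open>dims m \<subseteq> E m\<close> is assumed.\<close>

lemma E_square:
  assumes "1 \<le> l" "\<And>m. 4 \<le> m \<Longrightarrow> m \<le> l + 1 \<Longrightarrow> dims m \<subseteq> E m" "g \<in> E l"
  shows "g \<otimes> g \<in> E (2 * l)"
  using assms
proof (induction l arbitrary: g rule: less_induct)
  case (less l)
  have IH: "h \<otimes> h \<in> E (2 * m)" if "1 \<le> m" "m < l" "h \<in> E m" for h m
    using that less.prems by (intro less.IH) auto
  have cmE: "cm p w \<in> E (m + Suc m)" if "2 \<le> m" "m + m \<le> l" "p \<in> E m" "w \<in> E (Suc m)" for p w m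
  proof -
    have "cm p w \<in> dims (m + Suc m)"
      using that E_subset_dims[of m] E_subset_dims[of "Suc m"] dims_strongly_central[of m "Suc m"]
      by (auto dest: csubD)
    then show ?thesis using less.prems(2)[of "m + Suc m"] that by auto
  qed
  have cm2: "cm p w \<in> E (m + Suc m)" if "1 \<le> m" "m + m \<le> l" "p \<in> E m" "w \<in> E (Suc m)" for p w m
  proof (cases "m = 1")
    case True
    then have "p \<in> carrier G" "w \<in> lc 2" using that normal_carrier[OF E_normal] E_2 by (auto simp: numeral_2_eq_2)
    then show ?thesis using True lc_gcomm[of 2] by (auto dest: csubD simp: E_3 numeral_3_eq_3[symmetric] simp flip: numeral_2_eq_2)
  qed (use cmE that in auto)
  have prodE: "(p \<otimes> p) \<otimes> (q \<otimes> q) \<in> E (m + Suc m)"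
    if "1 \<le> m" "m + m \<le> l" "Suc m < l" "p \<in> E m" "q \<in> E m" "p \<otimes> q \<in> E (Suc m)" for p q m
  proof -
    have car: "p \<in> carrier G" "q \<in> carrier G" using normal_carrier[OF E_normal] that by auto
    have "(p \<otimes> q) \<otimes> (p \<otimes> q) \<in> E (m + Suc m)"
      using IH[of "Suc m" "p \<otimes> q"] E_antimono[of "m + Suc m" "2 * Suc m"] that by auto
    then show ?thesis
      unfolding square_product[OF car] using that cm2[of m p "p \<otimes> q"]
      by (intro normal_mult[OF E_normal, of _ "cm p (p \<otimes> q)"]) auto
  qed
  consider "l = 1" | "l = 2" | j where "1 \<le> j" "l = 4 * j + 1" | j where "1 \<le> j" "l = 4 * j + 2"
    | j where "l = 4 * j + 3" | j where "l = 4 * j + 4"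
  proof -
    have "l = 4 * (l div 4) + l mod 4" "l mod 4 < 4" by simp_all
    moreover define j where "j = l div 4"
    ultimately consider "l = 4 * j" | "l = 4 * j + 1" | "l = 4 * j + 2" | "l = 4 * j + 3" by linarith
    then show ?thesis
    proof cases
      case 1
      then have "l = 4 * (j - 1) + 4" using less.prems(1) by simp
      then show ?thesis using that by blast
    next
      case 2
      then show ?thesis using that by (cases "j = 0") auto
    next
      case 3
      then show ?thesis using that by (cases "j = 0") auto
    next
      case 4
      then show ?thesis using that by blast
    qed
  qed
  then show ?case
  proof cases
    case 1
    then show ?thesis using less.prems(3) square_lc_2 E_1 E_2 by simp
  next
    case 2
    have "g \<in> PP P (lc 2)" using less.prems(3) 2 lc_2_sections E_2 by auto
    then have "g \<otimes> g \<in> PP (lc 2) (lc 3)"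
    proof (rule square_PP[OF P_normal, rotated 2])
      fix p q assume pq: "p \<in> P" "q \<in> P" "p \<otimes> q \<in> lc 2"
      have car: "p \<in> carrier G" "q \<in> carrier G" using pq normal_carrier[OF P_normal] by auto
      have "cm p (p \<otimes> q) \<in> lc 3" using csubD[OF lc_gcomm[of 2] car(1) pq(3)] by (simp add: numeral_3_eq_3)
      moreover have "(p \<otimes> q) \<otimes> (p \<otimes> q) \<in> lc 3" using quadD(11)[OF quad_0 pq(3)] .
      ultimately show "(p \<otimes> p) \<otimes> (q \<otimes> q) \<in> lc 3"
        unfolding square_product[OF car] by (rule normal_mult[OF lc_normal])
    qed (use square_lc_2 normal_carrier[OF P_normal] in blast)
    then show ?thesis using 2 E_8[of 0] by (simp add: E_2 E_3 flip: numeral_2_eq_2)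
  next
    case (3 j)
    let ?X = "E (2 * j + 1)"
    have "g \<otimes> g \<in> PP (E (4 * j + 1)) (E (4 * j + 2))"
    proof (rule square_PP[of ?X _ ?X])
      have sq: "h \<otimes> h \<in> E (4 * j + 2)" if "h \<in> ?X" for h
        using IH[of "2 * j + 1" h] that 3 by simp
      then show "h \<otimes> h \<in> E (4 * j + 1)" if "h \<in> ?X" for h
        using that E_Suc_subset[of "4 * j + 1"] by auto
      show "p \<otimes> p \<otimes> (q \<otimes> q) \<in> E (4 * j + 2)" if "p \<in> ?X" "q \<in> ?X" for p q
        by (rule normal_mult[OF E_normal sq[OF that(1)] sq[OF that(2)]]) simp
      show "g \<in> PP ?X ?X" using less.prems(3) 3 E_5 by simp
    qed (simp add: E_normal)
    moreover have eq: "2 * l = 4 * (2 * j) + 2" "2 * (2 * j) + 1 = 4 * j + 1" "2 * (2 * j) + 2 = 4 * j + 2" "1 \<le> 2 * j" using 3 by simp_all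
    ultimately show ?thesis unfolding eq(1) E_6[OF eq(4)] eq(2,3) by simp
  next
    case (4 j)
    let ?X = "E (2 * j + 1)" and ?Y = "E (2 * j + 2)"
    have "g \<otimes> g \<in> PP (E (4 * j + 2)) (E (4 * j + 3))"
    proof (rule square_PP[of ?X _ ?Y])
      show "h \<otimes> h \<in> E (4 * j + 2)" if "h \<in> ?X" for h
        using IH[of "2 * j + 1" h] that 4 by simp
      show "p \<otimes> p \<otimes> (q \<otimes> q) \<in> E (4 * j + 3)" if "p \<in> ?X" "q \<in> ?X" "p \<otimes> q \<in> ?Y" for p q
      proof -
        have "2 * j + 1 + Suc (2 * j + 1) = 4 * j + 3" by simp
        then show ?thesis using prodE[of "2 * j + 1" p q] that 4 by (simp only:) simp
      qed
      show "g \<in> PP ?X ?Y" using less.prems(3) 4 E_6 by simp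
    qed (simp add: E_normal)
    moreover have eq: "2 * l = 4 * (2 * j) + 4" "2 * (2 * j) + 2 = 4 * j + 2" "2 * (2 * j) + 3 = 4 * j + 3" using 4 by simp_all
    ultimately show ?thesis unfolding eq(1) E_8 eq(2,3) by simp
  next
    case (5 j)
    have e: "2 * (2 * j + 2) = 4 * j + 4" by simp
    let ?X = "E (2 * j + 2)" and ?Y = "qC j"
    have "g \<otimes> g \<in> PP (E (4 * j + 3)) (E (4 * j + 4))"
    proof (rule square_PP[of ?X _ ?Y])
      have sq: "h \<otimes> h \<in> E (4 * j + 4)" if "h \<in> ?X" for h
        using IH[of "2 * j + 2" h, unfolded e] that 5 by simp
      then show "h \<otimes> h \<in> E (4 * j + 3)" if "h \<in> ?X" for h
        using that E_antimono[of "4 * j + 3" "4 * j + 4"] by auto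
      show "p \<otimes> p \<otimes> (q \<otimes> q) \<in> E (4 * j + 4)" if "p \<in> ?X" "q \<in> ?X" for p q
        by (rule normal_mult[OF E_normal sq[OF that(1)] sq[OF that(2)]]) simp
      show "g \<in> PP ?X ?Y" using less.prems(3) 5 E_7 by simp
    qed (simp add: E_normal)
    moreover have eq: "2 * l = 4 * (2 * j + 1) + 2" "2 * (2 * j + 1) + 1 = 4 * j + 3" "2 * (2 * j + 1) + 2 = 4 * j + 4" "1 \<le> 2 * j + 1" using 5 by simp_all
    ultimately show ?thesis unfolding eq(1) E_6[OF eq(4)] eq(2,3) by simp
  next
    case (6 j)
    have e: "2 * (2 * j + 2) = 4 * j + 4" by simp
    let ?X = "E (2 * j + 2)" and ?Y = "E (2 * j + 3)"
    have "g \<otimes> g \<in> PP (E (4 * j + 4)) (E (4 * j + 5))"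
    proof (rule square_PP[of ?X _ ?Y])
      show "h \<otimes> h \<in> E (4 * j + 4)" if "h \<in> ?X" for h
        using IH[of "2 * j + 2" h, unfolded e] that 6 by simp
      show "p \<otimes> p \<otimes> (q \<otimes> q) \<in> E (4 * j + 5)" if "p \<in> ?X" "q \<in> ?X" "p \<otimes> q \<in> ?Y" for p q
      proof -
        have "2 * j + 2 + Suc (2 * j + 2) = 4 * j + 5" "Suc (2 * j + 2) = 2 * j + 3" by simp_all
        then show ?thesis using prodE[of "2 * j + 2" p q] that 6 by (simp only:)
      qed
      show "g \<in> PP ?X ?Y" using less.prems(3) 6 E_8 by simp
    qed (simp add: E_normal)
    moreover have eq: "2 * l = 4 * (2 * j + 1) + 4" "2 * (2 * j + 1) + 2 = 4 * j + 4" "2 * (2 * j + 1) + 3 = 4 * j + 5" using 6 by simp_all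
    ultimately show ?thesis unfolding eq(1) E_8 eq(2,3) by simp
  qed
qed

lemma dims_eq_E: "1 \<le> n \<Longrightarrow> dims n = E n"
proof (induction n rule: less_induct)
  case (less n)
  have "dims n \<subseteq> E n"
  proof (cases "n = 1")
    case True
    then show ?thesis by (simp add: dims_1 E_1[simplified])
  next
    case False
    then have n: "2 \<le> n" using less.prems by simp
    show ?thesis
    proof (rule dims_leastI[OF n])
      show "subgroup (E n) G" using normal_imp_subgroup[OF E_normal[OF less.prems]] .
      show "csub (carrier G) (dims (n - 1)) (E n)"
        using less.IH[of "n - 1"] n E_central[of "n - 1"] by simp
      fix h assume h: "h \<in> dims ((n + 1) div 2)"
      define l where "l = (n + 1) div 2"
      have l: "1 \<le> l" "l < n" "n \<le> 2 * l" "2 * l \<le> n + 1" using n by (auto simp: l_def)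
      have "h \<otimes> h \<in> E (2 * l)"
      proof (rule E_square[OF l(1)])
        show "h \<in> E l" using h less.IH[of l] l by (simp add: l_def)
        \<comment> \<open>The lower bound 4 matters: for \<open>n\<close> equal to 2 or 3 the upper
          bound \<open>l + 1\<close> equals \<open>n\<close>, where induction says nothing, but the
          range is then empty.\<close>
        show "dims m \<subseteq> E m" if "4 \<le> m" "m \<le> l + 1" for m
          using less.IH[of m] that l by simp
      qed
      then show "h \<otimes> h \<in> E n" using E_antimono[of n "2 * l"] l n by auto
    qed
  qed
  then show ?case using E_subset_dims[OF less.prems] by blast
qed

lemma dims_2: "dims 2 = lc 2"
  by (simp add: dims_eq_E E_2)

lemma dims_odd_layer:
  assumes "odd n" "3 \<le> n" "g \<in> dims n"
  shows "g \<in> dims (Suc n) \<or> inv (yv n) \<otimes> g \<in> dims (Suc n)"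
proof -
  obtain i where n: "n = 2 * i + 1" using assms(1) by (auto elim: oddE)
  have i: "1 \<le> i" using n assms(2) by simp
  have "Suc n = 2 * i + 2" using n by simp
  then have "dims (Suc n) = qB i" using dims_eq_E[of "Suc n"] by (auto simp only: E_q)
  moreover have "dims n = qA i" using dims_eq_E[of n] n by (auto simp only: E_q)
  ultimately show ?thesis using quadD_pos(5)[OF quad_q i, of g] assms(3) n by simp
qed

text \<open>Antidiagonal pairs carry the layer at \<open>k\<close> to the layer at
  \<open>2 * k\<close>, since \<open>lc (2 * k) = PP (lc k) (lc (Suc k))\<close> and
  \<open>lc (2 * k + 1)\<close> differs only in the deeper sections. A layer of order at most 2 thus
  reproduces itself under doubling; the first one, in degree 4, comes from \<open>K\<close> over
  \<open>lc 3\<close>.\<close>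

lemma lc_two_power_layer:
  assumes "2 \<le> r" "g \<in> lc (2 ^ r)"
  shows "g \<in> lc (Suc (2 ^ r)) \<or> inv (yv (2 ^ r)) \<otimes> g \<in> lc (Suc (2 ^ r))"
  using assms
proof (induction r arbitrary: g rule: dec_induct)
  case base
  have x3: "inv x \<otimes> h \<in> lc 3" if h: "h \<in> K" "x \<otimes> h \<in> lc 3" for h
  proof -
    have "inv (x \<otimes> x) \<otimes> (x \<otimes> h) \<in> lc 3"
      using gcomm_K_gens(1) unfolding gcomm_K
      by (intro normal_mult[OF lc_normal _ h(2)] normal_inv[OF lc_normal])
    then show ?thesis using normal_carrier[OF K_normal h(1)] by (simp add: inv_mult_group m_assoc)
  qed
  have y: "yv 4 = pr x (inv x)" using yv_even[of 2] by (simp add: yv_2)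
  have g: "g \<in> PP K (lc 3)" using base by (simp add: lc_4_eq)
  have "g \<in> PP (lc 3) (lc 3) \<or> inv (pr x (inv x)) \<otimes> g \<in> PP (lc 3) (lc 3)"
  proof (rule PP_inner_step[OF K_normal lc_normal lc_normal subset_refl x_K _ _ _ g])
    show "pr x (inv x) \<in> carrier G" using pr_carrier_K[OF x_K normal_inv[OF K_normal x_K]] .
    show "h \<in> lc 3 \<or> inv x \<otimes> h \<in> lc 3" if "h \<in> K" for h using K_cases[OF that] x3[OF that] by blast
    show "csub (carrier G) K (lc 3)" by (simp add: csub_def gcomm_incl flip: gcomm_K)
  qed
  then show ?case by (simp add: y lc_5_eq)
next
  case (step r)
  define k where "k = (2::nat) ^ r"
  have k: "4 \<le> k" using power_increasing[OF step(1), of "2::nat"] by (simp add: k_def)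
  have y: "yv k \<in> lc k" using yv_lc k by simp
  have g: "g \<in> PP (lc k) (lc (Suc k))" using step.prems k lc_even[of k] by (simp add: k_def)
  have "g \<in> PP (lc (Suc k)) (lc (Suc k)) \<or> inv (pr (yv k) (inv (yv k))) \<otimes> g \<in> PP (lc (Suc k)) (lc (Suc k))"
  proof (rule PP_inner_step[OF lc_normal lc_normal lc_normal subset_refl y _ _ _ g])
    show "pr (yv k) (inv (yv k)) \<in> carrier G" using pr_carrier_lc[of k, OF _ y normal_inv[OF lc_normal y]] k by simp
    show "h \<in> lc (Suc k) \<or> inv (yv k) \<otimes> h \<in> lc (Suc k)" if "h \<in> lc k" for h
      using step.IH that by (simp add: k_def)
    show "csub (carrier G) (lc k) (lc (Suc k))" using lc_gcomm k by simp
  qed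
  moreover have "lc (Suc (2 * k)) = PP (lc (Suc k)) (lc (Suc k))" using lc_odd[of "Suc k"] k by simp
  ultimately show ?case using yv_even[of k] k by (simp add: k_def)
qed

end

context grig_group
begin

text \<open>Adjoining \<open>b\<close>, \<open>c\<close>, \<open>a\<close> in turn to
  \<open>lc 2\<close> yields normal subgroups, each consisting of at most two cosets of the previous
  one; the last contains all generators because \<open>d = bc\<close>.\<close>

lemma abelianization_cases:
  assumes g: "g \<in> carrier G"
  shows "\<exists>p\<in>{\<one>, b}. \<exists>q\<in>{\<one>, c}. \<exists>r\<in>{\<one>, a}. p \<otimes> (q \<otimes> (r \<otimes> g)) \<in> lc 2"
proof -
  let ?ext = "\<lambda>N u. {g \<in> carrier G. g \<in> N \<or> u \<otimes> g \<in> N}"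
  have ext: "?ext N u \<lhd> G \<and> lc 2 \<subseteq> ?ext N u" if "N \<lhd> G" "lc 2 \<subseteq> N" "u \<in> gs" for N u
  proof -
    have uc: "u \<in> carrier G" using that gs_carrier by blast
    have "?ext N u \<lhd> G"
    proof (rule extend_normal[OF gs_carrier generated _ that(1) uc])
      show "inv s \<in> gs" if "s \<in> gs" for s using that by auto
      show "u \<otimes> u \<in> N" using square_lc_2[OF uc] that(2) by blast
      show "cm s u \<in> N" if "s \<in> gs" for s
        using cm_lc_2[of s u] uc gs_carrier that \<open>lc 2 \<subseteq> N\<close> by blast
    qed
    then show ?thesis using that(2) lc_carrier by blast
  qed
  let ?B = "?ext (lc 2) b"
  let ?C = "?ext ?B c"
  let ?A = "?ext ?C a"
  have B: "?B \<lhd> G" "lc 2 \<subseteq> ?B" using ext[of "lc 2" b] lc_normal by auto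
  have C: "?C \<lhd> G" "lc 2 \<subseteq> ?C" using ext[of ?B c] B by blast+
  have A: "?A \<lhd> G" using ext[of ?C a] C by blast
  have one: "\<one> \<in> lc 2" using normal_one[OF lc_normal] .
  have b: "b \<in> ?B" using one by (simp add: squares)
  have c: "c \<in> ?C" using normal_one[OF B(1)] by (simp add: squares)
  have bC: "b \<in> ?C" using b by blast
  have "d \<in> ?C" using normal_mult[OF C(1) bC c] by (simp only: bc)
  moreover have "a \<in> ?A" using normal_one[OF C(1)] by (simp add: squares)
  ultimately have "gs \<subseteq> ?A" using bC c by blast
  then have "carrier G \<subseteq> ?A"
    by (subst generated) (rule generate_subgroup_incl[OF _ normal_imp_subgroup[OF A]])
  then have "g \<in> ?A" using g by blast
  then obtain r where r: "r \<in> {\<one>, a}" "r \<otimes> g \<in> ?C" using g by fastforce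
  then obtain q where q: "q \<in> {\<one>, c}" "q \<otimes> (r \<otimes> g) \<in> ?B" by fastforce
  then obtain p where "p \<in> {\<one>, b}" "p \<otimes> (q \<otimes> (r \<otimes> g)) \<in> lc 2" by fastforce
  then show ?thesis using q r by blast
qed

end

section \<open>The permutation group as an instance of the abstract relations\<close>

lemma pr_comp: "pr g h (pr g' h' w) = pr (g \<circ> g') (h \<circ> h') w"
  by (cases w) auto

lemma pr_id: "pr (\<lambda>w. w) (\<lambda>w. w) w = w"
  by (cases w) auto

lemma pr_cong_iff: "pr g h = pr g' h' \<longleftrightarrow> g = g' \<and> h = h'"
proof
  assume e: "pr g h = pr g' h'"
  have "g w = g' w" "h w = h' w" for w
    using fun_cong[OF e, of "0 # w"] fun_cong[OF e, of "1 # w"] by simp_all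
  then show "g = g' \<and> h = h'" by auto
qed simp

lemma grig_bc: "grig_b (grig_c w) = grig_d w" and grig_cd: "grig_c (grig_d w) = grig_b w"
  and grig_db: "grig_d (grig_b w) = grig_c w"
  by (induction w) (auto simp: grig_a_involution)

interpretation gg: grig_group Grigorchuk pr grig_a grig_b grig_c grig_d
proof (intro grig_group.intro grig_group_axioms.intro Grigorchuk_group)
  have gens: "grig_gens \<subseteq> carrier Grigorchuk"
    by (subst Grigorchuk_generate) (auto intro: generate.incl)
  show abcd: "grig_a \<in> carrier Grigorchuk" "grig_b \<in> carrier Grigorchuk"
    "grig_c \<in> carrier Grigorchuk" "grig_d \<in> carrier Grigorchuk"
    using gens by (auto simp: grig_gens_def)
  show "carrier Grigorchuk = generate Grigorchuk {grig_a, grig_b, grig_c, grig_d}"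
    by (subst Grigorchuk_generate) (simp add: grig_gens_def)
  show "grig_a \<otimes>\<^bsub>Grigorchuk\<^esub> grig_a = \<one>\<^bsub>Grigorchuk\<^esub>" "grig_b \<otimes>\<^bsub>Grigorchuk\<^esub> grig_b = \<one>\<^bsub>Grigorchuk\<^esub>"
    "grig_c \<otimes>\<^bsub>Grigorchuk\<^esub> grig_c = \<one>\<^bsub>Grigorchuk\<^esub>" "grig_d \<otimes>\<^bsub>Grigorchuk\<^esub> grig_d = \<one>\<^bsub>Grigorchuk\<^esub>"
    "grig_b \<otimes>\<^bsub>Grigorchuk\<^esub> grig_c = grig_d"
    by (simp_all add: grig.mult_comp abcd grig.one_fun fun_eq_iff grig_a_involution grig_bcd_involution grig_bc)
  have pm: "pr g h \<circ> pr g' h' = pr (g \<circ> g') (h \<circ> h')" for g h g' h'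
    by (simp add: fun_eq_iff pr_comp)
  have p1: "pr \<one>\<^bsub>Grigorchuk\<^esub> \<one>\<^bsub>Grigorchuk\<^esub> = \<one>\<^bsub>Grigorchuk\<^esub>"
    by (simp add: grig.one_fun fun_eq_iff pr_id)
  then show "pr \<one>\<^bsub>Grigorchuk\<^esub> \<one>\<^bsub>Grigorchuk\<^esub> = \<one>\<^bsub>Grigorchuk\<^esub>" .
  \<comment> \<open>A pair of group elements may lie outside the group, but it is a bijection. That
    suffices, as multiplication in \<open>Grigorchuk\<close> is that of
    \<open>BijGroup UNIV\<close>, which is composition on bijections.\<close>
  have bij: "pr k l \<in> Bij UNIV" if "k \<in> carrier Grigorchuk" "l \<in> carrier Grigorchuk" for k l
  proof -
    have i: "inv\<^bsub>Grigorchuk\<^esub> k \<in> carrier Grigorchuk" "inv\<^bsub>Grigorchuk\<^esub> l \<in> carrier Grigorchuk"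
      using that by auto
    have "k \<circ> inv\<^bsub>Grigorchuk\<^esub> k = (\<lambda>w. w)" "inv\<^bsub>Grigorchuk\<^esub> k \<circ> k = (\<lambda>w. w)"
      "l \<circ> inv\<^bsub>Grigorchuk\<^esub> l = (\<lambda>w. w)" "inv\<^bsub>Grigorchuk\<^esub> l \<circ> l = (\<lambda>w. w)"
      using that i grig.r_inv[of k] grig.l_inv[of k] grig.r_inv[of l] grig.l_inv[of l]
      by (simp_all add: grig.mult_comp grig.one_fun)
    then have "pr k l \<circ> pr (inv\<^bsub>Grigorchuk\<^esub> k) (inv\<^bsub>Grigorchuk\<^esub> l) = id"
      "pr (inv\<^bsub>Grigorchuk\<^esub> k) (inv\<^bsub>Grigorchuk\<^esub> l) \<circ> pr k l = id"
      by (simp_all add: pm) (simp_all add: fun_eq_iff pr_id)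
    then show ?thesis by (simp add: Bij_def o_bij)
  qed
  have mult: "pr g h \<otimes>\<^bsub>BijGroup UNIV\<^esub> pr g' h' = pr (g \<otimes>\<^bsub>BijGroup UNIV\<^esub> g') (h \<otimes>\<^bsub>BijGroup UNIV\<^esub> h')"
    if "g \<in> carrier Grigorchuk" "h \<in> carrier Grigorchuk" "g' \<in> carrier Grigorchuk" "h' \<in> carrier Grigorchuk"
    for g h g' h'
    using that by (simp add: Bij_mult bij Grigorchuk_Bij pm)
  then show mult': "pr g h \<otimes>\<^bsub>Grigorchuk\<^esub> pr g' h' = pr (g \<otimes>\<^bsub>Grigorchuk\<^esub> g') (h \<otimes>\<^bsub>Grigorchuk\<^esub> h')"
    if "g \<in> carrier Grigorchuk" "h \<in> carrier Grigorchuk" "g' \<in> carrier Grigorchuk" "h' \<in> carrier Grigorchuk"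
    for g h g' h'
    using that by (simp add: Grigorchuk_def)
  show "inv\<^bsub>Grigorchuk\<^esub> pr g h = pr (inv\<^bsub>Grigorchuk\<^esub> g) (inv\<^bsub>Grigorchuk\<^esub> h)"
    if "g \<in> carrier Grigorchuk" "h \<in> carrier Grigorchuk" "pr g h \<in> carrier Grigorchuk" for g h
  proof -
    let ?i = "inv\<^bsub>Grigorchuk\<^esub> pr g h" and ?p = "pr (inv\<^bsub>Grigorchuk\<^esub> g) (inv\<^bsub>Grigorchuk\<^esub> h)"
    have "?i \<circ> pr g h = (\<lambda>w. w)"
      using that grig.l_inv[of "pr g h"] by (simp add: grig.mult_comp grig.one_fun)
    moreover have "pr g h \<circ> ?p = (\<lambda>w. w)"
      using that grig.r_inv[of g] grig.r_inv[of h] p1 by (simp add: pm grig.mult_comp grig.one_fun)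
    ultimately show ?thesis
      by (metis comp_apply ext)
  qed
  show "pr g h = pr g' h' \<longleftrightarrow> g = g' \<and> h = h'" for g h g' h'
    by (rule pr_cong_iff)
  show "grig_a \<otimes>\<^bsub>Grigorchuk\<^esub> pr g h \<otimes>\<^bsub>Grigorchuk\<^esub> grig_a = pr h g"
    if "g \<in> carrier Grigorchuk" "h \<in> carrier Grigorchuk" for g h
  proof -
    have ap: "grig_a \<circ> pr g h \<in> Bij UNIV"
      using bij[OF that] Grigorchuk_Bij[OF abcd(1)] by (simp add: Bij_def bij_comp)
    have "(grig_a \<circ> pr g h \<circ> grig_a) w = pr h g w" for w
      by (cases w) (auto simp: add.assoc)
    then show ?thesis
      using ap bij[OF that] Grigorchuk_Bij[OF abcd(1)] by (simp add: Grigorchuk_def Bij_mult fun_eq_iff)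
  qed
  show "grig_b = pr grig_a grig_c" "grig_c = pr grig_a grig_d" "grig_d = pr \<one>\<^bsub>Grigorchuk\<^esub> grig_b"
    using grig_pr by (simp_all add: grig.one_fun)
qed


abbreviation "grig_lc \<equiv> lower_central Grigorchuk"
abbreviation "grig_dims \<equiv> dimension_series Grigorchuk 2"

section \<open>The kernel of the symbol map\<close>

text \<open>The test vector \<open>1 \<otimes> v\<close> has weights below \<open>2 * t - 1\<close>
  when those of \<open>v\<close> are below \<open>t\<close>. The coefficients of the result at words
  beginning with 0 are those of \<open>delta g v\<close>, at doubled weight.\<close>

lemma pr_filt:
  assumes "filt (2 * n + 1) (delta (pr g h))"
  shows "filt (n + 1) (delta g)"
  unfolding filt_def
proof (intro allI ballI)
  fix t v assume v: "v \<in> fil t"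
  define V :: vec where "V = (\<lambda>w. case w of [] \<Rightarrow> 0 | j # u \<Rightarrow> if j = 0 then v u else 0)"
  have V: "V \<in> fil (2 * t - 1)"
    using v by (fastforce simp: fil_def V_def split: list.splits if_splits)
  have sl: "sl V 0 = v" by (simp add: V_def)
  have "delta g v w \<noteq> 0 \<Longrightarrow> wt w < t - (n + 1)" for w
    using filtD[OF assms V] delta_pr(2)[of g h V w] unfolding fil_def sl by fastforce
  then show "delta g v \<in> fil (t - (n + 1))" by (simp add: fil_def)
qed

text \<open>The same test vector, read at words beginning with 1: with trivial second section these
  also carry \<open>delta g v\<close>, and their weight is larger by 1. So the hypothesis may be one
  degree weaker than in \<open>pr_filt\<close>.\<close>

lemma pr_id_filt:
  assumes "filt (2 * n) (delta (pr g (\<lambda>w. w)))"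
  shows "filt (n + 1) (delta g)"
  unfolding filt_def
proof (intro allI ballI)
  fix t v assume v: "v \<in> fil t"
  define V :: vec where "V = (\<lambda>w. case w of [] \<Rightarrow> 0 | j # u \<Rightarrow> if j = 0 then v u else 0)"
  have V: "V \<in> fil (2 * t - 1)"
    using v by (fastforce simp: fil_def V_def split: list.splits if_splits)
  have sl: "sl V 0 = v" by (simp add: V_def)
  have "delta g v w \<noteq> 0 \<Longrightarrow> wt w < t - (n + 1)" for w
    using filtD[OF assms V] delta_pr(3)[of g "\<lambda>w. w" V w] unfolding fil_def sl by fastforce
  then show "delta g v \<in> fil (t - (n + 1))" by (simp add: fil_def)
qed

definition unit_vec :: "nat list \<Rightarrow> vec"
  where "unit_vec u = (\<lambda>w. if w = u then 1 else 0)"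

lemma unit_vec_tens: "set u \<subseteq> {..<2} \<Longrightarrow> unit_vec u \<in> tens"
  unfolding tens_iff unit_vec_def by (intro exI[of _ "length u"]) simp

lemma symb_gens:
  "v \<in> tens \<Longrightarrow> symb 1 (delta grig_a) v = act grig_data Ga v"
  "v \<in> tens \<Longrightarrow> symb 1 (delta grig_b) v = act grig_data Gb v"
  "v \<in> tens \<Longrightarrow> symb 1 (delta grig_c) v = act grig_data Gc v"
  using symb_letter[of v Ga] symb_letter[of v Gb] symb_letter[of v Gc] by auto

text \<open>Three coefficients at which \<open>a\<close>, \<open>b\<close>, \<open>c\<close> take
  linearly independent values. Those of \<open>b\<close> and \<open>c\<close> agree on the first two
  levels, hence the test word of length 3.\<close>

lemma act_values:
  "act grig_data Ga (unit_vec [1]) [0] = 1"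
  "act grig_data Gb (unit_vec [1]) [0] = 0" "act grig_data Gc (unit_vec [1]) [0] = 0"
  "act grig_data Ga (unit_vec [0, 1]) [1, 0] = 0"
  "act grig_data Gb (unit_vec [0, 1]) [1, 0] = 1" "act grig_data Gc (unit_vec [0, 1]) [1, 0] = 1"
  "act grig_data Ga (unit_vec [0, 0, 1]) [1, 1, 0] = 0"
  "act grig_data Gb (unit_vec [0, 0, 1]) [1, 1, 0] = 1" "act grig_data Gc (unit_vec [0, 0, 1]) [1, 1, 0] = 0"
  by (simp_all add: act_letters unit_vec_def)

lemma gens_independent:
  assumes "p \<in> {\<one>\<^bsub>Grigorchuk\<^esub>, grig_b}" "q \<in> {\<one>\<^bsub>Grigorchuk\<^esub>, grig_c}" "r \<in> {\<one>\<^bsub>Grigorchuk\<^esub>, grig_a}"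
    and F: "p \<otimes>\<^bsub>Grigorchuk\<^esub> (q \<otimes>\<^bsub>Grigorchuk\<^esub> r) \<in> grig.F 2"
  shows "p = \<one>\<^bsub>Grigorchuk\<^esub> \<and> q = \<one>\<^bsub>Grigorchuk\<^esub> \<and> r = \<one>\<^bsub>Grigorchuk\<^esub>"
proof -
  have car: "p \<in> grig.F 1" "q \<in> grig.F 1" "r \<in> grig.F 1"
    using assms by (auto simp: grig.F_1' simp del: One_nat_def)
  have qr: "q \<otimes>\<^bsub>Grigorchuk\<^esub> r \<in> grig.F 1"
    using car by (simp add: grig.F_1' del: One_nat_def)
  have "symb 1 (delta p) v + (symb 1 (delta q) v + symb 1 (delta r) v) = 0" for v
    using grig.symb_mult[OF _ car(1) qr] grig.symb_mult[OF _ car(2,3)] F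
    symb_eq_0[of 1 "delta (p \<otimes>\<^bsub>Grigorchuk\<^esub> (q \<otimes>\<^bsub>Grigorchuk\<^esub> r))" v]
    by (simp add: grig.F_def numeral_2_eq_2)
  from fun_cong[OF this[of "unit_vec [1]"], of "[0]"] fun_cong[OF this[of "unit_vec [0, 1]"], of "[1, 0]"]
    fun_cong[OF this[of "unit_vec [0, 0, 1]"], of "[1, 1, 0]"]
  show ?thesis
    using assms(1-3)
    by (auto simp: symb_gens unit_vec_tens act_values grig.symb_one simp del: One_nat_def)
qed

lemma kernel_1: "carrier Grigorchuk \<inter> grig.F 2 \<subseteq> grig_lc 2"
proof
  fix g assume g: "g \<in> carrier Grigorchuk \<inter> grig.F 2"
  obtain p q r where pqr: "p \<in> {\<one>\<^bsub>Grigorchuk\<^esub>, grig_b}" "q \<in> {\<one>\<^bsub>Grigorchuk\<^esub>, grig_c}" "r \<in> {\<one>\<^bsub>Grigorchuk\<^esub>, grig_a}"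
    "p \<otimes>\<^bsub>Grigorchuk\<^esub> (q \<otimes>\<^bsub>Grigorchuk\<^esub> (r \<otimes>\<^bsub>Grigorchuk\<^esub> g)) \<in> grig_lc 2"
    using gg.abelianization_cases[of g] g by blast
  have car: "p \<in> carrier Grigorchuk" "q \<in> carrier Grigorchuk" "r \<in> carrier Grigorchuk" "g \<in> carrier Grigorchuk"
    using pqr g by auto
  have "p \<otimes>\<^bsub>Grigorchuk\<^esub> (q \<otimes>\<^bsub>Grigorchuk\<^esub> (r \<otimes>\<^bsub>Grigorchuk\<^esub> g)) \<in> grig.F 2"
    using pqr(4) grig.lc_subset_F[of 2] by auto
  then have "p \<otimes>\<^bsub>Grigorchuk\<^esub> (q \<otimes>\<^bsub>Grigorchuk\<^esub> (r \<otimes>\<^bsub>Grigorchuk\<^esub> g)) \<otimes>\<^bsub>Grigorchuk\<^esub> inv\<^bsub>Grigorchuk\<^esub> g \<in> grig.F 2"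
    using g by (blast intro: grig.F_mult grig.F_inv)
  then have "p \<otimes>\<^bsub>Grigorchuk\<^esub> (q \<otimes>\<^bsub>Grigorchuk\<^esub> r) \<in> grig.F 2"
    using car by (simp add: grig.m_assoc)
  then show "g \<in> grig_lc 2"
    using gens_independent[OF pqr(1-3)] pqr(4) car by auto
qed

text \<open>Follows the recursion of \<open>yv\<close>: if the symbol of a pair vanished,
  \<open>pr_filt\<close> or \<open>pr_id_filt\<close> would make that of its first section vanish.
  Degree 1 rests on the independence of the generators.\<close>

lemma yv_not_F: "1 \<le> n \<Longrightarrow> gg.yv n \<notin> grig.F (Suc n)"
proof (induction n rule: less_induct)
  case (less n)
  consider "n = 1" | k where "1 \<le> k" "n = 2 * k + 1" | k where "1 \<le> k" "n = 2 * k"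
  proof (cases "even n")
    case True
    then show ?thesis using that(3) less.prems by (auto elim!: evenE)
  next
    case False
    then show ?thesis using that(1,2) by (auto elim!: oddE) (metis One_nat_def Suc_leI neq0_conv)
  qed
  then show ?case
  proof cases
    case 1
    have "gg.y1 \<notin> grig.F 2"
      using gens_independent[of "\<one>\<^bsub>Grigorchuk\<^esub>" grig_c grig_a] grig_distinct
      by (auto simp: gg.y1_def simp flip: grig.one_fun)
    then show ?thesis using 1 gg.yv_1 by (simp add: numeral_2_eq_2)
  next
    case (2 k)
    have "gg.yv n \<notin> grig.F (2 * (k + 1))"
      using less.IH[of "k + 1"] 2 pr_id_filt[of "k + 1" "gg.yv (k + 1)"] gg.yv_odd[of k] gg.yv_carrier[of "k + 1"]
      by (auto simp: grig.F_def grig.one_fun)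
    then show ?thesis using 2 by simp
  next
    case (3 k)
    have "gg.yv n \<notin> grig.F (2 * k + 1)"
      using less.IH[of k] 3 pr_filt[of k "gg.yv k"] gg.yv_even[of k] gg.yv_carrier[of k]
      by (auto simp: grig.F_def)
    then show ?thesis using 3 by simp
  qed
qed

text \<open>If a layer has at most one non-trivial coset and that coset contains
  \<open>yv n\<close>, whose symbol is non-zero, then an element with zero symbol must lie in the
  trivial coset.\<close>

lemma kernel_step:
  assumes n: "1 \<le> n" and g: "g \<in> grig.F (Suc n)" and N: "N \<subseteq> grig.F (Suc n)"
    and cases: "g \<in> N \<or> inv\<^bsub>Grigorchuk\<^esub> (gg.yv n) \<otimes>\<^bsub>Grigorchuk\<^esub> g \<in> N"
  shows "g \<in> N"
proof (rule ccontr)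
  assume "g \<notin> N"
  then have "inv\<^bsub>Grigorchuk\<^esub> (gg.yv n) \<otimes>\<^bsub>Grigorchuk\<^esub> g \<in> grig.F (Suc n)" using cases N by blast
  then have "inv\<^bsub>Grigorchuk\<^esub> (gg.yv n) \<otimes>\<^bsub>Grigorchuk\<^esub> g \<otimes>\<^bsub>Grigorchuk\<^esub> inv\<^bsub>Grigorchuk\<^esub> g \<in> grig.F (Suc n)"
    using g by (blast intro: grig.F_mult grig.F_inv)
  moreover have "g \<in> carrier Grigorchuk" "gg.yv n \<in> carrier Grigorchuk"
    using g gg.yv_carrier[OF n] by (auto simp: grig.F_def)
  ultimately have "inv\<^bsub>Grigorchuk\<^esub> (gg.yv n) \<in> grig.F (Suc n)"
    by (simp add: grig.m_assoc)
  then have "gg.yv n \<in> grig.F (Suc n)"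
    using grig.F_inv[of "inv\<^bsub>Grigorchuk\<^esub> (gg.yv n)" "Suc n"] gg.yv_carrier[OF n] by simp
  then show False using yv_not_F[OF n] by blast
qed

lemma dims_kernel_odd: "odd n \<Longrightarrow> grig_dims n \<inter> grig.F (Suc n) \<subseteq> grig_dims (Suc n)"
proof
  fix g assume n: "odd n" and g: "g \<in> grig_dims n \<inter> grig.F (Suc n)"
  show "g \<in> grig_dims (Suc n)"
  proof (cases "n = 1")
    case True
    then have "g \<in> grig_lc 2" using kernel_1 g grig.dims_1 by (auto simp: numeral_2_eq_2)
    then show ?thesis using True gg.dims_2 by (simp add: numeral_2_eq_2)
  next
    case False
    then have "3 \<le> n" using n by (auto elim!: oddE)
    then show ?thesis
      using gg.dims_odd_layer[OF n, of g] g grig.dims_subset_F[of "Suc n"] by (intro kernel_step[of n g "grig_dims (Suc n)"]) auto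
  qed
qed

lemma lc_kernel_two_power: "2 \<le> r \<Longrightarrow> grig_lc (2 ^ r) \<inter> grig.F (Suc (2 ^ r)) \<subseteq> grig_lc (Suc (2 ^ r))"
  using gg.lc_two_power_layer[of r] grig.lc_subset_F[of "Suc (2 ^ r)"]
  by (intro subsetI kernel_step[of "2 ^ r" _ "grig_lc (Suc (2 ^ r))"]) auto

lemma dims_kernel_central:
  "1 \<le> m \<Longrightarrow> 1 \<le> n \<Longrightarrow> grig.csub (grig_dims m) (grig_dims n \<inter> grig.F (Suc n)) (grig_dims (Suc (m + n)))"
  by (rule grig.dims_kernel_central[OF dims_kernel_odd])

lemmas lc_kernel_cut = grig.lc_kernel_cut[OF lc_kernel_two_power]

section \<open>The hulls of the generating endomorphisms\<close>

abbreviation "LH \<equiv> lie_subalgebra hull gen_endos grig_data"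
abbreviation "RH \<equiv> restricted_lie_subalgebra hull gen_endos grig_data"

lemma tens_zero: "(0 :: vec) \<in> tens"
  by (simp add: tens_iff)

lemma tens_add:
  fixes u v :: vec
  assumes "u \<in> tens" "v \<in> tens"
  shows "u + v \<in> tens"
proof -
  from assms obtain m n where "\<forall>w. u w \<noteq> 0 \<longrightarrow> length w \<le> m \<and> set w \<subseteq> {..<2}"
    "\<forall>w. v w \<noteq> (0::bit) \<longrightarrow> length w \<le> n \<and> set w \<subseteq> {..<2}"
    unfolding tens_iff by blast
  then have "\<forall>w. (u + v) w \<noteq> 0 \<longrightarrow> length w \<le> max m n \<and> set w \<subseteq> {..<2}"
    by (metis add.right_neutral max.coboundedI1 max.coboundedI2 plus_fun_apply)
  then show ?thesis unfolding tens_iff by blast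
qed

lemma lie_subalgebra_Inter: "(\<And>A. A \<in> \<A> \<Longrightarrow> lie_subalgebra A) \<Longrightarrow> lie_subalgebra (\<Inter>\<A>)"
  unfolding lie_subalgebra_def by (intro conjI ballI allI InterI) (meson InterD)+

lemma restricted_lie_subalgebra_Inter:
  "(\<And>A. A \<in> \<A> \<Longrightarrow> restricted_lie_subalgebra A) \<Longrightarrow> restricted_lie_subalgebra (\<Inter>\<A>)"
  unfolding restricted_lie_subalgebra_def by (intro conjI lie_subalgebra_Inter ballI InterI) (meson InterD)+

lemma LH_subalgebra: "lie_subalgebra LH"
  by (rule hull_in) (blast intro: lie_subalgebra_Inter)

lemma RH_subalgebra: "restricted_lie_subalgebra RH"
  by (rule hull_in) (blast intro: restricted_lie_subalgebra_Inter)

lemma lie_subalgebraD: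
  assumes "lie_subalgebra A"
  shows "endo_zero \<in> A" "f \<in> A \<Longrightarrow> g \<in> A \<Longrightarrow> endo_add f g \<in> A" "f \<in> A \<Longrightarrow> endo_scale c f \<in> A"
    "f \<in> A \<Longrightarrow> g \<in> A \<Longrightarrow> endo_brak f g \<in> A"
  using assms unfolding lie_subalgebra_def by blast+

lemma restricted_lie_subalgebraI:
  assumes "endo_zero \<in> A" "\<And>f g. f \<in> A \<Longrightarrow> g \<in> A \<Longrightarrow> endo_add f g \<in> A" "\<And>c f. f \<in> A \<Longrightarrow> endo_scale c f \<in> A"
    "\<And>f g. f \<in> A \<Longrightarrow> g \<in> A \<Longrightarrow> endo_brak f g \<in> A" "\<And>f. f \<in> A \<Longrightarrow> endo_pmap f \<in> A"
  shows "restricted_lie_subalgebra A"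
  unfolding restricted_lie_subalgebra_def lie_subalgebra_def
  by (intro conjI ballI allI assms)

lemma restricted_lie_subalgebraD:
  "restricted_lie_subalgebra A \<Longrightarrow> lie_subalgebra A" "restricted_lie_subalgebra A \<Longrightarrow> f \<in> A \<Longrightarrow> endo_pmap f \<in> A"
  unfolding restricted_lie_subalgebra_def by blast+

lemmas RH_closed = lie_subalgebraD[OF restricted_lie_subalgebraD(1)[OF RH_subalgebra]]
  restricted_lie_subalgebraD(2)[OF RH_subalgebra]

lemma LH_RH: "LH \<subseteq> RH"
  by (rule hull_minimal) (simp_all add: hull_subset restricted_lie_subalgebraD(1)[OF RH_subalgebra])

lemma bit_diff: "a - b = a + (b::bit)"
  by (cases a; cases b) auto

lemma endo_apply:
  "v \<in> tens \<Longrightarrow> endo_zero v = (0 :: vec)"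
  "v \<in> tens \<Longrightarrow> endo_add f g v = f v + (g v :: vec)"
  "v \<in> tens \<Longrightarrow> endo_brak f g v = f (g v) + (g (f v) :: vec)"
  "v \<in> tens \<Longrightarrow> endo_pmap f v = (f (f v) :: vec)"
  "v \<in> tens \<Longrightarrow> endo_scale 0 f v = (0 :: vec)"
  "v \<in> tens \<Longrightarrow> endo_scale 1 f v = (f v :: vec)"
  by (auto simp: endo_zero_def endo_add_def endo_brak_def endo_pmap_def endo_scale_def fun_eq_iff
      bit_diff card_bit numeral_2_eq_2)

lemma endo_ext:
  "endo_zero \<in> extensional tens" "endo_add f g \<in> extensional tens" "endo_brak f g \<in> extensional tens"
  "endo_pmap f \<in> extensional tens" "endo_scale c f \<in> extensional tens"
  by (simp_all add: endo_zero_def endo_add_def endo_brak_def endo_pmap_def endo_scale_def)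

lemma endo_eqI: "f \<in> extensional tens \<Longrightarrow> g \<in> extensional tens \<Longrightarrow> (\<And>v. v \<in> tens \<Longrightarrow> f v = g v) \<Longrightarrow> f = g"
  by (rule extensionalityI)

lemma endo_scale_bit:
  assumes "f \<in> extensional tens"
  shows "endo_scale c f = (if c = 0 then endo_zero else (f :: bit endo))"
  using assms by (cases c) (auto intro!: endo_eqI simp: endo_ext endo_apply)

text \<open>A restricted subalgebra containing the generators, hence the hull: additivity and
  stability of \<open>tens\<close> thereby become available for every element of the hull.\<close>

definition additive_endos :: "bit endo set"
  where "additive_endos = {f \<in> extensional tens. (\<forall>v\<in>tens. f v \<in> tens) \<and> (\<forall>u\<in>tens. \<forall>v\<in>tens. f (u + v) = f u + f v)}"

lemma additive_endosD:
  assumes "f \<in> additive_endos"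
  shows "f \<in> extensional tens" "v \<in> tens \<Longrightarrow> f v \<in> tens" "u \<in> tens \<Longrightarrow> v \<in> tens \<Longrightarrow> f (u + v) = f u + f v"
    "f 0 = 0"
proof -
  show "f \<in> extensional tens" "v \<in> tens \<Longrightarrow> f v \<in> tens"
    and add: "u \<in> tens \<Longrightarrow> v \<in> tens \<Longrightarrow> f (u + v) = f u + f v" for u v
    using assms unfolding additive_endos_def by blast+
  show "f 0 = 0" using add[OF tens_zero tens_zero] by simp
qed

lemma additive_endos_subalgebra: "restricted_lie_subalgebra additive_endos"
proof -
  have zero: "endo_zero \<in> additive_endos"
    using tens_zero by (auto simp: additive_endos_def endo_ext endo_apply tens_add)
  have scale: "endo_scale c f \<in> additive_endos" if f: "f \<in> additive_endos" for c f
    using f zero endo_scale_bit[OF additive_endosD(1)[OF f]] by simp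
  have closed: "endo_add f g \<in> additive_endos" "endo_brak f g \<in> additive_endos" "endo_pmap f \<in> additive_endos"
    if f: "f \<in> additive_endos" and g: "g \<in> additive_endos" for f g
    using additive_endosD[OF f] additive_endosD[OF g]
    by (simp_all add: additive_endos_def endo_ext endo_apply tens_add ac_simps) (simp add: plus_fun_def)
  show ?thesis
    by (intro restricted_lie_subalgebraI zero closed scale)
qed

abbreviation gen_endo :: "letter \<Rightarrow> bit endo"
  where "gen_endo s \<equiv> (\<lambda>v\<in>tens. act grig_data s v)"

lemma gen_endo_RH: "gen_endo s \<in> RH"
  by (rule subsetD[OF hull_subset]) (cases s; simp add: gen_endos_def gens_grig_data)

lemma act_symb: "v \<in> tens \<Longrightarrow> act grig_data s v = symb 1 (delta (letter_fun s)) v"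
  by (rule ext) (rule symb_letter[symmetric])

lemma letter_fun_carrier: "letter_fun s \<in> carrier Grigorchuk"
  by (cases s) auto

lemma act_tens: "v \<in> tens \<Longrightarrow> act grig_data s v \<in> tens"
  unfolding act_symb
  by (rule local_op_tens[OF symb_local[OF delta_local]]) (use grig.length_fun letter_fun_carrier in auto)

lemma act_add: "u \<in> tens \<Longrightarrow> v \<in> tens \<Longrightarrow> act grig_data s (u + v) = act grig_data s u + act grig_data s v"
  by (simp add: act_symb tens_add additive_opD[OF symb_apply_add[OF delta_additive]])

lemma gen_endos_additive: "gen_endos grig_data \<subseteq> additive_endos"
  by (auto simp: gen_endos_def additive_endos_def act_tens act_add tens_add)

lemma RH_additive: "RH \<subseteq> additive_endos"
  by (rule hull_minimal) (rule gen_endos_additive additive_endos_subalgebra)+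

lemmas RH_D = additive_endosD[OF subsetD[OF RH_additive]]

text \<open>The endomorphism \<open>\<alpha> \<partial>\<^sub>x + 1 \<otimes> U + x \<otimes> V\<close>.\<close>

definition wreath :: "bit \<Rightarrow> bit endo \<Rightarrow> bit endo \<Rightarrow> bit endo \<Rightarrow> bool"
  where "wreath \<alpha> U V T \<longleftrightarrow> (\<forall>v\<in>tens. T v [] = 0 \<and> (\<forall>w. T v (0 # w) = \<alpha> * v (1 # w) + U (sl v 0) w) \<and>
    (\<forall>w. T v (1 # w) = V (sl v 0) w + U (sl v 1) w) \<and> (\<forall>j>1. \<forall>w. T v (j # w) = 0))"

lemma wreathD:
  assumes "wreath \<alpha> U V T" "v \<in> tens"
  shows "T v [] = 0" "T v (0 # w) = \<alpha> * v (1 # w) + U (sl v 0) w"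
    "T v (1 # w) = V (sl v 0) w + U (sl v 1) w" "1 < j \<Longrightarrow> T v (j # w) = 0"
    "sl (T v) 0 = (\<lambda>w. \<alpha> * v (1 # w)) + U (sl v 0)" "sl (T v) 1 = V (sl v 0) + U (sl v 1)"
  using assms unfolding wreath_def by (auto simp: fun_eq_iff)

lemma scaled_tens: "v \<in> tens \<Longrightarrow> (\<lambda>w. \<alpha> * (v w :: bit)) \<in> tens"
  by (cases \<alpha>) (simp_all add: tens_zero[unfolded zero_fun_def])

lemma scaled_apply: "U \<in> additive_endos \<Longrightarrow> v \<in> tens \<Longrightarrow> U (\<lambda>w. \<alpha> * v w) w = \<alpha> * U v w"
  using additive_endosD(4)[of U] by (cases \<alpha>) (auto simp: zero_fun_def)

text \<open>A composite need not be of the form \<open>wreath\<close>, so its two slices are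
  computed separately; the obstructing terms cancel in brackets and in squares.\<close>

lemma wreath_comp:
  assumes T: "wreath \<alpha> U V T" "U \<in> additive_endos" "V \<in> additive_endos" "T \<in> additive_endos"
    and S: "wreath \<beta> U' V' S" "U' \<in> additive_endos" "V' \<in> additive_endos" "S \<in> additive_endos"
    and v: "v \<in> tens"
  shows "T (S v) (0 # w) = \<alpha> * V' (sl v 0) w + \<alpha> * U' (sl v 1) w + \<beta> * U (sl v 1) w + U (U' (sl v 0)) w"
    "T (S v) (1 # w) = \<beta> * V (sl v 1) w + V (U' (sl v 0)) w + U (V' (sl v 0)) w + U (U' (sl v 1)) w"
proof -
  note t = sl_tens[OF v] additive_endosD(2)[OF S(2)] additive_endosD(2)[OF S(3)] scaled_tens
  have Sv: "S v \<in> tens" using additive_endosD(2)[OF S(4) v] .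
  show "T (S v) (0 # w) = \<alpha> * V' (sl v 0) w + \<alpha> * U' (sl v 1) w + \<beta> * U (sl v 1) w + U (U' (sl v 0)) w"
    unfolding wreathD(2)[OF T(1) Sv] wreathD(5)[OF S(1) v] wreathD(3)[OF S(1) v]
    using t by (simp add: additive_endosD(3)[OF T(2)]
        scaled_apply[OF T(2)] distrib_left add.assoc del: One_nat_def)
  show "T (S v) (1 # w) = \<beta> * V (sl v 1) w + V (U' (sl v 0)) w + U (V' (sl v 0)) w + U (U' (sl v 1)) w"
    unfolding wreathD(3)[OF T(1) Sv] wreathD(5,6)[OF S(1) v]
    using t by (simp add: additive_endosD(3)[OF T(2)] additive_endosD(3)[OF T(3)]
        scaled_apply[OF T(3)] add.assoc del: One_nat_def)
qed

lemma wreathI: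
  assumes "\<And>v. v \<in> tens \<Longrightarrow> T v [] = 0" "\<And>v w. v \<in> tens \<Longrightarrow> T v (0 # w) = \<alpha> * v (1 # w) + U (sl v 0) w"
    "\<And>v w. v \<in> tens \<Longrightarrow> T v (1 # w) = V (sl v 0) w + U (sl v 1) w"
    "\<And>v j w. v \<in> tens \<Longrightarrow> 1 < j \<Longrightarrow> T v (j # w) = 0"
  shows "wreath \<alpha> U V T"
  using assms unfolding wreath_def by blast

text \<open>The elements of \<open>RH\<close> with such a decomposition form a restricted subalgebra
  containing the generators: the components of a bracket or a square are sums, brackets and squares
  of components, so they remain in \<open>RH\<close>.\<close>

lemma RH_wreath:
  assumes "T \<in> RH"
  shows "\<exists>\<alpha>. \<exists>U\<in>RH. \<exists>V\<in>RH. wreath \<alpha> U V T"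
proof -
  let ?A = "{T \<in> RH. \<exists>\<alpha>. \<exists>U\<in>RH. \<exists>V\<in>RH. wreath \<alpha> U V T}"
  have zero: "endo_zero \<in> ?A"
    using RH_closed(1) by (intro CollectI conjI exI[of _ 0] bexI[of _ endo_zero] wreathI)
      (simp_all add: endo_apply sl_tens)
  have "RH \<subseteq> ?A"
  proof (rule hull_minimal)
    show "gen_endos grig_data \<subseteq> ?A"
    proof
      fix T assume "T \<in> gen_endos grig_data"
      then obtain s where s: "T = gen_endo s" by (auto simp: gen_endos_def)
      have "\<exists>\<alpha>. \<exists>U\<in>RH. \<exists>V\<in>RH. wreath \<alpha> U V (gen_endo s)"
      proof (cases s)
        case Ga
        then show ?thesis
          by (intro exI[of _ 1] bexI[of _ endo_zero] wreathI RH_closed(1))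
            (simp_all add: act_letters endo_apply sl_tens)
      next
        case Gb
        then show ?thesis
          by (intro exI[of _ 0] bexI[of _ endo_zero] bexI[of _ "endo_add (gen_endo Ga) (gen_endo Gc)"]
              wreathI RH_closed(1,2) gen_endo_RH)
            (simp_all add: act_letters endo_apply sl_tens)
      next
        case Gc
        then show ?thesis
          by (intro exI[of _ 0] bexI[of _ endo_zero] bexI[of _ "endo_add (gen_endo Ga) (gen_endo Gd)"]
              wreathI RH_closed(1,2) gen_endo_RH)
            (simp_all add: act_letters endo_apply sl_tens)
      next
        case Gd
        then show ?thesis
          by (intro exI[of _ 0] bexI[of _ endo_zero] bexI[of _ "gen_endo Gb"]
              wreathI RH_closed(1) gen_endo_RH)
            (simp_all add: act_letters endo_apply sl_tens)
      qed
      then show "T \<in> ?A" using s gen_endo_RH by blast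
    qed
    have add: "endo_add T S \<in> ?A" if T: "T \<in> ?A" and S: "S \<in> ?A" for T S
    proof -
      obtain \<alpha> U V where t: "T \<in> RH" "U \<in> RH" "V \<in> RH" "wreath \<alpha> U V T" using T by blast
      obtain \<beta> U' V' where s: "S \<in> RH" "U' \<in> RH" "V' \<in> RH" "wreath \<beta> U' V' S" using S by blast
      have "wreath (\<alpha> + \<beta>) (endo_add U U') (endo_add V V') (endo_add T S)"
        using t s by (intro wreathI)
          (simp_all add: endo_apply sl_tens wreathD[OF t(4)] wreathD[OF s(4)] distrib_right ac_simps del: One_nat_def)
      then show ?thesis using t s RH_closed(2) by blast
    qed
    have brak: "endo_brak T S \<in> ?A" if T: "T \<in> ?A" and S: "S \<in> ?A" for T S
    proof -
      obtain \<alpha> U V where t: "T \<in> RH" "U \<in> RH" "V \<in> RH" "wreath \<alpha> U V T" using T by blast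
      obtain \<beta> U' V' where s: "S \<in> RH" "U' \<in> RH" "V' \<in> RH" "wreath \<beta> U' V' S" using S by blast
      note ta = t(1-3)[THEN subsetD[OF RH_additive]] and sa = s(1-3)[THEN subsetD[OF RH_additive]]
      note c1 = wreath_comp[OF t(4) ta(2,3,1) s(4) sa(2,3,1)] and c2 = wreath_comp[OF s(4) sa(2,3,1) t(4) ta(2,3,1)]
      have "wreath 0 (endo_add (endo_add (endo_scale \<alpha> V') (endo_scale \<beta> V)) (endo_brak U U'))
          (endo_add (endo_brak V U') (endo_brak U V')) (endo_brak T S)"
      proof (rule wreathI)
        fix v :: vec and w assume v: "v \<in> tens"
        have tv: "T v \<in> tens" "S v \<in> tens" using additive_endosD(2) ta sa v by blast+
        show "endo_brak T S v [] = 0" using v tv by (simp add: endo_apply wreathD[OF t(4)] wreathD[OF s(4)])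
        show "endo_brak T S v (j # w) = 0" if "1 < j" for j
          using v tv that by (simp add: endo_apply wreathD[OF t(4)] wreathD[OF s(4)] del: One_nat_def)
        show "endo_brak T S v (0 # w) = 0 * v (1 # w) +
            endo_add (endo_add (endo_scale \<alpha> V') (endo_scale \<beta> V)) (endo_brak U U') (sl v 0) w"
          using v by (cases \<alpha>; cases \<beta>) (simp_all add: endo_apply c1 c2 sl_tens ac_simps del: One_nat_def)
        show "endo_brak T S v (1 # w) = endo_add (endo_brak V U') (endo_brak U V') (sl v 0) w +
            endo_add (endo_add (endo_scale \<alpha> V') (endo_scale \<beta> V)) (endo_brak U U') (sl v 1) w"
          using v by (cases \<alpha>; cases \<beta>) (simp_all add: endo_apply c1 c2 sl_tens ac_simps del: One_nat_def)
      qed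
      moreover have "endo_add (endo_add (endo_scale \<alpha> V') (endo_scale \<beta> V)) (endo_brak U U') \<in> RH"
        "endo_add (endo_brak V U') (endo_brak U V') \<in> RH" "endo_brak T S \<in> RH"
        using t s by (auto intro!: RH_closed)
      ultimately show ?thesis by blast
    qed
    have pmap: "endo_pmap T \<in> ?A" if T: "T \<in> ?A" for T
    proof -
      obtain \<alpha> U V where t: "T \<in> RH" "U \<in> RH" "V \<in> RH" "wreath \<alpha> U V T" using T by blast
      note ta = t(1-3)[THEN subsetD[OF RH_additive]]
      note c = wreath_comp[OF t(4) ta(2,3,1) t(4) ta(2,3,1)]
      have "wreath 0 (endo_add (endo_scale \<alpha> V) (endo_pmap U)) (endo_brak V U) (endo_pmap T)"
      proof (rule wreathI)
        fix v :: vec and w assume v: "v \<in> tens"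
        have tv: "T v \<in> tens" using additive_endosD(2) ta v by blast
        show "endo_pmap T v [] = 0" using v tv by (simp add: endo_apply wreathD[OF t(4)])
        show "endo_pmap T v (j # w) = 0" if "1 < j" for j
          using v tv that by (simp add: endo_apply wreathD[OF t(4)] del: One_nat_def)
        show "endo_pmap T v (0 # w) = 0 * v (1 # w) + endo_add (endo_scale \<alpha> V) (endo_pmap U) (sl v 0) w"
          using v by (cases \<alpha>) (simp_all add: endo_apply c sl_tens ac_simps del: One_nat_def)
        show "endo_pmap T v (1 # w) = endo_brak V U (sl v 0) w + endo_add (endo_scale \<alpha> V) (endo_pmap U) (sl v 1) w"
          using v by (cases \<alpha>) (simp_all add: endo_apply c sl_tens ac_simps del: One_nat_def)
      qed
      moreover have "endo_add (endo_scale \<alpha> V) (endo_pmap U) \<in> RH" "endo_brak V U \<in> RH" "endo_pmap T \<in> RH"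
        using t by (auto intro!: RH_closed)
      ultimately show ?thesis by blast
    qed
    have scale: "endo_scale c T \<in> ?A" if T: "T \<in> ?A" for c T
      using T zero endo_scale_bit[of T c] RH_D(1)[of T] by auto
    show "restricted_lie_subalgebra ?A"
      by (intro restricted_lie_subalgebraI zero add brak pmap scale)
  qed
  then show ?thesis using assms by blast
qed

lemma act_bcd: "act grig_data Gc v w + act grig_data Gd v w = act grig_data Gb v w"
proof (induction w arbitrary: v)
  case (Cons j w)
  show ?case
    by (auto simp: act_letters Cons.IH[symmetric] ac_simps)
qed simp

definition embed :: "vec \<Rightarrow> vec"
  where "embed v = (\<lambda>w. case w of [] \<Rightarrow> 0 | j # u \<Rightarrow> if j = 0 then v u else 0)"

lemma embed_tens: "v \<in> tens \<Longrightarrow> embed v \<in> tens" and sl_embed: "sl (embed v) 0 = v" "sl (embed v) 1 = 0"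
proof -
  show "sl (embed v) 0 = v" "sl (embed v) 1 = 0" by (simp_all add: embed_def fun_eq_iff)
  assume "v \<in> tens"
  then obtain n where n: "\<forall>w. v w \<noteq> 0 \<longrightarrow> length w \<le> n \<and> set w \<subseteq> {..<2}" unfolding tens_iff by blast
  then have "\<forall>w. embed v w \<noteq> 0 \<longrightarrow> length w \<le> Suc n \<and> set w \<subseteq> {..<2}"
    by (auto simp: embed_def split: list.splits if_splits)
  then show "embed v \<in> tens" unfolding tens_iff by blast
qed

abbreviation "act_ac v \<equiv> act grig_data Ga v + act grig_data Gc v"
abbreviation "act_ad v \<equiv> act grig_data Ga v + act grig_data Gd v"

lemma sl_act:
  "sl (act grig_data Ga v) 0 = sl v 1" "sl (act grig_data Ga v) 1 = 0"
  "sl (act grig_data Gb v) 0 = 0" "sl (act grig_data Gb v) 1 = act_ac (sl v 0)"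
  "sl (act grig_data Gd v) 0 = 0" "sl (act grig_data Gd v) 1 = act grig_data Gb (sl v 0)"
  by (auto simp: act_letters fun_eq_iff)

text \<open>Comparison on vectors \<open>1 \<otimes> v\<close>, which \<open>b\<close> sends to
  \<open>x \<otimes> (a + c) v\<close>. Values of \<open>b\<close> have no part free of
  \<open>x\<close>, which forces \<open>\<alpha>\<close> to vanish; this is seen at
  \<open>v = x\<close>, where \<open>(a + c) v\<close> is 1.\<close>

lemma commute_b:
  assumes T: "wreath \<alpha> U V T" "U \<in> additive_endos" "V \<in> additive_endos" "T \<in> additive_endos"
    and b: "\<And>v. v \<in> tens \<Longrightarrow> T (act grig_data Gb v) = act grig_data Gb (T v)"
  shows "\<alpha> = 0" and "v \<in> tens \<Longrightarrow> U (act_ac v) = act_ac (U v)"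
proof -
  note [simp del] = One_nat_def
  have e: "act grig_data Gb (embed v) \<in> tens" if "v \<in> tens" for v
    using that by (intro act_tens embed_tens)
  have "T (act grig_data Gb (embed (unit_vec [1]))) [0, 0] = act grig_data Gb (T (embed (unit_vec [1]))) [0, 0]"
    by (subst b) (simp_all add: embed_tens unit_vec_tens)
  moreover have "T (act grig_data Gb (embed (unit_vec [1]))) [0, 0] = \<alpha>"
    using wreathD(2)[OF T(1) e[OF unit_vec_tens], of "[1]" "[0]"] additive_endosD(4)[OF T(2)]
    by (simp add: act_letters(2) sl_act sl_embed) (simp add: act_values zero_fun_def)
  ultimately show \<alpha>: "\<alpha> = 0" by (simp add: act_letters)
  show "U (act_ac v) = act_ac (U v)" if v: "v \<in> tens"
  proof
    fix w
    have "T (act grig_data Gb (embed v)) (1 # w) = U (act_ac v) w"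
      using wreathD(3)[OF T(1) e[OF v], of w] additive_endosD(4)[OF T(3)]
      by (simp add: sl_act sl_embed)
    moreover have "act grig_data Gb (T (embed v)) (1 # w) = act_ac (U v) w"
      using wreathD(5)[OF T(1) embed_tens[OF v]] by (simp add: act_letters(2) \<alpha> sl_embed zero_fun_def[symmetric])
    ultimately show "U (act_ac v) w = act_ac (U v) w"
      using b[OF embed_tens[OF v]] by simp
  qed
qed

text \<open>The pair \<open>b\<close>, \<open>a + c\<close> reproduces itself one level down:
  commuting with \<open>b\<close> makes \<open>U1\<close> commute with \<open>a + c\<close>;
  commuting with \<open>a + c\<close> kills \<open>V1\<close> and makes \<open>U1\<close> commute
  with \<open>a + d\<close>; and the sum of \<open>a + c\<close> and \<open>a + d\<close> is
  \<open>c + d = b\<close>. The induction is on the output word.\<close>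

lemma commuting_zero:
  assumes "U \<in> RH" "\<And>v. v \<in> tens \<Longrightarrow> U (act grig_data Gb v) = act grig_data Gb (U v)"
    "\<And>v. v \<in> tens \<Longrightarrow> U (act_ac v) = act_ac (U v)" "v \<in> tens"
  shows "U v w = 0"
  using assms
proof (induction w arbitrary: U v)
  case Nil
  obtain \<beta> U1 V1 where u: "U1 \<in> RH" "V1 \<in> RH" "wreath \<beta> U1 V1 U" using RH_wreath[OF Nil(1)] by blast
  then show ?case using wreathD(1) Nil by blast
next
  case (Cons j w)
  note [simp del] = One_nat_def
  obtain \<beta> U1 V1 where u: "U1 \<in> RH" "V1 \<in> RH" "wreath \<beta> U1 V1 U" using RH_wreath[OF Cons.prems(1)] by blast
  have ua: "U1 \<in> additive_endos" "V1 \<in> additive_endos" "U \<in> additive_endos"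
    using u Cons.prems(1) RH_additive by blast+
  have cb: "\<beta> = 0" "v \<in> tens \<Longrightarrow> U1 (act_ac v) = act_ac (U1 v)" for v
    by (rule commute_b[OF u(3) ua Cons.prems(2)], assumption+)+
  have ac: "act_ac v \<in> tens" and ad: "act_ad v \<in> tens" if "v \<in> tens" for v
    using that by (simp_all add: tens_add act_tens)
  have sl_ac: "sl (act_ac v) 0 = sl v 1" "sl (act_ac v) 1 = act_ad (sl v 0)" for v
    by (auto simp: act_letters fun_eq_iff)
  have V1: "V1 v = 0" and ad_c: "U1 (act_ad v) = act_ad (U1 v)" if v: "v \<in> tens" for v
  proof -
    have c: "U (act_ac (embed v)) = act_ac (U (embed v))"
      by (rule Cons.prems(3)[OF embed_tens[OF v]])
    note wa = wreathD[OF u(3) ac[OF embed_tens[OF v]]] and we = wreathD[OF u(3) embed_tens[OF v]]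
    show "V1 v = 0"
    proof
      fix w
      have "U (act_ac (embed v)) (0 # w) = 0"
        using wa(2)[of w] unfolding sl_ac sl_embed additive_endosD(4)[OF ua(1)] by (simp add: cb(1))
      moreover have "act_ac (U (embed v)) (0 # w) = V1 v w"
        using we(3)[of w] additive_endosD(4)[OF ua(1)] by (simp add: act_letters sl_embed)
      ultimately show "V1 v w = 0 w" using c by simp
    qed
    show "U1 (act_ad v) = act_ad (U1 v)"
    proof
      fix w
      have "U (act_ac (embed v)) (1 # w) = U1 (act_ad v) w"
        using wa(3)[of w] unfolding sl_ac sl_embed additive_endosD(4)[OF ua(2)] by simp
      moreover have "act_ac (U (embed v)) (1 # w) = act_ad (U1 v) w"
        using we(5) by (simp add: act_letters cb(1) sl_embed zero_fun_def[symmetric])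
      ultimately show "U1 (act_ad v) w = act_ad (U1 v) w" using c by simp
    qed
  qed
  have sum: "act_ac v + act_ad v = act grig_data Gb v" for v
    by (rule ext) (simp add: act_bcd[symmetric] ac_simps)
  have U1_b: "U1 (act grig_data Gb v) = act grig_data Gb (U1 v)" if v: "v \<in> tens" for v
    using additive_endosD(3)[OF ua(1) ac[OF v] ad[OF v]] cb(2)[OF v] ad_c[OF v] by (simp add: sum)
  have IH: "U1 v w = 0" if "v \<in> tens" for v
    by (rule Cons.IH[OF u(1)]) (assumption | rule U1_b cb(2) that)+
  note wv = wreathD[OF u(3) Cons.prems(4)]
  consider "j = 0" | "j = 1" | "1 < j" by linarith
  then show ?case
  proof cases
    case 1
    then show ?thesis using wv(2) IH cb(1) sl_tens[OF Cons.prems(4)] by simp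
  next
    case 2
    then show ?thesis using wv(3) IH V1 sl_tens[OF Cons.prems(4)] by simp
  next
    case 3
    then show ?thesis using wv(4) by simp
  qed
qed

text \<open>\<open>a\<close> kills \<open>V\<close>, \<open>b\<close> kills \<open>\<alpha>\<close>
  and gives commutation of \<open>U\<close> with \<open>a + c\<close>, and \<open>d\<close> gives
  commutation with \<open>b\<close>; then \<open>commuting_zero\<close> applies to
  \<open>U\<close>.\<close>

lemma RH_centreless:
  assumes T: "T \<in> RH" and c: "\<And>s. endo_brak T (gen_endo s) = endo_zero"
  shows "T = endo_zero"
proof -
  note [simp del] = One_nat_def
  obtain \<alpha> U V where u: "U \<in> RH" "V \<in> RH" "wreath \<alpha> U V T" using RH_wreath[OF T] by blast
  have ua: "U \<in> additive_endos" "V \<in> additive_endos" "T \<in> additive_endos"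
    using u T RH_additive by blast+
  have comm: "T (act grig_data s v) = act grig_data s (T v)" if v: "v \<in> tens" for s v
  proof -
    have "endo_brak T (gen_endo s) v = 0" using c v by (simp add: endo_apply)
    then show ?thesis
      using v additive_endosD(2)[OF ua(3) v] by (simp add: endo_apply vec_add_eq_0_iff)
  qed
  have cb: "\<alpha> = 0" "v \<in> tens \<Longrightarrow> U (act_ac v) = act_ac (U v)" for v
    by (rule commute_b[OF u(3) ua comm], assumption+)+
  have V: "V v = 0" and U_b: "U (act grig_data Gb v) = act grig_data Gb (U v)" if v: "v \<in> tens" for v
  proof -
    note e = embed_tens[OF v]
    note we = wreathD[OF u(3) e]
    show "V v = 0"
    proof
      fix w
      have "T (act grig_data Ga (embed v)) (0 # w) = 0"
        using wreathD(2)[OF u(3) act_tens[OF e], of Ga w] additive_endosD(4)[OF ua(1)]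
        by (simp add: cb(1) sl_act sl_embed)
      moreover have "act grig_data Ga (T (embed v)) (0 # w) = V v w"
        using we(3)[of w] additive_endosD(4)[OF ua(1)] by (simp add: act_letters sl_embed)
      ultimately show "V v w = 0 w" using comm[OF e] by simp
    qed
    show "U (act grig_data Gb v) = act grig_data Gb (U v)"
    proof
      fix w
      have "T (act grig_data Gd (embed v)) (1 # w) = U (act grig_data Gb v) w"
        using wreathD(3)[OF u(3) act_tens[OF e], of Gd w] additive_endosD(4)[OF ua(2)]
        by (simp add: sl_act sl_embed)
      moreover have "act grig_data Gd (T (embed v)) (1 # w) = act grig_data Gb (U v) w"
        using we(5) by (simp add: act_letters cb(1) sl_embed zero_fun_def[symmetric])
      ultimately show "U (act grig_data Gb v) w = act grig_data Gb (U v) w" using comm[OF e] by simp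
    qed
  qed
  have U: "U v w = 0" if "v \<in> tens" for v w
    by (rule commuting_zero[OF u(1)]) (assumption | rule U_b cb(2) that)+
  have "T v w = 0" if v: "v \<in> tens" for v w
  proof (cases w)
    case Nil
    then show ?thesis using wreathD(1)[OF u(3) v] by simp
  next
    case (Cons j w')
    consider "j = 0" | "j = 1" | "1 < j" by linarith
    then show ?thesis
      by cases (use Cons wreathD[OF u(3) v] U V sl_tens[OF v] cb(1) in auto)
  qed
  then show ?thesis
    using RH_D(1)[OF T] by (intro endo_eqI) (auto simp: endo_ext endo_apply)
qed

section \<open>The image of the symbol map\<close>

context word_group
begin

definition se :: "nat \<Rightarrow> (bit list \<Rightarrow> bit list) \<Rightarrow> bit endo"
  where "se n g = (\<lambda>v\<in>tens. symb n (delta g) v)"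

lemma se_apply: "v \<in> tens \<Longrightarrow> se n g v = symb n (delta g) v"
  by (simp add: se_def)

lemma se_ext: "se n g \<in> extensional tens"
  by (simp add: se_def)

lemma symb_tens: "g \<in> carrier G \<Longrightarrow> v \<in> tens \<Longrightarrow> symb n (delta g) v \<in> tens"
  by (rule local_op_tens[OF symb_local[OF delta_local]]) (simp_all add: length_fun)

lemma F_carrier: "g \<in> F n \<Longrightarrow> g \<in> carrier G"
  by (simp add: F_def)

lemma se_mult: "1 \<le> n \<Longrightarrow> g \<in> F n \<Longrightarrow> h \<in> F n \<Longrightarrow> se n (g \<otimes> h) = endo_add (se n g) (se n h)"
  by (rule endo_eqI) (simp_all add: se_ext endo_ext se_apply endo_apply symb_mult)

lemma se_zero: "g \<in> F (Suc n) \<Longrightarrow> se n g = endo_zero"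
  by (rule endo_eqI) (simp_all add: se_ext endo_ext se_apply endo_apply F_def symb_eq_0)

lemma se_inv:
  assumes n: "1 \<le> n" and g: "g \<in> F n"
  shows "se n (inv g) = se n g"
proof (rule endo_eqI[OF se_ext se_ext])
  fix v :: vec assume "v \<in> tens"
  have "symb n (delta (inv g)) v + symb n (delta g) v = 0"
    using symb_mult[OF n F_inv[OF g] g, of v] F_carrier[OF g] by (simp add: symb_one)
  then show "se n (inv g) v = se n g v"
    using \<open>v \<in> tens\<close> by (simp add: se_apply vec_add_eq_0_iff)
qed

lemma se_commutator:
  "g \<in> F m \<Longrightarrow> h \<in> F n \<Longrightarrow> se (m + n) (cm g h) = endo_brak (se m g) (se n h)"
  by (rule endo_eqI) (simp_all add: se_ext endo_ext se_apply endo_apply symb_commutator symb_tens F_carrier)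

lemma se_square: "g \<in> F n \<Longrightarrow> se (2 * n) (g \<otimes> g) = endo_pmap (se n g)"
  by (rule endo_eqI) (simp_all add: se_ext endo_ext se_apply endo_apply symb_square symb_tens F_carrier)

lemma subgroup_se:
  assumes n: "1 \<le> n" and A: "lie_subalgebra A"
  shows "subgroup {g \<in> F n. se n g \<in> A} G"
proof
  show "{g \<in> F n. se n g \<in> A} \<subseteq> carrier G" by (auto simp: F_def)
  show "\<one> \<in> {g \<in> F n. se n g \<in> A}"
    using normal_one[OF F_normal] lie_subalgebraD(1)[OF A] se_zero[of \<one> n] by simp
  show "g \<otimes> h \<in> {g \<in> F n. se n g \<in> A}" if "g \<in> {g \<in> F n. se n g \<in> A}" "h \<in> {g \<in> F n. se n g \<in> A}" for g h
    using that n lie_subalgebraD(2)[OF A] by (auto simp: se_mult F_mult)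
  show "inv g \<in> {g \<in> F n. se n g \<in> A}" if "g \<in> {g \<in> F n. se n g \<in> A}" for g
    using that n by (auto simp: se_inv F_inv)
qed

lemma lc_se:
  assumes A: "lie_subalgebra A" and G: "\<And>g. g \<in> carrier G \<Longrightarrow> se 1 g \<in> A"
  shows "1 \<le> n \<Longrightarrow> g \<in> lc n \<Longrightarrow> se n g \<in> A"
proof -
  have "lc n \<subseteq> {g \<in> F n. se n g \<in> A}" if "1 \<le> n"
    using that
  proof (induction n rule: dec_induct)
    case base
    then show ?case using G by (simp add: F_1'[simplified] subset_iff)
  next
    case (step n)
    show ?case
      unfolding lc_Suc[OF step(1)]
    proof (rule gcomm_least[OF subgroup_se[OF _ A]])
      show "csub (carrier G) (lc n) {g \<in> F (Suc n). se (Suc n) g \<in> A}"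
        unfolding csub_def
      proof (intro ballI CollectI conjI)
        fix s h assume s: "s \<in> carrier G" and h: "h \<in> lc n"
        have sh: "s \<in> F 1" "h \<in> F n" "se n h \<in> A" using s h step F_1' by auto
        show "cm s h \<in> F (Suc n)" using F_commutator[OF sh(1,2)] by simp
        show "se (Suc n) (cm s h) \<in> A"
          using se_commutator[OF sh(1,2)] lie_subalgebraD(4)[OF A G[OF s] sh(3)] by simp
      qed
    qed simp
  qed
  then show "1 \<le> n \<Longrightarrow> g \<in> lc n \<Longrightarrow> se n g \<in> A" by blast
qed

lemma dims_se:
  assumes A: "restricted_lie_subalgebra A" and G: "\<And>g. g \<in> carrier G \<Longrightarrow> se 1 g \<in> A"
  shows "1 \<le> n \<Longrightarrow> g \<in> dims n \<Longrightarrow> se n g \<in> A"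
proof -
  note A' = restricted_lie_subalgebraD(1)[OF A]
  have "dims n \<subseteq> {g \<in> F n. se n g \<in> A}" if "1 \<le> n"
    using that
  proof (induction n rule: less_induct)
    case (less n)
    show ?case
    proof (cases "n = 1")
      case True
      then show ?thesis using G dims_1[of 1] F_1' by auto
    next
      case False
      then have n: "2 \<le> n" using less.prems by simp
      have IH': "dims (n - 1) \<subseteq> {g \<in> F (n - 1). se (n - 1) g \<in> A}"
        by (rule less.IH) (use n in auto)
      show ?thesis
      proof (rule dims_leastI[OF n subgroup_se[OF less.prems A']])
        show "csub (carrier G) (dims (n - 1)) {g \<in> F n. se n g \<in> A}"
          unfolding csub_def
        proof (intro ballI CollectI conjI)
          fix s h assume s: "s \<in> carrier G" and h: "h \<in> dims (n - 1)"
          have sh: "s \<in> F 1" "h \<in> F (n - 1)" "se (n - 1) h \<in> A"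
            using s h IH' F_1' by auto
          show "cm s h \<in> F n" using F_commutator[OF sh(1,2)] n by simp
          show "se n (cm s h) \<in> A"
            using se_commutator[OF sh(1,2)] lie_subalgebraD(4)[OF A' G[OF s] sh(3)] n by simp
        qed
        fix h assume h: "h \<in> dims ((n + 1) div 2)"
        define l where "l = (n + 1) div 2"
        have l: "1 \<le> l" "l < n" "n = 2 * l \<or> Suc n = 2 * l" using n by (auto simp: l_def)
        have hl: "h \<in> F l" "se l h \<in> A" using h less.IH[OF l(2,1)] by (auto simp: l_def)
        have sq: "h \<otimes> h \<in> F (2 * l)" by (rule F_square_closed[OF hl(1)])
        from l(3) show "h \<otimes> h \<in> {g \<in> F n. se n g \<in> A}"
        proof
          assume "n = 2 * l"
          then show ?thesis
            using sq se_square[OF hl(1)] restricted_lie_subalgebraD(2)[OF A hl(2)] by simp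
        next
          \<comment> \<open>For odd \<open>n\<close> the index of the root is rounded up, so the
            square already lies in \<open>F (Suc n)\<close> and its symbol in degree
            \<open>n\<close> is 0.\<close>
          assume "Suc n = 2 * l"
          then have "h \<otimes> h \<in> F (Suc n)" using sq by simp
          then show ?thesis
            using F_Suc lie_subalgebraD(1)[OF A'] by (auto simp: se_zero)
        qed
      qed
    qed
  qed
  then show "1 \<le> n \<Longrightarrow> g \<in> dims n \<Longrightarrow> se n g \<in> A" by blast
qed

end

lemma subalgebra_group:
  assumes A: "lie_subalgebra (carrier M)" "carrier M \<subseteq> (extensional tens :: bit endo set)"
    and M: "monoid.mult M = endo_add" "one M = endo_zero"
  shows "Group.group M"
proof (rule groupI)
  note closed = lie_subalgebraD[OF A(1)]
  have ext: "f \<in> extensional tens" if "f \<in> carrier M" for f using that A(2) by blast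
  show "\<one>\<^bsub>M\<^esub> \<in> carrier M" by (simp add: M closed)
  fix f g h assume f: "f \<in> carrier M" and g: "g \<in> carrier M" and h: "h \<in> carrier M"
  show "f \<otimes>\<^bsub>M\<^esub> g \<in> carrier M" using f g by (simp add: M closed)
  show "f \<otimes>\<^bsub>M\<^esub> g \<otimes>\<^bsub>M\<^esub> h = f \<otimes>\<^bsub>M\<^esub> (g \<otimes>\<^bsub>M\<^esub> h)"
    by (rule endo_eqI) (simp_all add: M endo_ext endo_apply add.assoc)
  show "\<one>\<^bsub>M\<^esub> \<otimes>\<^bsub>M\<^esub> f = f"
    by (rule endo_eqI) (simp_all add: M endo_ext endo_apply ext f)
  have "f \<otimes>\<^bsub>M\<^esub> f = \<one>\<^bsub>M\<^esub>"
    by (rule endo_eqI) (simp_all add: M endo_ext endo_apply)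
  then show "\<exists>g\<in>carrier M. g \<otimes>\<^bsub>M\<^esub> f = \<one>\<^bsub>M\<^esub>" using f by blast
qed

context graded_lie
begin

lemma Phi_in:
  assumes A: "lie_subalgebra A" and se: "\<And>n g. 1 \<le> n \<Longrightarrow> g \<in> N n \<Longrightarrow> se n g \<in> A" and x: "x \<in> carrier L"
  shows "Phi x \<in> A"
proof -
  obtain B where B: "\<And>n. B < n \<Longrightarrow> x n = N (Suc n)"
    using bound[OF x x] by metis
  have "(\<lambda>v\<in>tens. Psum C x v) \<in> A" for C
  proof (induction C)
    case 0
    have "(\<lambda>v\<in>tens. Psum 0 x v) = endo_zero"
      by (rule endo_eqI) (simp_all add: endo_ext endo_apply Psum_def zero_fun_def)
    then show ?case using lie_subalgebraD(1)[OF A] by simp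
  next
    case (Suc C)
    obtain g where g: "g \<in> N (Suc C)" "x (Suc C) = cl (Suc C) g"
      using L_comp[OF x, of "Suc C"] by (auto elim: layerE)
    have "(\<lambda>v\<in>tens. Psum (Suc C) x v) = endo_add (\<lambda>v\<in>tens. Psum C x v) (se (Suc C) g)"
      by (rule endo_eqI) (simp_all add: endo_ext endo_apply se_apply Psum_def g sy_cl plus_fun_def)
    then show ?case using lie_subalgebraD(2)[OF A Suc se[OF _ g(1)]] by (simp only: Suc_le_eq zero_less_Suc One_nat_def)
  qed
  moreover have "Phi x = (\<lambda>v\<in>tens. Psum B x v)"
    by (rule endo_eqI) (simp_all add: Phi_ext Phi_eq[OF x B])
  ultimately show ?thesis by simp
qed

text \<open>Elements concentrated in degree 1. For the four letters their images are the generating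
  endomorphisms, which makes \<open>Phi\<close> onto the hulls.\<close>

definition deg_1 :: "(bit list \<Rightarrow> bit list) \<Rightarrow> nat \<Rightarrow> (bit list \<Rightarrow> bit list) set"
  where "deg_1 g = (\<lambda>n\<in>{1..}. if n = 1 then cl 1 g else N (Suc n))"

lemma deg_1_carrier: "g \<in> N 1 \<Longrightarrow> deg_1 g \<in> carrier L"
  unfolding in_L_iff
proof (intro conjI allI impI)
  assume g: "g \<in> N 1"
  show "deg_1 g \<in> extensional {1..}" by (simp add: deg_1_def)
  show "deg_1 g n \<in> carrier (Ly n)" if "1 \<le> n" for n
    using that g cl_layer[OF g] cl_layer[OF normal_one[OF N_normal], of n] by (simp add: deg_1_def cl_one)
  show "\<exists>B. \<forall>n>B. deg_1 g n = N (Suc n)"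
    by (rule exI[of _ 1]) (simp add: deg_1_def)
qed

lemma Phi_deg_1:
  assumes g: "g \<in> N 1"
  shows "Phi (deg_1 g) = se 1 g"
proof (rule endo_eqI[OF Phi_ext se_ext])
  fix v :: vec assume v: "v \<in> tens"
  have "Phi (deg_1 g) v = Psum 1 (deg_1 g) v"
    by (rule Phi_eq[OF deg_1_carrier[OF g] _ v]) (simp add: deg_1_def)
  then show "Phi (deg_1 g) v = se 1 g v"
    using v sy_cl[OF _ g] by (simp add: Psum_def se_apply deg_1_def)
qed

lemma Phi_one: "Phi (one L) = endo_zero"
  by (simp add: Phi_def one_L endo_zero_def cong: conj_cong)

lemma Phi_0: "x \<in> carrier L \<Longrightarrow> Phi x 0 = 0"
proof -
  assume x: "x \<in> carrier L"
  obtain B where B: "\<And>n. B < n \<Longrightarrow> x n = N (Suc n)"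
    using bound[OF x x] by metis
  show ?thesis
    using Phi_eq[OF x B tens_zero] additive_op_0[OF Psum_additive[OF x]] by simp
qed

definition ker :: "(nat \<Rightarrow> (bit list \<Rightarrow> bit list) set) set"
  where "ker = {x \<in> carrier L. Phi x = endo_zero}"

lemma endo_zero_brak: "y \<in> carrier L \<Longrightarrow> endo_brak endo_zero (Phi y) = endo_zero"
  by (rule endo_eqI) (simp_all add: endo_ext endo_apply Phi_0 Phi_tens)

lemma ker_brak: "x \<in> ker \<Longrightarrow> y \<in> carrier L \<Longrightarrow> brak L x y \<in> ker"
  by (simp add: ker_def Phi_brak endo_zero_brak brak_L_closed)

lemma quot_ker_isomorphism:
  assumes A: "lie_subalgebra (carrier M)" "carrier M \<subseteq> (extensional tens :: bit endo set)"
    and M: "monoid.mult M = endo_add" "one M = endo_zero" "brak M = endo_brak"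
    and im: "Phi ` carrier L = carrier M"
  shows "LL.ideal_of ker" "\<exists>f\<in>lie_isos (lie_quot L ker) M. \<forall>x\<in>carrier L. f (ker #>\<^bsub>L\<^esub> x) = Phi x"
proof -
  have grp: "Group.group M" by (rule subalgebra_group[OF A M(1,2)])
  have hom: "Phi \<in> hom L M" using im by (auto simp: hom_def Phi_mult M)
  interpret h: group_hom L M Phi
    using grp hom by (intro group_hom.intro group_hom_axioms.intro LL.group_axioms)
  have "kernel L M Phi = ker" by (simp add: kernel_def ker_def M)
  then have "subgroup ker L" using h.subgroup_kernel by simp
  then show ideal: "LL.ideal_of ker" by (simp add: LL.ideal_of_def ker_brak)
  show "\<exists>f\<in>lie_isos (lie_quot L ker) M. \<forall>x\<in>carrier L. f (ker #>\<^bsub>L\<^esub> x) = Phi x"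
    by (rule LL.lie_quot_isomorphism[OF grp hom im _ ideal]) (simp_all add: M Phi_brak ker_def)
qed

end


section \<open>Centres and kernels\<close>

interpretation FL: graded_lie Grigorchuk grig_dims "lie_F2 Grigorchuk"
  by (intro graded_lie.intro graded_rep.intro graded_rep_axioms.intro graded_lie_axioms.intro
      grig.word_group_axioms grig.dims_normal grig.dims_Suc_subset grig.dims_strongly_central grig.dims_subset_F)
    (simp_all add: lie_F2_def Let_def)

interpretation ZL: graded_lie Grigorchuk grig_lc "lie_Z Grigorchuk"
  by (intro graded_lie.intro graded_rep.intro graded_rep_axioms.intro graded_lie_axioms.intro
      grig.word_group_axioms grig.lc_normal grig.lc_Suc_subset grig.lc_strongly_central grig.lc_subset_F)
    (simp_all add: lie_Z_def Let_def)

lemma se_letter: "grig.se 1 (letter_fun s) = gen_endo s"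
  by (rule endo_eqI) (simp_all add: grig.se_apply grig.se_ext act_symb del: One_nat_def)

lemma se_carrier:
  assumes A: "lie_subalgebra A" "gen_endos grig_data \<subseteq> A" and g: "g \<in> carrier Grigorchuk"
  shows "grig.se 1 g \<in> A"
proof -
  have gen: "gen_endo s \<in> A" for s
    using A(2) by (cases s) (auto simp: gen_endos_def gens_grig_data)
  have "carrier Grigorchuk \<subseteq> {g \<in> grig.F 1. grig.se 1 g \<in> A}"
    unfolding Grigorchuk_generate
  proof (rule grig.generate_subgroup_incl[OF _ grig.subgroup_se[OF _ A(1)]])
    show "grig_gens \<subseteq> {g \<in> grig.F 1. grig.se 1 g \<in> A}"
      unfolding letter_fun_image
      using letter_fun_carrier gen by (auto simp: se_letter grig.F_1' simp del: One_nat_def letter_fun.simps)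
  qed simp
  then show ?thesis using g by blast
qed

lemma FL_pmap:
  assumes "x \<in> carrier (lie_F2 Grigorchuk)"
  shows "pmap (lie_F2 Grigorchuk) x \<in> carrier (lie_F2 Grigorchuk)"
    "FL.Phi (pmap (lie_F2 Grigorchuk) x) = endo_pmap (FL.Phi x)"
proof -
  have "pmap (lie_F2 Grigorchuk) x = graded_square Grigorchuk grig_dims x"
    by (simp add: lie_F2_def Let_def)
  then show "pmap (lie_F2 Grigorchuk) x \<in> carrier (lie_F2 Grigorchuk)"
    "FL.Phi (pmap (lie_F2 Grigorchuk) x) = endo_pmap (FL.Phi x)"
    using FL.Phi_square[of x] grig.dims_square assms by simp_all
qed

lemma FL_image: "FL.Phi ` carrier (lie_F2 Grigorchuk) = RH"
proof
  show "FL.Phi ` carrier (lie_F2 Grigorchuk) \<subseteq> RH"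
    using FL.Phi_in[OF restricted_lie_subalgebraD(1)[OF RH_subalgebra]]
      grig.dims_se[OF RH_subalgebra se_carrier[OF restricted_lie_subalgebraD(1)[OF RH_subalgebra] hull_subset]]
    by blast
  let ?A = "FL.Phi ` carrier (lie_F2 Grigorchuk)"
  have one: "endo_zero \<in> ?A"
    using FL.Phi_one FL.LL.one_closed by (metis imageI)
  show "RH \<subseteq> ?A"
  proof (rule hull_minimal)
    show "gen_endos grig_data \<subseteq> ?A"
    proof
      fix T assume "T \<in> gen_endos grig_data"
      then obtain s where s: "T = gen_endo s" by (auto simp: gen_endos_def)
      have "letter_fun s \<in> grig_dims 1" by (simp add: grig.dims_1 letter_fun_carrier)
      then show "T \<in> ?A"
        using FL.Phi_deg_1 FL.deg_1_carrier s se_letter by (metis imageI)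
    qed
    show "restricted_lie_subalgebra ?A"
    proof (rule restricted_lie_subalgebraI[OF one])
      fix f g assume f: "f \<in> ?A" and g: "g \<in> ?A"
      obtain x y where xy: "f = FL.Phi x" "g = FL.Phi y" "x \<in> carrier (lie_F2 Grigorchuk)" "y \<in> carrier (lie_F2 Grigorchuk)"
        using f g by blast
      show "endo_add f g \<in> ?A"
        unfolding xy FL.Phi_mult[OF xy(3,4), symmetric] by (rule imageI[OF FL.LL.m_closed[OF xy(3,4)]])
      show "endo_brak f g \<in> ?A"
        unfolding xy FL.Phi_brak[OF xy(3,4), symmetric] by (rule imageI[OF FL.brak_L_closed[OF xy(3,4)]])
    next
      fix c f assume f: "f \<in> ?A"
      show "endo_scale c f \<in> ?A"
        using f one endo_scale_bit[of f c] FL.Phi_ext by auto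
      obtain x where x: "f = FL.Phi x" "x \<in> carrier (lie_F2 Grigorchuk)" using f by blast
      show "endo_pmap f \<in> ?A"
        unfolding x FL_pmap(2)[OF x(2), symmetric] by (rule imageI[OF FL_pmap(1)[OF x(2)]])
    qed
  qed
qed

lemma ZL_image: "ZL.Phi ` carrier (lie_Z Grigorchuk) = LH"
proof
  show "ZL.Phi ` carrier (lie_Z Grigorchuk) \<subseteq> LH"
    using ZL.Phi_in[OF LH_subalgebra] grig.lc_se[OF LH_subalgebra se_carrier[OF LH_subalgebra hull_subset]]
    by blast
  let ?A = "ZL.Phi ` carrier (lie_Z Grigorchuk)"
  have one: "endo_zero \<in> ?A"
    using ZL.Phi_one ZL.LL.one_closed by (metis imageI)
  show "LH \<subseteq> ?A"
  proof (rule hull_minimal)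
    show "gen_endos grig_data \<subseteq> ?A"
    proof
      fix T assume "T \<in> gen_endos grig_data"
      then obtain s where s: "T = gen_endo s" by (auto simp: gen_endos_def)
      have "letter_fun s \<in> grig_lc 1" by (simp add: letter_fun_carrier)
      then show "T \<in> ?A"
        using ZL.Phi_deg_1 ZL.deg_1_carrier s se_letter by (metis imageI)
    qed
    show "lie_subalgebra ?A"
      unfolding lie_subalgebra_def
    proof (intro conjI ballI allI one)
      fix f g assume f: "f \<in> ?A" and g: "g \<in> ?A"
      obtain x y where xy: "f = ZL.Phi x" "g = ZL.Phi y" "x \<in> carrier (lie_Z Grigorchuk)" "y \<in> carrier (lie_Z Grigorchuk)"
        using f g by blast
      show "endo_add f g \<in> ?A"
        unfolding xy ZL.Phi_mult[OF xy(3,4), symmetric] by (rule imageI[OF ZL.LL.m_closed[OF xy(3,4)]])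
      show "endo_brak f g \<in> ?A"
        unfolding xy ZL.Phi_brak[OF xy(3,4), symmetric] by (rule imageI[OF ZL.brak_L_closed[OF xy(3,4)]])
    next
      fix c f assume f: "f \<in> ?A"
      show "endo_scale c f \<in> ?A"
        using f one endo_scale_bit[of f c] ZL.Phi_ext by auto
    qed
  qed
qed

text \<open>The image of a central element commutes with the images of degree 1 elements, among them
  all generators, and is 0 by \<open>RH_centreless\<close>. Conversely
  \<open>dims_kernel_central\<close> puts every term of a bracket with a kernel element one layer
  deeper.\<close>

lemma FL_centre: "lie_centre (lie_F2 Grigorchuk) = FL.ker"
proof
  show "lie_centre (lie_F2 Grigorchuk) \<subseteq> FL.ker"
  proof
    fix x assume x: "x \<in> lie_centre (lie_F2 Grigorchuk)"
    then have xc: "x \<in> carrier (lie_F2 Grigorchuk)" by (simp add: lie_centre_def)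
    have "endo_brak (FL.Phi x) (gen_endo s) = endo_zero" for s
    proof -
      have s: "letter_fun s \<in> grig_dims 1" by (simp add: grig.dims_1 letter_fun_carrier)
      have "FL.Phi (brak (lie_F2 Grigorchuk) x (FL.deg_1 (letter_fun s))) = endo_zero"
        using x FL.deg_1_carrier[OF s] by (simp add: lie_centre_def FL.Phi_one)
      then show ?thesis
        using FL.Phi_brak[OF xc FL.deg_1_carrier[OF s]] FL.Phi_deg_1[OF s] se_letter by simp
    qed
    then show "x \<in> FL.ker"
      using RH_centreless[of "FL.Phi x"] FL_image xc by (auto simp: FL.ker_def)
  qed
  show "FL.ker \<subseteq> lie_centre (lie_F2 Grigorchuk)"
  proof
    fix x assume x: "x \<in> FL.ker"
    then have xc: "x \<in> carrier (lie_F2 Grigorchuk)" by (simp add: FL.ker_def)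
    have "brak (lie_F2 Grigorchuk) x y = one (lie_F2 Grigorchuk)" if y: "y \<in> carrier (lie_F2 Grigorchuk)" for y
    proof (rule FL.L_eqI[OF FL.brak_L_closed[OF xc y] FL.LL.one_closed])
      fix k :: nat assume k: "1 \<le> k"
      have "layer_brak Grigorchuk grig_dims m (k - m) (x m) (y (k - m)) = grig_dims (Suc k)"
        if m: "m \<in> {1..<k}" for m
      proof -
        have mk: "1 \<le> m" "1 \<le> k - m" "m + (k - m) = k" "k - m + m = k" using m by auto
        obtain g h where g: "g \<in> grig_dims m" "x m = FL.cl m g"
          and h: "h \<in> grig_dims (k - m)" "y (k - m) = FL.cl (k - m) h"
          using FL.L_comp[OF xc mk(1)] FL.L_comp[OF y mk(2)] by (metis FL.layerE)
        have "g \<in> grig.F (Suc m)"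
          using x FL.Phi_eq_zero_iff[OF xc] g mk(1) by (simp add: FL.ker_def)
        then have "commutator Grigorchuk h g \<in> grig_dims (Suc k)"
          using grig.csubD[OF dims_kernel_central[OF mk(2,1)] h(1), of g] g mk by simp
        then have "commutator Grigorchuk g h \<in> grig_dims (Suc k)"
          using grig.normal_inv[OF grig.dims_normal] grig.inv_cm[of h g] g h FL.N_carrier by metis
        then show ?thesis
          using FL.layer_brak_cl[OF mk(1,2) g(1) h(1)] g h mk FL.cl_N by simp
      qed
      then show "brak (lie_F2 Grigorchuk) x y k = one (lie_F2 Grigorchuk) k"
        using FL.brak_comp_one[OF xc y k] k by (simp add: FL.one_L)
    qed
    then show "x \<in> lie_centre (lie_F2 Grigorchuk)"
      using xc by (simp add: lie_centre_def)
  qed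
qed

text \<open>If all brackets of \<open>x\<close> lie in the kernel, the image of \<open>x\<close>
  commutes with the generators and is 0. So the quotient by the kernel is centreless, and the upper
  central series cannot leave the kernel.\<close>

lemma ZL_upper_central_subset: "upper_central (lie_Z Grigorchuk) n \<subseteq> ZL.ker"
proof (induction n)
  case 0
  then show ?case by (simp add: ZL.ker_def ZL.Phi_one)
next
  case (Suc n)
  show ?case
  proof
    fix x assume x: "x \<in> upper_central (lie_Z Grigorchuk) (Suc n)"
    then have xc: "x \<in> carrier (lie_Z Grigorchuk)" by (simp add: ZL.LL.upper_central_Suc_iff del: upper_central.simps)
    have "endo_brak (ZL.Phi x) (gen_endo s) = endo_zero" for s
    proof -
      have s: "letter_fun s \<in> grig_lc 1" by (simp add: letter_fun_carrier)
      have "brak (lie_Z Grigorchuk) x (ZL.deg_1 (letter_fun s)) \<in> ZL.ker"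
        using x Suc ZL.deg_1_carrier[OF s] by (auto simp: ZL.LL.upper_central_Suc_iff simp del: upper_central.simps)
      then show ?thesis
        using ZL.Phi_brak[OF xc ZL.deg_1_carrier[OF s]] ZL.Phi_deg_1[OF s] se_letter by (simp add: ZL.ker_def)
    qed
    then show "x \<in> ZL.ker"
      using RH_centreless[of "ZL.Phi x"] ZL_image LH_RH xc by (auto simp: ZL.ker_def)
  qed
qed

text \<open>
  Each bracket raises the lowest degree of an element of the kernel, and past a degree \<open>2 ^ r\<close> in
  which the kernel vanishes nothing is left.
\<close>

lemma ZL_ker_upper_central:
  assumes r: "2 \<le> r"
  shows "x \<in> ZL.ker \<Longrightarrow> (\<And>n. 1 \<le> n \<Longrightarrow> n + k \<le> 2 ^ r \<or> 2 ^ r < n \<Longrightarrow> x n = grig_lc (Suc n)) \<Longrightarrow>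
    x \<in> upper_central (lie_Z Grigorchuk) k"
proof (induction k arbitrary: x)
  case 0
  have "x = one (lie_Z Grigorchuk)"
  proof (rule ZL.L_eqI[OF _ ZL.LL.one_closed])
    show "x \<in> carrier (lie_Z Grigorchuk)" using 0 by (simp add: ZL.ker_def)
    show "x n = one (lie_Z Grigorchuk) n" if "1 \<le> n" for n
      using 0(2)[OF that] that by (simp add: ZL.one_L) linarith
  qed
  then show ?case by simp
next
  case (Suc k)
  have xc: "x \<in> carrier (lie_Z Grigorchuk)" using Suc.prems(1) by (simp add: ZL.ker_def)
  have "brak (lie_Z Grigorchuk) x y \<in> upper_central (lie_Z Grigorchuk) k"
    if y: "y \<in> carrier (lie_Z Grigorchuk)" for y
  proof (rule Suc.IH[OF ZL.ker_brak[OF Suc.prems(1) y]])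
    fix j :: nat assume j: "1 \<le> j" "j + k \<le> 2 ^ r \<or> 2 ^ r < j"
    have "layer_brak Grigorchuk grig_lc m (j - m) (x m) (y (j - m)) = grig_lc (Suc j)"
      if m: "m \<in> {1..<j}" for m
    proof (cases "m + Suc k \<le> 2 ^ r \<or> 2 ^ r < m")
      case True
      then have "x m = grig_lc (Suc m)" using Suc.prems(2)[of m] m by auto
      then show ?thesis using ZL.brak_term_one[OF xc y m] by blast
    next
      case False
      have mk: "1 \<le> m" "1 \<le> j - m" "m + (j - m) = j" "j - m + m = j" "m \<le> 2 ^ r" "2 ^ r < j - m + m"
        using m j False by auto
      obtain g h where g: "g \<in> grig_lc m" "x m = ZL.cl m g"
        and h: "h \<in> grig_lc (j - m)" "y (j - m) = ZL.cl (j - m) h"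
        using ZL.L_comp[OF xc mk(1)] ZL.L_comp[OF y mk(2)] by (metis ZL.layerE)
      have "g \<in> grig.F (Suc m)"
        using Suc.prems(1) ZL.Phi_eq_zero_iff[OF xc] g mk(1) by (simp add: ZL.ker_def)
      then have "commutator Grigorchuk h g \<in> grig_lc (Suc j)"
        using grig.csubD[OF lc_kernel_cut[OF r mk(2,1,5,6)] h(1), of g] g mk by simp
      then have "commutator Grigorchuk g h \<in> grig_lc (Suc j)"
        using grig.normal_inv[OF grig.lc_normal] grig.inv_cm[of h g] g h ZL.N_carrier by metis
      then show ?thesis
        using ZL.layer_brak_cl[OF mk(1,2) g(1) h(1)] g h mk ZL.cl_N by simp
    qed
    then show "brak (lie_Z Grigorchuk) x y j = grig_lc (Suc j)"
      using ZL.brak_comp_one[OF xc y j(1)] by simp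
  qed
  then show ?case using xc by (simp add: ZL.LL.upper_central_Suc_iff del: upper_central.simps)
qed

lemma ZL_upper_central_omega: "upper_central_omega (lie_Z Grigorchuk) = ZL.ker"
proof
  show "upper_central_omega (lie_Z Grigorchuk) \<subseteq> ZL.ker"
    using ZL_upper_central_subset by (auto simp: upper_central_omega_def)
  show "ZL.ker \<subseteq> upper_central_omega (lie_Z Grigorchuk)"
  proof
    fix x assume x: "x \<in> ZL.ker"
    then have xc: "x \<in> carrier (lie_Z Grigorchuk)" by (simp add: ZL.ker_def)
    obtain B where B: "\<And>n. B < n \<Longrightarrow> x n = grig_lc (Suc n)"
      using ZL.bound[OF xc xc] by metis
    have r: "B + 2 < 2 ^ (B + 2)" by (rule less_exp)
    \<comment> \<open>\<open>B + 2\<close> is at least 2 and its power of 2 exceeds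
      \<open>B\<close>. With \<open>k\<close> equal to that power, no \<open>n \<ge> 1\<close>
      satisfies \<open>n + k \<le> 2 ^ r\<close>, so only the vanishing of the components beyond the
      power has to be checked.\<close>
    have "x \<in> upper_central (lie_Z Grigorchuk) (2 ^ (B + 2))"
      by (rule ZL_ker_upper_central[of "B + 2", OF _ x]) (use B r in auto)
    then show "x \<in> upper_central_omega (lie_Z Grigorchuk)"
      unfolding upper_central_omega_def by blast
  qed
qed

text \<open>The symbol map yields isomorphisms from the quotient onto the algebra, while one of the
  claims runs in the opposite direction. Closure of \<open>L\<close> under bracket and 2-mapping
  lets the inverse map be cancelled on their values.\<close>

lemma restricted_lie_isomorphic_sym:
  assumes L: "Group.group L" and brak: "\<And>x y. x \<in> carrier L \<Longrightarrow> y \<in> carrier L \<Longrightarrow> brak L x y \<in> carrier L"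
    and pmap: "\<And>x. x \<in> carrier L \<Longrightarrow> pmap L x \<in> carrier L"
    and iso: "restricted_lie_isomorphic L M"
  shows "restricted_lie_isomorphic M L"
proof -
  obtain h where h: "h \<in> iso L M" "\<And>x y. x \<in> carrier L \<Longrightarrow> y \<in> carrier L \<Longrightarrow> h (brak L x y) = brak M (h x) (h y)"
    "\<And>x. x \<in> carrier L \<Longrightarrow> h (pmap L x) = pmap M (h x)"
    using iso by (auto simp: restricted_lie_isomorphic_def lie_isos_def)
  let ?k = "inv_into (carrier L) h"
  have bij: "bij_betw h (carrier L) (carrier M)" using h(1) by (simp add: iso_def)
  have k: "?k u \<in> carrier L" "h (?k u) = u" if "u \<in> carrier M" for u
    using that bij by (auto simp: bij_betw_def inv_into_into f_inv_into_f)
  have kh: "?k (h x) = x" if "x \<in> carrier L" for x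
    using that bij by (simp add: bij_betw_def)
  have "?k (brak M u v) = brak L (?k u) (?k v)" if "u \<in> carrier M" "v \<in> carrier M" for u v
    using kh[OF brak[OF k(1)[OF that(1)] k(1)[OF that(2)]]] h(2)[OF k(1)[OF that(1)] k(1)[OF that(2)]] k(2) that by simp
  moreover have "?k (pmap M u) = pmap L (?k u)" if "u \<in> carrier M" for u
    using kh[OF pmap[OF k(1)[OF that]]] h(3)[OF k(1)[OF that]] k(2)[OF that] by simp
  ultimately show ?thesis
    using group.iso_set_sym[OF L h(1)] by (auto simp: restricted_lie_isomorphic_def lie_isos_def)
qed

lemma L_Grig_sel:
  "carrier L_Grig = LH" "monoid.mult L_Grig = endo_add" "one L_Grig = endo_zero" "brak L_Grig = endo_brak"
  by (simp_all add: L_Grig_def self_similar_lie_def)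

lemma restricted_L_Grig_sel:
  "carrier restricted_L_Grig = RH" "monoid.mult restricted_L_Grig = endo_add" "one restricted_L_Grig = endo_zero"
  "brak restricted_L_Grig = endo_brak" "pmap restricted_L_Grig = endo_pmap"
  by (simp_all add: restricted_L_Grig_def self_similar_restricted_lie_def)

lemma RH_ext: "RH \<subseteq> extensional tens"
  using RH_D(1) by blast

lemma L_Grig_isomorphic:
  "lie_isomorphic (lie_quot (lie_Z Grigorchuk) (upper_central_omega (lie_Z Grigorchuk))) L_Grig"
  using ZL.quot_ker_isomorphism(2)[of L_Grig] LH_subalgebra order_trans[OF LH_RH RH_ext] ZL_image
  by (auto simp: lie_isomorphic_def L_Grig_sel ZL_upper_central_omega)

abbreviation "LF \<equiv> lie_F2 Grigorchuk"
abbreviation "quot_F \<equiv> restricted_lie_quot LF (lie_centre LF)"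

lemma FL_quot:
  "FL.LL.ideal_of FL.ker"
  "\<exists>f\<in>lie_isos (lie_quot LF FL.ker) restricted_L_Grig. \<forall>x\<in>carrier LF. f (FL.ker #>\<^bsub>LF\<^esub> x) = FL.Phi x"
  using FL.quot_ker_isomorphism[of restricted_L_Grig] restricted_lie_subalgebraD(1)[OF RH_subalgebra] RH_ext FL_image
  by (auto simp: restricted_L_Grig_sel)

lemma quot_F_sel:
  "carrier quot_F = carrier (lie_quot LF FL.ker)" "monoid.mult quot_F = monoid.mult (lie_quot LF FL.ker)"
  "one quot_F = one (lie_quot LF FL.ker)" "brak quot_F = brak (lie_quot LF FL.ker)"
  "pmap quot_F A = (\<Union>x\<in>A. FL.ker #>\<^bsub>LF\<^esub> pmap LF x)"
  by (simp_all add: restricted_lie_quot_def FL_centre)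

lemma quot_F_carrier: "A \<in> carrier quot_F \<longleftrightarrow> (\<exists>x\<in>carrier LF. A = FL.ker #>\<^bsub>LF\<^esub> x)"
  by (auto simp: quot_F_sel carrier_FactGroup)

text \<open>Independence of the representative comes from the symbol map: congruent elements have
  equal images, hence so do their squares, and the induced map on cosets is injective.\<close>

lemma quot_F_pmap:
  assumes x: "x \<in> carrier LF"
  shows "pmap quot_F (FL.ker #>\<^bsub>LF\<^esub> x) = FL.ker #>\<^bsub>LF\<^esub> pmap LF x"
proof -
  obtain f where f: "f \<in> lie_isos (lie_quot LF FL.ker) restricted_L_Grig"
    "\<And>x. x \<in> carrier LF \<Longrightarrow> f (FL.ker #>\<^bsub>LF\<^esub> x) = FL.Phi x"
    using FL_quot(2) by blast
  have inj: "inj_on f (carrier quot_F)"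
    using f(1) by (simp add: lie_isos_def iso_def bij_betw_def quot_F_sel(1))
  have coset: "FL.ker #>\<^bsub>LF\<^esub> p = FL.ker #>\<^bsub>LF\<^esub> q"
    if "p \<in> carrier LF" "q \<in> carrier LF" "FL.Phi p = FL.Phi q" for p q
    using that inj_onD[OF inj, of "FL.ker #>\<^bsub>LF\<^esub> p" "FL.ker #>\<^bsub>LF\<^esub> q"] f(2) quot_F_carrier by auto
  have sub: "subgroup FL.ker LF" using FL_quot(1) by (simp add: FL.LL.ideal_of_def)
  have eq: "FL.ker #>\<^bsub>LF\<^esub> pmap LF y = FL.ker #>\<^bsub>LF\<^esub> pmap LF x" if y: "y \<in> FL.ker #>\<^bsub>LF\<^esub> x" for y
  proof -
    have yc: "y \<in> carrier LF"
      using FL.LL.r_coset_subset_G[OF subgroup.subset[OF sub] x] y by blast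
    have "FL.Phi y = FL.Phi x"
      using FL.LL.repr_independence[OF y x sub] f(2)[OF x] f(2)[OF yc] by simp
    then show ?thesis by (intro coset) (simp_all add: FL_pmap x yc)
  qed
  have "FL.ker #>\<^bsub>LF\<^esub> x \<noteq> {}" using FL.LL.rcos_self[OF x sub] by blast
  then show ?thesis
    unfolding quot_F_sel(5) by (rule SUP_eq_const) (rule eq)
qed

lemma quot_F_isomorphic: "restricted_lie_isomorphic quot_F restricted_L_Grig"
proof -
  obtain f where f: "f \<in> lie_isos (lie_quot LF FL.ker) restricted_L_Grig"
    "\<And>x. x \<in> carrier LF \<Longrightarrow> f (FL.ker #>\<^bsub>LF\<^esub> x) = FL.Phi x"
    using FL_quot(2) by blast
  have "f \<in> lie_isos quot_F restricted_L_Grig"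
    using f(1) by (simp add: lie_isos_def iso_def hom_def quot_F_sel)
  moreover have "f (pmap quot_F A) = pmap restricted_L_Grig (f A)" if "A \<in> carrier quot_F" for A
    using that by (auto simp: quot_F_carrier quot_F_pmap f(2) FL_pmap restricted_L_Grig_sel)
  ultimately show ?thesis unfolding restricted_lie_isomorphic_def by blast
qed

lemma quot_F_isomorphic_sym: "restricted_lie_isomorphic restricted_L_Grig quot_F"
proof (rule restricted_lie_isomorphic_sym[OF _ _ _ quot_F_isomorphic])
  have grp: "Group.group (LF Mod FL.ker)"
    by (rule normal.factorgroup_is_group[OF FL.LL.ideal_normal[OF FL_quot(1)]])
  \<comment> \<open>The restricted quotient and the factor group are different records, so the group
    axioms are transferred through their fields.\<close>
  show "Group.group quot_F"
    using grp by (simp add: Group.group_def Group.monoid_def group_axioms_def Units_def quot_F_sel)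
  show "brak quot_F A B \<in> carrier quot_F" if AB: "A \<in> carrier quot_F" "B \<in> carrier quot_F" for A B
  proof -
    obtain x y where xy: "x \<in> carrier LF" "y \<in> carrier LF" "A = FL.ker #>\<^bsub>LF\<^esub> x" "B = FL.ker #>\<^bsub>LF\<^esub> y"
      using AB unfolding quot_F_carrier by blast
    have "brak quot_F A B = FL.ker #>\<^bsub>LF\<^esub> brak LF x y"
      unfolding quot_F_sel(4) xy(3,4) by (rule FL.LL.quot_brak[OF FL_quot(1) xy(1,2)])
    then show ?thesis unfolding quot_F_carrier by (rule bexI[OF _ FL.brak_L_closed[OF xy(1,2)]])
  qed
  show "pmap quot_F A \<in> carrier quot_F" if "A \<in> carrier quot_F" for A
    using that by (auto simp: quot_F_carrier quot_F_pmap intro: FL_pmap(1))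
qed

theorem theorem6p6:
  shows
    "restricted_lie_isomorphic (lie_of_group grig_gens)
       (restricted_lie_quot (lie_F2 Grigorchuk) (lie_centre (lie_F2 Grigorchuk))) \<and>
     restricted_lie_isomorphic
       (restricted_lie_quot (lie_F2 Grigorchuk) (lie_centre (lie_F2 Grigorchuk)))
       restricted_L_Grig \<and>
     lie_isomorphic
       (lie_quot (lie_Z Grigorchuk) (upper_central_omega (lie_Z Grigorchuk)))
       L_Grig"
  unfolding lie_of_group_eq
  by (intro conjI quot_F_isomorphic_sym quot_F_isomorphic L_Grig_isomorphic)

end
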